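(* Let $s, t \in \mathbb{N}$. Let $b_1, \dots, b_s$ be distinct integers with $b_i \geq 2$ for all $i = 1, \dots, s$, and let $\beta_1, \dots, \beta_t$ be distinct non-integer real numbers with $\beta_j > 1$ for all $j = 1, \dots, t$. (1) For any $f_1, \dots, f_s, g_1, \dots, g_t \in L^{\infty}(\lambda)$, $$\lim_{N \rightarrow \infty} \frac{1}{N} \sum_{n=0}^{N-1} \prod_{i=1}^s f_i(T_{b_i}^n x) \prod_{j=1}^t g_j(T_{\beta_j}^n x) = \prod_{i=1}^s \int f_i \, d\lambda \, \prod_{j=1}^t \int g_j \, d\mu_{\beta_j}$$ for almost every $x \in [0,1]$. (2) If $\log \beta_j \ne \frac{\pi^2}{6 \log 2}$ for $1 \leq j \leq t$, then for any $f_0, f_1, \dots, f_s, g_1, \dots, g_t \in L^{\infty}(\lambda)$, $$\lim_{N \rightarrow \infty} \frac{1}{N} \sum_{n=0}^{N-1} f_0(T_G^n x) \prod_{i=1}^s f_i(T_{b_i}^n x) \prod_{j=1}^t g_j(T_{\beta_j}^n x) = \int f_0 \, d\mu_G \, \prod_{i=1}^s \int f_i \, d\lambda \, \prod_{j=1}^t \int g_j \, d\mu_{\beta_j}$$ for almost every $x \in [0,1]$.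
   Context: $\lambda$ is Lebesgue measure on $[0,1]$; "almost every" is with respect to $\lambda$. For an integer $b\ge 2$, $T_b x = bx \bmod 1$ on $[0,1]$. For non-integer $\beta>1$, $T_\beta x = \beta x \bmod 1$ on $[0,1]$, and $\mu_\beta$ is the unique $T_\beta$-invariant ergodic probability measure satisfying $1-\frac1\beta \le \frac{d\mu_\beta}{d\lambda} \le \frac{1}{1-1/\beta}$ (existence and uniqueness due to Rényi). $T_G$ is the Gauss map $T_G(x)=\{1/x\}$ for $x\ne0$, $T_G(0)=0$, where $\{\cdot\}$ is the fractional part, and $\mu_G(A) = \frac{1}{\log 2}\int_A \frac{dx}{1+x}$ is the Gauss measure. $\mathbb{N}=\{1,2,\dots\}$. *)

theory Defs
  imports "HOL-Analysis.Analysis" "HOL-Probability.Probability"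
begin

abbreviation leb01 :: "real measure" where
  "leb01 \<equiv> lebesgue_on {0..1}"

definition mult_mod1 :: "real \<Rightarrow> real \<Rightarrow> real" where
  "mult_mod1 a x = frac (a * x)"

definition gauss_map :: "real \<Rightarrow> real" where
  "gauss_map x = (if x = 0 then 0 else frac (1 / x))"

definition gauss_measure :: "real measure" where
  "gauss_measure = density leb01 (\<lambda>x. ennreal (1 / ln 2 * (1 / (1 + x))))"

definition invariant_under :: "'a measure \<Rightarrow> ('a \<Rightarrow> 'a) \<Rightarrow> bool" where
  "invariant_under M T \<longleftrightarrow> T \<in> measurable M M \<and> distr M M T = M"

definition ergodic_under :: "'a measure \<Rightarrow> ('a \<Rightarrow> 'a) \<Rightarrow> bool" where
  "ergodic_under M T \<longleftrightarrow>
     (\<forall>A\<in>sets M. T -` A \<inter> space M = A \<longrightarrow> measure M A = 0 \<or> measure M A = 1)"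

text \<open>
  The defining property of Renyi's measure for a non-integer \<open>\<beta> > 1\<close>. Fixing the
  sigma-algebra (Lebesgue measurable subsets of the unit interval) is what makes a measure
  with this property unique as an object of type \<^typ>\<open>real measure\<close>.
\<close>

definition is_renyi_measure :: "real \<Rightarrow> real measure \<Rightarrow> bool" where
  "is_renyi_measure \<beta> M \<longleftrightarrow>
     sets M = sets leb01 \<and> prob_space M \<and>
     invariant_under M (mult_mod1 \<beta>) \<and> ergodic_under M (mult_mod1 \<beta>) \<and>
     absolutely_continuous leb01 M \<and>
     (AE x in leb01. ennreal (1 - 1 / \<beta>) \<le> RN_deriv leb01 M x \<and>
                     RN_deriv leb01 M x \<le> ennreal (1 / (1 - 1 / \<beta>)))"

definition renyi_measure :: "real \<Rightarrow> real measure" where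
  "renyi_measure \<beta> = (THE M. is_renyi_measure \<beta> M)"

text \<open>
  Essentially bounded complex functions, as representatives rather than classes modulo null
  sets; with domain measure \<^term>\<open>leb01\<close> their values off the unit interval are irrelevant.
\<close>

definition Linfty :: "'a measure \<Rightarrow> ('a \<Rightarrow> complex) set" where
  "Linfty M = {f \<in> borel_measurable M. \<exists>C. AE x in M. norm (f x) \<le> C}"

end

theory Submission
  imports Defs "HOL-Complex_Analysis.Complex_Analysis" "HOL-Real_Asymp.Real_Asymp"
begin

text \<open>
  All maps have an invariant density bounded above and below, so convergence may be studied for
  uniformly distributed \<open>x\<close>. The entropies \<open>log b\<^sub>i\<close>, \<open>log \<beta>\<^sub>j\<close>, \<open>\<pi>\<^sup>2 / (6 log 2)\<close> are pairwise
  distinct (for the Gauss map and an integer base because \<open>\<pi>\<^sup>2 / (6 log 2)\<close> lies strictly between \<open>log 10\<close>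
  and \<open>log 11\<close>). Order the maps by entropy and replace the functions one at a time by their means,
  beginning with the map of largest entropy \<open>h\<close>; it remains to treat a product in which the function of the
  fastest map has mean zero. For step functions and \<open>n < m\<close>, a cylinder of the fastest map of rank
  slightly below \<open>m\<close> has length about \<open>e\<^sup>-\<^sup>h\<^sup>m\<close>, so
  on most cylinders all slower factors up to time \<open>m\<close>, and all factors at time \<open>n\<close>, are constant, while
  mixing makes the fast factor at time \<open>m\<close> average out. This bounds the correlation of the times \<open>n\<close> and
  \<open>m\<close> by \<open>q\<^sup>m\<^sup>-\<^sup>n + n\<^sup>-\<^sup>1\<^sup>/\<^sup>2\<close>, and a second moment argument along \<open>N = k\<^sup>4\<close> gives
  almost sure convergence. The maximal ergodic inequality extends it to bounded functions.

  For a \<open>\<beta>\<close>-map, mixing follows from a renewal equation whose generating function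
  \<open>\<Sum> T\<^sup>k(1) (z / \<beta>)\<^sup>k\<close> has no zero in the closed unit disc. For the Gauss map it follows because the
  transfer operator preserves monotonicity up to sign and halves oscillations; the cylinder lengths follow
  from a weak law of large numbers for the truncated logarithm. The case of a single map is the pointwise ergodic
  theorem, which identifies the Renyi measure with the Parry density.
\<close>

section \<open>Averages along sequences\<close>

text \<open>The maps act simultaneously on one point and in general preserve different measures, so
  no ergodic theorem applies to the joint averages. Independence is replaced by separation of
  scales: once all other factors are frozen on a cylinder of the fastest map, only that map has to
  mix, and the slower ones merely must not separate nearby points too soon. Hence the two asymmetric
  assumptions \<open>fast\<close> and \<open>slow\<close> of \<open>jsys\<close>. Equal entropies
  would put two maps on the same scale, which is why \<open>exp (pi\<^sup>2 / (6 * ln 2))\<close> is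
  excluded as a \<beta>. The term of order 1 / sqrt n is the price of exceptional sets: Gauss
  cylinders have the expected length only in measure. It still gives second moments of order
  N^(3/2), summable after division by N^2 along N = k^4. Each single map does preserve a measure
  comparable to Lebesgue measure, and a product of factors bounded by 1 changes by at most the sum
  of the changes of its factors; so the maximal inequality can be applied to one map at a
  time.\<close>

lemma average_tendsto_zero_of_fourth_powers:
  fixes a :: "nat \<Rightarrow> complex"
  assumes a: "\<And>n. norm (a n) \<le> 1"
    and lim: "(\<lambda>k. (\<Sum>n<k^4. a n) / of_nat (k^4)) \<longlonglongrightarrow> 0"
  shows "(\<lambda>N. (\<Sum>n<N. a n) / of_nat N) \<longlonglongrightarrow> 0"
proof -
  define k where "k N = nat \<lfloor>root 4 (real N)\<rfloor>" for N
  \<comment> \<open>At most \<open>(k + 1)^4 - k^4\<close> terms lie between \<open>k^4\<close> and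
    \<open>N\<close>, each of norm at most 1; relative to \<open>k^4\<close> they are
    negligible.\<close>
  define B where "B k = norm ((\<Sum>n<k^4. a n) / of_nat (k^4)) + ((real k + 1)^4 - real k^4) / real k^4" for k
  have k1: "k N ^ 4 \<le> N" for N
  proof -
    have "real (k N) \<le> root 4 (real N)" by (simp add: k_def)
    then have "real (k N) ^ 4 \<le> root 4 (real N) ^ 4" by (rule power_mono) simp
    also have "\<dots> = real N" by simp
    finally show ?thesis by (metis of_nat_le_iff of_nat_power)
  qed
  have k2: "real N \<le> (real (k N) + 1) ^ 4" for N
  proof -
    have "root 4 (real N) \<le> real (k N) + 1" by (simp add: k_def)
    then have "root 4 (real N) ^ 4 \<le> (real (k N) + 1) ^ 4" by (rule power_mono) simp
    then show ?thesis by simp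
  qed
  have k3: "filterlim k at_top at_top"
    unfolding filterlim_at_top
  proof
    fix Z
    have "k N \<ge> Z" if "N \<ge> Z ^ 4" for N
    proof -
      have "real Z = root 4 (real Z ^ 4)" by (simp add: real_root_power_cancel)
      also have "\<dots> \<le> root 4 (real N)" using that
        by (metis of_nat_mono of_nat_power real_root_le_iff zero_less_numeral)
      finally show ?thesis unfolding k_def by (simp add: le_nat_floor)
    qed
    then show "eventually (\<lambda>N. Z \<le> k N) sequentially" using eventually_at_top_linorder by blast
  qed
  have "(\<lambda>k::nat. ((real k + 1)^4 - real k^4) / real k^4) \<longlonglongrightarrow> 0" by real_asymp
  then have "B \<longlonglongrightarrow> 0 + 0" unfolding B_def
    by (intro tendsto_add tendsto_norm_zero lim)
  then have "(\<lambda>N. B (k N)) \<longlonglongrightarrow> 0" using k3 by (metis add_0 filterlim_compose)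
  moreover have "eventually (\<lambda>N. norm ((\<Sum>n<N. a n) / of_nat N) \<le> B (k N)) sequentially"
    using eventually_ge_at_top[of 1]
  proof eventually_elim
    case (elim N)
    have "1 \<le> root 4 (real N)" using elim by simp
    then have kp: "k N \<ge> 1" unfolding k_def by (simp add: le_nat_floor)
    have "(\<Sum>n<N. a n) = (\<Sum>n<k N^4. a n) + (\<Sum>n=k N^4..<N. a n)"
      using k1[of N] by (simp add: lessThan_atLeast0 sum.atLeastLessThan_concat)
    moreover have "norm (\<Sum>n=k N^4..<N. a n) \<le> (\<Sum>n=k N^4..<N. 1)"
      by (rule sum_norm_le) (simp add: a)
    ultimately have "norm (\<Sum>n<N. a n) \<le> norm (\<Sum>n<k N^4. a n) + (real N - real (k N)^4)"
      using k1[of N] norm_triangle_ineq[of "\<Sum>n<k N^4. a n" "\<Sum>n=k N^4..<N. a n"]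
      by (simp add: of_nat_diff)
    also have "\<dots> \<le> norm (\<Sum>n<k N^4. a n) + ((real (k N) + 1)^4 - real (k N)^4)" using k2[of N] by simp
    finally have 1: "norm (\<Sum>n<N. a n) \<le> norm (\<Sum>n<k N^4. a n) + ((real (k N) + 1)^4 - real (k N)^4)" .
    have "norm ((\<Sum>n<N. a n) / of_nat N) = norm (\<Sum>n<N. a n) / real N" by (simp add: norm_divide)
    also have "\<dots> \<le> norm (\<Sum>n<N. a n) / real (k N)^4"
    proof (rule divide_left_mono)
      show "real (k N) ^ 4 \<le> real N" using k1[of N] by (simp flip: of_nat_power)
      have "0 < real N" "0 < real (k N)" using kp \<open>1 \<le> N\<close> by auto
      then show "0 < real N * real (k N) ^ 4" by simp
    qed simp
    also have "\<dots> \<le> B (k N)" unfolding B_def norm_divide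
      using divide_right_mono[OF 1, of "real (k N)^4"] by (simp add: add_divide_distrib norm_power)
    finally show ?case .
  qed
  ultimately show ?thesis by (rule Lim_null_comparison[rotated])
qed

text \<open>At \<open>N = k^4\<close> the second moment of the average is at most
  \<open>K / k^2\<close>, which is summable; so the squared averages are summable almost everywhere
  and tend to 0 along fourth powers. The exponent 4 also makes \<open>sqrt N\<close> the integer
  \<open>k^2\<close>.\<close>

lemma strong_law_of_second_moments:
  fixes X :: "nat \<Rightarrow> 'a \<Rightarrow> complex"
  assumes "prob_space M" and X[measurable]: "\<And>n. X n \<in> borel_measurable M"
    and b: "\<And>n x. norm (X n x) \<le> 1"
    and S: "\<And>N. (\<integral>x. (norm (\<Sum>n<N. X n x))\<^sup>2 \<partial>M) \<le> K * real N * sqrt (real N)"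
  shows "AE x in M. (\<lambda>N. (\<Sum>n<N. X n x) / of_nat N) \<longlonglongrightarrow> 0"
proof -
  interpret prob_space M by fact
  define Y where "Y k x = (norm ((\<Sum>n<k^4. X n x) / of_nat (k^4)))\<^sup>2" for k x
  have Y[measurable]: "Y k \<in> borel_measurable M" for k unfolding Y_def by measurable
  have nS: "norm (\<Sum>n<N. X n x) \<le> real N" for N x
    using sum_norm_le[of "{..<N}" "\<lambda>n. X n x" "\<lambda>_. 1"] b by simp
  have intS: "integrable M (\<lambda>x. (norm (\<Sum>n<N. X n x))\<^sup>2)" for N
    by (rule integrable_const_bound[where B="(real N)\<^sup>2"])
       (auto intro!: power_mono nS)
  have Yeq: "Y k x = (norm (\<Sum>n<k^4. X n x))\<^sup>2 / real k ^ 8" for k x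
    unfolding Y_def by (simp add: norm_divide norm_power power_divide flip: power_mult)
  have Yi: "(\<integral>\<^sup>+x. ennreal (Y k x) \<partial>M) \<le> ennreal (K / (real k)\<^sup>2)" for k
  proof -
    have "(\<integral>\<^sup>+x. ennreal (Y k x) \<partial>M) = ennreal (\<integral>x. Y k x \<partial>M)"
      using intS[of "k^4"] by (intro nn_integral_eq_integral) (auto simp: Yeq)
    also have "(\<integral>x. Y k x \<partial>M) = (\<integral>x. (norm (\<Sum>n<k^4. X n x))\<^sup>2 \<partial>M) / real k^8"
      unfolding Yeq by simp
    also have "\<dots> \<le> (K * real (k^4) * sqrt (real (k^4))) / real k^8"
      by (rule divide_right_mono[OF S]) simp
    also have "sqrt (real (k^4)) = (real k)^2"
      by (rule real_sqrt_unique) (simp_all flip: power_mult)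
    also have "(K * real (k^4) * (real k)^2) / real k^8 = K / (real k)\<^sup>2"
      by (cases "k = 0") (simp_all add: field_simps flip: power_add)
    finally show ?thesis by (simp add: ennreal_leI)
  qed
  have Kp: "K \<ge> 0" using order_trans[OF Bochner_Integration.integral_nonneg S[of 1]] by simp
  have sm: "summable (\<lambda>k. K / (real k)\<^sup>2)"
    using summable_mult[OF inverse_power_summable[of 2, where 'a=real], of K] by (simp add: divide_inverse)
  have "(\<integral>\<^sup>+x. (\<Sum>k. ennreal (Y k x)) \<partial>M) = (\<Sum>k. \<integral>\<^sup>+x. ennreal (Y k x) \<partial>M)"
    by (rule nn_integral_suminf) measurable
  also have "\<dots> \<le> (\<Sum>k. ennreal (K / (real k)\<^sup>2))" by (intro suminf_le Yi) auto
  also have "\<dots> = ennreal (\<Sum>k. K / (real k)\<^sup>2)" using sm Kp by (intro suminf_ennreal2) auto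
  also have "\<dots> < \<infinity>" by simp
  finally have "AE x in M. (\<Sum>k. ennreal (Y k x)) \<noteq> \<infinity>"
    by (intro nn_integral_PInf_AE) auto
  then show ?thesis
  proof eventually_elim
    case (elim x)
    have "summable (\<lambda>k. Y k x)" using elim by (intro summable_suminf_not_top) (auto simp: Y_def)
    then have "(\<lambda>k. Y k x) \<longlonglongrightarrow> 0" by (rule summable_LIMSEQ_zero)
    then have "(\<lambda>k. sqrt (Y k x)) \<longlonglongrightarrow> sqrt 0" by (rule tendsto_real_sqrt)
    then have "(\<lambda>k. (\<Sum>n<k^4. X n x) / of_nat (k^4)) \<longlonglongrightarrow> 0"
      by (intro tendsto_norm_zero_cancel[of "\<lambda>k. (\<Sum>n<k^4. X n x) / of_nat (k^4)"]) (simp add: Y_def)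
    then show ?case using b by (intro average_tendsto_zero_of_fourth_powers) auto
  qed
qed

section \<open>The maximal ergodic inequality\<close>

text \<open>The maximum of the Birkhoff sums of \<open>f\<close> with 0 to \<open>P\<close> terms,
  the empty sum included, in the recursive form on which Garsia's argument runs.\<close>

fun garsia_max :: "('a \<Rightarrow> 'a) \<Rightarrow> ('a \<Rightarrow> real) \<Rightarrow> nat \<Rightarrow> 'a \<Rightarrow> real" where
  "garsia_max T f 0 x = 0"
| "garsia_max T f (Suc P) x = max 0 (f x + garsia_max T f P (T x))"

lemma garsia_max_nonneg: "0 \<le> garsia_max T f P x"
  by (cases P) auto

lemma garsia_max_mono: "garsia_max T f P x \<le> garsia_max T f (Suc P) x"
  by (induction P arbitrary: x) (simp_all, smt (verit, best))

lemma garsia_max_ge_sum: "N \<le> P \<Longrightarrow> (\<Sum>n<N. f ((T ^^ n) x)) \<le> garsia_max T f P x"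
proof (induction P arbitrary: N x)
  case (Suc P)
  show ?case
  proof (cases N)
    case (Suc N')
    have "(\<Sum>n<N. f ((T ^^ n) x)) = f x + (\<Sum>n<N'. f ((T ^^ n) (T x)))"
      unfolding Suc sum.lessThan_Suc_shift by (simp add: funpow_swap1)
    also have "\<dots> \<le> f x + garsia_max T f P (T x)" using Suc.IH[of N' "T x"] Suc.prems Suc by simp
    finally show ?thesis by simp
  qed simp
qed simp

lemma measurable_garsia_max [measurable]:
  assumes [measurable]: "T \<in> measurable M M" "f \<in> borel_measurable M"
  shows "garsia_max T f P \<in> borel_measurable M"
proof (induction P)
  case 0
  have "garsia_max T f 0 = (\<lambda>x. 0)" by auto
  then show ?case by simp
next
  case (Suc P)
  note [measurable] = Suc
  have "garsia_max T f (Suc P) = (\<lambda>x. max 0 (f x + garsia_max T f P (T x)))" by auto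
  then show ?case by simp
qed

lemma garsia_max_bounded:
  assumes "\<And>x. \<bar>f x\<bar> \<le> C"
  shows "garsia_max T f P x \<le> real P * C"
proof (induction P arbitrary: x)
  case (Suc P)
  have "f x \<le> C" "0 \<le> C" using assms[of x] by auto
  then show ?case using Suc[of "T x"] by (simp add: algebra_simps)
qed simp

declare garsia_max.simps [simp del]

text \<open>Garsia's proof with \<open>f = h - e\<close>. Where the maximal function
  \<open>F\<close> is positive it equals \<open>f\<close> plus the previous maximal function after
  \<open>T\<close>, hence is at most \<open>f + F o T\<close>; elsewhere
  \<open>F = 0 <= F o T\<close>. On integration \<open>F\<close> and \<open>F o T\<close> cancel by
  invariance and leave a nonnegative integral of \<open>f\<close> over the set where
  \<open>F > 0\<close>.\<close>

lemma maximal_ergodic_inequality: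
  fixes h :: "'a \<Rightarrow> real"
  assumes "prob_space M" and T[measurable]: "T \<in> measurable M M" and inv: "distr M M T = M"
    and h[measurable]: "h \<in> borel_measurable M" and hb: "\<And>x. 0 \<le> h x" "\<And>x. h x \<le> C" and "0 < e"
  shows "measure M {x\<in>space M. \<exists>N. e * real N < (\<Sum>n<N. h ((T ^^ n) x))} \<le> (\<integral>x. h x \<partial>M) / e"
proof -
  interpret prob_space M by fact
  define f where "f x = h x - e" for x
  have [measurable]: "f \<in> borel_measurable M" unfolding f_def by measurable
  have fb: "\<bar>f x\<bar> \<le> C + e" for x using hb[of x] \<open>0 < e\<close> unfolding f_def by auto
  define A where "A P = {x\<in>space M. 0 < garsia_max T f P x}" for P
  have A[measurable]: "A P \<in> sets M" for P unfolding A_def by measurable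
  have inth: "integrable M h" by (rule integrable_const_bound[where B=C]) (use hb in auto)
  have bound: "measure M (A (Suc P)) \<le> (\<integral>x. h x \<partial>M) / e" for P
  proof -
    let ?F = "garsia_max T f (Suc P)"
    have F0: "0 \<le> ?F x" for x by (rule garsia_max_nonneg)
    have Fb: "\<bar>?F x\<bar> \<le> real (Suc P) * (C + e)" for x
      using garsia_max_bounded[of f "C + e" T "Suc P" x, OF fb] F0[of x] by linarith
    have iF: "integrable M ?F" by (rule integrable_const_bound[where B="real (Suc P) * (C + e)"]) (use Fb in auto)
    have iFT: "integrable M (\<lambda>x. ?F (T x))"
      by (rule integrable_const_bound[where B="real (Suc P) * (C + e)"]) (use Fb in auto)
    have eqF: "(\<integral>x. ?F (T x) \<partial>M) = (\<integral>x. ?F x \<partial>M)"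
      using integral_distr[OF T, of ?F] unfolding inv by (simp)
    have iI: "integrable M (\<lambda>x. h x * indicator (A (Suc P)) x)" "integrable M (indicator (A (Suc P)) :: 'a \<Rightarrow> real)"
       apply (rule integrable_const_bound[where B=C])
        using hb order_trans[OF hb(1) hb(2)] apply (auto simp: indicator_def)[2]
      by (rule integrable_real_indicator) (auto simp: emeasure_eq_measure)
    have "0 = (\<integral>x. ?F x - ?F (T x) \<partial>M)"
      using eqF iF iFT by (subst Bochner_Integration.integral_diff) (simp_all)
    also have "\<dots> \<le> (\<integral>x. h x * indicator (A (Suc P)) x - e * indicator (A (Suc P)) x \<partial>M)"
    proof (rule integral_mono)
      fix x assume x: "x \<in> space M"
      show "?F x - ?F (T x) \<le> h x * indicator (A (Suc P)) x - e * indicator (A (Suc P)) x"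
      proof (cases "x \<in> A (Suc P)")
        case True
        then have "0 < ?F x" by (simp add: A_def)
        then have "?F x = f x + garsia_max T f P (T x)" by (simp add: garsia_max.simps)
        also have "\<dots> \<le> f x + ?F (T x)" using garsia_max_mono[of T f P "T x"] by linarith
        finally show ?thesis using True by (simp add: f_def)
      next
        case False
        then have "?F x = 0" using F0[of x] x by (simp add: A_def)
        then show ?thesis using False F0[of "T x"] by (simp)
      qed
    qed (use iF iFT iI in auto)
    also have "\<dots> = (\<integral>x. h x * indicator (A (Suc P)) x \<partial>M) - e * measure M (A (Suc P))"
      using iI by (subst Bochner_Integration.integral_diff) auto
    also have "(\<integral>x. h x * indicator (A (Suc P)) x \<partial>M) \<le> (\<integral>x. h x \<partial>M)"
      using iI inth hb(1) by (intro integral_mono) (auto simp: indicator_def)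
    finally show ?thesis using \<open>0 < e\<close> by (simp add: field_simps)
  qed
  have inc: "incseq (\<lambda>P. A (Suc P))"
  proof (rule incseq_SucI)
    fix P show "A (Suc P) \<le> A (Suc (Suc P))"
      unfolding A_def using garsia_max_mono[of T f "Suc P"] by (auto intro: less_le_trans)
  qed
  have "(\<lambda>P. measure M (A (Suc P))) \<longlonglongrightarrow> measure M (\<Union>P. A (Suc P))"
    by (rule finite_Lim_measure_incseq[OF _ inc]) auto
  then have lim: "measure M (\<Union>P. A (Suc P)) \<le> (\<integral>x. h x \<partial>M) / e"
    by (rule LIMSEQ_le_const2) (use bound in auto)
  have "{x\<in>space M. \<exists>N. e * real N < (\<Sum>n<N. h ((T ^^ n) x))} \<subseteq> (\<Union>P. A (Suc P))"
  proof safe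
    fix x N assume x: "x \<in> space M" "e * real N < (\<Sum>n<N. h ((T ^^ n) x))"
    have "0 < (\<Sum>n<N. f ((T ^^ n) x))" using x by (simp add: f_def sum_subtractf mult.commute)
    also have "\<dots> \<le> garsia_max T f (Suc N) x" by (rule garsia_max_ge_sum) simp
    finally show "x \<in> (\<Union>P. A (Suc P))" using x by (auto simp: A_def)
  qed
  then have "measure M {x\<in>space M. \<exists>N. e * real N < (\<Sum>n<N. h ((T ^^ n) x))} \<le> measure M (\<Union>P. A (Suc P))"
    by (intro finite_measure_mono) auto
  with lim show ?thesis by linarith
qed

section \<open>The uniform measure and step functions\<close>

text \<open>The Borel counterpart of \<open>leb01\<close>, placed on the whole line: maps and test
  functions can be plain Borel functions of a real variable, and the completion is met only when the
  result is transferred at the end.\<close>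

definition unif :: "real measure" where
  "unif = density lborel (indicator {0..1})"

lemma sets_unif [simp, measurable_cong]: "sets unif = sets borel"
  by (simp add: unif_def)

lemma space_unif [simp]: "space unif = UNIV"
  by (simp add: unif_def)

lemma emeasure_unif: "A \<in> sets borel \<Longrightarrow> emeasure unif A = emeasure lborel (A \<inter> {0..1})"
  unfolding unif_def by (subst emeasure_density) (auto simp: indicator_inter_arith[symmetric] Int_commute nn_integral_indicator[symmetric] simp del: nn_integral_indicator)

lemma prob_space_unif: "prob_space unif"
  by (rule prob_spaceI) (simp add: emeasure_unif)

interpretation unif: prob_space unif
  by (rule prob_space_unif)

lemma AE_unif_iff: "(AE x in unif. P x) \<longleftrightarrow> (AE x in lborel. x \<in> {0..1} \<longrightarrow> P x)"
  unfolding unif_def by (subst AE_density) (auto simp: indicator_def)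

lemma AE_unif_mem: "AE x in unif. x \<in> {0..1}"
  by (simp add: AE_unif_iff)

lemma AE_unif_countable: "countable A \<Longrightarrow> AE x in unif. x \<notin> A"
  unfolding AE_unif_iff using AE_not_in[OF countable_imp_null_set_lborel] by (rule eventually_mono) auto

lemma integral_unif:
  fixes f :: "real \<Rightarrow> 'a::{banach, second_countable_topology}"
  assumes [measurable]: "f \<in> borel_measurable borel"
  shows "(\<integral>x. f x \<partial>unif) = (\<integral>x. indicator {0..1} x *\<^sub>R f x \<partial>lborel)"
proof -
  have eq: "unif = density lborel (\<lambda>x. ennreal (indicator {0..1} x))"
    by (simp add: unif_def ennreal_indicator)
  show ?thesis unfolding eq by (subst integral_density) auto
qed

lemma integrable_unif_iff:
  fixes f :: "real \<Rightarrow> 'a::{banach, second_countable_topology}"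
  assumes [measurable]: "f \<in> borel_measurable borel"
  shows "integrable unif f \<longleftrightarrow> integrable lborel (\<lambda>x. indicator {0..1} x *\<^sub>R f x)"
proof -
  have eq: "unif = density lborel (\<lambda>x. ennreal (indicator {0..1} x))"
    by (simp add: unif_def ennreal_indicator)
  show ?thesis unfolding eq by (subst integrable_density) auto
qed

lemma integrable_unif_bounded:
  fixes f :: "real \<Rightarrow> 'a::{banach, second_countable_topology}"
  assumes "f \<in> borel_measurable borel" and "\<And>x. x \<in> {0..1} \<Longrightarrow> norm (f x) \<le> C"
  shows "integrable unif f"
  using assms AE_unif_mem by (intro unif.integrable_const_bound[where B=C]) (auto elim: eventually_mono)

lemma norm_integral_unif_le:
  fixes f :: "real \<Rightarrow> 'a::{banach, second_countable_topology}"
  assumes [measurable]: "f \<in> borel_measurable borel" and b: "\<And>x. x \<in> {0..1} \<Longrightarrow> norm (f x) \<le> C"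
  shows "norm (\<integral>x. f x \<partial>unif) \<le> C"
proof -
  have "0 \<le> C" using order_trans[OF norm_ge_zero b[of 0]] by simp
  have "norm (\<integral>x. f x \<partial>unif) \<le> (\<integral>x. norm (f x) \<partial>unif)" by (rule integral_norm_bound)
  also have "\<dots> \<le> (\<integral>x. C \<partial>unif)" using AE_unif_mem
    by (intro integral_mono_AE integrable_unif_bounded[where C=C]) (use b \<open>0 \<le> C\<close> in \<open>auto elim: eventually_mono\<close>)
  finally show ?thesis using unif.prob_space by simp
qed

lemma measure_unif_le:
  assumes "a \<le> b"
  shows "measure unif {a..b} \<le> b - a"
proof -
  have "emeasure unif {a..b} \<le> emeasure lborel {a..b}"
    by (subst emeasure_unif) (auto intro: emeasure_mono)
  also have "\<dots> = ennreal (b - a)" using assms by simp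
  finally show ?thesis using assms unfolding measure_def by (metis diff_ge_0_iff_ge enn2real_leI)
qed

definition nbhd :: "real set \<Rightarrow> real \<Rightarrow> real set" where
  "nbhd D \<delta> = (\<Union>d\<in>D. {d - \<delta>..d + \<delta>})"

lemma nbhd_borel [measurable]: "finite D \<Longrightarrow> nbhd D \<delta> \<in> sets borel"
  unfolding nbhd_def by auto

lemma measure_nbhd_le:
  assumes "finite D" "0 \<le> \<delta>"
  shows "measure unif (nbhd D \<delta>) \<le> 2 * real (card D) * \<delta>"
proof -
  have "measure unif (nbhd D \<delta>) \<le> (\<Sum>d\<in>D. measure unif {d - \<delta>..d + \<delta>})"
    unfolding nbhd_def using assms by (intro unif.finite_measure_subadditive_finite) auto
  also have "\<dots> \<le> (\<Sum>d\<in>D. 2 * \<delta>)"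
    using measure_unif_le[of "_ - \<delta>" "_ + \<delta>"] assms by (intro sum_mono) (smt (verit))
  finally show ?thesis by simp
qed

lemma mem_nbhd: "x \<in> nbhd D \<delta> \<longleftrightarrow> (\<exists>d\<in>D. \<bar>x - d\<bar> \<le> \<delta>)"
  unfolding nbhd_def by (auto simp: abs_le_iff field_simps) 

lemma closed_segment_avoids_far_set:
  assumes "x \<notin> nbhd D \<delta>" "\<bar>y - x\<bar> \<le> \<delta>"
  shows "closed_segment x y \<inter> D = {}"
  using assms by (force simp: mem_nbhd closed_segment_eq_real_ivl split: if_splits)

text \<open>The finite set \<open>D\<close> contains the jumps of \<open>f\<close>; what matters is only where \<open>f\<close> is constant.\<close>

definition divides :: "real set \<Rightarrow> (real \<Rightarrow> complex) \<Rightarrow> bool" where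
  "divides D f \<longleftrightarrow> finite D \<and> (\<forall>x\<in>{0..1}. \<forall>y\<in>{0..1}. closed_segment x y \<inter> D = {} \<longrightarrow> f x = f y)"

lemma divides_const: "divides {} (\<lambda>_. c)"
  by (simp add: divides_def)

lemma divides_comp: "divides D f \<Longrightarrow> divides D (\<lambda>x. k (f x))"
  unfolding divides_def by metis

lemma divides_comp2: "divides D f \<Longrightarrow> divides E g \<Longrightarrow> divides (D \<union> E) (\<lambda>x. k (f x) (g x))"
  unfolding divides_def by (auto simp: Int_Un_distrib)

lemma divides_sum: 
  assumes "finite I" "\<And>i. i \<in> I \<Longrightarrow> \<exists>D. divides D (f i)"
  shows "\<exists>D. divides D (\<lambda>x. \<Sum>i\<in>I. f i x)"
  using assms
proof (induction I)
  case (insert i I)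
  have "\<exists>E. divides E (\<lambda>x. \<Sum>i\<in>I. f i x)" using insert by simp
  then obtain D E where "divides D (f i)" "divides E (\<lambda>x. \<Sum>i\<in>I. f i x)" using insert.prems by blast
  from divides_comp2[OF this, of "(+)"] insert.hyps show ?case by auto
qed (use divides_const[of 0] in auto)

lemma divides_indicator_Iic: "divides {a} (\<lambda>x. indicator {..a} x)"
  unfolding divides_def by (auto simp: indicator_def closed_segment_eq_real_ivl)

definition stepf :: "(real \<Rightarrow> complex) \<Rightarrow> bool" where
  "stepf f \<longleftrightarrow> f \<in> borel_measurable borel \<and> (\<forall>x. norm (f x) \<le> 1) \<and> (\<exists>D. divides D f)"

section \<open>Approximation by step functions in L1\<close>

definition L1_approx :: "(real \<Rightarrow> complex) \<Rightarrow> bool" where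
  "L1_approx f \<longleftrightarrow> (\<forall>e>0. \<exists>g\<in>borel_measurable borel. integrable unif g \<and> (\<exists>D. divides D g) \<and>
      (\<integral>x. norm (f x - g x) \<partial>unif) < e)"

text \<open>Dynkin's lemma on the rays \<open>{..a}\<close>. Complements are matched by
  \<open>1 - g\<close>; for a disjoint union, finitely many sets are approximated and the rest has
  small measure.\<close>

lemma L1_approx_indicator:
  assumes "A \<in> sets borel"
  shows "L1_approx (indicator A)"
proof -
  have "Int_stable (range (\<lambda>a::real. {..a}))"
    by (auto simp: Int_stable_def)
  moreover have "range (\<lambda>a::real. {..a}) \<subseteq> Pow UNIV" by auto
  moreover have "A \<in> sigma_sets UNIV (range (\<lambda>a::real. {..a}))"
    using assms by (metis borel_eq_atMost sets_measure_of subset_Pow_Union Union_UNIV Pow_UNIV top_greatest)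
  ultimately show ?thesis
  proof (induction rule: sigma_sets_induct_disjoint)
    case (basic A)
    then obtain a where A: "A = {..a}" by auto
    show ?case unfolding L1_approx_def A
      by (auto intro!: bexI[of _ "indicator {..a}"] exI[of _ "{a}"] integrable_unif_bounded[where C=1]
          simp: divides_indicator_Iic indicator_def)
  next
    case empty
    show ?case unfolding L1_approx_def
      by (auto intro!: bexI[of _ "\<lambda>_. 0"] exI[of _ "{}"] divides_const)
  next
    case (compl A)
    have Ab: "A \<in> sets borel"
      using compl(1) by (metis borel_eq_atMost sets_measure_of top_greatest Pow_UNIV)
    show ?case unfolding L1_approx_def
    proof (intro allI impI)
      fix e :: real assume "e > 0"
      then obtain g D where g[measurable]: "g \<in> borel_measurable borel" and gi: "integrable unif g" and D: "divides D g"
         and ge: "(\<integral>x. norm (indicator A x - g x) \<partial>unif) < e"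
        using compl.IH unfolding L1_approx_def by blast
      have "norm ((indicator (UNIV - A) x :: complex) - (1 - g x)) = norm (indicator A x - g x)" for x
        by (auto simp: indicator_def norm_minus_commute)
      then have "(\<integral>x. norm ((indicator (UNIV - A) x :: complex) - (1 - g x)) \<partial>unif) < e" using ge by simp
      moreover have "integrable unif (\<lambda>x. 1 - g x)" using gi by simp
      moreover have "\<exists>D. divides D (\<lambda>x. 1 - g x)" using divides_comp[OF D] by (rule exI)
      moreover have "(\<lambda>x. 1 - g x) \<in> borel_measurable borel" by measurable
      ultimately show "\<exists>g\<in>borel_measurable borel. integrable unif g \<and> (\<exists>D. divides D g) \<and>
          (\<integral>x. norm (indicator (UNIV - A) x - g x) \<partial>unif) < e"
        by meson
    qed
  next
    case (union A)
    have Ab[measurable]: "A i \<in> sets borel" for i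
      using union(2) by (metis borel_eq_atMost sets_measure_of top_greatest Pow_UNIV range_subsetD)
    show ?case unfolding L1_approx_def
    proof (intro allI impI)
      fix e :: real assume e: "e > 0"
      have "(\<lambda>N. measure unif (\<Union>i<N. A i)) \<longlonglongrightarrow> measure unif (\<Union>N. \<Union>i<N. A i)"
        by (rule unif.finite_Lim_measure_incseq) (auto intro!: incseq_SucI simp: lessThan_Suc)
      also have "(\<Union>N. \<Union>i<N. A i) = (\<Union>i. A i)" by auto
      finally have "eventually (\<lambda>N. measure unif (\<Union>i. A i) - e / 2 < measure unif (\<Union>i<N. A i)) sequentially"
        using e by (intro order_tendstoD) auto
      then obtain N where N: "measure unif (\<Union>i. A i) - e / 2 < measure unif (\<Union>i<N. A i)"
        unfolding eventually_sequentially by blast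
      have "\<exists>g\<in>borel_measurable borel. integrable unif g \<and> (\<exists>D. divides D g) \<and>
          (\<integral>x. norm (indicator (A i) x - g x) \<partial>unif) < e / (2 * (real N + 1))" for i
        using union(3)[of i] e unfolding L1_approx_def by simp
      then obtain g where gm[measurable]: "\<And>i. g i \<in> borel_measurable borel"
         and g: "\<And>i. integrable unif (g i)" "\<And>i. \<exists>D. divides D (g i)"
         "\<And>i. (\<integral>x. norm (indicator (A i) x - g i x) \<partial>unif) < e / (2 * (real N + 1))"
        by metis
      define G where "G x = (\<Sum>i<N. g i x)" for x
      have Gi: "integrable unif G" unfolding G_def using g by auto
      have [measurable]: "G \<in> borel_measurable borel" unfolding G_def by measurable
      have iA: "integrable unif (indicator B :: real \<Rightarrow> complex)" if "B \<in> sets borel" for B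
        using that by (intro integrable_unif_bounded[where C=1]) (auto simp: indicator_def)
      have iA': "integrable unif (indicator B :: real \<Rightarrow> real)" if "B \<in> sets borel" for B
        using that by (intro integrable_unif_bounded[where C=1]) (auto simp: indicator_def)
      let ?R = "(\<Union>i. A i) - (\<Union>i<N. A i)"
      have eq: "(indicator (\<Union>i. A i) x :: complex) = (\<Sum>i<N. indicator (A i) x) + indicator ?R x" for x
      proof -
        have "(indicator (\<Union>i<N. A i) x :: complex) = (\<Sum>i<N. indicator (A i) x)"
          using union(1) by (intro indicator_UN_disjoint) (auto simp: disjoint_family_on_def)
        moreover have "(indicator (\<Union>i. A i) x :: complex) = indicator (\<Union>i<N. A i) x + indicator ?R x"
          by (auto simp: indicator_def)
        ultimately show ?thesis by simp
      qed
      have "(\<integral>x. norm (indicator (\<Union>i. A i) x - G x) \<partial>unif)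
          \<le> (\<integral>x. (\<Sum>i<N. norm (indicator (A i) x - g i x)) + indicator ?R x \<partial>unif)"
      proof (rule integral_mono)
        fix x
        have "norm (indicator (\<Union>i. A i) x - G x) = norm ((\<Sum>i<N. indicator (A i) x - g i x) + indicator ?R x)"
          unfolding eq G_def by (simp add: sum_subtractf algebra_simps)
        also have "\<dots> \<le> (\<Sum>i<N. norm (indicator (A i) x - g i x)) + indicator ?R x"
        proof (rule norm_triangle_le, rule add_mono)
          show "norm (\<Sum>i<N. indicator (A i) x - g i x) \<le> (\<Sum>i<N. norm (indicator (A i) x - g i x))"
            by (rule norm_sum)
        qed (simp add: indicator_def)
        finally show "norm (indicator (\<Union>i. A i) x - G x) \<le> \<dots>" .
      qed (use Gi g iA iA' in auto)
      also have "\<dots> = (\<Sum>i<N. \<integral>x. norm (indicator (A i) x - g i x) \<partial>unif) + measure unif ?R"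
        using g iA iA' by (subst Bochner_Integration.integral_add) (auto simp: Bochner_Integration.integral_sum)
      also have "\<dots> \<le> (\<Sum>i<N. e / (2 * (real N + 1))) + (measure unif (\<Union>i. A i) - measure unif (\<Union>i<N. A i))"
      proof (rule add_mono)
        show "measure unif ?R \<le> measure unif (\<Union>i. A i) - measure unif (\<Union>i<N. A i)"
          by (subst unif.finite_measure_Diff) auto
      qed (intro sum_mono less_imp_le g)
      also have "\<dots> < e / 2 + e / 2"
        using N e by (intro add_le_less_mono) (auto simp: field_simps)
      finally have "(\<integral>x. norm (indicator (\<Union>i. A i) x - G x) \<partial>unif) < e" by simp
      moreover have "\<exists>D. divides D G" unfolding G_def using g by (intro divides_sum) auto
      ultimately show "\<exists>g\<in>borel_measurable borel. integrable unif g \<and> (\<exists>D. divides D g) \<and>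
          (\<integral>x. norm (indicator (\<Union>i. A i) x - g x) \<partial>unif) < e"
        using Gi by (intro bexI[of _ G]) auto
    qed
  qed
qed

lemma L1_approx_integrable:
  assumes "integrable unif f"
  shows "L1_approx f"
  using assms
proof (induction rule: integrable_induct)
  case (base A c)
  show ?case unfolding L1_approx_def
  proof (intro allI impI)
    fix e :: real assume e: "e > 0"
    have "L1_approx (indicator A)" using base by (intro L1_approx_indicator) simp
    moreover have "e / (norm c + 1) > 0" using e by (simp add: add_nonneg_pos)
    ultimately obtain g D where g[measurable]: "g \<in> borel_measurable borel" and gi: "integrable unif g" and D: "divides D g"
         and ge: "(\<integral>x. norm (indicator A x - g x) \<partial>unif) < e / (norm c + 1)"
      unfolding L1_approx_def by blast
    have "norm (indicator A x *\<^sub>R c - g x * c) = norm (indicator A x - g x) * norm c" for x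
      by (simp add: scaleR_conv_of_real of_real_indicator left_diff_distrib[symmetric] norm_mult)
    then have "(\<integral>x. norm (indicator A x *\<^sub>R c - g x * c) \<partial>unif) = (\<integral>x. norm (indicator A x - g x) \<partial>unif) * norm c"
      by simp
    also have "\<dots> \<le> (\<integral>x. norm (indicator A x - g x) \<partial>unif) * (norm c + 1)" by (intro mult_left_mono) auto
    also have "\<dots> < e" using ge by (simp add: pos_less_divide_eq add_nonneg_pos)
    finally show "\<exists>g\<in>borel_measurable borel. integrable unif g \<and> (\<exists>D. divides D g) \<and>
      (\<integral>x. norm (indicator A x *\<^sub>R c - g x) \<partial>unif) < e"
      using gi divides_comp[OF D, of "\<lambda>z. z * c"] by (intro bexI[of _ "\<lambda>x. g x * c"]) auto
  qed
next
  case (add f1 f2)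
  show ?case unfolding L1_approx_def
  proof (intro allI impI)
    fix e :: real assume e: "e > 0"
    obtain g1 D1 where g1[measurable]: "g1 \<in> borel_measurable borel" and g1i: "integrable unif g1" "divides D1 g1"
         and g1e: "(\<integral>x. norm (f1 x - g1 x) \<partial>unif) < e / 2"
      using add(3) e unfolding L1_approx_def by (meson half_gt_zero)
    obtain g2 D2 where g2[measurable]: "g2 \<in> borel_measurable borel" and g2i: "integrable unif g2" "divides D2 g2"
         and g2e: "(\<integral>x. norm (f2 x - g2 x) \<partial>unif) < e / 2"
      using add(4) e unfolding L1_approx_def by (meson half_gt_zero)
    have "(\<integral>x. norm (f1 x + f2 x - (g1 x + g2 x)) \<partial>unif) \<le> (\<integral>x. norm (f1 x - g1 x) + norm (f2 x - g2 x) \<partial>unif)"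
      using add(1,2) g1i g2i
      by (intro integral_mono) (auto intro!: Bochner_Integration.integrable_add Bochner_Integration.integrable_diff integrable_norm simp: norm_diff_triangle_ineq)
    also have "\<dots> = (\<integral>x. norm (f1 x - g1 x) \<partial>unif) + (\<integral>x. norm (f2 x - g2 x) \<partial>unif)"
      using add(1,2) g1i g2i by (intro Bochner_Integration.integral_add) auto
    also have "\<dots> < e" using g1e g2e by simp
    finally show "\<exists>g\<in>borel_measurable borel. integrable unif g \<and> (\<exists>D. divides D g) \<and>
      (\<integral>x. norm (f1 x + f2 x - g x) \<partial>unif) < e"
      using g1i g2i divides_comp2[OF g1i(2) g2i(2), of "(+)"] by (intro bexI[of _ "\<lambda>x. g1 x + g2 x"]) auto
  qed
next
  case (lim f s)
  have [measurable]: "f \<in> borel_measurable unif" "\<And>i. s i \<in> borel_measurable unif" using lim by auto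
  have "(\<lambda>i. \<integral>x. norm (f x - s i x) \<partial>unif) \<longlonglongrightarrow> (\<integral>x. 0 \<partial>unif)"
  proof (rule integral_dominated_convergence[where w="\<lambda>x. 3 * norm (f x)"])
    show "AE x in unif. (\<lambda>i. norm (f x - s i x)) \<longlonglongrightarrow> 0"
    proof (rule AE_I2)
      fix x assume "x \<in> space unif"
      from tendsto_diff[OF tendsto_const lim(2)[OF this], of "f x"]
      have "(\<lambda>i. f x - s i x) \<longlonglongrightarrow> 0" by simp
      then show "(\<lambda>i. norm (f x - s i x)) \<longlonglongrightarrow> 0" by (rule tendsto_norm_zero)
    qed
    show "AE x in unif. norm (norm (f x - s i x)) \<le> 3 * norm (f x)" for i
      using lim(3)[of _ i] norm_triangle_ineq4[of "f _" "s i _"] by (intro AE_I2) (smt (verit, ccfv_threshold) norm_ge_zero real_norm_def)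
  qed (use lim in auto)
  then have l0: "(\<lambda>i. \<integral>x. norm (f x - s i x) \<partial>unif) \<longlonglongrightarrow> 0" by simp
  show ?case unfolding L1_approx_def
  proof (intro allI impI)
    fix e :: real assume e: "e > 0"
    obtain i where i: "(\<integral>x. norm (f x - s i x) \<partial>unif) < e / 2"
      using order_tendstoD(2)[OF l0, of "e/2"] e by (auto simp: eventually_sequentially)
    obtain g D where g[measurable]: "g \<in> borel_measurable borel" and gi: "integrable unif g" "divides D g"
         and ge: "(\<integral>x. norm (s i x - g x) \<partial>unif) < e / 2"
      using lim(5)[of i] e unfolding L1_approx_def by (meson half_gt_zero)
    have "(\<integral>x. norm (f x - g x) \<partial>unif) \<le> (\<integral>x. norm (f x - s i x) + norm (s i x - g x) \<partial>unif)"
    proof (rule integral_mono)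
      show "norm (f x - g x) \<le> norm (f x - s i x) + norm (s i x - g x)" for x
        using norm_triangle_ineq[of "f x - s i x" "s i x - g x"] by simp
    qed (use lim(1)[of i] lim(4) gi in auto)
    also have "\<dots> = (\<integral>x. norm (f x - s i x) \<partial>unif) + (\<integral>x. norm (s i x - g x) \<partial>unif)"
      using lim(1)[of i] lim(4) gi by (intro Bochner_Integration.integral_add) auto
    also have "\<dots> < e" using i ge by simp
    finally show "\<exists>g\<in>borel_measurable borel. integrable unif g \<and> (\<exists>D. divides D g) \<and>
      (\<integral>x. norm (f x - g x) \<partial>unif) < e" using gi by (intro bexI[of _ g]) auto
  qed
qed

lemma ex_stepf_approx:
  assumes f[measurable]: "f \<in> borel_measurable borel" and f1: "\<And>x. norm (f x) \<le> 1" and e: "0 < e"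
  shows "\<exists>g. stepf g \<and> (\<integral>x. norm (f x - g x) \<partial>unif) < e"
proof -
  have fi: "integrable unif f" by (rule integrable_unif_bounded[where C=1]) (use f1 in auto)
  obtain g D where g[measurable]: "g \<in> borel_measurable borel" and gi: "integrable unif g" "divides D g"
         and ge: "(\<integral>x. norm (f x - g x) \<partial>unif) < e"
    using L1_approx_integrable[OF fi] e unfolding L1_approx_def by blast
  \<comment> \<open>Projection to the unit disc is 1-Lipschitz and fixes the values of
    \<open>f\<close>: it makes the approximant bounded by 1 at no cost in L1.\<close>
  let ?p = "closest_point (cball 0 1 :: complex set)"
  have lip: "norm (?p z - ?p y) \<le> norm (z - y)" for z y
    using closest_point_lipschitz[of "cball 0 1 :: complex set" z y] by (auto simp: dist_norm)
  have pin: "norm (?p z) \<le> 1" for z using closest_point_in_set[of "cball 0 1 :: complex set" z] by auto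
  have "continuous_on UNIV ?p" by (rule continuous_on_closest_point) auto
  then have [measurable]: "?p \<in> borel_measurable borel" by (rule borel_measurable_continuous_onI)
  have pf: "?p (f x) = f x" for x using f1[of x] by (intro closest_point_self) auto
  have "(\<integral>x. norm (f x - ?p (g x)) \<partial>unif) \<le> (\<integral>x. norm (f x - g x) \<partial>unif)"
  proof (rule integral_mono)
    show "norm (f x - ?p (g x)) \<le> norm (f x - g x)" for x using lip[of "f x" "g x"] unfolding pf .
    show "integrable unif (\<lambda>x. norm (f x - ?p (g x)))"
      using order_trans[OF norm_triangle_ineq4 add_mono[OF f1 pin]]
      by (intro integrable_norm integrable_unif_bounded[where C="1 + 1"]) auto
  qed (use fi gi in auto)
  then show ?thesis using ge divides_comp[OF gi(2), of ?p] pin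
    unfolding stepf_def by (intro exI[of _ "\<lambda>x. ?p (g x)"]) auto
qed

section \<open>Systems with cylinder representatives\<close>

text \<open>
  \<open>r k x\<close> is a point of the rank \<open>k\<close> cylinder of \<open>x\<close> that depends on the cylinder only, so functions of
  \<open>r k x\<close> are the ones measurable with respect to cylinders.
\<close>

definition cylinder_points :: "(nat \<Rightarrow> real \<Rightarrow> real) \<Rightarrow> bool" where
  "cylinder_points r \<longleftrightarrow> (\<forall>k. r k \<in> borel_measurable borel) \<and> (\<forall>k. \<forall>x\<in>{0..1}. r k x \<in> {0..1})"

text \<open>\<open>Z (r k x)\<close> is an arbitrary bounded function of the rank \<open>k\<close>
  cylinder. The bound is uniform in \<open>k\<close>: after \<open>k\<close> steps all that remains
  of the cylinder is a density of controlled shape, and the other \<open>j\<close> steps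
  mix.\<close>

definition cylinder_mixing :: "(real \<Rightarrow> real) \<Rightarrow> (real \<Rightarrow> real) \<Rightarrow> (nat \<Rightarrow> real \<Rightarrow> real) \<Rightarrow> real \<Rightarrow> real \<Rightarrow> bool" where
  "cylinder_mixing T w r C \<theta> \<longleftrightarrow> (\<forall>(Z :: real \<Rightarrow> complex) (g :: real \<Rightarrow> complex) k j.
     Z \<in> borel_measurable borel \<longrightarrow> g \<in> borel_measurable borel \<longrightarrow> (\<forall>x. norm (Z x) \<le> 1) \<longrightarrow> (\<forall>x. norm (g x) \<le> 1) \<longrightarrow>
     (\<integral>x. w x *\<^sub>R g x \<partial>unif) = 0 \<longrightarrow>
     norm (\<integral>x. Z (r k x) * g ((T ^^ (k + j)) x) \<partial>unif) \<le> C * \<theta> ^ j)"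

text \<open>The exceptional set is there for the Gauss map, whose cylinders have length about
  \<open>exp (- h * k)\<close> only for typical points; its size is what Chebyshev's inequality
  yields.\<close>

definition cylinder_size :: "real \<Rightarrow> (nat \<Rightarrow> real \<Rightarrow> real) \<Rightarrow> bool" where
  "cylinder_size h r \<longleftrightarrow> (\<forall>\<epsilon>>0. \<exists>K. \<forall>k\<ge>1.
     measure unif {x. exp (- (h - \<epsilon>) * real k) < \<bar>x - r k x\<bar>} \<le> K / sqrt (real k))"

definition cylinder_contraction :: "(real \<Rightarrow> real) \<Rightarrow> (nat \<Rightarrow> real \<Rightarrow> real) \<Rightarrow> real \<Rightarrow> real \<Rightarrow> bool" where
  "cylinder_contraction T r C \<theta> \<longleftrightarrow> (\<forall>k n. n \<le> k \<longrightarrow>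
     (AE x in unif. \<bar>(T ^^ n) x - (T ^^ n) (r k x)\<bar> \<le> C * \<theta> ^ (k - n)))"

locale acim =
  fixes T w :: "real \<Rightarrow> real"
  assumes T_borel [measurable]: "T \<in> borel_measurable borel"
    and T_mem: "x \<in> {0..1} \<Longrightarrow> T x \<in> {0..1}"
    and w_borel [measurable]: "w \<in> borel_measurable borel"
    and w_bounds: "\<exists>c C. 0 < c \<and> (\<forall>x\<in>{0..1}. c \<le> w x \<and> w x \<le> C)"
    and w_int: "(\<integral>x. w x \<partial>unif) = 1"
    and T_inv: "distr (density unif (\<lambda>x. ennreal (w x))) borel T = density unif (\<lambda>x. ennreal (w x))"
begin

lemma iter_borel [measurable]: "(T ^^ n) \<in> borel_measurable borel"
  by (induction n) (auto intro: measurable_comp)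

lemma iter_mem: "x \<in> {0..1} \<Longrightarrow> (T ^^ n) x \<in> {0..1}"
  by (induction n) (use T_mem in auto)

abbreviation \<mu> :: "real measure" where "\<mu> \<equiv> density unif (\<lambda>x. ennreal (w x))"

lemma AE_w_nonneg: "AE x in unif. 0 \<le> w x"
proof -
  obtain c C where "0 < c" "\<forall>x\<in>{0..1}. c \<le> w x \<and> w x \<le> C" using w_bounds by auto
  then have "0 \<le> w x" if "x \<in> {0..1}" for x
    using that less_le_trans[of 0 c "w x"] by auto
  then show ?thesis using AE_unif_mem by (rule eventually_mono[rotated])
qed

lemma integrable_w: "integrable unif w"
proof -
  obtain c C where "0 < c" "\<forall>x\<in>{0..1}. c \<le> w x \<and> w x \<le> C" using w_bounds by auto
  then show ?thesis by (intro integrable_unif_bounded[where C=C]) force+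
qed

lemma prob_space_mu: "prob_space \<mu>"
proof (rule prob_spaceI)
  have "emeasure \<mu> (space \<mu>) = (\<integral>\<^sup>+x. ennreal (w x) \<partial>unif)"
    by (simp add: emeasure_density)
  also have "\<dots> = ennreal (\<integral>x. w x \<partial>unif)"
    using integrable_w AE_w_nonneg by (rule nn_integral_eq_integral)
  finally show "emeasure \<mu> (space \<mu>) = 1" by (simp add: w_int)
qed

lemma integral_mu:
  fixes g :: "real \<Rightarrow> 'b::{banach, second_countable_topology}"
  assumes "g \<in> borel_measurable borel"
  shows "(\<integral>x. g x \<partial>\<mu>) = (\<integral>x. w x *\<^sub>R g x \<partial>unif)"
  using assms AE_w_nonneg by (intro integral_density) auto

lemma distr_iter: "distr \<mu> borel (T ^^ n) = \<mu>"
proof (induction n)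
  case 0
  then show ?case using distr_id2[of borel \<mu>] by (simp add: id_def)
next
  case (Suc n)
  have "distr \<mu> borel (T ^^ Suc n) = distr (distr \<mu> borel (T ^^ n)) borel T"
    by (subst distr_distr) auto
  then show ?case unfolding Suc T_inv .
qed

lemma ex_mu_bounds:
  "\<exists>c C. 0 < c \<and> 0 \<le> C \<and> (\<forall>A\<in>sets borel. c * measure unif A \<le> measure \<mu> A \<and> measure \<mu> A \<le> C * measure unif A)"
proof -
  obtain c C where c: "0 < c" "\<forall>x\<in>{0..1}. c \<le> w x \<and> w x \<le> C" using w_bounds by auto
  then have C: "0 \<le> C" by (force dest: bspec[of _ _ 0])
  have "c * measure unif A \<le> measure \<mu> A \<and> measure \<mu> A \<le> C * measure unif A" if A[measurable]: "A \<in> sets borel" for A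
  proof -
    interpret m: prob_space \<mu> by (rule prob_space_mu)
    have i: "integrable unif (\<lambda>x. w x * indicator A x)"
      using integrable_w by (intro integrable_real_mult_indicator) auto
    have i': "integrable unif (\<lambda>x. indicator A x :: real)"
      by (intro integrable_unif_bounded[where C=1]) (auto simp: indicator_def)
    have eq: "measure \<mu> A = (\<integral>x. w x * indicator A x \<partial>unif)"
      using integral_mu[of "indicator A :: real \<Rightarrow> real"] by simp
    have ae: "AE x in unif. c * indicator A x \<le> w x * indicator A x \<and> w x * indicator A x \<le> C * indicator A x"
      using AE_unif_mem by (rule eventually_mono) (use c in \<open>auto simp: indicator_def\<close>)
    have "(\<integral>x. c * indicator A x \<partial>unif) \<le> (\<integral>x. w x * indicator A x \<partial>unif)"
      using i i' ae by (intro integral_mono_AE) auto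
    moreover have "(\<integral>x. w x * indicator A x \<partial>unif) \<le> (\<integral>x. C * indicator A x \<partial>unif)"
      using i i' ae by (intro integral_mono_AE) auto
    ultimately show ?thesis unfolding eq by simp
  qed
  then show ?thesis using c(1) C by blast
qed

text \<open>The invariant measure of a preimage under the iterate does not change, and passing to it
  and back costs only the ratio of the density bounds; therefore one constant serves for all
  \<open>n\<close>.\<close>

lemma ex_nonsingular:
  "\<exists>C\<ge>0. \<forall>n. \<forall>A\<in>sets borel. measure unif ((T ^^ n) -` A) \<le> C * measure unif A"
proof -
  obtain c C where c: "0 < c" "0 \<le> C"
    "\<And>A. A\<in>sets borel \<Longrightarrow> c * measure unif A \<le> measure \<mu> A \<and> measure \<mu> A \<le> C * measure unif A"
    using ex_mu_bounds by blast
  have "measure unif ((T ^^ n) -` A) \<le> C / c * measure unif A" if A[measurable]: "A \<in> sets borel" for n A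
  proof -
    have m: "(T ^^ n) -` A \<in> sets borel"
      using measurable_sets[OF iter_borel A] by simp
    have "measure \<mu> ((T ^^ n) -` A) = measure (distr \<mu> borel (T ^^ n)) A"
      by (subst measure_distr) auto
    then have "measure \<mu> ((T ^^ n) -` A) = measure \<mu> A" by (simp add: distr_iter)
    then have "c * measure unif ((T ^^ n) -` A) \<le> C * measure unif A" using c(3)[OF m] c(3)[OF A] by linarith
    then show ?thesis using c(1) by (simp add: field_simps)
  qed
  then show ?thesis using c by (intro exI[of _ "C / c"]) auto
qed

lemma norm_mean_le:
  fixes g :: "real \<Rightarrow> complex"
  assumes [measurable]: "g \<in> borel_measurable borel" and b: "\<And>x. norm (g x) \<le> 1"
  shows "norm (\<integral>x. w x *\<^sub>R g x \<partial>unif) \<le> 1"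
proof -
  have "norm (\<integral>x. w x *\<^sub>R g x \<partial>unif) \<le> (\<integral>x. norm (w x *\<^sub>R g x) \<partial>unif)" by (rule integral_norm_bound)
  also have "\<dots> \<le> (\<integral>x. w x \<partial>unif)"
  proof (rule integral_mono_AE)
    show "AE x in unif. norm (w x *\<^sub>R g x) \<le> w x"
      using AE_w_nonneg by eventually_elim (use b in \<open>auto intro: mult_left_le\<close>)
    then show "integrable unif (\<lambda>x. norm (w x *\<^sub>R g x))"
      using AE_w_nonneg
      by (intro integrable_norm Bochner_Integration.integrable_bound[OF integrable_w]) (auto elim!: eventually_elim2)
  qed (rule integrable_w)
  finally show ?thesis by (simp add: w_int)
qed

lemma integrable_w_mult:
  fixes g :: "real \<Rightarrow> complex"
  assumes [measurable]: "g \<in> borel_measurable borel" and b: "\<And>x. norm (g x) \<le> C"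
  shows "integrable unif (\<lambda>x. w x *\<^sub>R g x)"
proof (rule Bochner_Integration.integrable_bound[where f="\<lambda>x. C * w x"])
  show "AE x in unif. norm (w x *\<^sub>R g x) \<le> norm (C * w x)"
    using AE_w_nonneg
  proof eventually_elim
    case (elim x)
    have "0 \<le> C" using b[of 0] norm_ge_zero order_trans by blast
    then show ?case using elim mult_right_mono[OF b[of x], of "w x"] by (simp add: mult.commute abs_mult)
  qed
qed (use integrable_w in auto)

end

text \<open>
  The parameter \<open>h\<close> is the entropy of \<open>T\<close>. The assumption \<open>fast\<close> is used when \<open>T\<close> has the largest entropy,
  \<open>slow\<close> when it has not: apart from a set \<open>B\<close>, points at distance \<open>\<delta>\<close> are not separated by \<open>D\<close> at time
  \<open>m\<close> as long as \<open>\<delta>\<close> is small compared with \<open>e\<^sup>-\<^sup>h\<^sup>m\<close>.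
\<close>

locale jsys = acim T w for T w :: "real \<Rightarrow> real" +
  fixes h :: real
  assumes h_pos: "0 < h"
    and fast: "\<exists>r C \<theta>. 0 < \<theta> \<and> \<theta> < 1 \<and> 0 \<le> C \<and> cylinder_points r \<and> cylinder_mixing T w r C \<theta> \<and>
      cylinder_size h r \<and> cylinder_contraction T r C \<theta>"
    and slow: "\<lbrakk>0 < \<epsilon>; finite D\<rbrakk> \<Longrightarrow> \<exists>K. \<forall>m\<ge>1. \<forall>\<delta>\<ge>0. \<exists>B\<in>sets borel.
      measure unif B \<le> K * (exp ((h + \<epsilon>) * real m) * \<delta> + 1 / sqrt (real m)) \<and>
      (\<forall>x\<in>{0..1} - B. \<forall>y\<in>{0..1}. \<bar>y - x\<bar> \<le> \<delta> \<longrightarrow> closed_segment ((T ^^ m) x) ((T ^^ m) y) \<inter> D = {})"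
lemma prod_borel:
  assumes "finite J" "\<And>j. j \<in> J \<Longrightarrow> F j \<in> borel_measurable M"
  shows "(\<lambda>x. \<Prod>j\<in>J. F j x :: complex) \<in> borel_measurable M"
  using assms by (induction J) auto

lemma norm_prod_le_1:
  assumes "\<And>j. j \<in> J \<Longrightarrow> norm (F j :: complex) \<le> 1"
  shows "norm (\<Prod>j\<in>J. F j) \<le> 1"
  using assms by (simp add: prod_norm[symmetric] prod_le_1)

section \<open>Decay of correlations for joint orbits\<close>

text \<open>Time \<open>m\<close> is cut at \<open>k = m - j\<close>. Passing from \<open>x\<close>
  to its cylinder point \<open>r k x\<close> changes neither the slow factors nor \<open>g\<close>
  at time \<open>n\<close> outside a small set; then the last \<open>j\<close> steps average out
  \<open>g\<close> at time \<open>m\<close>.\<close>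

lemma correlation_decay:
  fixes J :: "'i set" and T w :: "'i \<Rightarrow> real \<Rightarrow> real" and h :: "'i \<Rightarrow> real" and f :: "'i \<Rightarrow> real \<Rightarrow> complex"
  assumes J: "finite J" "\<And>j. j \<in> J \<Longrightarrow> jsys (T j) (w j) (h j)" "\<And>j. j \<in> J \<Longrightarrow> h j < h0" "\<And>j. j \<in> J \<Longrightarrow> stepf (f j)"
    and T0: "jsys T0 w0 h0" and g: "stepf g" "(\<integral>x. w0 x *\<^sub>R g x \<partial>unif) = 0"
    and X_def: "\<And>n x. X n x = (\<Prod>j\<in>J. f j ((T j ^^ n) x)) * g ((T0 ^^ n) x)"
  shows "\<exists>K q. 0 \<le> K \<and> 0 < q \<and> q < 1 \<and> (\<forall>n m. 1 \<le> n \<longrightarrow> n < m \<longrightarrow>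
    norm (\<integral>x. cnj (X n x) * X m x \<partial>unif) \<le> K * (q ^ (m - n) + 1 / sqrt (real n)))"
proof -
  interpret T0: jsys T0 w0 h0 by (rule T0)
  obtain r C \<theta> where \<theta>: "0 < \<theta>" "\<theta> < 1" and C: "0 \<le> C" and R: "cylinder_points r" "cylinder_mixing T0 w0 r C \<theta>"
      "cylinder_size h0 r" "cylinder_contraction T0 r C \<theta>"
    using T0.fast by blast
  have r[measurable]: "r k \<in> borel_measurable borel" for k using R(1) by (simp add: cylinder_points_def)
  have r_mem: "r k x \<in> {0..1}" if "x \<in> {0..1}" for k x using R(1) that unfolding cylinder_points_def by blast
  have F2: "\<exists>K. \<forall>k\<ge>1. measure unif {x. exp (- (h0 - \<epsilon>) * real k) < \<bar>x - r k x\<bar>} \<le> K / sqrt (real k)" if "\<epsilon> > 0" for \<epsilon>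
    using R(3) that unfolding cylinder_size_def by blast
  have F3: "AE x in unif. \<bar>(T0 ^^ n) x - (T0 ^^ n) (r k x)\<bar> \<le> C * \<theta> ^ (k - n)" if "n \<le> k" for k n
    using R(4) that unfolding cylinder_contraction_def by blast
  have gm[measurable]: "g \<in> borel_measurable borel" and g1: "norm (g x) \<le> 1" for x using g by (auto simp: stepf_def)
  obtain Dg where Dg: "divides Dg g" using g by (auto simp: stepf_def)
  then have Dg_fin: "finite Dg" by (simp add: divides_def)
  obtain Cn where Cn: "0 \<le> Cn" "\<And>n A. A \<in> sets borel \<Longrightarrow> measure unif ((T0 ^^ n) -` A) \<le> Cn * measure unif A"
    using T0.ex_nonsingular by blast
  \<comment> \<open>The 0 gives the maximum a meaning when \<open>J\<close> is empty; it does no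
    harm because \<open>h0\<close> is positive.\<close>
  define h' where "h' = Max (insert 0 (h ` J))"
  have h': "0 \<le> h'" "\<And>j. j \<in> J \<Longrightarrow> h j \<le> h'" using J(1) by (auto simp: h'_def)
  have h'0: "h' < h0" unfolding h'_def using J(1,3) T0.h_pos by auto
  define \<Delta> where "\<Delta> = h0 - h'"
  \<comment> \<open>With these choices the length \<open>exp (- (h0 - \<epsilon>) * k)\<close>, for
    \<open>k >= (1 - \<gamma>) * m\<close>, beats the slow expansion
    \<open>exp ((h' + \<epsilon>) * m)\<close> by at least \<open>exp (- \<Delta> * m / 2)\<close>:
    the losses add up to \<open>3 * \<epsilon>\<close>, which is below
    \<open>\<Delta> / 2\<close>.\<close>
  define \<epsilon> where "\<epsilon> = \<Delta> / 8"
  define \<gamma> where "\<gamma> = min (1/2) (\<epsilon> / h0)"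
  have \<Delta>: "\<Delta> > 0" "\<Delta> \<le> h0" using h'0 h' by (auto simp: \<Delta>_def)
  have \<epsilon>: "\<epsilon> > 0" using \<Delta> by (simp add: \<epsilon>_def)
  have \<gamma>: "\<gamma> > 0" "\<gamma> \<le> 1/2" "\<gamma> * h0 \<le> \<epsilon>" using \<epsilon> T0.h_pos by (auto simp: \<gamma>_def min_def field_simps)
  obtain K2 where K2: "\<And>k. k \<ge> 1 \<Longrightarrow> measure unif {x. exp (- (h0 - \<epsilon>) * real k) < \<bar>x - r k x\<bar>} \<le> K2 / sqrt (real k)"
    using F2[OF \<epsilon>] by blast
  have K2p: "K2 \<ge> 0" using order_trans[OF measure_nonneg K2[of 1]] by simp
  have "\<exists>D. divides D (f j)" if "j \<in> J" for j using J(4)[OF that] by (auto simp: stepf_def)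
  then obtain D where D: "\<And>j. j \<in> J \<Longrightarrow> divides (D j) (f j)" by metis
  have Dfin: "finite (D j)" if "j \<in> J" for j using D[OF that] by (simp add: divides_def)
  have "\<exists>K. \<forall>m\<ge>1. \<forall>\<delta>\<ge>0. \<exists>B\<in>sets borel.
      measure unif B \<le> K * (exp ((h j + \<epsilon>) * real m) * \<delta> + 1 / sqrt (real m)) \<and>
      (\<forall>x\<in>{0..1} - B. \<forall>y\<in>{0..1}. \<bar>y - x\<bar> \<le> \<delta> \<longrightarrow> closed_segment ((T j ^^ m) x) ((T j ^^ m) y) \<inter> D j = {})"
    if "j \<in> J" for j using jsys.slow[OF J(2)[OF that] \<epsilon> Dfin[OF that]] .
  then have "\<exists>K. \<forall>j\<in>J. \<forall>m\<ge>1. \<forall>\<delta>\<ge>0. \<exists>B\<in>sets borel.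
      measure unif B \<le> K j * (exp ((h j + \<epsilon>) * real m) * \<delta> + 1 / sqrt (real m)) \<and>
      (\<forall>x\<in>{0..1} - B. \<forall>y\<in>{0..1}. \<bar>y - x\<bar> \<le> \<delta> \<longrightarrow> closed_segment ((T j ^^ m) x) ((T j ^^ m) y) \<inter> D j = {})"
    by (intro bchoice) blast
  then obtain K where K: "\<forall>j\<in>J. \<forall>m\<ge>1. \<forall>\<delta>\<ge>0. \<exists>B\<in>sets borel.
      measure unif B \<le> K j * (exp ((h j + \<epsilon>) * real m) * \<delta> + 1 / sqrt (real m)) \<and>
      (\<forall>x\<in>{0..1} - B. \<forall>y\<in>{0..1}. \<bar>y - x\<bar> \<le> \<delta> \<longrightarrow> closed_segment ((T j ^^ m) x) ((T j ^^ m) y) \<inter> D j = {})" ..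
  define P where "P j m \<delta> B \<longleftrightarrow> B \<in> sets borel \<and>
      measure unif B \<le> K j * (exp ((h j + \<epsilon>) * real m) * \<delta> + 1 / sqrt (real m)) \<and>
      (\<forall>x\<in>{0..1} - B. \<forall>y\<in>{0..1}. \<bar>y - x\<bar> \<le> \<delta> \<longrightarrow> closed_segment ((T j ^^ m) x) ((T j ^^ m) y) \<inter> D j = {})" for j m \<delta> B
  define B where "B j m \<delta> = (SOME B. P j m \<delta> B)" for j m \<delta>
  have PB: "P j m \<delta> (B j m \<delta>)" if "j \<in> J" "m \<ge> 1" "\<delta> \<ge> 0" for j m \<delta>
  proof -
    have "\<exists>B. P j m \<delta> B" using K[rule_format, OF that] unfolding P_def by blast
    then show ?thesis unfolding B_def by (rule someI_ex)
  qed
  have B[measurable]: "B j m \<delta> \<in> sets borel"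
    and Bm: "measure unif (B j m \<delta>) \<le> K j * (exp ((h j + \<epsilon>) * real m) * \<delta> + 1 / sqrt (real m))"
    if "j \<in> J" "m \<ge> 1" "\<delta> \<ge> 0" for j m \<delta> using PB[OF that] by (simp_all add: P_def)
  have Bx: "closed_segment ((T j ^^ m) x) ((T j ^^ m) y) \<inter> D j = {}"
    if "j \<in> J" "m \<ge> 1" "\<delta> \<ge> 0" "x \<in> {0..1}" "x \<notin> B j m \<delta>" "y \<in> {0..1}" "\<bar>y - x\<bar> \<le> \<delta>" for j m \<delta> x y
    using PB[OF that(1-3)] that(4-7) unfolding P_def by blast
  have Kp: "K j \<ge> 0" if "j \<in> J" for j
    using order_trans[OF measure_nonneg Bm[OF that, of 1 0]] by simp
  define Y where "Y n x = (\<Prod>j\<in>J. f j ((T j ^^ n) x))" for n x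
  have itm: "(T j ^^ n) \<in> borel_measurable borel" if "j \<in> J" for j n
    using acim.iter_borel[OF jsys.axioms(1)[OF J(2)[OF that]]] .
  have fm: "f j \<in> borel_measurable borel" and f1: "norm (f j x) \<le> 1" if "j \<in> J" for j x
    using J(4)[OF that] by (auto simp: stepf_def)
  have Ym[measurable]: "Y n \<in> borel_measurable borel" for n
    unfolding Y_def using J(1) by (intro prod_borel) (auto intro: measurable_compose[OF itm fm])
  have Y1: "norm (Y n x) \<le> 1" for n x unfolding Y_def using f1 by (intro norm_prod_le_1) auto
  \<comment> \<open>One rate for three sources: slow expansion against cylinder length, mixing over
    about \<open>\<gamma> * (m - n)\<close> steps, and contraction over at least
    \<open>(m - n) / 2\<close> steps.\<close>
  define q where "q = max (exp (- \<Delta> / 2)) (max (\<theta> powr \<gamma>) (sqrt \<theta>))"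
  have tg: "\<theta> powr \<gamma> < 1" using \<theta> \<gamma> powr_less_mono'[of \<theta> 0 \<gamma>] by simp
  have q: "0 < q" "q < 1" using \<Delta> tg \<theta> by (auto simp: q_def less_max_iff_disj)
  define SS where "SS = (\<Sum>j\<in>J. 2 * K j) + K2 + Cn * (2 * real (card Dg) * C)"
  define KK where "KK = C / \<theta> + 2 * SS"
  have KK: "0 \<le> KK" unfolding KK_def SS_def using \<theta> C Kp K2p Cn by (intro add_nonneg_nonneg mult_nonneg_nonneg sum_nonneg) auto
  have main: "norm (\<integral>x. cnj (X n x) * X m x \<partial>unif) \<le> KK * (q ^ (m - n) + 1 / sqrt (real n))"
    if n: "1 \<le> n" "n < m" for n m
  proof -
    \<comment> \<open>Proportional to \<open>m - n\<close>, so that mixing is geometric in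
      \<open>m - n\<close>; at most half of it, so that \<open>k\<close> stays well beyond
      \<open>n\<close>.\<close>
    define j where "j = nat \<lfloor>\<gamma> * real (m - n)\<rfloor>"
    define k where "k = m - j"
    have j1: "real j \<le> \<gamma> * real (m - n)" using \<gamma> by (simp add: j_def)
    have j2: "\<gamma> * real (m - n) \<le> real j + 1" by (simp add: j_def) linarith
    have "\<gamma> * real (m - n) \<le> 1/2 * real (m - n)" using \<gamma> by (intro mult_right_mono) auto
    then have j3: "2 * j \<le> m - n" using j1 by linarith
    have k: "n \<le> k" "k + j = m" "m - n \<le> 2 * (k - n)" "1 \<le> k" using j3 n by (auto simp: k_def)
    define \<delta> where "\<delta> = exp (- (h0 - \<epsilon>) * real k)"
    have \<delta>: "0 \<le> \<delta>" by (simp add: \<delta>_def)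
    \<comment> \<open>Everything except the fast factor at time \<open>m\<close>; this part is to
      become a function of the cylinder.\<close>
    define Z where "Z x = cnj (Y n x) * cnj (g ((T0 ^^ n) x)) * Y m x" for x
    have [measurable]: "cnj \<in> borel_measurable borel"
      by (intro borel_measurable_continuous_onI continuous_intros)
    have Zm[measurable]: "Z \<in> borel_measurable borel"
      unfolding Z_def by (intro borel_measurable_times measurable_compose[OF Ym] Ym) measurable
    have Z1: "norm (Z x) \<le> 1" for x unfolding Z_def norm_mult complex_mod_cnj
      by (intro mult_le_one Y1 g1 mult_nonneg_nonneg) auto
    have eq: "cnj (X n x) * X m x = Z x * g ((T0 ^^ m) x)" for x
      by (simp add: X_def Z_def Y_def)
    define B0 where "B0 = {x. \<delta> < \<bar>x - r k x\<bar>}"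
    define Bg where "Bg = (T0 ^^ n) -` nbhd Dg (C * \<theta> ^ (k - n))"
    \<comment> \<open>Outside \<open>BB\<close> the point and its cylinder point are within
      \<open>\<delta>\<close>, the slow maps have no jump between their images at times
      \<open>m\<close> and \<open>n\<close>, and \<open>T0 ^^ n\<close> maps the point far from the
      jumps of \<open>g\<close>.\<close>
    define BB where "BB = (\<Union>i\<in>J. B i m \<delta> \<union> B i n \<delta>) \<union> B0 \<union> Bg"
    have B0m[measurable]: "B0 \<in> sets borel" unfolding B0_def by measurable
    have Bgm[measurable]: "Bg \<in> sets borel"
      unfolding Bg_def using measurable_sets[OF T0.iter_borel nbhd_borel[OF Dg_fin]] by simp
    have BJm: "(\<Union>i\<in>J. B i m \<delta> \<union> B i n \<delta>) \<in> sets borel" using J(1) n \<delta> by auto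
    have BBm[measurable]: "BB \<in> sets borel" unfolding BB_def using BJm by auto
    have e1: "exp ((h i + \<epsilon>) * real m') * \<delta> \<le> q ^ (m - n)" if i: "i \<in> J" and m': "m' \<le> m" for i m'
    proof -
      have hp: "0 < h i" using jsys.h_pos[OF J(2)[OF i]] .
      have "(h i + \<epsilon>) * real m' \<le> (h' + \<epsilon>) * real m" using h'(2)[OF i] hp m' \<epsilon> by (intro mult_mono) auto
      moreover have "(h0 - 2 * \<epsilon>) * real m \<le> (h0 - \<epsilon>) * real k"
      proof -
        have "\<gamma> * real (m - n) \<le> \<gamma> * real m" using \<gamma> by (intro mult_left_mono) auto
        then have "real j \<le> \<gamma> * real m" using j1 by linarith
        then have "(1 - \<gamma>) * real m \<le> real k" using k(2) by (simp add: algebra_simps)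
        then have "(h0 - \<epsilon>) * ((1 - \<gamma>) * real m) \<le> (h0 - \<epsilon>) * real k"
          using \<Delta> by (intro mult_left_mono) (auto simp: \<epsilon>_def)
        moreover have "(h0 - 2 * \<epsilon>) * real m \<le> ((h0 - \<epsilon>) * (1 - \<gamma>)) * real m"
        proof (rule mult_right_mono)
          have "(h0 - \<epsilon>) * (1 - \<gamma>) = h0 - \<epsilon> - \<gamma> * h0 + \<epsilon> * \<gamma>" by (simp add: algebra_simps)
          then show "h0 - 2 * \<epsilon> \<le> (h0 - \<epsilon>) * (1 - \<gamma>)" using \<gamma> mult_nonneg_nonneg[of \<epsilon> \<gamma>] \<epsilon> by linarith
        qed simp
        ultimately show ?thesis by (simp add: mult.assoc)
      qed
      ultimately have "(h i + \<epsilon>) * real m' + - (h0 - \<epsilon>) * real k \<le> (h' + \<epsilon>) * real m - (h0 - 2 * \<epsilon>) * real m"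
        unfolding mult_minus_left by linarith
      also have "\<dots> = (3 * \<epsilon> - \<Delta>) * real m" by (simp add: \<Delta>_def algebra_simps)
      also have "\<dots> \<le> (- \<Delta> / 2) * real m" using \<Delta> by (intro mult_right_mono) (auto simp: \<epsilon>_def)
      also have "\<dots> \<le> (- \<Delta> / 2) * real (m - n)" using \<Delta> by (intro mult_left_mono_neg) auto
      finally have "exp ((h i + \<epsilon>) * real m') * \<delta> \<le> exp ((- \<Delta> / 2) * real (m - n))"
        unfolding \<delta>_def by (simp flip: exp_add)
      also have "\<dots> = exp (- \<Delta> / 2) ^ (m - n)" by (simp add: exp_of_nat_mult[symmetric] mult.commute)
      also have "\<dots> \<le> q ^ (m - n)" by (intro power_mono) (auto simp: q_def)
      finally show ?thesis .
    qed
    have sq: "1 / sqrt (real m') \<le> 1 / sqrt (real n)" if "n \<le> m'" for m' using that n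
      by (intro divide_left_mono) auto
    have e2: "\<theta> ^ (k - n) \<le> q ^ (m - n)"
    proof -
      have "\<theta> ^ (k - n) = sqrt \<theta> ^ (2 * (k - n))" using \<theta> by (simp add: power_mult)
      also have "\<dots> \<le> sqrt \<theta> ^ (m - n)" using k \<theta> by (intro power_decreasing) auto
      also have "\<dots> \<le> q ^ (m - n)" using \<theta> by (intro power_mono) (auto simp: q_def)
      finally show ?thesis .
    qed
    \<comment> \<open>The division by \<open>\<theta>\<close> pays for rounding \<open>j\<close>
      down.\<close>
    have e3: "\<theta> ^ j \<le> q ^ (m - n) / \<theta>"
    proof -
      have "\<theta> ^ j = \<theta> powr real j" using \<theta> by (simp add: powr_realpow)
      also have "\<dots> \<le> \<theta> powr (\<gamma> * real (m - n) - 1)" using j2 \<theta> by (intro powr_mono') auto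
      also have "\<dots> = (\<theta> powr \<gamma>) ^ (m - n) / \<theta>" using \<theta> by (simp add: powr_diff powr_powr flip: powr_realpow)
      also have "\<dots> \<le> q ^ (m - n) / \<theta>" using \<theta> by (intro divide_right_mono power_mono) (auto simp: q_def)
      finally show ?thesis .
    qed
    let ?E = "q ^ (m - n) + 1 / sqrt (real n)"
    have E1: "q ^ (m - n) \<le> ?E" "1 / sqrt (real n) \<le> ?E" using q by auto
    have mB: "measure unif BB \<le> SS * ?E"
    proof -
      have b1: "measure unif (\<Union>i\<in>J. B i m \<delta> \<union> B i n \<delta>) \<le> (\<Sum>i\<in>J. 2 * K i) * ?E"
      proof -
        have "measure unif (\<Union>i\<in>J. B i m \<delta> \<union> B i n \<delta>) \<le> (\<Sum>i\<in>J. measure unif (B i m \<delta> \<union> B i n \<delta>))"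
          using J(1) n \<delta> by (intro unif.finite_measure_subadditive_finite) auto
        also have "\<dots> \<le> (\<Sum>i\<in>J. 2 * K i * ?E)"
        proof (rule sum_mono)
          fix i assume i: "i \<in> J"
          have "measure unif (B i m \<delta> \<union> B i n \<delta>) \<le> measure unif (B i m \<delta>) + measure unif (B i n \<delta>)"
            using i n \<delta> by (intro measure_Un_le) auto
          also have "measure unif (B i m \<delta>) \<le> K i * (exp ((h i + \<epsilon>) * real m) * \<delta> + 1 / sqrt (real m))"
            using i n \<delta> by (intro Bm) auto
          also have "\<dots> \<le> K i * ?E" using n by (intro mult_left_mono add_mono e1 i sq Kp) auto
          also have "measure unif (B i n \<delta>) \<le> K i * (exp ((h i + \<epsilon>) * real n) * \<delta> + 1 / sqrt (real n))"
            using i n \<delta> by (intro Bm) auto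
          also have "\<dots> \<le> K i * ?E" using n by (intro mult_left_mono add_mono e1 i sq Kp) auto
          finally show "measure unif (B i m \<delta> \<union> B i n \<delta>) \<le> 2 * K i * ?E" by simp
        qed
        finally show ?thesis by (simp only: sum_distrib_right)
      qed
      have b2: "measure unif B0 \<le> K2 * ?E"
      proof -
        have "measure unif B0 \<le> K2 * (1 / sqrt (real k))" unfolding B0_def \<delta>_def using K2[OF k(4)] by simp
        also have "\<dots> \<le> K2 * ?E" using sq[OF k(1)] E1 by (intro mult_left_mono K2p) linarith
        finally show ?thesis .
      qed
      have b3: "measure unif Bg \<le> Cn * (2 * real (card Dg) * C) * ?E"
      proof -
        have "measure unif Bg \<le> Cn * measure unif (nbhd Dg (C * \<theta> ^ (k - n)))"
          unfolding Bg_def by (intro Cn nbhd_borel Dg_fin)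
        also have "\<dots> \<le> Cn * (2 * real (card Dg) * (C * \<theta> ^ (k - n)))"
          using C \<theta> by (intro mult_left_mono measure_nbhd_le Dg_fin Cn) auto
        also have "\<dots> = Cn * (2 * real (card Dg) * C) * \<theta> ^ (k - n)" by simp
        also have "\<dots> \<le> Cn * (2 * real (card Dg) * C) * ?E" using Cn(1) C
          by (intro mult_left_mono order_trans[OF e2 E1(1)]) auto
        finally show ?thesis .
      qed
      have "measure unif BB \<le> measure unif ((\<Union>i\<in>J. B i m \<delta> \<union> B i n \<delta>) \<union> B0) + measure unif Bg"
        unfolding BB_def using BJm by (intro measure_Un_le) auto
      moreover have "measure unif ((\<Union>i\<in>J. B i m \<delta> \<union> B i n \<delta>) \<union> B0) \<le> measure unif (\<Union>i\<in>J. B i m \<delta> \<union> B i n \<delta>) + measure unif B0"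
        using BJm by (intro measure_Un_le) auto
      ultimately show ?thesis using b1 b2 b3 unfolding SS_def
        by (simp only: distrib_right)
    qed
    have ae: "AE x in unif. norm (Z x - Z (r k x)) \<le> 2 * indicator BB x"
      using F3[OF k(1)] AE_unif_mem
    proof eventually_elim
      case (elim x)
      show ?case
      proof (cases "x \<in> BB")
        case True
        then show ?thesis using norm_triangle_ineq4[of "Z x" "Z (r k x)"] Z1[of x] Z1[of "r k x"] by simp
      next
        case False
        let ?y = "r k x"
        have y: "?y \<in> {0..1}" using r_mem elim by auto
        have d: "\<bar>?y - x\<bar> \<le> \<delta>" using False by (auto simp: BB_def B0_def)
        have fe: "f i ((T i ^^ m') x) = f i ((T i ^^ m') ?y)" if i: "i \<in> J" and m': "m' = m \<or> m' = n" for i m'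
        proof -
          have "x \<notin> B i m' \<delta>" using False i m' by (auto simp: BB_def)
          then have "closed_segment ((T i ^^ m') x) ((T i ^^ m') ?y) \<inter> D i = {}"
            using n m' \<delta> elim y d by (intro Bx[OF i, of m' \<delta>]) auto
          then show ?thesis using D[OF i] acim.iter_mem[OF jsys.axioms(1)[OF J(2)[OF i]]] elim y unfolding divides_def by blast
        qed
        have "Y m x = Y m ?y" "Y n x = Y n ?y" unfolding Y_def using fe by (auto intro!: prod.cong)
        moreover have "g ((T0 ^^ n) x) = g ((T0 ^^ n) ?y)"
        proof -
          have "(T0 ^^ n) x \<notin> nbhd Dg (C * \<theta> ^ (k - n))" using False by (auto simp: BB_def Bg_def)
          moreover have "\<bar>(T0 ^^ n) ?y - (T0 ^^ n) x\<bar> \<le> C * \<theta> ^ (k - n)" using elim by (simp add: abs_minus_commute)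
          ultimately have "closed_segment ((T0 ^^ n) x) ((T0 ^^ n) ?y) \<inter> Dg = {}"
            by (rule closed_segment_avoids_far_set)
          then show ?thesis using Dg T0.iter_mem elim y unfolding divides_def by blast
        qed
        ultimately have "Z x = Z ?y" unfolding Z_def by simp
        then show ?thesis by simp
      qed
    qed
    have gT[measurable]: "(\<lambda>x. g ((T0 ^^ m) x)) \<in> borel_measurable borel" by measurable
    have Zg1: "norm (Z x * g ((T0 ^^ m) x)) \<le> 1" for x unfolding norm_mult by (intro mult_le_one Z1 g1) auto
    have Zg2: "norm (Z (r k x) * g ((T0 ^^ m) x)) \<le> 1" for x unfolding norm_mult by (intro mult_le_one Z1 g1) auto
    have i1: "integrable unif (\<lambda>x. Z x * g ((T0 ^^ m) x))" using Zg1 by (intro integrable_unif_bounded[where C=1]) auto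
    have i2: "integrable unif (\<lambda>x. Z (r k x) * g ((T0 ^^ m) x))" using Zg2 by (intro integrable_unif_bounded[where C=1]) auto
    have i3: "integrable unif (\<lambda>x. 2 * indicator BB x :: real)"
      by (intro integrable_unif_bounded[where C=2]) (auto simp: indicator_def)
    have "(\<integral>x. cnj (X n x) * X m x \<partial>unif) = (\<integral>x. Z (r k x) * g ((T0 ^^ m) x) \<partial>unif) +
        (\<integral>x. Z x * g ((T0 ^^ m) x) - Z (r k x) * g ((T0 ^^ m) x) \<partial>unif)"
      unfolding eq using i1 i2 by (subst Bochner_Integration.integral_diff) auto
    then have t1: "norm (\<integral>x. cnj (X n x) * X m x \<partial>unif) \<le> norm (\<integral>x. Z (r k x) * g ((T0 ^^ m) x) \<partial>unif) +
        norm (\<integral>x. Z x * g ((T0 ^^ m) x) - Z (r k x) * g ((T0 ^^ m) x) \<partial>unif)"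
      by (simp only: norm_triangle_ineq)
    have t2: "norm (\<integral>x. Z (r k x) * g ((T0 ^^ m) x) \<partial>unif) \<le> C * \<theta> ^ j"
      using R(2)[unfolded cylinder_mixing_def, rule_format, OF Zm gm Z1 g1 g(2), of k j] k(2) by simp
    have t3: "C * \<theta> ^ j \<le> C / \<theta> * ?E"
    proof -
      have "C * \<theta> ^ j \<le> C * (q ^ (m - n) / \<theta>)" by (intro mult_left_mono e3 C)
      also have "\<dots> = C / \<theta> * q ^ (m - n)" by simp
      also have "\<dots> \<le> C / \<theta> * ?E" using C \<theta> by (intro mult_left_mono E1(1)) auto
      finally show ?thesis .
    qed
    have t4: "norm (\<integral>x. Z x * g ((T0 ^^ m) x) - Z (r k x) * g ((T0 ^^ m) x) \<partial>unif) \<le> 2 * measure unif BB"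
    proof -
      have "norm (\<integral>x. Z x * g ((T0 ^^ m) x) - Z (r k x) * g ((T0 ^^ m) x) \<partial>unif)
        \<le> (\<integral>x. norm (Z x * g ((T0 ^^ m) x) - Z (r k x) * g ((T0 ^^ m) x)) \<partial>unif)" by (rule integral_norm_bound)
      also have "\<dots> \<le> (\<integral>x. 2 * indicator BB x \<partial>unif)"
      proof (rule integral_mono_AE)
        show "AE x in unif. norm (Z x * g ((T0 ^^ m) x) - Z (r k x) * g ((T0 ^^ m) x)) \<le> 2 * indicator BB x"
          using ae
        proof eventually_elim
          case (elim x)
          have "norm (Z x * g ((T0 ^^ m) x) - Z (r k x) * g ((T0 ^^ m) x)) = norm (Z x - Z (r k x)) * norm (g ((T0 ^^ m) x))"
            by (simp add: norm_mult flip: left_diff_distrib)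
          also have "\<dots> \<le> norm (Z x - Z (r k x)) * 1" by (intro mult_left_mono g1) auto
          finally show ?case using elim by simp
        qed
      qed (use i1 i2 i3 in auto)
      also have "\<dots> = 2 * measure unif BB" by simp
      finally show ?thesis .
    qed
    have "norm (\<integral>x. cnj (X n x) * X m x \<partial>unif) \<le> C / \<theta> * ?E + 2 * (SS * ?E)"
      using t1 t2 t3 t4 mB by linarith
    then show ?thesis unfolding KK_def distrib_right[of "C / \<theta>"] mult.assoc[of 2] .
  qed
  show ?thesis using KK q main by blast
qed

lemma sum_inverse_sqrt_le: "(\<Sum>n\<in>{1..<N}. 1 / sqrt (real n)) \<le> 2 * sqrt (real N)"
proof -
  have "(\<Sum>n\<in>{1..N}. 1 / sqrt (real n)) \<le> 2 * sqrt (real N)"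
  proof (induction N)
    case (Suc N)
    let ?a = "sqrt (real (Suc N))" and ?b = "sqrt (real N)"
    have s: "0 < ?a" "?b \<le> ?a" by auto
    have "1 = ?a\<^sup>2 - ?b\<^sup>2" by simp
    also have "\<dots> = (?a - ?b) * (?a + ?b)" by (simp only: power2_eq_square square_diff_square_factored mult.commute)
    also have "\<dots> \<le> (?a - ?b) * (2 * ?a)"
      using s by (intro mult_left_mono) auto
    finally have "1 / ?a \<le> 2 * (?a - ?b)" using s(1) by (simp only: pos_divide_le_eq mult_ac)
    then show ?case using Suc.IH by simp
  qed simp
  moreover have "(\<Sum>n\<in>{1..<N}. 1 / sqrt (real n)) \<le> (\<Sum>n\<in>{1..N}. 1 / sqrt (real n))"
    by (intro sum_mono2) auto
  ultimately show ?thesis by linarith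
qed

text \<open>The term \<open>N\<close> adds to the second moment at most 1 plus twice its
  correlations with the earlier terms, which sum to O(sqrt N) by the geometric series and
  \<open>sum_inverse_sqrt_le\<close>. Time 0 lies outside the correlation estimate and is bounded
  trivially.\<close>

lemma second_moment_bound:
  fixes X :: "nat \<Rightarrow> 'a \<Rightarrow> complex"
  assumes "prob_space M" and X[measurable]: "\<And>n. X n \<in> borel_measurable M" and X1: "\<And>n x. norm (X n x) \<le> 1"
    and K: "0 \<le> K" and q: "0 < q" "q < 1"
    and cor: "\<And>n m. 1 \<le> n \<Longrightarrow> n < m \<Longrightarrow> norm (\<integral>x. cnj (X n x) * X m x \<partial>M) \<le> K * (q ^ (m - n) + 1 / sqrt (real n))"
  shows "\<exists>A. \<forall>N. (\<integral>x. (norm (\<Sum>n<N. X n x))\<^sup>2 \<partial>M) \<le> A * real N * sqrt (real N)"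
proof -
  interpret prob_space M by fact
  define A where "A = 3 + 2 * K / (1 - q) + 4 * K"
  have [measurable]: "cnj \<in> borel_measurable borel"
    by (intro borel_measurable_continuous_onI continuous_intros)
  have cX[measurable]: "(\<lambda>x. cnj (X n x)) \<in> borel_measurable M" for n
    by (rule measurable_compose[OF X]) measurable
  have A: "0 \<le> A" using K q by (auto simp: A_def)
  have iXX: "integrable M (\<lambda>x. cnj (X n x) * X m x)" for n m
    by (rule integrable_const_bound[where B=1]) (auto simp: norm_mult intro!: mult_le_one X1)
  have cor0: "norm (\<integral>x. cnj (X n x) * X m x \<partial>M) \<le> 1" for n m
  proof -
    have "norm (\<integral>x. cnj (X n x) * X m x \<partial>M) \<le> (\<integral>x. norm (cnj (X n x) * X m x) \<partial>M)" by (rule integral_norm_bound)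
    also have "\<dots> \<le> (\<integral>x. 1 \<partial>M)" using iXX
      by (intro integral_mono integrable_norm) (auto simp: norm_mult intro!: mult_le_one X1)
    finally show ?thesis by (simp add: prob_space)
  qed
  have "(\<integral>x. (norm (\<Sum>n<N. X n x))\<^sup>2 \<partial>M) \<le> A * real N * sqrt (real N)" for N
  proof (induction N)
    case (Suc N)
    define S where "S x = (\<Sum>n<N. X n x)" for x
    have Sm[measurable]: "S \<in> borel_measurable M" unfolding S_def by measurable
    have nS: "norm (S x) \<le> real N" for x
      unfolding S_def using sum_norm_le[of "{..<N}" "\<lambda>n. X n x" "\<lambda>_. 1"] X1 by simp
    have iS: "integrable M (\<lambda>x. (norm (S x))\<^sup>2)"
      by (rule integrable_const_bound[where B="(real N)\<^sup>2"]) (auto intro!: power_mono nS)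
    have iX: "integrable M (\<lambda>x. (norm (X N x))\<^sup>2)"
      by (rule integrable_const_bound[where B="1"]) (auto intro!: power_le_one X1)
    have cS: "cnj (S x) * X N x = (\<Sum>n<N. cnj (X n x) * X N x)" for x
      unfolding S_def by (simp add: cnj_sum sum_distrib_right)
    have iSX: "integrable M (\<lambda>x. cnj (S x) * X N x)" unfolding cS using iXX by auto
    define R where "R x = Re (cnj (S x) * X N x)" for x
    have iR: "integrable M R" "(\<integral>x. R x \<partial>M) = Re (\<integral>x. cnj (S x) * X N x \<partial>M)"
      unfolding R_def using iSX by (rule integrable_Re, rule integral_Re)
    have sq: "(norm (\<Sum>n<Suc N. X n x))\<^sup>2 = (norm (S x))\<^sup>2 + 2 * R x + (norm (X N x))\<^sup>2" for x
      unfolding R_def S_def[symmetric] sum.lessThan_Suc cmod_power2 by (simp add: power2_eq_square algebra_simps)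
    have "(\<integral>x. (norm (\<Sum>n<Suc N. X n x))\<^sup>2 \<partial>M) = (\<integral>x. (norm (S x))\<^sup>2 \<partial>M) + 2 * Re (\<integral>x. cnj (S x) * X N x \<partial>M) + (\<integral>x. (norm (X N x))\<^sup>2 \<partial>M)"
      unfolding sq using iS iX iR by simp
    moreover have "(\<integral>x. (norm (X N x))\<^sup>2 \<partial>M) \<le> (\<integral>x. 1 \<partial>M)"
      using iX by (intro integral_mono) (auto intro!: power_le_one X1)
    moreover have "Re (\<integral>x. cnj (S x) * X N x \<partial>M) \<le> 1 + K / (1 - q) + 2 * K * sqrt (real N)"
    proof -
      have "(\<integral>x. cnj (S x) * X N x \<partial>M) = (\<Sum>n<N. \<integral>x. cnj (X n x) * X N x \<partial>M)"
        unfolding cS using iXX by (intro Bochner_Integration.integral_sum)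
      then have "Re (\<integral>x. cnj (S x) * X N x \<partial>M) \<le> norm (\<Sum>n<N. \<integral>x. cnj (X n x) * X N x \<partial>M)"
        by (simp only: complex_Re_le_cmod)
      also have "\<dots> \<le> (\<Sum>n<N. norm (\<integral>x. cnj (X n x) * X N x \<partial>M))" by (rule norm_sum)
      also have "\<dots> \<le> (\<Sum>n\<in>insert 0 {1..<N}. norm (\<integral>x. cnj (X n x) * X N x \<partial>M))"
        by (intro sum_mono2) auto
      also have "\<dots> \<le> 1 + (\<Sum>n\<in>{1..<N}. norm (\<integral>x. cnj (X n x) * X N x \<partial>M))"
        using cor0[of 0 N] by simp
      also have "(\<Sum>n\<in>{1..<N}. norm (\<integral>x. cnj (X n x) * X N x \<partial>M)) \<le> (\<Sum>n\<in>{1..<N}. K * (q ^ (N - n) + 1 / sqrt (real n)))"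
        by (intro sum_mono cor) auto
      also have "\<dots> = K * (\<Sum>n\<in>{1..<N}. q ^ (N - n)) + K * (\<Sum>n\<in>{1..<N}. 1 / sqrt (real n))"
        by (simp add: sum_distrib_left distrib_left sum.distrib)
      finally have r1: "Re (\<integral>x. cnj (S x) * X N x \<partial>M) \<le>
        1 + (K * (\<Sum>n\<in>{1..<N}. q ^ (N - n)) + K * (\<Sum>n\<in>{1..<N}. 1 / sqrt (real n)))" by simp
      have r2: "(\<Sum>n\<in>{1..<N}. q ^ (N - n)) \<le> 1 / (1 - q)"
      proof -
        have "(\<Sum>n\<in>{1..<N}. q ^ (N - n)) = (\<Sum>n\<in>{1..<N}. q ^ n)"
          by (rule sum.reindex_bij_witness[of _ "\<lambda>n. N - n" "\<lambda>n. N - n"]) auto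
        also have "\<dots> \<le> (\<Sum>n. q ^ n)" using q by (intro sum_le_suminf summable_geometric) auto
        finally show ?thesis using q by (simp add: suminf_geometric)
      qed
      show ?thesis
        using r1 mult_left_mono[OF r2 K] mult_left_mono[OF sum_inverse_sqrt_le[of N] K] by simp
    qed
    ultimately have "(\<integral>x. (norm (\<Sum>n<Suc N. X n x))\<^sup>2 \<partial>M) \<le>
        A * real N * sqrt (real N) + 2 * (1 + K / (1 - q) + 2 * K * sqrt (real N)) + 1"
      using Suc.IH by (simp add: prob_space S_def)
    also have "\<dots> \<le> A * real N * sqrt (real (Suc N)) + A * sqrt (real (Suc N))"
    proof (rule add_mono[of "A * real N * sqrt (real N)" _ "2 * (1 + K / (1 - q) + 2 * K * sqrt (real N)) + 1", unfolded add.assoc[symmetric]])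
      show "A * real N * sqrt (real N) \<le> A * real N * sqrt (real (Suc N))" using A by (intro mult_left_mono) auto
      have s: "1 \<le> sqrt (real (Suc N))" "sqrt (real N) \<le> sqrt (real (Suc N))" by auto
      have "3 + 2 * (K / (1 - q)) \<le> (3 + 2 * (K / (1 - q))) * sqrt (real (Suc N))"
        using mult_left_mono[OF s(1), of "3 + 2 * (K / (1 - q))"] K q by simp
      moreover have "4 * K * sqrt (real N) \<le> 4 * K * sqrt (real (Suc N))" using K s by (intro mult_left_mono) auto
      ultimately show "2 * (1 + K / (1 - q) + 2 * K * sqrt (real N)) + 1 \<le> A * sqrt (real (Suc N))"
        unfolding A_def by (simp add: algebra_simps)
    qed
    finally show ?case by (simp add: algebra_simps)
  qed simp
  then show ?thesis by blast
qed

section \<open>Pointwise joint ergodicity\<close>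

lemma joint_average_mean_zero:
  fixes J :: "'i set" and T w :: "'i \<Rightarrow> real \<Rightarrow> real" and h :: "'i \<Rightarrow> real" and f :: "'i \<Rightarrow> real \<Rightarrow> complex"
  assumes J: "finite J" "\<And>j. j \<in> J \<Longrightarrow> jsys (T j) (w j) (h j)" "\<And>j. j \<in> J \<Longrightarrow> h j < h0" "\<And>j. j \<in> J \<Longrightarrow> stepf (f j)"
    and T0: "jsys T0 w0 h0" and g: "stepf g" "(\<integral>x. w0 x *\<^sub>R g x \<partial>unif) = 0"
  shows "AE x in unif. (\<lambda>N. (\<Sum>n<N. (\<Prod>j\<in>J. f j ((T j ^^ n) x)) * g ((T0 ^^ n) x)) / of_nat N) \<longlonglongrightarrow> 0"
proof -
  let ?X = "\<lambda>n x. (\<Prod>j\<in>J. f j ((T j ^^ n) x)) * g ((T0 ^^ n) x)"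
  obtain K q where K: "0 \<le> K" "0 < q" "q < 1" "\<And>n m. 1 \<le> n \<Longrightarrow> n < m \<Longrightarrow>
    norm (\<integral>x. cnj (?X n x) * ?X m x \<partial>unif) \<le> K * (q ^ (m - n) + 1 / sqrt (real n))"
    using correlation_decay[where X = ?X, OF J T0 g refl] by blast
  have m: "?X n \<in> borel_measurable unif" for n
  proof -
    have "(\<lambda>x. g ((T0 ^^ n) x)) \<in> borel_measurable borel"
      using g(1) by (intro measurable_compose[OF acim.iter_borel[OF jsys.axioms(1)[OF T0]]]) (auto simp: stepf_def)
    moreover have "(\<lambda>x. \<Prod>j\<in>J. f j ((T j ^^ n) x)) \<in> borel_measurable borel"
      using J by (intro prod_borel) (auto intro!: measurable_compose[OF acim.iter_borel[OF jsys.axioms(1)[OF J(2)]]] simp: stepf_def)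
    ultimately show ?thesis by simp
  qed
  have b: "norm (?X n x) \<le> 1" for n x
    unfolding norm_mult using J(4) g(1) by (intro mult_le_one norm_prod_le_1) (auto simp: stepf_def)
  obtain A where A: "\<And>N. (\<integral>x. (norm (\<Sum>n<N. ?X n x))\<^sup>2 \<partial>unif) \<le> A * real N * sqrt (real N)"
    using second_moment_bound[where X = ?X, OF prob_space_unif m b K] by blast
  show ?thesis by (rule strong_law_of_second_moments[where X = ?X, OF prob_space_unif m b A])
qed

text \<open>Halving keeps the bound 1 of \<open>stepf\<close> once the mean is subtracted.\<close>

lemma stepf_center:
  assumes "stepf f" "norm c \<le> 1"
  shows "stepf (\<lambda>x. (f x - c) / 2)"
proof -
  obtain D where D: "divides D f" using assms by (auto simp: stepf_def)
  have "norm ((f x - c) / 2) \<le> 1" for x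
    using norm_triangle_ineq4[of "f x" c] assms by (simp add: norm_divide stepf_def) (smt (verit))
  then show ?thesis using assms divides_comp[OF D, of "\<lambda>z. (z - c) / 2"] unfolding stepf_def by auto
qed

lemma joint_average_step:
  fixes I :: "'i set" and T w :: "'i \<Rightarrow> real \<Rightarrow> real" and h :: "'i \<Rightarrow> real" and f :: "'i \<Rightarrow> real \<Rightarrow> complex"
  assumes "finite I" "\<And>j. j \<in> I \<Longrightarrow> jsys (T j) (w j) (h j)" "inj_on h I" "\<And>j. j \<in> I \<Longrightarrow> stepf (f j)"
  shows "AE x in unif. (\<lambda>N. (\<Sum>n<N. \<Prod>j\<in>I. f j ((T j ^^ n) x)) / of_nat N) \<longlonglongrightarrow> (\<Prod>j\<in>I. \<integral>x. w j x *\<^sub>R f j x \<partial>unif)"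
  using assms
\<comment> \<open>This induction inserts the systems in order of entropy, so the new one is the
  fastest; injectivity of \<open>h\<close> makes the comparison strict.\<close>
proof (induction rule: finite_ranking_induct[where f=h])
  case empty
  have "(\<lambda>N. (of_nat N / of_nat N :: complex)) \<longlonglongrightarrow> 1"
    by (rule tendsto_eventually) (use eventually_gt_at_top[of 0] in \<open>auto elim!: eventually_mono\<close>)
  then show ?case by simp
next
  case (insert i S)
  show ?case
  proof (cases "i \<in> S")
    case True
    then show ?thesis using insert by (simp add: insert_absorb)
  next
    case False
    have lt: "h j < h i" if "j \<in> S" for j
    proof -
      have "h j \<noteq> h i" using insert.prems(2) that False by (auto simp: inj_on_def)
      then show ?thesis using insert.hyps(2)[OF that] by simp
    qed
    have ji: "jsys (T i) (w i) (h i)" and si: "stepf (f i)" using insert.prems by auto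
    interpret i: jsys "T i" "w i" "h i" by (rule ji)
    have fim[measurable]: "f i \<in> borel_measurable borel" and fi1: "norm (f i x) \<le> 1" for x
      using si by (auto simp: stepf_def)
    define c where "c = (\<integral>x. w i x *\<^sub>R f i x \<partial>unif)"
    have c1: "norm c \<le> 1" unfolding c_def by (intro i.norm_mean_le fi1) auto
    define g where "g x = (f i x - c) / 2" for x
    have g: "stepf g" unfolding g_def by (rule stepf_center[OF si c1])
    have "w i x *\<^sub>R g x = (w i x *\<^sub>R f i x - w i x *\<^sub>R c) / 2" for x
      by (simp add: g_def scaleR_conv_of_real field_simps)
    then have "(\<integral>x. w i x *\<^sub>R g x \<partial>unif) = (\<integral>x. (w i x *\<^sub>R f i x - w i x *\<^sub>R c) / 2 \<partial>unif)"
      by (simp only:)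
    also have "\<dots> = (c - (\<integral>x. w i x \<partial>unif) *\<^sub>R c) / 2"
      using i.integrable_w_mult[OF fim fi1] i.integrable_w by (simp add: c_def)
    also have "\<dots> = 0" by (simp add: i.w_int)
    finally have g0: "(\<integral>x. w i x *\<^sub>R g x \<partial>unif) = 0" .
    have "AE x in unif. (\<lambda>N. (\<Sum>n<N. (\<Prod>j\<in>S. f j ((T j ^^ n) x)) * g ((T i ^^ n) x)) / of_nat N) \<longlonglongrightarrow> 0"
      using insert.prems insert.hyps lt by (intro joint_average_mean_zero[where w=w and h=h, OF _ _ _ _ ji g g0]) auto
    moreover have "AE x in unif. (\<lambda>N. (\<Sum>n<N. \<Prod>j\<in>S. f j ((T j ^^ n) x)) / of_nat N) \<longlonglongrightarrow> (\<Prod>j\<in>S. \<integral>x. w j x *\<^sub>R f j x \<partial>unif)"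
      using insert.prems by (intro insert.IH) (auto simp: inj_on_def)
    ultimately show ?thesis
    proof eventually_elim
      case (elim x)
      have fg: "f i y = 2 * g y + c" for y by (simp add: g_def field_simps)
      have "(\<Sum>n<N. \<Prod>j\<in>insert i S. f j ((T j ^^ n) x)) / of_nat N =
         2 * ((\<Sum>n<N. (\<Prod>j\<in>S. f j ((T j ^^ n) x)) * g ((T i ^^ n) x)) / of_nat N) +
         c * ((\<Sum>n<N. \<Prod>j\<in>S. f j ((T j ^^ n) x)) / of_nat N)" for N
        using False insert.hyps(1)
        by (simp add: fg distrib_right distrib_left sum.distrib sum_distrib_left add_divide_distrib mult_ac)
      moreover have "(\<lambda>N. 2 * ((\<Sum>n<N. (\<Prod>j\<in>S. f j ((T j ^^ n) x)) * g ((T i ^^ n) x)) / of_nat N) +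
         c * ((\<Sum>n<N. \<Prod>j\<in>S. f j ((T j ^^ n) x)) / of_nat N)) \<longlonglongrightarrow> 2 * 0 + c * (\<Prod>j\<in>S. \<integral>x. w j x *\<^sub>R f j x \<partial>unif)"
        by (intro tendsto_intros elim)
      ultimately show ?case using False insert.hyps(1) by (simp add: c_def)
    qed
  qed
qed

text \<open>For step functions with L1 error \<open>1 / (k + 1)\<close>, the maximal inequality for
  each single map bounds the averaged error, for all \<open>N\<close> at once, off a set of measure
  O(1 / k). A point that avoids one such set with \<open>k\<close> large inherits convergence up to
  \<open>e\<close>.\<close>

lemma joint_average_bounded:
  fixes I :: "'i set" and T w :: "'i \<Rightarrow> real \<Rightarrow> real" and h :: "'i \<Rightarrow> real" and f :: "'i \<Rightarrow> real \<Rightarrow> complex"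
  assumes I: "finite I" and T: "\<And>j. j \<in> I \<Longrightarrow> jsys (T j) (w j) (h j)" and inj: "inj_on h I"
    and fm: "\<And>j. j \<in> I \<Longrightarrow> f j \<in> borel_measurable borel" and f1: "\<And>j x. j \<in> I \<Longrightarrow> norm (f j x) \<le> 1"
  shows "AE x in unif. (\<lambda>N. (\<Sum>n<N. \<Prod>j\<in>I. f j ((T j ^^ n) x)) / of_nat N) \<longlonglongrightarrow> (\<Prod>j\<in>I. \<integral>x. w j x *\<^sub>R f j x \<partial>unif)"
proof -
  define L where "L = (\<Prod>j\<in>I. \<integral>x. w j x *\<^sub>R f j x \<partial>unif)"
  define A where "A N x = (\<Sum>n<N. \<Prod>j\<in>I. f j ((T j ^^ n) x)) / of_nat N" for N x
  define Q where "Q j c C \<longleftrightarrow> 0 < c \<and> 0 \<le> C \<and> (\<forall>A\<in>sets borel. c * measure unif A \<le> measure (density unif (\<lambda>x. ennreal (w j x))) A) \<and>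
      (\<forall>x\<in>{0..1}. w j x \<le> C)" for j c C
  have "\<exists>c C. Q j c C" if "j \<in> I" for j
  proof -
    interpret jsys "T j" "w j" "h j" by (rule T[OF that])
    obtain c C where c: "0 < c" "0 \<le> C" "\<forall>A\<in>sets borel. c * measure unif A \<le> measure \<mu> A \<and> measure \<mu> A \<le> C * measure unif A"
      using ex_mu_bounds by blast
    obtain c' C' where c': "0 < c'" "\<forall>x\<in>{0..1}. c' \<le> w j x \<and> w j x \<le> C'" using w_bounds by auto
    have "w j x \<le> max C C'" if "x \<in> {0..1}" for x
      using c'(2) that by (meson max.coboundedI2)
    then have "Q j c (max C C')" unfolding Q_def using c by auto
    then show ?thesis by blast
  qed
  then obtain c C where Q: "\<And>j. j \<in> I \<Longrightarrow> Q j (c j) (C j)" by metis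
  have c: "\<And>j. j \<in> I \<Longrightarrow> 0 < c j" "\<And>j. j \<in> I \<Longrightarrow> 0 \<le> C j"
    "\<And>j A. j \<in> I \<Longrightarrow> A \<in> sets borel \<Longrightarrow> c j * measure unif A \<le> measure (density unif (\<lambda>x. ennreal (w j x))) A"
    "\<And>j x. j \<in> I \<Longrightarrow> x \<in> {0..1} \<Longrightarrow> w j x \<le> C j"
    using Q unfolding Q_def by blast+
  have "\<exists>s. stepf s \<and> (\<integral>x. norm (f j x - s x) \<partial>unif) < 1 / (real k + 1)" if "j \<in> I" for j k
    using fm f1 that by (intro ex_stepf_approx) auto
  note ex = this
  define s where "s k j = (SOME s. stepf s \<and> (\<integral>x. norm (f j x - s x) \<partial>unif) < 1 / (real k + 1))" for k j
  have s: "stepf (s k j)" "(\<integral>x. norm (f j x - s k j x) \<partial>unif) < 1 / (real k + 1)" if "j \<in> I" for j k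
    using someI_ex[OF ex[OF that, of k]] unfolding s_def by blast+
  have sm: "s k j \<in> borel_measurable borel" and s1: "norm (s k j x) \<le> 1" if "j \<in> I" for j k x
    using s(1)[OF that] by (auto simp: stepf_def)
  define Lk where "Lk k = (\<Prod>j\<in>I. \<integral>x. w j x *\<^sub>R s k j x \<partial>unif)" for k
  define CC where "CC = (\<Sum>j\<in>I. C j)"
  have CC: "0 \<le> CC" unfolding CC_def using c by (intro sum_nonneg) auto
  have wdiff: "(\<integral>x. w j x * norm (f j x - s k j x) \<partial>unif) \<le> C j * (1 / (real k + 1))" if j: "j \<in> I" for j k
  proof -
    interpret jsys "T j" "w j" "h j" by (rule T[OF j])
    note [measurable] = fm[OF j] sm[OF j]
    have d2: "norm (f j x - s k j x) \<le> 2" for x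
      using norm_triangle_ineq4[of "f j x" "s k j x"] f1[OF j, of x] s1[OF j, of k x] by simp
    have id: "integrable unif (\<lambda>x. norm (f j x - s k j x))" using d2 by (intro integrable_unif_bounded[where C=2]) auto
    have iw: "integrable unif (\<lambda>x. w j x * norm (f j x - s k j x))"
      using integrable_norm[OF integrable_w_mult[of "\<lambda>x. f j x - s k j x" 2]] d2 AE_w_nonneg
      by (subst integrable_cong_AE[of _ _ "\<lambda>x. norm (w j x *\<^sub>R (f j x - s k j x))"]) (auto elim!: eventually_mono)
    have "(\<integral>x. w j x * norm (f j x - s k j x) \<partial>unif) \<le> (\<integral>x. C j * norm (f j x - s k j x) \<partial>unif)"
      using iw id AE_unif_mem by (intro integral_mono_AE) (auto elim!: eventually_mono[OF AE_unif_mem] intro!: mult_right_mono c(4)[OF j])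
    also have "\<dots> \<le> C j * (1 / (real k + 1))" using mult_left_mono[OF less_imp_le[OF s(2)[OF j, of k]] c(2)[OF j]] by simp
    finally show ?thesis .
  qed
  have LLk: "norm (L - Lk k) \<le> CC * (1 / (real k + 1))" for k
  proof -
    have "norm (L - Lk k) \<le> (\<Sum>j\<in>I. norm ((\<integral>x. w j x *\<^sub>R f j x \<partial>unif) - (\<integral>x. w j x *\<^sub>R s k j x \<partial>unif)))"
      unfolding L_def Lk_def
      by (intro norm_prod_diff acim.norm_mean_le[OF jsys.axioms(1)[OF T]] fm f1 sm s1)
    also have "\<dots> \<le> (\<Sum>j\<in>I. C j * (1 / (real k + 1)))"
    proof (rule sum_mono)
      fix j assume j: "j \<in> I"
      interpret jsys "T j" "w j" "h j" by (rule T[OF j])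
      have "(\<integral>x. w j x *\<^sub>R f j x \<partial>unif) - (\<integral>x. w j x *\<^sub>R s k j x \<partial>unif) = (\<integral>x. w j x *\<^sub>R (f j x - s k j x) \<partial>unif)"
        using integrable_w_mult[OF fm f1] integrable_w_mult[OF sm s1] j by (simp add: scaleR_diff_right)
      also have "norm \<dots> \<le> (\<integral>x. norm (w j x *\<^sub>R (f j x - s k j x)) \<partial>unif)" by (rule integral_norm_bound)
      also have "\<dots> = (\<integral>x. w j x * norm (f j x - s k j x) \<partial>unif)"
        using AE_w_nonneg fm[OF j] sm[OF j] by (intro integral_cong_AE) (auto elim!: eventually_mono)
      also note wdiff[OF j]
      finally show "norm ((\<integral>x. w j x *\<^sub>R f j x \<partial>unif) - (\<integral>x. w j x *\<^sub>R s k j x \<partial>unif)) \<le> C j * (1 / (real k + 1))" .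
    qed
    finally show ?thesis unfolding CC_def sum_distrib_right .
  qed
  have aek: "AE x in unif. \<forall>k. (\<lambda>N. (\<Sum>n<N. \<Prod>j\<in>I. s k j ((T j ^^ n) x)) / of_nat N) \<longlonglongrightarrow> Lk k"
    unfolding Lk_def AE_all_countable by (intro allI joint_average_step[OF I T inj s(1)])
  have main: "AE x in unif. eventually (\<lambda>N. norm (A N x - L) \<le> e) sequentially" if e: "0 < e" for e
  proof -
    \<comment> \<open>A third of \<open>e\<close> each for the passage to step functions (shared by
      \<open>card I\<close> factors), for their convergence, and for the distance of the limits; the
      added 1 covers an empty \<open>I\<close>.\<close>
    define e' where "e' = e / (3 * (real (card I) + 1))"
    have e': "0 < e'" "real (card I) * e' \<le> e / 3" using e by (auto simp: e'_def field_simps)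
    define Bj where "Bj k j = {x. \<exists>N. e' * real N < (\<Sum>n<N. norm (f j ((T j ^^ n) x) - s k j ((T j ^^ n) x)))}" for k j
    have Bjm: "Bj k j \<in> sets borel" if j: "j \<in> I" for k j
    proof -
      interpret jsys "T j" "w j" "h j" by (rule T[OF j])
      note [measurable] = fm[OF j] sm[OF j]
      show ?thesis unfolding Bj_def by measurable
    qed
    have Bjb: "measure unif (Bj k j) \<le> C j / c j / e' * (1 / (real k + 1))" if j: "j \<in> I" for k j
    proof -
      interpret jsys "T j" "w j" "h j" by (rule T[OF j])
      note [measurable] = fm[OF j] sm[OF j]
      have d2: "norm (f j x - s k j x) \<le> 2" for x
        using norm_triangle_ineq4[of "f j x" "s k j x"] f1[OF j, of x] s1[OF j, of k x] by simp
      have "measure \<mu> (Bj k j) \<le> (\<integral>x. norm (f j x - s k j x) \<partial>\<mu>) / e'"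
        using maximal_ergodic_inequality[OF prob_space_mu, of "T j" "\<lambda>x. norm (f j x - s k j x)" 2 e'] d2 e'(1) T_inv
        by (simp add: Bj_def measurable_cong_sets[OF sets_density sets_density] distr_cong[of \<mu> \<mu> \<mu> borel "T j" "T j"])
      also have "(\<integral>x. norm (f j x - s k j x) \<partial>\<mu>) = (\<integral>x. w j x * norm (f j x - s k j x) \<partial>unif)"
        by (subst integral_mu) auto
      also have "(\<integral>x. w j x * norm (f j x - s k j x) \<partial>unif) / e' \<le> C j * (1 / (real k + 1)) / e'"
        using e'(1) by (intro divide_right_mono wdiff j) auto
      finally have "c j * measure unif (Bj k j) \<le> C j * (1 / (real k + 1)) / e'"
        using c(3)[OF j Bjm[OF j], of k] by linarith
      then have "measure unif (Bj k j) \<le> C j * (1 / (real k + 1)) / e' / c j"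
        using c(1)[OF j] by (subst pos_le_divide_eq) (auto simp: mult.commute)
      then show ?thesis by (simp add: mult.commute mult.left_commute)
    qed
    define B where "B k = (\<Union>j\<in>I. Bj k j)" for k
    have Bm[measurable]: "B k \<in> sets borel" for k unfolding B_def using I Bjm by auto
    define CB where "CB = (\<Sum>j\<in>I. C j / c j / e')"
    have Bb: "measure unif (B k) \<le> CB * (1 / (real k + 1))" for k
    proof -
      have "measure unif (B k) \<le> (\<Sum>j\<in>I. measure unif (Bj k j))" unfolding B_def
        using I Bjm by (intro unif.finite_measure_subadditive_finite) auto
      also have "\<dots> \<le> (\<Sum>j\<in>I. C j / c j / e' * (1 / (real k + 1)))" by (intro sum_mono Bjb)
      finally show ?thesis unfolding CB_def sum_distrib_right .
    qed
    obtain k0 where k0: "CC * (1 / (real k + 1)) \<le> e / 3" if "k0 \<le> k" for k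
    proof -
      have "(\<lambda>k. CC * (1 / (real k + 1))) \<longlonglongrightarrow> 0" by real_asymp
      then have "eventually (\<lambda>k. CC * (1 / (real k + 1)) < e / 3) sequentially" using e by (intro order_tendstoD) auto
      then show ?thesis using that unfolding eventually_sequentially by (meson less_imp_le)
    qed
    \<comment> \<open>It suffices to avoid a single \<open>B k\<close> with \<open>k >= k0\<close>,
      so only the intersection has to be null and the rate O(1 / k) is enough.\<close>
    have "measure unif (\<Inter>k\<in>{k0..}. B k) \<le> 0"
    proof (rule LIMSEQ_le_const)
      show "(\<lambda>k. CB * (1 / (real k + 1))) \<longlonglongrightarrow> 0" by real_asymp
      show "\<exists>N. \<forall>n\<ge>N. measure unif (\<Inter>k\<in>{k0..}. B k) \<le> CB * (1 / (real n + 1))"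
      proof (intro exI[of _ k0] allI impI)
        fix n assume "k0 \<le> n"
        then have "measure unif (\<Inter>k\<in>{k0..}. B k) \<le> measure unif (B n)" by (intro unif.finite_measure_mono) auto
        with Bb[of n] show "measure unif (\<Inter>k\<in>{k0..}. B k) \<le> CB * (1 / (real n + 1))" by linarith
      qed
    qed
    moreover have "(\<Inter>k\<in>{k0..}. B k) \<in> sets unif" by (auto intro!: sets.countable_INT'')
    ultimately have "(\<Inter>k\<in>{k0..}. B k) \<in> null_sets unif"
      by (simp add: null_sets_def unif.emeasure_eq_measure measure_le_0_iff)
    then have "AE x in unif. x \<notin> (\<Inter>k\<in>{k0..}. B k)" by (rule AE_not_in)
    then show ?thesis using aek
    proof eventually_elim
      case (elim x)
      then obtain k where k: "k0 \<le> k" "x \<notin> B k" by auto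
      have "(\<lambda>N. norm ((\<Sum>n<N. \<Prod>j\<in>I. s k j ((T j ^^ n) x)) / of_nat N - Lk k)) \<longlonglongrightarrow> 0"
        using elim(2) by (intro tendsto_norm_zero) (simp add: LIM_zero_iff)
      then have "eventually (\<lambda>N. norm ((\<Sum>n<N. \<Prod>j\<in>I. s k j ((T j ^^ n) x)) / of_nat N - Lk k) < e / 3) sequentially"
        using e by (intro order_tendstoD) auto
      then show ?case using eventually_gt_at_top[of 0]
      proof eventually_elim
        case (elim N)
        have "norm ((\<Sum>n<N. \<Prod>j\<in>I. f j ((T j ^^ n) x)) - (\<Sum>n<N. \<Prod>j\<in>I. s k j ((T j ^^ n) x)))
           \<le> (\<Sum>n<N. norm ((\<Prod>j\<in>I. f j ((T j ^^ n) x)) - (\<Prod>j\<in>I. s k j ((T j ^^ n) x))))"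
          unfolding sum_subtractf[symmetric] by (rule norm_sum)
        also have "\<dots> \<le> (\<Sum>n<N. \<Sum>j\<in>I. norm (f j ((T j ^^ n) x) - s k j ((T j ^^ n) x)))"
          by (intro sum_mono norm_prod_diff f1 s1)
        also have "\<dots> = (\<Sum>j\<in>I. \<Sum>n<N. norm (f j ((T j ^^ n) x) - s k j ((T j ^^ n) x)))" by (rule sum.swap)
        also have "\<dots> \<le> (\<Sum>j\<in>I. e' * real N)"
        proof (rule sum_mono)
          fix j assume "j \<in> I"
          then have "x \<notin> Bj k j" using k by (auto simp: B_def)
          then show "(\<Sum>n<N. norm (f j ((T j ^^ n) x) - s k j ((T j ^^ n) x))) \<le> e' * real N"
            unfolding Bj_def by (auto simp: not_less)
        qed
        also have "\<dots> = real (card I) * e' * real N" by simp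
        also have "\<dots> \<le> e / 3 * real N" using e' by (intro mult_right_mono) auto
        finally have "norm ((\<Sum>n<N. \<Prod>j\<in>I. f j ((T j ^^ n) x)) - (\<Sum>n<N. \<Prod>j\<in>I. s k j ((T j ^^ n) x))) / real N \<le> e / 3"
          using elim(2) by (simp add: pos_divide_le_eq)
        then have "norm (A N x - (\<Sum>n<N. \<Prod>j\<in>I. s k j ((T j ^^ n) x)) / of_nat N) \<le> e / 3"
          unfolding A_def diff_divide_distrib[symmetric] by (simp add: norm_divide)
        moreover have "norm (Lk k - L) \<le> e / 3" using order_trans[OF LLk k0[OF k(1)]]
          by (subst norm_minus_commute)
        ultimately show ?case using elim(1)
          norm_triangle_ineq[of "A N x - (\<Sum>n<N. \<Prod>j\<in>I. s k j ((T j ^^ n) x)) / of_nat N" "(\<Sum>n<N. \<Prod>j\<in>I. s k j ((T j ^^ n) x)) / of_nat N - L"]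
          norm_triangle_ineq[of "(\<Sum>n<N. \<Prod>j\<in>I. s k j ((T j ^^ n) x)) / of_nat N - Lk k" "Lk k - L"]
          by simp
      qed
    qed
  qed
  have "AE x in unif. \<forall>p. eventually (\<lambda>N. norm (A N x - L) \<le> 1 / (real p + 1)) sequentially"
    unfolding AE_all_countable by (intro allI main) simp
  then have "AE x in unif. (\<lambda>N. A N x) \<longlonglongrightarrow> L"
  proof eventually_elim
    case (elim x)
    show ?case
    proof (rule metric_LIMSEQ_I)
      fix e :: real assume "0 < e"
      then obtain p where p: "1 / (real p + 1) < e" using nat_approx_posE[of e] by (metis of_nat_Suc add.commute)
      from elim have "eventually (\<lambda>N. norm (A N x - L) \<le> 1 / (real p + 1)) sequentially" ..
      then obtain N where "\<And>n. N \<le> n \<Longrightarrow> norm (A n x - L) \<le> 1 / (real p + 1)" unfolding eventually_sequentially by blast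
      then show "\<exists>no. \<forall>n\<ge>no. dist (A n x) L < e" using p by (intro exI[of _ N]) (force simp: dist_norm)
    qed
  qed
  then show ?thesis unfolding A_def L_def .
qed

section \<open>Integrals over initial segments and the digit decomposition\<close>

text \<open>With half-open intervals the pieces cut out by the digits fit together exactly.\<close>

definition initial_integral :: "real \<Rightarrow> (real \<Rightarrow> 'a) \<Rightarrow> 'a::{banach, second_countable_topology}" where
  "initial_integral a F = (\<integral>x. indicator {0..<a} x *\<^sub>R F x \<partial>lborel)"

lemma initial_integrable:
  fixes F :: "real \<Rightarrow> 'a::{banach, second_countable_topology}"
  assumes "F \<in> borel_measurable borel" "\<And>x. norm (F x) \<le> M"
  shows "integrable lborel (\<lambda>x. indicator {a..<b} x *\<^sub>R F x)"
proof (rule Bochner_Integration.integrable_bound[where f="\<lambda>x. M * indicator {a..<b} x"])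
  have "0 \<le> M" using assms(2)[of 0] norm_ge_zero order_trans by blast
  then show "AE x in lborel. norm (indicator {a..<b} x *\<^sub>R F x) \<le> norm (M * indicator {a..<b} x)"
    using assms(2) by (intro AE_I2) (auto simp: indicator_def)
  show "integrable lborel (\<lambda>x. M * indicator {a..<b} x)"
  proof (intro integrable_mult_right integrable_real_indicator)
    show "emeasure lborel {a..<b} < \<infinity>" by (cases "a \<le> b") auto
  qed simp
qed (use assms in measurable)

lemma initial_integral_cong:
  "(\<And>x. 0 \<le> x \<Longrightarrow> x < a \<Longrightarrow> F x = G x) \<Longrightarrow> initial_integral a F = initial_integral a G"
  unfolding initial_integral_def by (intro Bochner_Integration.integral_cong) (auto simp: indicator_def)

lemma norm_initial_integral_le:
  fixes F :: "real \<Rightarrow> 'a::{banach, second_countable_topology}"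
  assumes F: "F \<in> borel_measurable borel" "\<And>x. norm (F x) \<le> M" and "0 \<le> a"
  shows "norm (initial_integral a F) \<le> M * a"
proof -
  have "norm (initial_integral a F) \<le> (\<integral>x. norm (indicator {0..<a} x *\<^sub>R F x) \<partial>lborel)"
    unfolding initial_integral_def by (rule integral_norm_bound)
  also have "\<dots> \<le> (\<integral>x. indicator {0..<a} x *\<^sub>R M \<partial>lborel)"
    using initial_integrable[OF F] initial_integrable[of "\<lambda>_. M" "\<bar>M\<bar>"] F(2)
    by (intro integral_mono integrable_norm) (auto simp: indicator_def)
  also have "\<dots> = M * a" using \<open>0 \<le> a\<close> by (simp add: mult.commute)
  finally show ?thesis .
qed

lemma initial_integral_1:
  fixes F :: "real \<Rightarrow> 'a::{banach, second_countable_topology}"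
  assumes "F \<in> borel_measurable borel"
  shows "initial_integral 1 F = (\<integral>x. F x \<partial>unif)"
proof -
  have "AE x in lborel. x \<noteq> (1::real)" by (rule AE_lborel_singleton)
  then have "AE x in lborel. indicator {0..<1} x *\<^sub>R F x = indicator {0..1} x *\<^sub>R F x"
    by eventually_elim (auto simp: indicator_def)
  then show ?thesis using assms unfolding initial_integral_def integral_unif[OF assms]
    by (intro integral_cong_AE) auto
qed

lemma initial_integral_scale:
  fixes F :: "real \<Rightarrow> 'a::{banach, second_countable_topology}"
  assumes "0 < b"
  shows "initial_integral a F = (1 / b) *\<^sub>R initial_integral (b * a) (\<lambda>x. F (x / b))"
proof -
  have i: "indicator {0..<b * a} (b * x) = (indicator {0..<a} x :: real)" for x
    using assms by (auto simp: indicator_def zero_le_mult_iff)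
  have "initial_integral (b * a) (\<lambda>x. F (x / b)) = \<bar>b\<bar> *\<^sub>R (\<integral>x. indicator {0..<b * a} (0 + b * x) *\<^sub>R F ((0 + b * x) / b) \<partial>lborel)"
    unfolding initial_integral_def using assms by (intro lborel_integral_real_affine) auto
  also have "\<dots> = b *\<^sub>R initial_integral a F" unfolding initial_integral_def using assms i by simp
  finally show ?thesis using assms by simp
qed

lemma initial_integral_split_units:
  fixes F :: "real \<Rightarrow> 'a::{banach, second_countable_topology}"
  assumes F[measurable]: "F \<in> borel_measurable borel" and b: "\<And>x. norm (F x) \<le> M" and s: "0 \<le> s"
  shows "initial_integral (real n + s) F = (\<Sum>d<n. initial_integral 1 (\<lambda>y. F (real d + y))) + initial_integral s (\<lambda>y. F (real n + y))"
  using F b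
proof (induction n arbitrary: F)
  case (Suc n)
  note [measurable] = Suc.prems(1)
  have i: "indicator {0..<real (Suc n) + s} x *\<^sub>R F x = indicator {0..<1} x *\<^sub>R F x + indicator {1..<real (Suc n) + s} x *\<^sub>R F x" for x
    using s by (auto simp: indicator_def)
  have "initial_integral (real (Suc n) + s) F = initial_integral 1 F + (\<integral>x. indicator {1..<real (Suc n) + s} x *\<^sub>R F x \<partial>lborel)"
    unfolding initial_integral_def i
    by (intro Bochner_Integration.integral_add initial_integrable[where M=M] Suc.prems)
  also have "(\<integral>x. indicator {1..<real (Suc n) + s} x *\<^sub>R F x \<partial>lborel) = 
     \<bar>1\<bar> *\<^sub>R (\<integral>x. indicator {1..<real (Suc n) + s} (1 + 1 * x) *\<^sub>R F (1 + 1 * x) \<partial>lborel)"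
    by (rule lborel_integral_real_affine) simp
  also have "\<dots> = initial_integral (real n + s) (\<lambda>y. F (1 + y))"
    unfolding initial_integral_def by (auto intro!: Bochner_Integration.integral_cong simp: indicator_def)
  also have "\<dots> = (\<Sum>d<n. initial_integral 1 (\<lambda>y. F (1 + (real d + y)))) + initial_integral s (\<lambda>y. F (1 + (real n + y)))"
    using Suc.prems(2) by (intro Suc.IH) measurable
  finally show ?case unfolding sum.lessThan_Suc_shift by (simp add: add.assoc)
qed simp

text \<open>After the substitution \<open>x = y / \<beta>\<close> the interval
  \<open>{0..<\<beta> * a}\<close> is cut at the integers; the last piece has length
  \<open>frac (\<beta> * a)\<close>, the image of \<open>a\<close> under the \<beta>-map.\<close>

lemma initial_integral_digits:
  fixes F :: "real \<Rightarrow> 'a::{banach, second_countable_topology}"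
  assumes F[measurable]: "F \<in> borel_measurable borel" and b: "\<And>x. norm (F x) \<le> M" and \<beta>: "0 < \<beta>" and a: "0 \<le> a"
  shows "initial_integral a F = (1 / \<beta>) *\<^sub>R ((\<Sum>d<nat \<lfloor>\<beta> * a\<rfloor>. initial_integral 1 (\<lambda>y. F ((real d + y) / \<beta>))) +
     initial_integral (frac (\<beta> * a)) (\<lambda>y. F ((real (nat \<lfloor>\<beta> * a\<rfloor>) + y) / \<beta>)))"
proof -
  have "\<beta> * a = real (nat \<lfloor>\<beta> * a\<rfloor>) + frac (\<beta> * a)" using \<beta> a by (simp add: frac_def)
  then have "initial_integral (\<beta> * a) (\<lambda>x. F (x / \<beta>)) = initial_integral (real (nat \<lfloor>\<beta> * a\<rfloor>) + frac (\<beta> * a)) (\<lambda>x. F (x / \<beta>))"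
    by simp
  also have "\<dots> = (\<Sum>d<nat \<lfloor>\<beta> * a\<rfloor>. initial_integral 1 (\<lambda>y. F ((real d + y) / \<beta>))) +
     initial_integral (frac (\<beta> * a)) (\<lambda>y. F ((real (nat \<lfloor>\<beta> * a\<rfloor>) + y) / \<beta>))"
    using b by (intro initial_integral_split_units) auto
  finally show ?thesis using initial_integral_scale[OF \<beta>, of a F] by simp
qed

section \<open>Beta transformations\<close>

locale beta_map =
  fixes \<beta> :: real
  assumes beta_gt_1: "1 < \<beta>"
begin

abbreviation T :: "real \<Rightarrow> real" where "T \<equiv> mult_mod1 \<beta>"

lemma beta_pos: "0 < \<beta>" using beta_gt_1 by simp

lemma T_borel [measurable]: "T \<in> borel_measurable borel"
  unfolding mult_mod1_def[abs_def] frac_def by measurable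

lemma iter_borel [measurable]: "(T ^^ n) \<in> borel_measurable borel"
  by (induction n) (auto intro: measurable_comp)

lemma T_range: "0 \<le> T x" "T x < 1"
  unfolding mult_mod1_def by (auto simp: frac_lt_1)

lemma iter_range: "x \<in> {0..1} \<Longrightarrow> (T ^^ n) x \<in> {0..1}"
  by (cases n) (use T_range less_imp_le in auto)

lemma T_le: "0 \<le> x \<Longrightarrow> T x \<le> \<beta> * x"
  unfolding mult_mod1_def using beta_pos by (simp add: frac_def)

lemma iter_le: "0 \<le> x \<Longrightarrow> (T ^^ n) x \<le> \<beta> ^ n * x"
proof (induction n)
  case (Suc n)
  have "0 \<le> (T ^^ n) x" using Suc.prems T_range by (cases n) auto
  then have "(T ^^ Suc n) x \<le> \<beta> * (T ^^ n) x" using T_le by simp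
  also have "\<dots> \<le> \<beta> * (\<beta> ^ n * x)" using Suc beta_pos by simp
  finally show ?case by (simp add: mult.assoc)
qed simp

lemma T_digit: "0 \<le> y \<Longrightarrow> y < 1 \<Longrightarrow> T ((real d + y) / \<beta>) = y"
  unfolding mult_mod1_def using beta_pos by (simp add: frac_unique_iff)

definition digit :: "real \<Rightarrow> nat" where "digit x = nat \<lfloor>\<beta> * x\<rfloor>"

lemma digit_eq: "0 \<le> x \<Longrightarrow> real (digit x) = \<beta> * x - T x"
  unfolding digit_def mult_mod1_def frac_def using beta_pos by simp

lemma digit_weight_le: "0 \<le> x \<Longrightarrow> x \<le> 1 \<Longrightarrow> real (digit x) / \<beta> \<le> x"
  using digit_eq[of x] T_range[of x] beta_pos by (simp add: divide_le_eq mult.commute)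

text \<open>Each complete digit interval contributes the full integral and the last one the integral
  up to \<open>T a\<close>. This recursion is the source of the renewal equation and of the
  invariance of the Parry density.\<close>

lemma initial_integral_iter_Suc:
  fixes F :: "real \<Rightarrow> 'a::{banach, second_countable_topology}"
  assumes F[measurable]: "F \<in> borel_measurable borel" and b: "\<And>x. norm (F x) \<le> M" and a: "0 \<le> a"
  shows "initial_integral a (\<lambda>x. F ((T ^^ Suc m) x)) =
    (real (digit a) / \<beta>) *\<^sub>R initial_integral 1 (\<lambda>x. F ((T ^^ m) x)) + (1 / \<beta>) *\<^sub>R initial_integral (T a) (\<lambda>x. F ((T ^^ m) x))"
proof -
  have eq: "initial_integral s (\<lambda>y. F ((T ^^ Suc m) ((real d + y) / \<beta>))) = initial_integral s (\<lambda>y. F ((T ^^ m) y))" if "s \<le> 1" for s d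
    using that T_digit by (intro initial_integral_cong) (simp add: funpow_swap1)
  have Ta: "T a = frac (\<beta> * a)" by (simp add: mult_mod1_def)
  have "initial_integral a (\<lambda>x. F ((T ^^ Suc m) x)) =
     (1 / \<beta>) *\<^sub>R ((\<Sum>d<digit a. initial_integral 1 (\<lambda>y. F ((T ^^ Suc m) ((real d + y) / \<beta>)))) +
     initial_integral (T a) (\<lambda>y. F ((T ^^ Suc m) ((real (digit a) + y) / \<beta>))))"
    unfolding digit_def Ta using b beta_pos a by (intro initial_integral_digits[where M=M]) auto
  also have "\<dots> = (1 / \<beta>) *\<^sub>R ((\<Sum>d<digit a. initial_integral 1 (\<lambda>y. F ((T ^^ m) y))) + initial_integral (T a) (\<lambda>y. F ((T ^^ m) y)))"
    using T_range[of a] by (simp only: eq less_imp_le order_refl)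
  finally show ?thesis by (simp add: scaleR_add_right sum_constant_scaleR)
qed

definition orbit1 :: "nat \<Rightarrow> real" where "orbit1 k = (T ^^ k) 1"

definition Q :: "nat \<Rightarrow> real" where "Q k = orbit1 k / \<beta> ^ k"

lemma orbit1_range: "0 \<le> orbit1 k" "orbit1 k \<le> 1"
  using iter_range[of 1 k] by (auto simp: orbit1_def)

lemma orbit1_0 [simp]: "orbit1 0 = 1" by (simp add: orbit1_def)

lemma orbit1_Suc: "orbit1 (Suc k) = T (orbit1 k)" by (simp add: orbit1_def)

lemma Q_nonneg: "0 \<le> Q k" using orbit1_range beta_pos by (simp add: Q_def)

lemma Q_le: "Q k \<le> (1 / \<beta>) ^ k"
  using orbit1_range[of k] beta_pos by (simp add: Q_def divide_right_mono power_one_over)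

lemma Q_0 [simp]: "Q 0 = 1" by (simp add: Q_def)

text \<open>The terms of the \<beta>-expansion of 1: nonnegative weights of total mass 1, which play
  the part of waiting time probabilities in the renewal equation.\<close>

lemma Q_diff: "Q k - Q (Suc k) = real (digit (orbit1 k)) / \<beta> ^ Suc k"
  using digit_eq[OF orbit1_range(1), of k] beta_pos by (simp add: Q_def orbit1_Suc field_simps)

lemma summable_inv_beta: "summable (\<lambda>k. (1 / \<beta>) ^ k)"
  using beta_gt_1 by (intro summable_geometric) auto

lemma summable_Q: "summable Q"
  by (rule summable_comparison_test'[OF summable_inv_beta]) (use Q_le Q_nonneg in auto)

lemma suminf_inv_beta: "(\<Sum>k. (1 / \<beta>) ^ k) = 1 / (1 - 1 / \<beta>)"
  using beta_gt_1 by (intro suminf_geometric) auto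

subsection \<open>The renewal identity\<close>

text \<open>Unrolling the digit recursion from the end point 1 expresses \<open>e m\<close> by
  earlier values with weights \<open>Q i - Q (Suc i)\<close>, plus a remainder. Adding these
  identities over \<open>m\<close> turns the differences into \<open>Q\<close> itself and collects
  the remainders on the right.\<close>

lemma renewal_identity:
  fixes F :: "real \<Rightarrow> 'a::{banach, second_countable_topology}"
  assumes F[measurable]: "F \<in> borel_measurable borel" and b: "\<And>x. norm (F x) \<le> M"
  shows "(\<Sum>i\<le>m. Q i *\<^sub>R initial_integral 1 (\<lambda>x. F ((T ^^ (m - i)) x))) = (\<Sum>i\<le>m. (1 / \<beta> ^ i) *\<^sub>R initial_integral (orbit1 i) F)"
proof -
  define e where "e m = initial_integral 1 (\<lambda>x. F ((T ^^ m) x))" for m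
  define V where "V n k = (1 / \<beta> ^ k) *\<^sub>R initial_integral (orbit1 k) (\<lambda>x. F ((T ^^ n) x))" for n k
  have V_Suc: "V (Suc n) k = (Q k - Q (Suc k)) *\<^sub>R e n + V n (Suc k)" for n k
    unfolding V_def initial_integral_iter_Suc[OF F b orbit1_range(1)] e_def Q_diff
    using beta_pos by (simp add: scaleR_add_right orbit1_Suc mult.commute)
  have V: "V n k = (\<Sum>i<n. (Q (k + i) - Q (Suc (k + i))) *\<^sub>R e (n - 1 - i)) + V 0 (k + n)" for n k
  proof (induction n arbitrary: k)
    case (Suc n)
    show ?case unfolding V_Suc Suc.IH sum.lessThan_Suc_shift by simp
  qed simp
  have "(\<Sum>i\<le>m. Q i *\<^sub>R e (m - i)) = (\<Sum>i\<le>m. V 0 i)"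
  proof (induction m)
    case 0
    then show ?case by (simp add: V_def e_def)
  next
    case (Suc m)
    have "(\<Sum>i\<le>Suc m. Q i *\<^sub>R e (Suc m - i)) = e (Suc m) + (\<Sum>i\<le>m. Q (Suc i) *\<^sub>R e (m - i))"
      by (simp only: sum.atMost_Suc_shift) simp
    also have "e (Suc m) = V (Suc m) 0" by (simp add: V_def e_def)
    also have "V (Suc m) 0 = (\<Sum>i\<le>m. (Q i - Q (Suc i)) *\<^sub>R e (m - i)) + V 0 (Suc m)"
      unfolding V[of "Suc m" 0] lessThan_Suc_atMost by simp
    finally show ?case using Suc.IH by (simp add: scaleR_diff_left sum_subtractf)
  qed
  then show ?thesis by (simp add: V_def e_def)
qed

subsection \<open>Exponential decay of the inverse of the renewal series\<close>

definition QF :: "complex fps" where "QF = Abs_fps (\<lambda>k. complex_of_real (Q k))"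

lemma QF_conv_radius: "fps_conv_radius QF \<ge> \<beta>"
  unfolding fps_conv_radius_def
proof (rule conv_radius_geI_ex)
  fix r :: real assume r: "0 < r" "ereal r < ereal \<beta>"
  have "summable (\<lambda>n. (r / \<beta>) ^ n)" using r by (intro summable_geometric) auto
  then have "summable (\<lambda>n. fps_nth QF n * of_real r ^ n)"
  proof (rule summable_comparison_test')
    fix n
    have "norm (fps_nth QF n * of_real r ^ n) = Q n * r ^ n" using Q_nonneg[of n] r by (simp add: QF_def norm_mult norm_power)
    also have "\<dots> \<le> (1 / \<beta>) ^ n * r ^ n" using r by (intro mult_right_mono Q_le) auto
    finally show "norm (fps_nth QF n * of_real r ^ n) \<le> (r / \<beta>) ^ n" by (simp add: power_mult_distrib[symmetric])
  qed
  then show "\<exists>z. norm z = r \<and> summable (\<lambda>n. fps_nth QF n * z ^ n)"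
    using r by (intro exI[of _ "of_real r"]) auto
qed

lemma QF_summable:
  fixes z :: complex
  assumes "norm z < \<beta>"
  shows "summable (\<lambda>n. of_real (Q n) * z ^ n)"
proof -
  have "ereal (norm z) < ereal \<beta>" using assms by simp
  also have "\<dots> \<le> conv_radius (fps_nth QF)" using QF_conv_radius by (simp add: fps_conv_radius_def)
  finally have "summable (\<lambda>n. fps_nth QF n * z ^ n)" by (rule summable_in_conv_radius)
  then show ?thesis by (simp add: QF_def)
qed

lemma eval_QF: "eval_fps QF z = (\<Sum>n. of_real (Q n) * z ^ n)"
  by (simp add: eval_fps_def QF_def)

text \<open>At a zero, multiplication by \<open>1 - z\<close> gives
  \<open>(\<Sum>n. D n * z ^ Suc n) = 1\<close> with nonnegative weights \<open>D n\<close> of sum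
  1. As \<open>D 0\<close> is positive and \<open>norm z <= 1\<close>, this forces
  \<open>z = 1\<close>, where the series is at least \<open>Q 0 = 1\<close>.\<close>

lemma eval_QF_nonzero:
  assumes z: "norm z \<le> 1"
  shows "eval_fps QF z \<noteq> 0"
proof
  assume 0: "eval_fps QF z = 0"
  define D where "D k = Q k - Q (Suc k)" for k
  have D0: "0 \<le> D k" for k unfolding D_def Q_diff using beta_pos by simp
  have sQ: "summable (\<lambda>n. of_real (Q n) * z ^ n)" using z beta_gt_1 by (intro QF_summable) auto
  have sumD: "D sums 1"
    using telescope_sums'[OF summable_LIMSEQ_zero[OF summable_Q]] by (simp add: D_def[abs_def])
  have s0: "(\<lambda>n. of_real (Q n) * z ^ n) sums 0" using sQ 0 unfolding eval_QF by (metis summable_sums)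
  have "(\<lambda>n. of_real (Q (Suc n)) * z ^ Suc n) sums (0 - of_real (Q 0) * z ^ 0)"
    using s0 sums_Suc_iff[of "\<lambda>n. of_real (Q n) * z ^ n" "0 - of_real (Q 0) * z ^ 0"] by simp
  with sums_mult[OF s0, of z] have "(\<lambda>n. z * (of_real (Q n) * z ^ n) - of_real (Q (Suc n)) * z ^ Suc n) sums (z * 0 - (0 - of_real (Q 0) * z ^ 0))"
    by (rule sums_diff)
  then have "(\<lambda>n. of_real (D n) * z ^ Suc n) sums 1" by (simp add: D_def algebra_simps)
  then have "(\<lambda>n. Re (of_real (D n) * z ^ Suc n)) sums Re 1" by (rule sums_Re)
  from sums_diff[OF sumD this] have s: "(\<lambda>n. D n * (1 - Re (z ^ Suc n))) sums 0" by (simp add: algebra_simps)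
  have Re1: "Re (z ^ n) \<le> 1" for n
    using complex_Re_le_cmod[of "z ^ n"] z power_le_one[of "norm z" n] by (simp add: norm_power)
  have "D 0 * (1 - Re (z ^ Suc 0)) \<le> (\<Sum>n. D n * (1 - Re (z ^ Suc n)))"
    using s D0 Re1 sum_le_suminf[of "\<lambda>n. D n * (1 - Re (z ^ Suc n))" "{0}"] by (auto simp: sums_iff simp del: power_Suc)
  also have "\<dots> = 0" using s by (simp add: sums_iff)
  finally have "D 0 * (1 - Re z) \<le> 0" by simp
  moreover have "0 < D 0"
  proof -
    have "1 \<le> digit 1" using beta_gt_1 by (simp add: digit_def le_nat_floor)
    then show ?thesis unfolding D_def Q_diff using beta_pos by simp
  qed
  ultimately have "1 \<le> Re z" by (simp add: mult_le_0_iff)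
  then have "Re z = 1" using Re1[of 1] by simp
  moreover have "(Re z)\<^sup>2 + (Im z)\<^sup>2 \<le> 1" using z cmod_power2[of z] power_le_one[of "norm z" 2] by simp
  ultimately have "z = 1" by (simp add: complex_eq_iff)
  then have "(\<Sum>n. complex_of_real (Q n)) = 0" using 0 unfolding eval_QF by simp
  then have "complex_of_real (\<Sum>n. Q n) = 0" using suminf_of_real[OF summable_Q, where 'a=complex] by simp
  then have "(\<Sum>n. Q n) = 0" by simp
  moreover have "Q 0 \<le> (\<Sum>n. Q n)" using sum_le_suminf[OF summable_Q, of "{0}"] Q_nonneg by simp
  ultimately show False by simp
qed

text \<open>The zeros in a closed disc of radius between 1 and \<beta> form a compact set, which is
  empty or has a member of least modulus; that modulus exceeds 1.\<close>

lemma ex_QF_zero_free_radius: "\<exists>r>1. r < \<beta> \<and> (\<forall>z. norm z < r \<longrightarrow> eval_fps QF z \<noteq> 0)"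
proof -
  define b where "b = (1 + \<beta>) / 2"
  have b: "1 < b" "b < \<beta>" using beta_gt_1 by (auto simp: b_def)
  define Z where "Z = {z \<in> cball 0 b. eval_fps QF z = 0}"
  have "cball (0::complex) b \<subseteq> eball 0 (fps_conv_radius QF)"
  proof
    fix z :: complex assume "z \<in> cball 0 b"
    then have "ereal (norm z) < ereal \<beta>" using b by simp
    also have "\<dots> \<le> fps_conv_radius QF" by (rule QF_conv_radius)
    finally show "z \<in> eball 0 (fps_conv_radius QF)" by simp
  qed
  then have cont: "continuous_on (cball 0 b) (eval_fps QF)"
    by (rule continuous_on_subset[OF continuous_on_eval_fps])
  have "closed Z" unfolding Z_def
    using continuous_closed_preimage_constant[OF cont closed_cball, of 0] by simp
  then have "compact Z" unfolding Z_def using compact_Int_closed[of "cball 0 b" Z] by (auto simp: Z_def Int_def compact_eq_bounded_closed intro: bounded_subset[OF bounded_cball])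
  show ?thesis
  proof (cases "Z = {}")
    case True
    then show ?thesis using b by (intro exI[of _ b]) (auto simp: Z_def)
  next
    case False
    obtain z0 where z0: "z0 \<in> Z" "\<And>z. z \<in> Z \<Longrightarrow> norm z0 \<le> norm z"
      using continuous_attains_inf[OF \<open>compact Z\<close> False, of norm] continuous_on_norm[OF continuous_on_id] by blast
    have n1: "1 < norm z0" using z0(1) eval_QF_nonzero[of z0] by (force simp: Z_def)
    have nb: "norm z0 \<le> b" using z0(1) by (auto simp: Z_def)
    have "eval_fps QF z \<noteq> 0" if "norm z < norm z0" for z
      using z0(2)[of z] that nb by (force simp: Z_def)
    then show ?thesis using n1 nb b by (intro exI[of _ "norm z0"]) auto
  qed
qed

text \<open>The inverse series converges beyond the unit circle, so its coefficients decay
  geometrically. The bound \<open>1 / \<beta> < \<rho>\<close> is for the later convolution with a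
  sequence of order \<open>(1 / \<beta>) ^ n\<close>.\<close>

lemma ex_inverse_decay: "\<exists>\<rho> C. 1 / \<beta> < \<rho> \<and> \<rho> < 1 \<and> 0 \<le> C \<and> (\<forall>n. norm (fps_nth (inverse QF) n) \<le> C * \<rho> ^ n)"
proof -
  obtain r where r: "1 < r" "r < \<beta>" "\<And>z. norm z < r \<Longrightarrow> eval_fps QF z \<noteq> 0" using ex_QF_zero_free_radius by auto
  have "fps_conv_radius (inverse QF) \<ge> min (ereal r) (fps_conv_radius QF)"
    using r by (intro fps_conv_radius_inverse) auto
  moreover have "ereal r \<le> fps_conv_radius QF" using r QF_conv_radius by (meson ereal_less_eq(3) less_imp_le order_trans)
  ultimately have cr: "conv_radius (fps_nth (inverse QF)) \<ge> ereal r" by (simp add: fps_conv_radius_def min_def)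
  define s where "s = (1 + r) / 2"
  have s: "1 < s" "s < r" using r by (auto simp: s_def)
  have "summable (\<lambda>n. norm (fps_nth (inverse QF) n * of_real s ^ n))"
    using s cr by (intro abs_summable_in_conv_radius) (auto intro: less_le_trans[of "ereal s" "ereal r"])
  then have "(\<lambda>n. norm (fps_nth (inverse QF) n * of_real s ^ n)) \<longlonglongrightarrow> 0" by (rule summable_LIMSEQ_zero)
  then have "Bseq (\<lambda>n. norm (fps_nth (inverse QF) n * of_real s ^ n))" by (intro convergent_imp_Bseq convergentI)
  then obtain C where C: "0 < C" "\<And>n. norm (norm (fps_nth (inverse QF) n * of_real s ^ n)) \<le> C" unfolding Bseq_def by blast
  have "norm (fps_nth (inverse QF) n) \<le> C * (1 / s) ^ n" for n
    using C(2)[of n] s by (simp add: norm_mult norm_power power_one_over field_simps)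
  moreover have "1 / \<beta> < 1 / s" "1 / s < 1" using s r by (auto simp: field_simps)
  ultimately show ?thesis using C by (intro exI[of _ "1 / s"] exI[of _ C]) auto
qed

end

context beta_map
begin

subsection \<open>The Parry density\<close>

text \<open>Parry's invariant density before normalisation. The term \<open>k = 0\<close> makes it
  at least 1 on the unit interval and the geometric series bounds it by
  \<open>1 / (1 - 1 / \<beta>)\<close>; normalising turns these into Renyi's bounds.\<close>

definition parry0 :: "real \<Rightarrow> real" where
  "parry0 x = (\<Sum>k. (1 / \<beta>) ^ k * indicator {..orbit1 k} x)"

lemma parry0_summable: "summable (\<lambda>k. (1 / \<beta>) ^ k * indicator {..orbit1 k} x)"
  by (rule summable_comparison_test'[OF summable_inv_beta]) (use beta_pos in \<open>auto simp: indicator_def\<close>)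

lemma parry0_borel [measurable]: "parry0 \<in> borel_measurable borel"
  unfolding parry0_def[abs_def] by measurable

lemma parry0_le: "parry0 x \<le> 1 / (1 - 1 / \<beta>)"
  unfolding parry0_def suminf_inv_beta[symmetric]
  by (rule suminf_le[OF _ parry0_summable summable_inv_beta]) (use beta_pos in \<open>auto simp: indicator_def\<close>)

lemma parry0_nonneg: "0 \<le> parry0 x"
  unfolding parry0_def by (rule suminf_nonneg[OF parry0_summable]) (use beta_pos in auto)

lemma parry0_ge: "x \<le> 1 \<Longrightarrow> 1 \<le> parry0 x"
  using sum_le_suminf[OF parry0_summable, of "{0}" x] beta_pos unfolding parry0_def by simp

lemma integral_indicator_unif:
  fixes F :: "real \<Rightarrow> 'a::{banach, second_countable_topology}"
  assumes [measurable]: "F \<in> borel_measurable borel" and t: "0 \<le> t" "t \<le> 1"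
  shows "(\<integral>x. indicator {..t} x *\<^sub>R F x \<partial>unif) = initial_integral t F"
proof -
  have "AE x in lborel. x \<noteq> t" by (rule AE_lborel_singleton)
  then have "AE x in lborel. indicator {0..1} x *\<^sub>R indicator {..t} x *\<^sub>R F x = indicator {0..<t} x *\<^sub>R F x"
    by eventually_elim (use t in \<open>auto simp: indicator_def\<close>)
  then show ?thesis unfolding initial_integral_def
    by (subst integral_unif, simp, intro integral_cong_AE) auto
qed

lemma parry0_integral_sums:
  fixes F :: "real \<Rightarrow> 'a::{banach, second_countable_topology}"
  assumes F[measurable]: "F \<in> borel_measurable borel" and b: "\<And>x. norm (F x) \<le> M"
  shows "(\<lambda>k. (1 / \<beta> ^ k) *\<^sub>R initial_integral (orbit1 k) F) sums (\<integral>x. parry0 x *\<^sub>R F x \<partial>unif)"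
proof -
  let ?f = "\<lambda>k x. ((1 / \<beta>) ^ k * indicator {..orbit1 k} x) *\<^sub>R F x"
  have M: "0 \<le> M" using b[of 0] norm_ge_zero order_trans by blast
  have fb: "norm (?f k x) \<le> (1 / \<beta>) ^ k * M" for k x
    using b[of x] beta_pos M by (auto simp: indicator_def intro!: mult_left_mono)
  have fi: "integrable unif (?f k)" for k
    using fb by (intro integrable_unif_bounded[where C="(1 / \<beta>) ^ k * M"]) auto
  have sM: "summable (\<lambda>k. (1 / \<beta>) ^ k * M)" using summable_inv_beta by (rule summable_mult2)
  have "(\<lambda>k. \<integral>x. ?f k x \<partial>unif) sums (\<integral>x. (\<Sum>k. ?f k x) \<partial>unif)"
  proof (rule sums_integral[OF fi])
    show "AE x in unif. summable (\<lambda>k. norm (?f k x))"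
      by (intro AE_I2 summable_comparison_test'[OF sM]) (use fb in auto)
    show "summable (\<lambda>k. \<integral>x. norm (?f k x) \<partial>unif)"
    proof (rule summable_comparison_test'[OF sM])
      fix k
      have "(\<integral>x. norm (?f k x) \<partial>unif) = norm (\<integral>x. norm (?f k x) \<partial>unif)"
        by (simp add: integral_nonneg_AE)
      also have "\<dots> \<le> (1 / \<beta>) ^ k * M" using fb by (intro norm_integral_unif_le) auto
      finally show "norm (\<integral>x. norm (?f k x) \<partial>unif) \<le> (1 / \<beta>) ^ k * M" by simp
    qed
  qed
  moreover have "(\<integral>x. ?f k x \<partial>unif) = (1 / \<beta> ^ k) *\<^sub>R initial_integral (orbit1 k) F" for k
  proof -
    have "?f k x = (1 / \<beta> ^ k) *\<^sub>R (indicator {..orbit1 k} x *\<^sub>R F x)" for x by (simp add: power_one_over)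
    then have "(\<integral>x. ?f k x \<partial>unif) = (\<integral>x. (1 / \<beta> ^ k) *\<^sub>R (indicator {..orbit1 k} x *\<^sub>R F x) \<partial>unif)"
      by (simp only:)
    then show ?thesis by (simp only: integral_scaleR_right integral_indicator_unif[OF F orbit1_range])
  qed
  moreover have "(\<Sum>k. ?f k x) = parry0 x *\<^sub>R F x" for x
    unfolding parry0_def by (rule suminf_scaleR_left[OF parry0_summable, symmetric])
  ultimately show ?thesis by simp
qed

definition parry_mass :: real where "parry_mass = (\<integral>x. parry0 x \<partial>unif)"

lemma parry0_integrable: "integrable unif parry0"
  using parry0_le parry0_nonneg by (intro integrable_unif_bounded[where C="1 / (1 - 1 / \<beta>)"]) auto

lemma parry_mass_ge: "1 \<le> parry_mass"
proof -
  have "(\<integral>x. 1 \<partial>unif) \<le> parry_mass" unfolding parry_mass_def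
  proof (intro integral_mono_AE)
    show "AE x in unif. 1 \<le> parry0 x"
      using AE_unif_mem by (rule eventually_mono) (auto intro: parry0_ge)
  qed (use parry0_integrable in auto)
  then show ?thesis using unif.prob_space by simp
qed

lemma parry_mass_le: "parry_mass \<le> 1 / (1 - 1 / \<beta>)"
proof -
  have "parry_mass \<le> (\<integral>x. 1 / (1 - 1 / \<beta>) \<partial>unif)" unfolding parry_mass_def
    using parry0_integrable parry0_le by (intro integral_mono) auto
  then show ?thesis using unif.prob_space by simp
qed

definition parry :: "real \<Rightarrow> real" where "parry x = parry0 x / parry_mass"

lemma parry_borel [measurable]: "parry \<in> borel_measurable borel"
  unfolding parry_def[abs_def] by measurable

lemma parry_bounds:
  assumes "x \<le> 1"
  shows "1 - 1 / \<beta> \<le> parry x" "parry x \<le> 1 / (1 - 1 / \<beta>)"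
proof -
  have p: "0 < 1 - 1 / \<beta>" using beta_gt_1 by simp
  have "1 - 1 / \<beta> \<le> 1 / parry_mass" using parry_mass_ge parry_mass_le p by (simp add: field_simps)
  also have "\<dots> \<le> parry x" unfolding parry_def using parry0_ge[OF assms] parry_mass_ge by (intro divide_right_mono) auto
  finally show "1 - 1 / \<beta> \<le> parry x" .
  have "parry x \<le> parry0 x / 1" unfolding parry_def using parry_mass_ge parry0_nonneg by (intro divide_left_mono) auto
  then show "parry x \<le> 1 / (1 - 1 / \<beta>)" using parry0_le[of x] by simp
qed

lemma parry_integral: "(\<integral>x. parry x \<partial>unif) = 1"
  unfolding parry_def using parry_mass_ge by (simp add: parry_mass_def)

lemma parry_integral_eq:
  fixes F :: "real \<Rightarrow> 'a::{banach, second_countable_topology}"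
  shows "(\<integral>x. parry x *\<^sub>R F x \<partial>unif) = (1 / parry_mass) *\<^sub>R (\<integral>x. parry0 x *\<^sub>R F x \<partial>unif)"
proof -
  have "parry x *\<^sub>R F x = (1 / parry_mass) *\<^sub>R (parry0 x *\<^sub>R F x)" for x by (simp add: parry_def)
  then have "(\<integral>x. parry x *\<^sub>R F x \<partial>unif) = (\<integral>x. (1 / parry_mass) *\<^sub>R (parry0 x *\<^sub>R F x) \<partial>unif)"
    by (simp only:)
  then show ?thesis by (simp only: integral_scaleR_right)
qed

text \<open>The digit recursion turns term \<open>k\<close> of the series for \<open>F o T\<close>
  into term \<open>Suc k\<close> of the series for \<open>F\<close> plus a share
  \<open>Q k - Q (Suc k)\<close> of its term 0. The shares add up to 1 and restore the missing
  term.\<close>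

lemma parry0_invariant:
  fixes F :: "real \<Rightarrow> 'a::{banach, second_countable_topology}"
  assumes F[measurable]: "F \<in> borel_measurable borel" and b: "\<And>x. norm (F x) \<le> M"
  shows "(\<integral>x. parry0 x *\<^sub>R F (T x) \<partial>unif) = (\<integral>x. parry0 x *\<^sub>R F x \<partial>unif)"
proof -
  let ?I = "\<lambda>k. (1 / \<beta> ^ k) *\<^sub>R initial_integral (orbit1 k) F"
  have s: "?I sums (\<integral>x. parry0 x *\<^sub>R F x \<partial>unif)" by (rule parry0_integral_sums[OF F b])
  have "(\<lambda>k. ?I (Suc k)) sums ((\<integral>x. parry0 x *\<^sub>R F x \<partial>unif) - ?I 0)"
    using s sums_Suc_iff[of ?I "(\<integral>x. parry0 x *\<^sub>R F x \<partial>unif) - ?I 0"] by simp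
  moreover have "(\<lambda>k. Q k - Q (Suc k)) sums (Q 0 - 0)"
    by (rule telescope_sums'[OF summable_LIMSEQ_zero[OF summable_Q]])
  then have "(\<lambda>k. (Q k - Q (Suc k)) *\<^sub>R ?I 0) sums (1 *\<^sub>R ?I 0)"
    by (intro sums_scaleR_left) simp
  ultimately have "(\<lambda>k. (Q k - Q (Suc k)) *\<^sub>R ?I 0 + ?I (Suc k)) sums (1 *\<^sub>R ?I 0 + ((\<integral>x. parry0 x *\<^sub>R F x \<partial>unif) - ?I 0))"
    by (intro sums_add)
  moreover have "(1 / \<beta> ^ k) *\<^sub>R initial_integral (orbit1 k) (\<lambda>x. F (T x)) = (Q k - Q (Suc k)) *\<^sub>R ?I 0 + ?I (Suc k)" for k
    using initial_integral_iter_Suc[OF F b orbit1_range(1), of k 0] beta_pos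
    by (simp add: Q_diff scaleR_add_right orbit1_Suc mult.commute)
  ultimately have "(\<lambda>k. (1 / \<beta> ^ k) *\<^sub>R initial_integral (orbit1 k) (\<lambda>x. F (T x))) sums (\<integral>x. parry0 x *\<^sub>R F x \<partial>unif)"
    by simp
  moreover have "(\<lambda>k. (1 / \<beta> ^ k) *\<^sub>R initial_integral (orbit1 k) (\<lambda>x. F (T x))) sums (\<integral>x. parry0 x *\<^sub>R F (T x) \<partial>unif)"
    using b by (intro parry0_integral_sums) auto
  ultimately show ?thesis using sums_unique2 by blast
qed

lemma emeasure_parry:
  assumes [measurable]: "A \<in> sets borel"
  shows "emeasure (density unif (\<lambda>x. ennreal (parry x))) A = ennreal (\<integral>x. parry x *\<^sub>R indicator A x \<partial>unif)"
proof -
  have p0: "0 \<le> parry x" for x using parry0_nonneg parry_mass_ge by (simp add: parry_def)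
  have "integrable unif parry" unfolding parry_def[abs_def] using parry0_integrable by simp
  then have i: "integrable unif (\<lambda>x. parry x * indicator A x)" by (intro integrable_real_mult_indicator) auto
  have "emeasure (density unif (\<lambda>x. ennreal (parry x))) A = (\<integral>\<^sup>+x. ennreal (parry x * indicator A x) \<partial>unif)"
    by (subst emeasure_density) (auto intro!: nn_integral_cong simp: indicator_def)
  also have "\<dots> = ennreal (\<integral>x. parry x * indicator A x \<partial>unif)"
    using i p0 by (intro nn_integral_eq_integral) auto
  finally show ?thesis by simp
qed

lemma acim_parry: "acim T parry"
proof
  show "T x \<in> {0..1}" for x using T_range[of x] by simp
  show "\<exists>c C. 0 < c \<and> (\<forall>x\<in>{0..1}. c \<le> parry x \<and> parry x \<le> C)"
    using parry_bounds beta_gt_1 by (intro exI[of _ "1 - 1 / \<beta>"] exI[of _ "1 / (1 - 1 / \<beta>)"]) auto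
  show "distr (density unif (\<lambda>x. ennreal (parry x))) borel T = density unif (\<lambda>x. ennreal (parry x))"
  proof (rule measure_eqI)
    fix A assume "A \<in> sets (distr (density unif (\<lambda>x. ennreal (parry x))) borel T)"
    then have A[measurable]: "A \<in> sets borel" by simp
    have TA: "T -` A \<in> sets borel" using measurable_sets[OF T_borel A] by simp
    have "(\<integral>x. parry x *\<^sub>R indicator (T -` A) x \<partial>unif) = (\<integral>x. parry x *\<^sub>R (indicator A (T x) :: real) \<partial>unif)"
      by (simp add: indicator_def vimage_def)
    also have "\<dots> = (\<integral>x. parry x *\<^sub>R indicator A x \<partial>unif)"
      unfolding parry_integral_eq by (subst parry0_invariant[where M=1]) (auto simp: indicator_def)
    finally show "emeasure (distr (density unif (\<lambda>x. ennreal (parry x))) borel T) A = emeasure (density unif (\<lambda>x. ennreal (parry x))) A"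
      using TA by (subst emeasure_distr) (auto simp: emeasure_parry)
  qed simp
qed (use parry_integral in auto)

subsection \<open>Exponential mixing\<close>

text \<open>As power series the renewal identity reads \<open>QF * e = S\<close>, where
  \<open>S\<close> lists the partial sums of the series for the integral against
  \<open>parry0\<close>. That integral is 0, so \<open>S\<close> consists of negative tails and
  decays like \<open>(1 / \<beta>) ^ m\<close>; convolution with the inverse of \<open>QF\<close>
  keeps the decay geometric.\<close>

lemma ex_unit_decay:
  "\<exists>C \<theta>. 0 \<le> C \<and> 1 / \<beta> < \<theta> \<and> \<theta> < 1 \<and> (\<forall>(g :: real \<Rightarrow> complex) m. g \<in> borel_measurable borel \<longrightarrow> (\<forall>x. norm (g x) \<le> 1) \<longrightarrow>
     (\<integral>x. parry x *\<^sub>R g x \<partial>unif) = 0 \<longrightarrow> norm (initial_integral 1 (\<lambda>x. g ((T ^^ m) x))) \<le> C * \<theta> ^ m)"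
proof -
  obtain \<rho> C where \<rho>: "1 / \<beta> < \<rho>" "\<rho> < 1" and C: "0 \<le> C" "\<And>n. norm (fps_nth (inverse QF) n) \<le> C * \<rho> ^ n"
    using ex_inverse_decay by blast
  have \<rho>0: "0 < \<rho>" using \<rho> beta_pos by (meson divide_pos_pos less_trans zero_less_one)
  define C2 where "C2 = 1 / (1 - 1 / \<beta>)"
  have C2: "0 \<le> C2" using beta_gt_1 by (simp add: C2_def)
  \<comment> \<open>The quotient of the two rates \<open>1 / \<beta>\<close> and \<rho>; being less
    than 1, it lets the convolution have order \<open>\<rho> ^ m\<close> without a factor
    \<open>m\<close>.\<close>
  define q where "q = 1 / (\<beta> * \<rho>)"
  have q: "0 < q" "q < 1" using \<rho> \<rho>0 beta_pos by (auto simp: q_def field_simps)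
  have main: "norm (initial_integral 1 (\<lambda>x. g ((T ^^ m) x))) \<le> C * C2 / (1 - q) * \<rho> ^ m"
    if g[measurable]: "g \<in> borel_measurable borel" and g1: "\<And>x. norm (g x) \<le> 1" and g0: "(\<integral>x. parry x *\<^sub>R g x \<partial>unif) = 0"
    for g :: "real \<Rightarrow> complex" and m
  proof -
    define I where "I k = (1 / \<beta> ^ k) *\<^sub>R initial_integral (orbit1 k) g" for k
    define S where "S m = (\<Sum>i\<le>m. I i)" for m
    define e where "e m = initial_integral 1 (\<lambda>x. g ((T ^^ m) x))" for m
    have "(\<integral>x. parry0 x *\<^sub>R g x \<partial>unif) = 0" using g0 parry_mass_ge unfolding parry_integral_eq by simp
    then have I0: "I sums 0" using parry0_integral_sums[OF g g1] unfolding I_def by simp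
    have Ib: "norm (I k) \<le> (1 / \<beta>) ^ k" for k
    proof -
      have "norm (initial_integral (orbit1 k) g) \<le> 1 * orbit1 k" using g1 orbit1_range by (intro norm_initial_integral_le) auto
      also have "\<dots> \<le> 1" using orbit1_range by simp
      finally show ?thesis using beta_pos unfolding I_def
        by (simp add: power_one_over divide_right_mono)
    qed
    have Sb: "norm (S m) \<le> C2 * (1 / \<beta>) ^ m" for m
    proof -
      have "S m + (\<Sum>n. I (n + Suc m)) = 0"
        using suminf_split_initial_segment[of I "Suc m"] I0 unfolding S_def lessThan_Suc_atMost by (simp add: sums_iff add.commute)
      then have "norm (S m) = norm (\<Sum>n. I (n + Suc m))" by (metis add_eq_0_iff norm_minus_cancel)
      also have "\<dots> \<le> (\<Sum>n. (1 / \<beta>) ^ n * (1 / \<beta>) ^ m)"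
      proof (rule norm_suminf_le)
        show "norm (I (n + Suc m)) \<le> (1 / \<beta>) ^ n * (1 / \<beta>) ^ m" for n
        proof -
          have "norm (I (n + Suc m)) \<le> (1 / \<beta>) ^ (n + Suc m)" by (rule Ib)
          also have "\<dots> \<le> (1 / \<beta>) ^ (n + m)" using beta_gt_1 by (intro power_decreasing) auto
          finally show ?thesis by (simp add: power_add)
        qed
        show "summable (\<lambda>n. (1 / \<beta>) ^ n * (1 / \<beta>) ^ m)" using summable_inv_beta by (rule summable_mult2)
      qed
      also have "\<dots> = C2 * (1 / \<beta>) ^ m" unfolding C2_def suminf_inv_beta[symmetric]
        using suminf_mult2[OF summable_inv_beta] by simp
      finally show ?thesis .
    qed
    have "QF * Abs_fps e = Abs_fps S"
    proof (rule fps_ext)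
      fix n
      have "fps_nth (QF * Abs_fps e) n = (\<Sum>i\<le>n. Q i *\<^sub>R e (n - i))"
        by (simp add: fps_mult_nth QF_def atLeast0AtMost scaleR_conv_of_real)
      also have "\<dots> = S n" unfolding e_def S_def I_def by (rule renewal_identity[OF g g1])
      finally show "fps_nth (QF * Abs_fps e) n = fps_nth (Abs_fps S) n" by simp
    qed
    moreover have "inverse QF * QF = 1" by (rule inverse_mult_eq_1) (simp add: QF_def)
    ultimately have "Abs_fps e = inverse QF * Abs_fps S" by (metis mult.assoc mult_1)
    then have "e m = fps_nth (inverse QF * Abs_fps S) m" by (metis fps_nth_Abs_fps)
    also have "\<dots> = (\<Sum>i\<le>m. fps_nth (inverse QF) i * S (m - i))"
      by (simp add: fps_mult_nth atLeast0AtMost)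
    finally have "norm (e m) \<le> (\<Sum>i\<le>m. norm (fps_nth (inverse QF) i * S (m - i)))" by (simp add: norm_sum)
    also have "\<dots> \<le> (\<Sum>i\<le>m. (C * \<rho> ^ i) * (C2 * (1 / \<beta>) ^ (m - i)))"
      unfolding norm_mult using C \<rho>0 by (intro sum_mono mult_mono Sb C) auto
    also have "\<dots> = (\<Sum>i\<le>m. (C * C2 * \<rho> ^ m) * q ^ (m - i))"
    proof (rule sum.cong)
      fix i assume "i \<in> {..m}"
      then have "\<rho> ^ m = \<rho> ^ i * \<rho> ^ (m - i)" by (simp flip: power_add)
      moreover have "\<rho> ^ (m - i) * q ^ (m - i) = (1 / \<beta>) ^ (m - i)"
        using \<rho>0 beta_pos by (simp add: q_def flip: power_mult_distrib)
      ultimately show "(C * \<rho> ^ i) * (C2 * (1 / \<beta>) ^ (m - i)) = (C * C2 * \<rho> ^ m) * q ^ (m - i)"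
        by (simp add: mult_ac)
    qed simp
    also have "\<dots> = (C * C2 * \<rho> ^ m) * (\<Sum>i\<le>m. q ^ (m - i))" by (simp add: sum_distrib_left)
    also have "(\<Sum>i\<le>m. q ^ (m - i)) = (\<Sum>i\<le>m. q ^ i)"
      by (rule sum.reindex_bij_witness[of _ "\<lambda>i. m - i" "\<lambda>i. m - i"]) auto
    also have "(C * C2 * \<rho> ^ m) * (\<Sum>i\<le>m. q ^ i) \<le> (C * C2 * \<rho> ^ m) * (1 / (1 - q))"
    proof (rule mult_left_mono)
      have "(\<Sum>i\<le>m. q ^ i) \<le> (\<Sum>i. q ^ i)" using q by (intro sum_le_suminf summable_geometric) auto
      then show "(\<Sum>i\<le>m. q ^ i) \<le> 1 / (1 - q)" using q by (simp add: suminf_geometric)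
    qed (use C C2 \<rho>0 in auto)
    finally show ?thesis unfolding e_def by simp
  qed
  show ?thesis
    using main \<rho> C C2 q by (intro exI[of _ "C * C2 / (1 - q)"] exI[of _ \<rho>]) auto
qed

lemma ex_initial_decay:
  "\<exists>C \<theta>. 0 \<le> C \<and> 1 / \<beta> < \<theta> \<and> \<theta> < 1 \<and> (\<forall>(g :: real \<Rightarrow> complex) m. g \<in> borel_measurable borel \<longrightarrow> (\<forall>x. norm (g x) \<le> 1) \<longrightarrow>
     (\<integral>x. parry x *\<^sub>R g x \<partial>unif) = 0 \<longrightarrow> (\<forall>a\<in>{0..1}. norm (initial_integral a (\<lambda>x. g ((T ^^ m) x))) \<le> C * \<theta> ^ m))"
proof -
  obtain C \<theta> where C: "0 \<le> C" and \<theta>: "1 / \<beta> < \<theta>" "\<theta> < 1" and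
    E: "\<And>(g :: real \<Rightarrow> complex) m. g \<in> borel_measurable borel \<Longrightarrow> (\<And>x. norm (g x) \<le> 1) \<Longrightarrow>
     (\<integral>x. parry x *\<^sub>R g x \<partial>unif) = 0 \<Longrightarrow> norm (initial_integral 1 (\<lambda>x. g ((T ^^ m) x))) \<le> C * \<theta> ^ m"
    using ex_unit_decay by blast
  \<comment> \<open>Large enough that the recursion reproduces the bound,
    \<open>C + C' / \<beta> <= C' * \<theta>\<close>; the 1 covers \<open>m = 0\<close>.\<close>
  define C' where "C' = max 1 (C / (\<theta> - 1 / \<beta>))"
  have C': "1 \<le> C'" "C + C' / \<beta> \<le> C' * \<theta>"
  proof -
    show "1 \<le> C'" by (simp add: C'_def)
    have "C / (\<theta> - 1 / \<beta>) \<le> C'" by (simp add: C'_def)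
    then have "C \<le> C' * (\<theta> - 1 / \<beta>)" using \<theta> by (simp add: pos_divide_le_eq)
    then show "C + C' / \<beta> \<le> C' * \<theta>" by (simp add: algebra_simps)
  qed
  have \<theta>0: "0 < \<theta>" using \<theta> beta_pos by (meson divide_pos_pos less_trans zero_less_one)
  have "norm (initial_integral a (\<lambda>x. g ((T ^^ m) x))) \<le> C' * \<theta> ^ m"
    if g[measurable]: "g \<in> borel_measurable borel" and g1: "\<And>x. norm (g x) \<le> 1" and g0: "(\<integral>x. parry x *\<^sub>R g x \<partial>unif) = 0"
      and a: "a \<in> {0..1}" for g :: "real \<Rightarrow> complex" and m a
    using a
  proof (induction m arbitrary: a)
    case 0
    have "norm (initial_integral a g) \<le> 1 * a" using g1 0 by (intro norm_initial_integral_le) auto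
    then show ?case using 0 C' by simp
  next
    case (Suc m)
    have Ta: "T a \<in> {0..1}" using T_range[of a] by simp
    have "norm (initial_integral a (\<lambda>x. g ((T ^^ Suc m) x))) \<le>
      norm ((real (digit a) / \<beta>) *\<^sub>R initial_integral 1 (\<lambda>x. g ((T ^^ m) x))) + norm ((1 / \<beta>) *\<^sub>R initial_integral (T a) (\<lambda>x. g ((T ^^ m) x)))"
      using Suc.prems initial_integral_iter_Suc[OF g g1, of a m] by (simp add: norm_triangle_ineq del: norm_scaleR)
    also have "norm ((real (digit a) / \<beta>) *\<^sub>R initial_integral 1 (\<lambda>x. g ((T ^^ m) x))) \<le> 1 * (C * \<theta> ^ m)"
    proof -
      have a: "0 \<le> a" "a \<le> 1" using Suc.prems by auto
      have "0 \<le> real (digit a) / \<beta>" using beta_pos by simp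
      with order_trans[OF digit_weight_le[OF a] a(2)] have "\<bar>real (digit a) / \<beta>\<bar> \<le> 1" by linarith
      then show ?thesis unfolding norm_scaleR by (intro mult_mono E g g1 g0) auto
    qed
    also have "norm ((1 / \<beta>) *\<^sub>R initial_integral (T a) (\<lambda>x. g ((T ^^ m) x))) \<le> (1 / \<beta>) * (C' * \<theta> ^ m)"
      unfolding norm_scaleR using Suc.IH[OF Ta] beta_pos by (simp add: mult_left_mono divide_right_mono)
    also have "1 * (C * \<theta> ^ m) + (1 / \<beta>) * (C' * \<theta> ^ m) = (C + C' / \<beta>) * \<theta> ^ m" by (simp add: algebra_simps)
    also have "\<dots> \<le> (C' * \<theta>) * \<theta> ^ m" using C' \<theta>0 by (intro mult_right_mono) auto
    finally show ?case by (simp add: mult_ac)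
  qed
  then show ?thesis using C' \<theta> by (intro exI[of _ C'] exI[of _ \<theta>]) auto
qed

subsection \<open>Cylinder base points\<close>

text \<open>On the cylinder of \<open>x\<close> the map \<open>T ^^ k\<close> has slope
  \<open>\<beta> ^ k\<close> and starts at 0, so this is the left end point of the cylinder.\<close>

definition base_point :: "nat \<Rightarrow> real \<Rightarrow> real" where
  "base_point k x = x - (T ^^ k) x / \<beta> ^ k"

lemma base_point_borel [measurable]: "base_point k \<in> borel_measurable borel"
  unfolding base_point_def[abs_def] by measurable

lemma base_point_range:
  assumes "x \<in> {0..1}"
  shows "0 \<le> base_point k x" "base_point k x \<le> x"
proof -
  show "0 \<le> base_point k x" using iter_le[of x k] assms beta_pos by (simp add: base_point_def divide_le_eq mult.commute)
  show "base_point k x \<le> x" using iter_range[OF assms, of k] beta_pos by (simp add: base_point_def)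
qed

lemma base_point_Suc: "0 \<le> y \<Longrightarrow> y < 1 \<Longrightarrow> base_point (Suc k) ((real d + y) / \<beta>) = (real d + base_point k y) / \<beta>"
  unfolding base_point_def funpow_Suc_right comp_def using T_digit[of y d] beta_pos
  by (simp add: field_simps)

lemma T_base_point:
  assumes "x \<in> {0..1}"
  shows "T (base_point (Suc k) x) = base_point k (T x)"
proof -
  have x: "x = (real (digit x) + T x) / \<beta>" using digit_eq[of x] assms beta_pos by simp
  have "T x \<in> {0..1}" using T_range[of x] by simp
  note b = base_point_range[OF this, of k]
  have "base_point (Suc k) x = (real (digit x) + base_point k (T x)) / \<beta>"
    by (subst x, rule base_point_Suc) (use T_range in auto)
  then show ?thesis using b T_range[of x] by (simp add: T_digit)
qed

lemma iter_base_point: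
  assumes "x \<in> {0..1}" "n \<le> k"
  shows "(T ^^ n) (base_point k x) = base_point (k - n) ((T ^^ n) x)"
  using assms
proof (induction n arbitrary: k x)
  case (Suc n)
  then obtain k' where k': "k = Suc k'" by (cases k) auto
  have "(T ^^ Suc n) (base_point k x) = (T ^^ n) (base_point k' (T x))"
    using Suc.prems k' by (simp add: funpow_swap1 T_base_point)
  also have "\<dots> = base_point (k' - n) ((T ^^ n) (T x))" using Suc k' T_range[of x] by simp
  finally show ?case using k' by (simp add: funpow_swap1)
qed simp

text \<open>Multiplied by \<open>\<beta> ^ k\<close>, this is an upper count of the rank
  \<open>k\<close> cylinders that meet \<open>{0..<a}\<close>.\<close>

fun cylinder_bound :: "nat \<Rightarrow> real \<Rightarrow> real" where
  "cylinder_bound 0 a = 1"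
| "cylinder_bound (Suc k) a = (real (digit a) * cylinder_bound k 1 + cylinder_bound k (T a)) / \<beta>"

text \<open>The bound reproduces itself under the identity
  \<open>digit a + T a = \<beta> * a\<close>. At \<open>a = 1\<close> it is a geometric series, so
  the number of cylinders is of order \<open>\<beta> ^ k\<close> although they need not be
  full.\<close>

lemma cylinder_bound_le: "0 \<le> a \<Longrightarrow> cylinder_bound k a \<le> a * (\<Sum>i<k. (1 / \<beta>) ^ i) + (1 / \<beta>) ^ k"
proof (induction k arbitrary: a)
  case (Suc k)
  have "cylinder_bound k 1 \<le> (\<Sum>i<Suc k. (1 / \<beta>) ^ i)" using Suc.IH[of 1] by simp
  then have "real (digit a) * cylinder_bound k 1 \<le> real (digit a) * (\<Sum>i<Suc k. (1 / \<beta>) ^ i)" by (intro mult_left_mono) auto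
  moreover have "cylinder_bound k (T a) \<le> T a * (\<Sum>i<Suc k. (1 / \<beta>) ^ i) + (1 / \<beta>) ^ k"
  proof -
    have "T a * (\<Sum>i<k. (1 / \<beta>) ^ i) \<le> T a * (\<Sum>i<Suc k. (1 / \<beta>) ^ i)"
      using T_range beta_pos by (intro mult_left_mono) auto
    then show ?thesis using Suc.IH[OF T_range(1), of a] by linarith
  qed
  ultimately have "real (digit a) * cylinder_bound k 1 + cylinder_bound k (T a) \<le> (real (digit a) + T a) * (\<Sum>i<Suc k. (1 / \<beta>) ^ i) + (1 / \<beta>) ^ k"
    unfolding distrib_right by linarith
  also have "real (digit a) + T a = \<beta> * a" using digit_eq[OF Suc.prems] by simp
  finally have "cylinder_bound (Suc k) a \<le> (\<beta> * a * (\<Sum>i<Suc k. (1 / \<beta>) ^ i) + (1 / \<beta>) ^ k) / \<beta>"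
    using beta_pos by (simp add: divide_right_mono del: sum.lessThan_Suc)
  also have "\<dots> = a * (\<Sum>i<Suc k. (1 / \<beta>) ^ i) + (1 / \<beta>) ^ Suc k" using beta_pos by (simp add: add_divide_distrib del: sum.lessThan_Suc)
  finally show ?case .
qed simp

lemma cylinder_bound_1: "cylinder_bound k 1 \<le> 1 / (1 - 1 / \<beta>)"
proof -
  have "cylinder_bound k 1 \<le> (\<Sum>i<Suc k. (1 / \<beta>) ^ i)" using cylinder_bound_le[of 1 k] by simp
  also have "\<dots> \<le> (\<Sum>i. (1 / \<beta>) ^ i)" using beta_pos by (intro sum_le_suminf summable_inv_beta) auto
  finally show ?thesis by (simp add: suminf_inv_beta)
qed

text \<open>On a rank \<open>k\<close> cylinder \<open>Z\<close> is constant and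
  \<open>T ^^ k\<close> maps affinely onto an initial segment, so the contribution is at most
  \<open>M / \<beta> ^ k\<close>. Cylinders that are not full are the reason why \<open>M\<close>
  must bound the integrals over all initial segments.\<close>

lemma cylinder_integral_le:
  fixes F Z :: "real \<Rightarrow> complex"
  assumes F[measurable]: "F \<in> borel_measurable borel" and F1: "\<And>x. norm (F x) \<le> 1"
    and M: "\<And>a. a \<in> {0..1} \<Longrightarrow> norm (initial_integral a F) \<le> M"
    and "Z \<in> borel_measurable borel" "\<And>x. norm (Z x) \<le> 1" "a \<in> {0..1}"
  shows "norm (initial_integral a (\<lambda>x. Z (base_point k x) * F ((T ^^ k) x))) \<le> cylinder_bound k a * M"
  using assms(4-6)
proof (induction k arbitrary: Z a)
  case 0
  have "initial_integral a (\<lambda>x. Z (base_point 0 x) * F ((T ^^ 0) x)) = Z 0 * initial_integral a F"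
    unfolding initial_integral_def by (simp add: base_point_def flip: mult_scaleR_right)
  also have "norm \<dots> \<le> 1 * M" unfolding norm_mult using 0 M by (intro mult_mono) auto
  finally show ?case by simp
next
  case (Suc k)
  note [measurable] = Suc.prems(1)
  let ?G = "\<lambda>x. Z (base_point (Suc k) x) * F ((T ^^ Suc k) x)"
  have G1: "norm (?G x) \<le> 1" for x unfolding norm_mult using Suc.prems(2) F1 by (intro mult_le_one) auto
  have Ta: "T a = frac (\<beta> * a)" "T a \<in> {0..1}" using T_range[of a] by (simp_all add: mult_mod1_def)
  have piece: "norm (initial_integral s (\<lambda>y. ?G ((real d + y) / \<beta>))) \<le> cylinder_bound k s * M" if "s \<in> {0..1}" for s d
  proof -
    have "initial_integral s (\<lambda>y. ?G ((real d + y) / \<beta>)) = initial_integral s (\<lambda>y. Z ((real d + base_point k y) / \<beta>) * F ((T ^^ k) y))"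
      using that by (intro initial_integral_cong) (simp add: funpow_swap1 T_digit base_point_Suc)
    also have "norm \<dots> \<le> cylinder_bound k s * M" using that Suc.prems
      by (intro Suc.IH[of "\<lambda>y. Z ((real d + y) / \<beta>)"]) auto
    finally show ?thesis .
  qed
  have eq: "initial_integral a ?G = (1 / \<beta>) *\<^sub>R ((\<Sum>d<digit a. initial_integral 1 (\<lambda>y. ?G ((real d + y) / \<beta>))) +
     initial_integral (T a) (\<lambda>y. ?G ((real (digit a) + y) / \<beta>)))"
    unfolding digit_def Ta(1) using G1 beta_pos Suc.prems by (intro initial_integral_digits[where M=1]) auto
  have "norm (initial_integral a ?G) \<le> (1 / \<beta>) * ((\<Sum>d<digit a. cylinder_bound k 1 * M) + cylinder_bound k (T a) * M)"
    unfolding eq norm_scaleR using beta_pos Ta(2)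
    by (intro mult_mono norm_triangle_le add_mono order_trans[OF norm_sum] sum_mono piece) auto
  also have "\<dots> = cylinder_bound (Suc k) a * M" by (simp add: distrib_right add_divide_distrib)
  finally show ?case .
qed

subsection \<open>Discontinuities of iterates\<close>

lemma iter_0: "(T ^^ m) 0 = 0"
  by (induction m) (simp_all add: mult_mod1_def)

text \<open>While \<open>x\<close> and \<open>y\<close> have equal digits their distance is
  multiplied by \<beta>. When the digits differ, an end point of the branch of \<open>x\<close> lies
  between them; its image 1 or 0 is then followed in place of \<open>y\<close>, so only points of
  the orbits of 0 and 1 can arise.\<close>

lemma iter_dist:
  assumes "x \<in> {0..1}" "y \<in> {0..1}"
  shows "\<bar>(T ^^ m) y - (T ^^ m) x\<bar> \<le> \<beta> ^ m * \<bar>y - x\<bar> \<or> (\<exists>p\<in>insert 0 (orbit1 ` {..m}). \<bar>(T ^^ m) x - p\<bar> \<le> \<beta> ^ m * \<bar>y - x\<bar>)"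
  using assms
proof (induction m arbitrary: x y)
  case (Suc m)
  have Tx: "T x \<in> {0..1}" and Ty: "T y \<in> {0..1}" using T_range[of x] T_range[of y] by auto
  \<comment> \<open>The induction step for a substitute \<open>z\<close> of \<open>T y\<close>:
    \<open>T y\<close> itself, 1 or 0.\<close>
  have aux: ?case if z: "z \<in> {0..1}" "\<bar>z - T x\<bar> \<le> \<beta> * \<bar>y - x\<bar>" "(T ^^ m) z = (T ^^ Suc m) y \<or> (T ^^ m) z \<in> insert 0 (orbit1 ` {..Suc m})" for z
  proof -
    have le: "\<beta> ^ m * \<bar>z - T x\<bar> \<le> \<beta> ^ Suc m * \<bar>y - x\<bar>"
      using mult_left_mono[OF z(2), of "\<beta> ^ m"] beta_pos by (simp add: mult_ac)
    have eq: "(T ^^ m) (T x) = (T ^^ Suc m) x" by (simp add: funpow_swap1)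
    from Suc.IH[OF Tx z(1)] show ?thesis
    proof (elim disjE bexE)
      assume "\<bar>(T ^^ m) z - (T ^^ m) (T x)\<bar> \<le> \<beta> ^ m * \<bar>z - T x\<bar>"
      then have 1: "\<bar>(T ^^ m) z - (T ^^ Suc m) x\<bar> \<le> \<beta> ^ Suc m * \<bar>y - x\<bar>" using le unfolding eq by linarith
      from z(3) show ?thesis
      proof
        assume "(T ^^ m) z = (T ^^ Suc m) y" with 1 show ?thesis by simp
      next
        assume "(T ^^ m) z \<in> insert 0 (orbit1 ` {..Suc m})" with 1 show ?thesis by (metis abs_minus_commute)
      qed
    next
      fix p assume p: "p \<in> insert 0 (orbit1 ` {..m})" "\<bar>(T ^^ m) (T x) - p\<bar> \<le> \<beta> ^ m * \<bar>z - T x\<bar>"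
      then have "p \<in> insert 0 (orbit1 ` {..Suc m})" "\<bar>(T ^^ Suc m) x - p\<bar> \<le> \<beta> ^ Suc m * \<bar>y - x\<bar>"
        using le unfolding eq by auto
      then show ?thesis by blast
    qed
  qed
  have Tf: "T u = \<beta> * u - of_int \<lfloor>\<beta> * u\<rfloor>" for u by (simp add: mult_mod1_def frac_def)
  consider "\<lfloor>\<beta> * x\<rfloor> = \<lfloor>\<beta> * y\<rfloor>" | "\<lfloor>\<beta> * x\<rfloor> < \<lfloor>\<beta> * y\<rfloor>" | "\<lfloor>\<beta> * y\<rfloor> < \<lfloor>\<beta> * x\<rfloor>" by linarith
  then show ?case
  proof cases
    case 1
    have "\<bar>T y - T x\<bar> = \<bar>\<beta> * (y - x)\<bar>" unfolding Tf 1 by (simp add: algebra_simps)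
    then show ?thesis using beta_pos by (intro aux[OF Ty]) (auto simp: abs_mult funpow_swap1)
  next
    case 2
    have "1 - T x \<le> \<beta> * (y - x)" unfolding Tf right_diff_distrib using 2 by linarith
    also have "\<dots> \<le> \<beta> * \<bar>y - x\<bar>" using beta_pos by simp
    finally have "\<bar>1 - T x\<bar> \<le> \<beta> * \<bar>y - x\<bar>" using T_range[of x] by simp
    then show ?thesis by (intro aux[of 1]) (auto simp: orbit1_def)
  next
    case 3
    have "T x \<le> \<beta> * (x - y)" unfolding Tf right_diff_distrib using 3 by linarith
    also have "\<dots> \<le> \<beta> * \<bar>y - x\<bar>" using beta_pos by simp
    finally have "\<bar>0 - T x\<bar> \<le> \<beta> * \<bar>y - x\<bar>" using T_range[of x] by simp
    then show ?thesis by (intro aux[of 0]) (auto simp: iter_0)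
  qed
qed simp

theorem jsys_beta: "jsys T parry (ln \<beta>)"
proof -
  interpret acim T parry by (rule acim_parry)
  show ?thesis
  proof
    show "0 < ln \<beta>" using beta_gt_1 by simp
  next
    obtain C \<theta> where C: "0 \<le> C" and \<theta>: "1 / \<beta> < \<theta>" "\<theta> < 1" and
      E: "\<And>(g :: real \<Rightarrow> complex) m a. g \<in> borel_measurable borel \<Longrightarrow> (\<And>x. norm (g x) \<le> 1) \<Longrightarrow>
       (\<integral>x. parry x *\<^sub>R g x \<partial>unif) = 0 \<Longrightarrow> a \<in> {0..1} \<Longrightarrow> norm (initial_integral a (\<lambda>x. g ((T ^^ m) x))) \<le> C * \<theta> ^ m"
      using ex_initial_decay by blast
    have \<theta>0: "0 < \<theta>" using \<theta> beta_pos by (meson divide_pos_pos less_trans zero_less_one)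
    \<comment> \<open>One constant for mixing and for contraction, which asks for at least
      1.\<close>
    define C' where "C' = max 1 (C / (1 - 1 / \<beta>))"
    have "base_point k x \<in> {0..1}" if "x \<in> {0..1}" for k x
      using base_point_range[OF that, of k] that by simp
    then have p1: "cylinder_points base_point" unfolding cylinder_points_def
      by (intro conjI allI ballI base_point_borel)
    have p2: "cylinder_mixing T parry base_point C' \<theta>" unfolding cylinder_mixing_def
    proof (intro allI impI)
      fix Z g :: "real \<Rightarrow> complex" and k j
      assume Z: "Z \<in> borel_measurable borel" and g[measurable]: "g \<in> borel_measurable borel"
        and Z1: "\<forall>x. norm (Z x) \<le> 1" and g1: "\<forall>x. norm (g x) \<le> 1" and g0: "(\<integral>x. parry x *\<^sub>R g x \<partial>unif) = 0"
      note [measurable] = Z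
      have "(\<integral>x. Z (base_point k x) * g ((T ^^ (k + j)) x) \<partial>unif) =
         initial_integral 1 (\<lambda>x. Z (base_point k x) * (\<lambda>y. g ((T ^^ j) y)) ((T ^^ k) x))"
        by (subst initial_integral_1) (simp_all add: add.commute[of k j] funpow_add)
      also have "norm \<dots> \<le> cylinder_bound k 1 * (C * \<theta> ^ j)"
        using E[OF g _ g0] g1 Z Z1 by (intro cylinder_integral_le) auto
      also have "\<dots> \<le> 1 / (1 - 1 / \<beta>) * (C * \<theta> ^ j)" using C \<theta>0 by (intro mult_right_mono cylinder_bound_1) auto
      also have "\<dots> = C / (1 - 1 / \<beta>) * \<theta> ^ j" by simp
      also have "\<dots> \<le> C' * \<theta> ^ j" using \<theta>0 by (intro mult_right_mono) (auto simp: C'_def)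
      finally show "norm (\<integral>x. Z (base_point k x) * g ((T ^^ (k + j)) x) \<partial>unif) \<le> C' * \<theta> ^ j" .
    qed
    have diff: "\<bar>x - base_point k x\<bar> \<le> (1 / \<beta>) ^ k" if "x \<in> {0..1}" for k x
      using iter_range[OF that, of k] beta_pos by (simp add: base_point_def power_one_over divide_right_mono)
    \<comment> \<open>Every point of the unit interval is within \<open>(1 / \<beta>) ^ k\<close> of
      its base point, so the exceptional set is null.\<close>
    have p3: "cylinder_size (ln \<beta>) base_point" unfolding cylinder_size_def
    proof (intro allI impI exI)
      fix \<epsilon> :: real and k :: nat assume "0 < \<epsilon>" "1 \<le> k"
      let ?A = "{x. exp (- (ln \<beta> - \<epsilon>) * real k) < \<bar>x - base_point k x\<bar>}"
      have "(1 / \<beta>) ^ k \<le> exp (- (ln \<beta> - \<epsilon>) * real k)"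
      proof -
        have "(1 / \<beta>) ^ k = exp (- ln \<beta>) ^ k" using beta_pos by (simp add: exp_minus inverse_eq_divide)
        also have "\<dots> = exp (- ln \<beta> * real k)" by (simp add: exp_of_nat_mult[symmetric] mult.commute)
        also have "\<dots> \<le> exp (- (ln \<beta> - \<epsilon>) * real k)" using \<open>0 < \<epsilon>\<close> by (simp add: left_diff_distrib)
        finally show ?thesis .
      qed
      then have "x \<notin> ?A" if "x \<in> {0..1}" for x using diff[OF that, of k] by simp
      then have "AE x in unif. x \<notin> ?A" by (intro eventually_mono[OF AE_unif_mem])
      then have "measure unif ?A = 0"
        by (subst unif.prob_eq_0) auto
      then show "measure unif ?A \<le> 0 / sqrt (real k)" by simp
    qed
    have p4: "cylinder_contraction T base_point C' \<theta>" unfolding cylinder_contraction_def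
    proof (intro allI impI)
      fix k n :: nat assume nk: "n \<le> k"
      show "AE x in unif. \<bar>(T ^^ n) x - (T ^^ n) (base_point k x)\<bar> \<le> C' * \<theta> ^ (k - n)"
        using AE_unif_mem
      proof eventually_elim
        case (elim x)
        have "\<bar>(T ^^ n) x - (T ^^ n) (base_point k x)\<bar> \<le> (1 / \<beta>) ^ (k - n)"
          unfolding iter_base_point[OF elim nk] by (intro diff beta_map.iter_range beta_map.intro beta_gt_1 elim)
        also have "\<dots> \<le> \<theta> ^ (k - n)" using \<theta> beta_pos by (intro power_mono) auto
        also have "\<dots> \<le> C' * \<theta> ^ (k - n)" using \<theta>0 by (simp add: C'_def)
        finally show ?case .
      qed
    qed
    have "0 \<le> C'" by (simp add: C'_def)
    then show "\<exists>r C \<theta>. 0 < \<theta> \<and> \<theta> < 1 \<and> 0 \<le> C \<and> cylinder_points r \<and> cylinder_mixing T parry r C \<theta> \<and>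
      cylinder_size (ln \<beta>) r \<and> cylinder_contraction T r C \<theta>" using p1 p2 p3 p4 \<theta> \<theta>0 by blast
  next
    fix \<epsilon> :: real and D :: "real set" assume \<epsilon>: "0 < \<epsilon>" and D: "finite D"
    obtain Cn where Cn: "0 \<le> Cn" "\<And>n A. A \<in> sets borel \<Longrightarrow> measure unif ((T ^^ n) -` A) \<le> Cn * measure unif A"
      using ex_nonsingular by blast
    \<comment> \<open>At most \<open>card D + 2 + m\<close> points must be kept at a distance; the
      linear growth in \<open>m\<close> is absorbed by \<open>exp (\<epsilon> * m)\<close> at the
      price of \<open>1 / \<epsilon>\<close>.\<close>
    define K where "K = Cn * (2 * (real (card D) + 2 + 1 / \<epsilon>))"
    have K: "0 \<le> K" using Cn \<epsilon> by (simp add: K_def)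
    show "\<exists>K. \<forall>m\<ge>1. \<forall>\<delta>\<ge>0. \<exists>B\<in>sets borel.
      measure unif B \<le> K * (exp ((ln \<beta> + \<epsilon>) * real m) * \<delta> + 1 / sqrt (real m)) \<and>
      (\<forall>x\<in>{0..1} - B. \<forall>y\<in>{0..1}. \<bar>y - x\<bar> \<le> \<delta> \<longrightarrow> closed_segment ((T ^^ m) x) ((T ^^ m) y) \<inter> D = {})"
    proof (intro exI allI impI)
      fix m :: nat and \<delta> :: real assume m: "1 \<le> m" and \<delta>: "0 \<le> \<delta>"
      define P where "P = D \<union> insert 0 (orbit1 ` {..m})"
      define \<eta> where "\<eta> = \<beta> ^ m * \<delta>"
      have \<eta>: "0 \<le> \<eta>" using \<delta> beta_pos by (simp add: \<eta>_def)
      have P: "finite P" using D by (simp add: P_def)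
      have "card P \<le> card D + (1 + card {..m})"
        unfolding P_def by (intro order_trans[OF card_Un_le] add_left_mono order_trans[OF card_insert_le_m1] card_image_le) 
          (auto intro: le_SucI card_image_le order_trans[OF card_insert_le_m1] simp: card_insert_if le_Suc_eq
            intro!: order_trans[OF card_image_le])
      then have cP: "real (card P) \<le> real (card D) + 2 + real m" by simp
      define B where "B = (T ^^ m) -` nbhd P \<eta>"
      have B: "B \<in> sets borel" unfolding B_def using measurable_sets[OF iter_borel nbhd_borel[OF P]] by simp
      have "measure unif B \<le> Cn * measure unif (nbhd P \<eta>)" unfolding B_def by (intro Cn nbhd_borel P)
      also have "\<dots> \<le> Cn * (2 * real (card P) * \<eta>)" by (intro mult_left_mono measure_nbhd_le P \<eta> Cn)
      also have "\<dots> \<le> Cn * (2 * ((real (card D) + 2 + 1 / \<epsilon>) * exp (\<epsilon> * real m)) * \<eta>)"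
      proof (intro mult_left_mono mult_right_mono \<eta> Cn)
        have e1: "1 \<le> exp (\<epsilon> * real m)" using \<epsilon> by simp
        have "\<epsilon> * real m \<le> exp (\<epsilon> * real m)" using exp_ge_add_one_self[of "\<epsilon> * real m"] by linarith
        then have "real m \<le> 1 / \<epsilon> * exp (\<epsilon> * real m)" using \<epsilon> by (simp add: field_simps)
        moreover have "real (card D) + 2 \<le> (real (card D) + 2) * exp (\<epsilon> * real m)"
          using mult_left_mono[OF e1, of "real (card D) + 2"] by simp
        ultimately show "real (card P) \<le> (real (card D) + 2 + 1 / \<epsilon>) * exp (\<epsilon> * real m)"
          using cP unfolding distrib_right by linarith
      qed auto
      also have "\<dots> = K * (exp ((ln \<beta> + \<epsilon>) * real m) * \<delta>)"
      proof -
        have "exp ((ln \<beta> + \<epsilon>) * real m) = \<beta> ^ m * exp (\<epsilon> * real m)"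
          using beta_pos by (simp add: distrib_right exp_add mult.commute[of "ln \<beta>"] exp_of_nat_mult)
        then show ?thesis unfolding K_def \<eta>_def by (simp add: mult_ac)
      qed
      also have "\<dots> \<le> K * (exp ((ln \<beta> + \<epsilon>) * real m) * \<delta> + 1 / sqrt (real m))"
        using K by (intro mult_left_mono) auto
      finally have mB: "measure unif B \<le> K * (exp ((ln \<beta> + \<epsilon>) * real m) * \<delta> + 1 / sqrt (real m))" .
      have seg: "closed_segment ((T ^^ m) x) ((T ^^ m) y) \<inter> D = {}"
        if x: "x \<in> {0..1} - B" and y: "y \<in> {0..1}" and d: "\<bar>y - x\<bar> \<le> \<delta>" for x y
      proof -
        have nx: "(T ^^ m) x \<notin> nbhd P \<eta>" using x by (simp add: B_def)
        have le: "\<beta> ^ m * \<bar>y - x\<bar> \<le> \<eta>" unfolding \<eta>_def using d beta_pos by (intro mult_left_mono) auto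
        have x': "x \<in> {0..1}" using x by blast
        from iter_dist[OF x' y, of m] have "\<bar>(T ^^ m) y - (T ^^ m) x\<bar> \<le> \<eta>"
        proof (elim disjE bexE)
          fix p assume p: "p \<in> insert 0 (orbit1 ` {..m})" "\<bar>(T ^^ m) x - p\<bar> \<le> \<beta> ^ m * \<bar>y - x\<bar>"
          then have "(T ^^ m) x \<in> nbhd P \<eta>" unfolding mem_nbhd P_def using le by force
          with nx show ?thesis by simp
        qed (use le in auto)
        from closed_segment_avoids_far_set[OF nx this] show ?thesis by (auto simp: P_def)
      qed
      show "\<exists>B\<in>sets borel. measure unif B \<le> K * (exp ((ln \<beta> + \<epsilon>) * real m) * \<delta> + 1 / sqrt (real m)) \<and>
        (\<forall>x\<in>{0..1} - B. \<forall>y\<in>{0..1}. \<bar>y - x\<bar> \<le> \<delta> \<longrightarrow> closed_segment ((T ^^ m) x) ((T ^^ m) y) \<inter> D = {})"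
        using B mB seg by blast
    qed
  qed
qed

end

section \<open>The branches of the Gauss map\<close>

text \<open>The substitution \<open>x = 1 / (n + t)\<close> as an identity of measures, verified on
  the rays \<open>{x<..}\<close>, where both sides are explicit by the fundamental theorem.\<close>

lemma gauss_branch_measure:
  fixes n :: nat
  assumes n: "1 \<le> n"
  shows "density lborel (indicator {1 / (real n + 1)..1 / real n}) =
    distr (density unif (\<lambda>t. ennreal (1 / (real n + t)\<^sup>2))) borel (\<lambda>t. 1 / (real n + t))" (is "?M = ?N")
proof (rule measure_eqI_lessThan)
  have n0: "0 < real n" using n by simp
  have M: "emeasure ?M {x<..} = emeasure lborel ({x<..} \<inter> {1 / (real n + 1)..1 / real n})" for x
    by (subst emeasure_density) (auto simp: indicator_inter_arith[symmetric] Int_commute nn_integral_indicator[symmetric] simp del: nn_integral_indicator)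
  have N: "emeasure ?N {x<..} = (\<integral>\<^sup>+t. ennreal (1 / (real n + t)\<^sup>2) * indicator ({0..1} \<inter> {t. x < 1 / (real n + t)}) t \<partial>lborel)" for x
  proof -
    have "emeasure ?N {x<..} = (\<integral>\<^sup>+t. ennreal (1 / (real n + t)\<^sup>2) * indicator ((\<lambda>t. 1 / (real n + t)) -` {x<..}) t \<partial>unif)"
      by (subst emeasure_distr, simp, simp, subst emeasure_density) (auto intro!: measurable_sets_borel[of _ borel])
    also have "\<dots> = (\<integral>\<^sup>+t. indicator {0..1} t * (ennreal (1 / (real n + t)\<^sup>2) * indicator ((\<lambda>t. 1 / (real n + t)) -` {x<..}) t) \<partial>lborel)"
      unfolding unif_def by (subst nn_integral_density) (auto intro!: borel_measurable_times_ennreal borel_measurable_indicator measurable_sets_borel[of _ borel])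
    also have "\<dots> = (\<integral>\<^sup>+t. ennreal (1 / (real n + t)\<^sup>2) * indicator ({0..1} \<inter> {t. x < 1 / (real n + t)}) t \<partial>lborel)"
      by (intro nn_integral_cong) (auto simp: indicator_def)
    finally show ?thesis .
  qed
  have FTC: "(\<integral>\<^sup>+t. ennreal (1 / (real n + t)\<^sup>2) * indicator {0..s} t \<partial>lborel) = ennreal (1 / real n - 1 / (real n + s))" if s: "0 \<le> s" for s
  proof -
    have "(\<integral>\<^sup>+t. ennreal (1 / (real n + t)\<^sup>2) * indicator {0..s} t \<partial>lborel) = ennreal (- 1 / (real n + s) - - 1 / (real n + 0))"
    proof (rule nn_integral_FTC_Icc)
      show "((\<lambda>t. - 1 / (real n + t)) has_real_derivative 1 / (real n + t)\<^sup>2) (at t)" if "t \<in> {0..s}" for t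
        using that n0 by (auto intro!: derivative_eq_intros simp: power2_eq_square)
    qed (use s n0 in auto)
    then show ?thesis by (simp add: algebra_simps)
  qed
  fix x :: real
  have le: "1 / (real n + 1) \<le> 1 / real n" using n0 by (simp add: divide_left_mono)
  show "emeasure ?M {x<..} < \<infinity>"
    unfolding M by (rule le_less_trans[OF emeasure_mono[of _ "{1 / (real n + 1)..1 / real n}"]]) (use le in auto)
  consider "x < 1 / (real n + 1)" | "1 / (real n + 1) \<le> x" "x < 1 / real n" | "1 / real n \<le> x" by linarith
  then show "emeasure ?M {x<..} = emeasure ?N {x<..}"
  proof cases
    case 1
    have "x < 1 / (real n + t)" if "t \<in> {0..1}" for t
    proof -
      have "1 / (real n + 1) \<le> 1 / (real n + t)" using that n0 by (intro divide_left_mono) auto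
      with 1 show ?thesis by linarith
    qed
    then have "{0..1} \<inter> {t. x < 1 / (real n + t)} = {0..1}" by auto
    moreover have "{x<..} \<inter> {1 / (real n + 1)..1 / real n} = {1 / (real n + 1)..1 / real n}" using 1 by auto
    ultimately show ?thesis unfolding M N using FTC[of 1] le by simp
  next
    case 2
    define s where "s = 1 / x - real n"
    have x0: "0 < x" using 2(1) n0 by (meson divide_pos_pos add_pos_pos less_le_trans zero_less_one)
    have s: "0 < s" "s \<le> 1" using 2 x0 n0 by (auto simp: s_def field_simps)
    have xs: "1 / (real n + s) = x" using x0 by (simp add: s_def)
    have "{0..1} \<inter> {t. x < 1 / (real n + t)} = {0..<s}"
    proof (intro set_eqI iffI)
      fix t assume t: "t \<in> {0..1} \<inter> {t. x < 1 / (real n + t)}"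
      moreover have "0 < real n + t" using t n0 by auto
      ultimately have "x * (real n + t) < 1" by (simp add: pos_less_divide_eq)
      then show "t \<in> {0..<s}" using t x0 by (simp add: s_def field_simps)
    next
      fix t assume t: "t \<in> {0..<s}"
      then have "x * (real n + t) < 1" using x0 by (simp add: s_def field_simps)
      then show "t \<in> {0..1} \<inter> {t. x < 1 / (real n + t)}" using t s n0 by (simp add: pos_less_divide_eq)
    qed
    then have "emeasure ?N {x<..} = (\<integral>\<^sup>+t. ennreal (1 / (real n + t)\<^sup>2) * indicator {0..<s} t \<partial>lborel)" using N by simp
    also have "\<dots> = (\<integral>\<^sup>+t. ennreal (1 / (real n + t)\<^sup>2) * indicator {0..s} t \<partial>lborel)"
      using AE_lborel_singleton[of s] by (intro nn_integral_cong_AE) (auto elim!: eventually_mono simp: indicator_def)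
    also have "\<dots> = ennreal (1 / real n - x)" using FTC[of s] s xs by simp
    also have "\<dots> = emeasure lborel {x<..1 / real n}" using 2 by simp
    also have "{x<..1 / real n} = {x<..} \<inter> {1 / (real n + 1)..1 / real n}" using 2 by auto
    finally show ?thesis unfolding M by simp
  next
    case 3
    have "\<not> x < 1 / (real n + t)" if "t \<in> {0..1}" for t
    proof -
      have "1 / (real n + t) \<le> 1 / real n" using that n0 by (intro divide_left_mono) auto
      with 3 show ?thesis by linarith
    qed
    then have "{0..1} \<inter> {t. x < 1 / (real n + t)} = {}" by auto
    moreover have "{x<..} \<inter> {1 / (real n + 1)..1 / real n} = {}" using 3 by auto
    ultimately show ?thesis unfolding M N by simp
  qed
qed auto

lemma gauss_branch_integral:
  fixes F :: "real \<Rightarrow> 'a::{banach, second_countable_topology}"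
  assumes F[measurable]: "F \<in> borel_measurable borel" and n: "1 \<le> n"
  shows "(\<integral>x. indicator {1 / (real n + 1)<..1 / real n} x *\<^sub>R F x \<partial>lborel) =
    (\<integral>t. (1 / (real n + t)\<^sup>2) *\<^sub>R F (1 / (real n + t)) \<partial>unif)"
proof -
  have "(\<integral>x. indicator {1 / (real n + 1)<..1 / real n} x *\<^sub>R F x \<partial>lborel) = (\<integral>x. indicator {1 / (real n + 1)..1 / real n} x *\<^sub>R F x \<partial>lborel)"
    using AE_lborel_singleton[of "1 / (real n + 1)"] by (intro integral_cong_AE) (auto elim!: eventually_mono simp: indicator_def)
  also have "\<dots> = (\<integral>x. F x \<partial>density lborel (indicator {1 / (real n + 1)..1 / real n}))"
  proof -
    have eq: "density lborel (indicator {1 / (real n + 1)..1 / real n}) = density lborel (\<lambda>x. ennreal (indicator {1 / (real n + 1)..1 / real n} x))"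
      by (simp add: ennreal_indicator)
    show ?thesis unfolding eq by (subst integral_density) auto
  qed
  also have "\<dots> = (\<integral>x. F x \<partial>distr (density unif (\<lambda>t. ennreal (1 / (real n + t)\<^sup>2))) borel (\<lambda>t. 1 / (real n + t)))"
    unfolding gauss_branch_measure[OF n] ..
  also have "\<dots> = (\<integral>t. F (1 / (real n + t)) \<partial>density unif (\<lambda>t. ennreal (1 / (real n + t)\<^sup>2)))"
    by (subst integral_distr) auto
  also have "\<dots> = (\<integral>t. (1 / (real n + t)\<^sup>2) *\<^sub>R F (1 / (real n + t)) \<partial>unif)"
    by (subst integral_density) auto
  finally show ?thesis .
qed

lemma ex_gauss_interval:
  assumes x: "0 < x" "x \<le> (1::real)"
  shows "\<exists>a::nat. 1 / (real (Suc a) + 1) < x \<and> x \<le> 1 / real (Suc a)"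
proof -
  define a where "a = nat \<lfloor>1 / x\<rfloor> - 1"
  have "1 \<le> 1 / x" using x by simp
  then have f: "1 \<le> \<lfloor>1 / x\<rfloor>" by simp
  then have "int (Suc a) = \<lfloor>1 / x\<rfloor>" using x by (simp add: a_def)
  then have Sa: "real (Suc a) = of_int \<lfloor>1 / x\<rfloor>" by (metis of_int_of_nat_eq)
  have "real (Suc a) \<le> 1 / x" "1 / x < real (Suc a) + 1" unfolding Sa by linarith+
  then show ?thesis using x by (intro exI[of _ a]) (auto simp: field_simps)
qed

lemma gauss_branch_sums:
  fixes F :: "real \<Rightarrow> 'a::{banach, second_countable_topology}"
  assumes F[measurable]: "F \<in> borel_measurable borel" and i: "integrable unif F"
  shows "(\<lambda>a. \<integral>t. (1 / (real (Suc a) + t)\<^sup>2) *\<^sub>R F (1 / (real (Suc a) + t)) \<partial>unif) sums (\<integral>x. F x \<partial>unif)"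
proof -
  define A where "A a = {1 / (real (Suc a) + 1)<..1 / real (Suc a)}" for a
  have A[measurable]: "A a \<in> sets lborel" for a by (simp add: A_def)
  have disj: "A a \<inter> A b = {}" if "a < b" for a b
  proof -
    have "1 / real (Suc b) \<le> 1 / (real (Suc a) + 1)" using that by (intro divide_left_mono) auto
    then show ?thesis by (auto simp: A_def)
  qed
  then have disj': "A a \<inter> A b = {}" if "a \<noteq> b" for a b using that by (metis Int_commute nat_neq_iff)
  have U: "(\<Union>a. A a) = {0<..1}"
  proof (intro set_eqI iffI)
    fix x assume "x \<in> (\<Union>a. A a)"
    then obtain a where a: "1 / (real (Suc a) + 1) < x" "x \<le> 1 / real (Suc a)" by (auto simp: A_def)
    have "0 < 1 / (real (Suc a) + 1)" "1 / real (Suc a) \<le> 1" by auto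
    then show "x \<in> {0<..1}" using a by (simp only: greaterThanAtMost_iff) linarith
  next
    fix x :: real assume "x \<in> {0<..1}"
    then show "x \<in> (\<Union>a. A a)" using ex_gauss_interval[of x] unfolding A_def by (auto simp del: of_nat_Suc)
  qed
  have ae: "AE x in lborel. indicator {0<..1} x *\<^sub>R F x = indicator {0..1} x *\<^sub>R F x"
    using AE_lborel_singleton[of 0] by eventually_elim (auto simp: indicator_def)
  have si: "set_integrable lborel (\<Union>a. A a) F"
    unfolding U set_integrable_def using i ae by (subst integrable_cong_AE[OF _ _ ae]) (auto simp: integrable_unif_iff)
  have int: "integrable lborel (\<lambda>x. indicator (A a) x *\<^sub>R F x)" for a
    unfolding set_integrable_def[symmetric] by (rule set_integrable_subset[OF si A]) auto
  have "(\<lambda>a. \<integral>x. indicator (A a) x *\<^sub>R F x \<partial>lborel) sums (\<integral>x. (\<Sum>a. indicator (A a) x *\<^sub>R F x) \<partial>lborel)"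
  proof (rule sums_integral[OF int])
    show "AE x in lborel. summable (\<lambda>a. norm (indicator (A a) x *\<^sub>R F x))"
    proof (rule AE_I2)
      fix x
      have "(\<lambda>a. indicator (A a) x * norm (F x)) sums (indicator (\<Union>a. A a) x * norm (F x))"
        by (intro sums_mult2 indicator_sums disj')
      then show "summable (\<lambda>a. norm (indicator (A a) x *\<^sub>R F x))" by (simp add: sums_iff)
    qed
    show "summable (\<lambda>a. \<integral>x. norm (indicator (A a) x *\<^sub>R F x) \<partial>lborel)"
    proof (rule summableI_nonneg_bounded)
      fix N
      have "(\<Sum>a<N. \<integral>x. norm (indicator (A a) x *\<^sub>R F x) \<partial>lborel) = (\<integral>x. (\<Sum>a<N. norm (indicator (A a) x *\<^sub>R F x)) \<partial>lborel)"
        by (intro Bochner_Integration.integral_sum[symmetric] integrable_norm int)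
      also have "\<dots> \<le> (\<integral>x. norm (indicator (\<Union>a. A a) x *\<^sub>R F x) \<partial>lborel)"
      proof (rule integral_mono)
        show "integrable lborel (\<lambda>x. norm (indicator (\<Union>a. A a) x *\<^sub>R F x))"
          using si unfolding set_integrable_def by (rule integrable_norm)
        show "(\<Sum>a<N. norm (indicator (A a) x *\<^sub>R F x)) \<le> norm (indicator (\<Union>a. A a) x *\<^sub>R F x)" for x
        proof -
          have s: "(\<lambda>a. indicator (A a) x * norm (F x)) sums (indicator (\<Union>a. A a) x * norm (F x))"
            by (intro sums_mult2 indicator_sums disj')
          have "(\<Sum>a<N. indicator (A a) x * norm (F x)) \<le> indicator (\<Union>a. A a) x * norm (F x)"
            using sum_le_suminf[of "\<lambda>a. indicator (A a) x * norm (F x)" "{..<N}"] s by (auto simp: sums_iff)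
          then show ?thesis by simp
        qed
      qed (intro Bochner_Integration.integrable_sum integrable_norm int)
      finally show "(\<Sum>a<N. \<integral>x. norm (indicator (A a) x *\<^sub>R F x) \<partial>lborel) \<le> (\<integral>x. norm (indicator (\<Union>a. A a) x *\<^sub>R F x) \<partial>lborel)" .
    qed auto
  qed
  moreover have "(\<Sum>a. indicator (A a) x *\<^sub>R F x) = indicator {0<..1} x *\<^sub>R F x" for x
  proof -
    have "(\<lambda>a. indicator (A a) x *\<^sub>R F x) sums (indicator (\<Union>a. A a) x *\<^sub>R F x)"
      by (intro sums_scaleR_left indicator_sums disj')
    then show ?thesis by (simp add: sums_iff U)
  qed
  moreover have "(\<integral>x. indicator {0<..1} x *\<^sub>R F x \<partial>lborel) = (\<integral>x. F x \<partial>unif)"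
    unfolding integral_unif[OF F] by (intro integral_cong_AE ae) auto
  moreover have "(\<integral>x. indicator (A a) x *\<^sub>R F x \<partial>lborel) = (\<integral>t. (1 / (real (Suc a) + t)\<^sup>2) *\<^sub>R F (1 / (real (Suc a) + t)) \<partial>unif)" for a
    unfolding A_def by (rule gauss_branch_integral) auto
  ultimately show ?thesis by simp
qed

lemma gauss_map_borel [measurable]: "gauss_map \<in> borel_measurable borel"
  unfolding gauss_map_def[abs_def] frac_def by measurable

lemma gauss_iter_borel [measurable]: "(gauss_map ^^ n) \<in> borel_measurable borel"
  by (induction n) (auto intro: measurable_comp)

lemma gauss_map_range: "0 \<le> gauss_map x" "gauss_map x < 1"
  unfolding gauss_map_def by (auto simp: frac_lt_1)

lemma gauss_iter_range: "x \<in> {0..1} \<Longrightarrow> (gauss_map ^^ n) x \<in> {0..1}"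
  by (cases n) (use gauss_map_range less_imp_le in auto)

lemma gauss_map_branch:
  assumes "1 \<le> n" "0 \<le> t" "t < 1"
  shows "gauss_map (1 / (real n + t)) = t" "\<lfloor>1 / (1 / (real n + t))\<rfloor> = int n"
  using assms by (auto simp: gauss_map_def frac_unique_iff floor_eq_iff)

section \<open>The Gauss measure and its transfer operator\<close>

definition gauss_density :: "real \<Rightarrow> real" where
  "gauss_density x = 1 / ln 2 * (1 / (1 + x))"

lemma gauss_density_borel [measurable]: "gauss_density \<in> borel_measurable borel"
  unfolding gauss_density_def[abs_def] by measurable

lemma gauss_density_bounds:
  assumes "x \<in> {0..1}"
  shows "1 / 2 \<le> gauss_density x" "gauss_density x \<le> 2"
proof -
  have l: "0 < ln (2::real)" "ln 2 \<le> (1::real)" "1 / 2 \<le> ln (2::real)"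
    using ln2_le_25_over_36 ln2_ge_two_thirds by auto
  have "1 * (1 / 2) \<le> 1 / ln 2 * (1 / (1 + x))"
    using assms l by (intro mult_mono) (auto simp: field_simps)
  then show "1 / 2 \<le> gauss_density x" by (simp add: gauss_density_def)
  have "1 / ln 2 * (1 / (1 + x)) \<le> 2 * 1"
    using assms l by (intro mult_mono) (auto simp: field_simps)
  then show "gauss_density x \<le> 2" by (simp add: gauss_density_def)
qed

lemma gauss_density_integral: "(\<integral>x. gauss_density x \<partial>unif) = 1"
proof -
  have "(\<integral>x. gauss_density x \<partial>unif) = (\<integral>x. gauss_density x * indicator {0..1} x \<partial>lborel)"
    by (subst integral_unif) (auto simp: mult.commute)
  also have "\<dots> = ln (1 + 1) / ln 2 - ln (1 + 0) / ln 2"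
  proof (rule integral_FTC_Icc_real)
    fix x :: real assume x: "0 \<le> x" "x \<le> 1"
    show "((\<lambda>x. ln (1 + x) / ln 2) has_real_derivative gauss_density x) (at x)"
      using x by (auto intro!: derivative_eq_intros simp: gauss_density_def)
    show "isCont gauss_density x" unfolding gauss_density_def[abs_def] using x by (intro continuous_intros) auto
  qed simp
  finally show ?thesis by simp
qed

text \<open>Equal to \<open>gauss_density (1 / (n + s)) / ((n + s)\<^sup>2 * gauss_density
  s)\<close>: the weights of the transfer operator normalised by the Gauss density. They telescope,
  hence sum to 1.\<close>

definition gauss_weight :: "nat \<Rightarrow> real \<Rightarrow> real" where
  "gauss_weight n s = (1 + s) / ((real n + s) * (real n + s + 1))"

lemma gauss_weight_borel [measurable]: "gauss_weight n \<in> borel_measurable borel"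
  unfolding gauss_weight_def[abs_def] by measurable

lemma gauss_weight_pos: "1 \<le> n \<Longrightarrow> 0 \<le> s \<Longrightarrow> 0 < gauss_weight n s"
  unfolding gauss_weight_def by (auto intro!: divide_pos_pos mult_pos_pos)

lemma gauss_weight_diff: "0 \<le> s \<Longrightarrow> gauss_weight (Suc a) s = (1 + s) * (1 / (real a + 1 + s)) - (1 + s) * (1 / (real (Suc a) + 1 + s))"
  unfolding gauss_weight_def by (simp add: field_simps)

lemma gauss_weight_partial:
  assumes "0 \<le> s" shows "(\<Sum>a<N. gauss_weight (Suc a) s) = real N / (real N + 1 + s)"
proof -
  have "(\<Sum>a<N. gauss_weight (Suc a) s) = 1 - (1 + s) * (1 / (real N + 1 + s))"
    using assms by (induction N) (auto simp: gauss_weight_diff)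
  also have "\<dots> = real N / (real N + 1 + s)" using assms by (simp add: field_simps)
  finally show ?thesis .
qed

lemma gauss_weight_sums: "0 \<le> s \<Longrightarrow> (\<lambda>a. gauss_weight (Suc a) s) sums 1"
  unfolding sums_def gauss_weight_partial by real_asymp

lemma gauss_weight_le:
  assumes "s \<in> {0..1}" shows "gauss_weight (Suc a) s \<le> 2 / (real a + 1)\<^sup>2"
proof -
  have "(real a + 1)\<^sup>2 \<le> (real (Suc a) + s) * (real (Suc a) + s + 1)"
    unfolding power2_eq_square using assms by (intro mult_mono) auto
  then show ?thesis unfolding gauss_weight_def using assms by (intro frac_le) auto
qed

lemma summable_inverse_Suc_sq: "summable (\<lambda>a. K * (2 / (real a + 1)\<^sup>2))"
  using summable_mult[OF sums_summable[OF inverse_squares_sums], of "2 * K"]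
  by (simp add: add.commute mult.commute)

definition gauss_transfer :: "(real \<Rightarrow> real) \<Rightarrow> real \<Rightarrow> real" where
  "gauss_transfer f s = (\<Sum>a. gauss_weight (Suc a) s * f (1 / (real (Suc a) + s)))"

lemma gauss_transfer_borel [measurable]:
  assumes [measurable]: "f \<in> borel_measurable borel"
  shows "gauss_transfer f \<in> borel_measurable borel"
  unfolding gauss_transfer_def[abs_def] by measurable

lemma branch_mem: "s \<in> {0..1} \<Longrightarrow> 1 / (real (Suc a) + s) \<in> {0..1}"
  by (auto simp: field_simps)

lemma gauss_transfer_summable:
  assumes "\<And>x. x \<in> {0..1} \<Longrightarrow> \<bar>f x\<bar> \<le> A" "s \<in> {0..1}"
  shows "summable (\<lambda>a. gauss_weight (Suc a) s * f (1 / (real (Suc a) + s)))"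
proof (rule summable_comparison_test')
  show "summable (\<lambda>a. gauss_weight (Suc a) s * A)"
    using gauss_weight_sums[of s] assms(2) by (intro summable_mult2) (auto simp: sums_iff)
  show "norm (gauss_weight (Suc a) s * f (1 / (real (Suc a) + s))) \<le> gauss_weight (Suc a) s * A" for a
    unfolding real_norm_def abs_mult using gauss_weight_pos[of "Suc a" s] assms branch_mem
    by (intro mult_mono) auto
qed

lemma gauss_transfer_uminus:
  assumes "\<And>x. x \<in> {0..1} \<Longrightarrow> \<bar>f x\<bar> \<le> A" "s \<in> {0..1}"
  shows "gauss_transfer (\<lambda>x. - f x) s = - gauss_transfer f s"
  unfolding gauss_transfer_def using suminf_minus[OF gauss_transfer_summable[OF assms]] by simp

lemma gauss_transfer_duality:
  fixes g :: "real \<Rightarrow> 'a::{banach, second_countable_topology}"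
  assumes f[measurable]: "f \<in> borel_measurable borel" and fb: "\<And>x. x \<in> {0..1} \<Longrightarrow> \<bar>f x\<bar> \<le> A"
    and g[measurable]: "g \<in> borel_measurable borel" and gb: "\<And>x. x \<in> {0..1} \<Longrightarrow> norm (g x) \<le> B"
  shows "(\<integral>x. (gauss_density x * f x) *\<^sub>R g (gauss_map x) \<partial>unif) = (\<integral>x. (gauss_density x * gauss_transfer f x) *\<^sub>R g x \<partial>unif)"
proof -
  let ?F = "\<lambda>x. (gauss_density x * f x) *\<^sub>R g (gauss_map x)"
  let ?t = "\<lambda>a t. (gauss_density t * (gauss_weight (Suc a) t * f (1 / (real (Suc a) + t)))) *\<^sub>R g t"
  have ne1: "AE x in unif. x \<noteq> 1" using AE_unif_countable[of "{1::real}"] by simp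
  have A: "0 \<le> A" using fb[of 0] by auto
  have B: "0 \<le> B" using gb[of 0] norm_ge_zero[of "g 0"] by (simp del: norm_ge_zero)
  have iF: "integrable unif ?F"
  proof (rule integrable_unif_bounded[where C="2 * A * B"])
    show "norm (?F x) \<le> 2 * A * B" if x: "x \<in> {0..1}" for x
    proof -
      have "\<bar>gauss_density x\<bar> \<le> 2" using gauss_density_bounds[OF x] by simp
      moreover have "gauss_map x \<in> {0..1}" using gauss_map_range[of x] by simp
      ultimately show ?thesis unfolding norm_scaleR abs_mult using fb[OF x] gb A B
        by (intro mult_mono) auto
    qed
  qed measurable
  have "(\<integral>t. (1 / (real (Suc a) + t)\<^sup>2) *\<^sub>R ?F (1 / (real (Suc a) + t)) \<partial>unif) = (\<integral>t. ?t a t \<partial>unif)" for a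
  proof (rule integral_cong_AE)
    show "AE t in unif. (1 / (real (Suc a) + t)\<^sup>2) *\<^sub>R ?F (1 / (real (Suc a) + t)) = ?t a t"
      using AE_unif_mem ne1
    proof eventually_elim
      case (elim t)
      have t: "0 \<le> t" "t < 1" using elim by auto
      have "1 / (real (Suc a) + t)\<^sup>2 * gauss_density (1 / (real (Suc a) + t)) = gauss_density t * gauss_weight (Suc a) t"
        using t unfolding gauss_density_def gauss_weight_def by (simp add: power2_eq_square divide_simps)
      then have "1 / (real (Suc a) + t)\<^sup>2 * (gauss_density (1 / (real (Suc a) + t)) * f (1 / (real (Suc a) + t))) = gauss_density t * (gauss_weight (Suc a) t * f (1 / (real (Suc a) + t)))"
        by (simp only: mult.assoc[symmetric])
      moreover have "gauss_map (1 / (real (Suc a) + t)) = t" using gauss_map_branch(1)[of "Suc a" t] t by simp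
      ultimately show ?case by (simp only: scaleR_scaleR of_nat_Suc add.commute[of 1])
    qed
  qed measurable
  moreover have "(\<lambda>a. \<integral>t. ?t a t \<partial>unif) sums (\<integral>t. (\<Sum>a. ?t a t) \<partial>unif)"
  proof -
    have tb: "norm (?t a t) \<le> (2 * A * B) * (2 / (real a + 1)\<^sup>2)" if t: "t \<in> {0..1}" for a t
    proof -
      have "\<bar>gauss_density t\<bar> \<le> 2" using gauss_density_bounds[OF t] by simp
      moreover have "\<bar>gauss_weight (Suc a) t\<bar> \<le> 2 / (real a + 1)\<^sup>2"
        using gauss_weight_le[OF t, of a] gauss_weight_pos[of "Suc a" t] t by simp
      ultimately have "norm (?t a t) \<le> (2 * (2 / (real a + 1)\<^sup>2 * A)) * B"
        unfolding norm_scaleR abs_mult using fb[OF branch_mem[OF t]] gb[OF t] A B by (intro mult_mono) auto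
      then show ?thesis by (simp add: mult_ac)
    qed
    have it: "integrable unif (?t a)" for a
      using tb by (intro integrable_unif_bounded[where C="(2 * A * B) * (2 / (real a + 1)\<^sup>2)"]) auto
    show ?thesis
    proof (rule sums_integral[OF it])
      show "AE t in unif. summable (\<lambda>a. norm (?t a t))"
        using AE_unif_mem
      proof eventually_elim
        case (elim t)
        show ?case
        proof (rule summable_comparison_test'[OF summable_inverse_Suc_sq])
          show "norm (norm (?t a t)) \<le> (2 * A * B) * (2 / (real a + 1)\<^sup>2)" for a
            using tb[OF elim] unfolding real_norm_def abs_norm_cancel .
        qed
      qed
      show "summable (\<lambda>a. \<integral>t. norm (?t a t) \<partial>unif)"
      proof (rule summable_comparison_test'[OF summable_inverse_Suc_sq])
        fix a
        show "norm (\<integral>t. norm (?t a t) \<partial>unif) \<le> (2 * A * B) * (2 / (real a + 1)\<^sup>2)"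
          using tb[of _ a] by (intro norm_integral_unif_le) auto
      qed
    qed
  qed
  ultimately have "(\<integral>x. ?F x \<partial>unif) = (\<integral>t. (\<Sum>a. ?t a t) \<partial>unif)"
    using gauss_branch_sums[OF _ iF] sums_unique2 by (simp add: del: of_nat_Suc) 
  also have "\<dots> = (\<integral>x. (gauss_density x * gauss_transfer f x) *\<^sub>R g x \<partial>unif)"
  proof (rule integral_cong_AE)
    show "AE t in unif. (\<Sum>a. ?t a t) = (gauss_density t * gauss_transfer f t) *\<^sub>R g t"
      using AE_unif_mem
    proof eventually_elim
      case (elim t)
      have s: "summable (\<lambda>a. gauss_weight (Suc a) t * f (1 / (real (Suc a) + t)))"
        using gauss_transfer_summable[of f A t] fb elim by blast
      show ?case unfolding gauss_transfer_def
        using suminf_scaleR_left[OF summable_mult[OF s, where c="gauss_density t"], where x="g t"] suminf_mult[OF s, where c="gauss_density t"] by simp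
    qed
  qed measurable
  finally show ?thesis .
qed

lemma gauss_transfer_1: "s \<in> {0..1} \<Longrightarrow> gauss_transfer (\<lambda>_. 1) s = 1"
  using gauss_weight_sums[of s] unfolding gauss_transfer_def by (simp add: sums_iff)

lemma gauss_density_invariant:
  fixes g :: "real \<Rightarrow> 'a::{banach, second_countable_topology}"
  assumes g[measurable]: "g \<in> borel_measurable borel" and gb: "\<And>x. x \<in> {0..1} \<Longrightarrow> norm (g x) \<le> B"
  shows "(\<integral>x. gauss_density x *\<^sub>R g (gauss_map x) \<partial>unif) = (\<integral>x. gauss_density x *\<^sub>R g x \<partial>unif)"
proof -
  have "(\<integral>x. gauss_density x *\<^sub>R g (gauss_map x) \<partial>unif) = (\<integral>x. (gauss_density x * gauss_transfer (\<lambda>_. 1) x) *\<^sub>R g x \<partial>unif)"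
    using gauss_transfer_duality[of "\<lambda>_. 1" 1 g B] gb by simp
  also have "\<dots> = (\<integral>x. gauss_density x *\<^sub>R g x \<partial>unif)"
  proof (rule integral_cong_AE)
    show "AE x in unif. (gauss_density x * gauss_transfer (\<lambda>_. 1) x) *\<^sub>R g x = gauss_density x *\<^sub>R g x"
      by (rule eventually_mono[OF AE_unif_mem]) (simp only: gauss_transfer_1 mult_1_right)
  qed measurable
  finally show ?thesis .
qed

subsection \<open>The transfer operator halves the oscillation of monotone functions\<close>

lemma sum_by_parts_nonneg:
  fixes d c :: "nat \<Rightarrow> real"
  assumes "\<And>n. 0 \<le> (\<Sum>a<n. d a)" "\<And>a. c (Suc a) \<le> c a"
  shows "c N * (\<Sum>a<Suc N. d a) \<le> (\<Sum>a<Suc N. d a * c a)"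
proof (induction N)
  case (Suc N)
  have "c (Suc N) * (\<Sum>a<Suc (Suc N). d a) = c (Suc N) * (\<Sum>a<Suc N. d a) + d (Suc N) * c (Suc N)" by (simp add: algebra_simps)
  also have "c (Suc N) * (\<Sum>a<Suc N. d a) \<le> c N * (\<Sum>a<Suc N. d a)" by (intro mult_right_mono assms)
  finally show ?case using Suc by simp
qed simp

text \<open>Two effects act in the same direction when \<open>f\<close> increases: a larger
  \<open>s\<close> moves every branch point down, and it shifts weight to larger digits, since the
  partial sums of the weights decrease in \<open>s\<close>. The second is exploited by Abel
  summation against the decreasing values \<open>c\<close>, made nonnegative by subtracting
  \<open>f 0\<close>.\<close>

lemma gauss_transfer_antimono:
  assumes m: "mono_on {0..1} f" and s: "s \<in> {0..1}" "s' \<in> {0..1}" "s \<le> s'"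
  shows "gauss_transfer f s' \<le> gauss_transfer f s"
proof -
  have fb: "\<bar>f x\<bar> \<le> \<bar>f 0\<bar> + \<bar>f 1\<bar>" if "x \<in> {0..1}" for x
    using mono_onD[OF m, of 0 x] mono_onD[OF m, of x 1] that by auto
  define c where "c a = f (1 / (real (Suc a) + s)) - f 0" for a
  define d where "d a = gauss_weight (Suc a) s - gauss_weight (Suc a) s'" for a
  have c0: "0 \<le> c a" for a unfolding c_def using branch_mem[OF s(1), of a] mono_onD[OF m, of 0] by simp
  have cd: "c (Suc a) \<le> c a" for a
    unfolding c_def using branch_mem[OF s(1)] s by (intro diff_right_mono mono_onD[OF m] divide_left_mono) auto
  have D: "0 \<le> (\<Sum>a<n. d a)" for n
  proof -
    have "(\<Sum>a<n. d a) = real n / (real n + 1 + s) - real n / (real n + 1 + s')"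
      using s by (simp add: d_def sum_subtractf gauss_weight_partial)
    moreover have "real n / (real n + 1 + s') \<le> real n / (real n + 1 + s)" using s by (intro divide_left_mono) auto
    ultimately show ?thesis by simp
  qed
  have S: "summable (\<lambda>a. gauss_weight (Suc a) u * f (1 / (real (Suc a) + u')))" if "u \<in> {0..1}" "u' \<in> {0..1}" for u u'
  proof (rule summable_comparison_test')
    show "summable (\<lambda>a. gauss_weight (Suc a) u * (\<bar>f 0\<bar> + \<bar>f 1\<bar>))"
      using gauss_weight_sums[of u] that by (intro summable_mult2) (auto simp: sums_iff)
    show "norm (gauss_weight (Suc a) u * f (1 / (real (Suc a) + u'))) \<le> gauss_weight (Suc a) u * (\<bar>f 0\<bar> + \<bar>f 1\<bar>)" for a
      unfolding real_norm_def abs_mult using gauss_weight_pos[of "Suc a" u] fb[OF branch_mem[OF that(2)]] that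
      by (intro mult_mono) auto
  qed
  have W: "summable (\<lambda>a. gauss_weight (Suc a) u)" "(\<Sum>a. gauss_weight (Suc a) u) = 1" if "u \<in> {0..1}" for u
    using gauss_weight_sums[of u] that by (auto simp: sums_iff)
  have "gauss_transfer f s' \<le> (\<Sum>a. gauss_weight (Suc a) s' * f (1 / (real (Suc a) + s)))"
    unfolding gauss_transfer_def
  proof (rule suminf_le[OF _ S S])
    show "gauss_weight (Suc a) s' * f (1 / (real (Suc a) + s')) \<le> gauss_weight (Suc a) s' * f (1 / (real (Suc a) + s))" for a
      using s branch_mem gauss_weight_pos[of "Suc a" s']
      by (intro mult_left_mono mono_onD[OF m] divide_left_mono) auto
  qed (use s in auto)
  moreover have "(\<Sum>a. gauss_weight (Suc a) s' * f (1 / (real (Suc a) + s))) - f 0 \<le> gauss_transfer f s - f 0"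
  proof (rule LIMSEQ_le)
    have lim: "(\<lambda>n. \<Sum>a<n. gauss_weight (Suc a) u * c a) \<longlonglongrightarrow> (\<Sum>a. gauss_weight (Suc a) u * f (1 / (real (Suc a) + s))) - f 0"
      if u: "u \<in> {0..1}" for u
    proof -
      have "(\<lambda>a. gauss_weight (Suc a) u * f (1 / (real (Suc a) + s)) - gauss_weight (Suc a) u * f 0) sums
        ((\<Sum>a. gauss_weight (Suc a) u * f (1 / (real (Suc a) + s))) - 1 * f 0)"
        using summable_sums[OF S[OF u s(1)]] gauss_weight_sums[of u] u by (intro sums_diff sums_mult2) auto
      then show ?thesis unfolding sums_def c_def right_diff_distrib by simp
    qed
    show "(\<lambda>n. \<Sum>a<n. gauss_weight (Suc a) s' * c a) \<longlonglongrightarrow> (\<Sum>a. gauss_weight (Suc a) s' * f (1 / (real (Suc a) + s))) - f 0"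
      by (rule lim[OF s(2)])
    show "(\<lambda>n. \<Sum>a<n. gauss_weight (Suc a) s * c a) \<longlonglongrightarrow> gauss_transfer f s - f 0"
      unfolding gauss_transfer_def by (rule lim[OF s(1)])
    have "(\<Sum>a<n. gauss_weight (Suc a) s' * c a) \<le> (\<Sum>a<n. gauss_weight (Suc a) s * c a)" for n
    proof (cases n)
      case (Suc N)
      have "0 \<le> c N * (\<Sum>a<Suc N. d a)" using c0 D by (intro mult_nonneg_nonneg)
      also have "\<dots> \<le> (\<Sum>a<Suc N. d a * c a)" by (rule sum_by_parts_nonneg[of d c N, OF D cd])
      finally show ?thesis unfolding Suc d_def left_diff_distrib sum_subtractf by simp
    qed simp
    then show "\<exists>N. \<forall>n\<ge>N. (\<Sum>a<n. gauss_weight (Suc a) s' * c a) \<le> (\<Sum>a<n. gauss_weight (Suc a) s * c a)" by blast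
  qed
  ultimately show ?thesis by linarith
qed

text \<open>Digit \<open>n\<close> at \<open>s = 1\<close> and digit \<open>n + 1\<close> at
  \<open>s = 0\<close> have the same branch point, and their weights differ by the factor 2. Both
  values are thus expressed by one sum, which is at least \<open>f 0 / 2\<close>; the remaining
  digit 1 at \<open>s = 0\<close> has weight 1/2. This is the origin of the rate 1/2.\<close>

lemma gauss_transfer_oscillation:
  assumes m: "mono_on {0..1} f"
  shows "gauss_transfer f 0 - gauss_transfer f 1 \<le> (f 1 - f 0) / 2"
proof -
  have fb: "\<bar>f x\<bar> \<le> \<bar>f 0\<bar> + \<bar>f 1\<bar>" if "x \<in> {0..1}" for x
    using mono_onD[OF m, of 0 x] mono_onD[OF m, of x 1] that by auto
  define u where "u a = gauss_weight (Suc (Suc a)) 0 * f (1 / (real a + 2))" for a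
  have s0: "summable (\<lambda>a. gauss_weight (Suc a) 0 * f (1 / (real (Suc a) + 0)))"
    using gauss_transfer_summable[OF fb, where s=0] by simp
  have us: "summable u"
    using summable_ignore_initial_segment[OF s0, of 1] by (simp add: u_def[abs_def] add.commute)
  have T0: "gauss_transfer f 0 = f 1 / 2 + (\<Sum>a. u a)"
    unfolding gauss_transfer_def using suminf_split_head[OF s0] by (simp add: u_def gauss_weight_def add.commute)
  have "gauss_weight (Suc a) 1 * f (1 / (real (Suc a) + 1)) = 2 * u a" for a
    by (simp add: u_def gauss_weight_def add.commute)
  then have T1: "gauss_transfer f 1 = 2 * (\<Sum>a. u a)"
    unfolding gauss_transfer_def using suminf_mult[OF us, of 2] by simp
  have ws: "(\<lambda>a. gauss_weight (Suc (Suc a)) 0) sums (1 - gauss_weight 1 0)"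
    using gauss_weight_sums[of 0] sums_Suc_iff[of "\<lambda>a. gauss_weight (Suc a) 0" "1 - gauss_weight 1 0"] by simp
  have "(\<Sum>a. gauss_weight (Suc (Suc a)) 0 * f 0) \<le> (\<Sum>a. u a)"
  proof (rule suminf_le[OF _ _ us])
    show "gauss_weight (Suc (Suc a)) 0 * f 0 \<le> u a" for a
      unfolding u_def using gauss_weight_pos[of "Suc (Suc a)" 0]
      by (intro mult_left_mono mono_onD[OF m]) auto
    show "summable (\<lambda>a. gauss_weight (Suc (Suc a)) 0 * f 0)" using ws by (intro summable_mult2) (auto simp: sums_iff)
  qed
  moreover have "(\<Sum>a. gauss_weight (Suc (Suc a)) 0 * f 0) = f 0 / 2"
    using sums_mult2[OF ws, of "f 0"] by (simp add: sums_iff gauss_weight_def)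
  ultimately have "f 0 / 2 \<le> suminf u" by simp
  then show ?thesis unfolding T0 T1 by (simp add: field_simps)
qed

text \<open>Both directions of monotonicity are allowed because each application of the transfer
  operator reverses it.\<close>

definition osc_le :: "real \<Rightarrow> (real \<Rightarrow> real) \<Rightarrow> bool" where
  "osc_le c f \<longleftrightarrow> (mono_on {0..1} f \<and> f 1 - f 0 \<le> c) \<or> (mono_on {0..1} (\<lambda>x. - f x) \<and> f 0 - f 1 \<le> c)"

lemma osc_le_abs: "osc_le c f \<Longrightarrow> x \<in> {0..1} \<Longrightarrow> \<bar>f x - f 0\<bar> \<le> c"
  unfolding osc_le_def
proof (elim disjE conjE)
  assume "mono_on {0..1} f" "f 1 - f 0 \<le> c" "x \<in> {0..1}"
  then show ?thesis using mono_onD[of "{0..1}" f 0 x] mono_onD[of "{0..1}" f x 1] by simp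
next
  assume "mono_on {0..1} (\<lambda>x. - f x)" "f 0 - f 1 \<le> c" "x \<in> {0..1}"
  then show ?thesis using mono_onD[of "{0..1}" "\<lambda>x. - f x" 0 x] mono_onD[of "{0..1}" "\<lambda>x. - f x" x 1] by simp
qed

lemma osc_le_bounded: "osc_le c f \<Longrightarrow> x \<in> {0..1} \<Longrightarrow> \<bar>f x\<bar> \<le> c + \<bar>f 0\<bar>"
  using osc_le_abs[of c f x] by linarith

lemma osc_le_transfer:
  assumes "osc_le c f"
  shows "osc_le (c / 2) (gauss_transfer f)"
proof -
  note b = osc_le_bounded[OF assms]
  from assms consider "mono_on {0..1} f" "f 1 - f 0 \<le> c" | "mono_on {0..1} (\<lambda>x. - f x)" "f 0 - f 1 \<le> c"
    unfolding osc_le_def by blast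
  then show ?thesis
  proof cases
    case 1
    then show ?thesis using gauss_transfer_antimono[OF 1(1)] gauss_transfer_oscillation[OF 1(1)]
      unfolding osc_le_def by (auto intro!: mono_onI)
  next
    case 2
    have u: "gauss_transfer (\<lambda>x. - f x) s = - gauss_transfer f s" if "s \<in> {0..1}" for s
      using gauss_transfer_uminus[OF b that] .
    have "mono_on {0..1} (gauss_transfer f)"
      using gauss_transfer_antimono[OF 2(1)] u by (intro mono_onI) fastforce
    moreover have "gauss_transfer f 1 - gauss_transfer f 0 \<le> c / 2"
      using gauss_transfer_oscillation[OF 2(1)] u[of 0] u[of 1] 2(2) by simp
    ultimately show ?thesis unfolding osc_le_def by blast
  qed
qed

text \<open>Duality moves one iterate at a time from \<open>g\<close> to \<open>f\<close>, which
  loses half of its oscillation; at the end the mean zero of \<open>g\<close> permits subtracting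
  \<open>f 0\<close>.\<close>

lemma gauss_mixing_monotone:
  fixes g :: "real \<Rightarrow> 'a::{banach, second_countable_topology}"
  assumes f[measurable]: "f \<in> borel_measurable borel" and c: "osc_le c f"
    and g[measurable]: "g \<in> borel_measurable borel" and g1: "\<And>x. x \<in> {0..1} \<Longrightarrow> norm (g x) \<le> B"
    and g0: "(\<integral>x. gauss_density x *\<^sub>R g x \<partial>unif) = 0"
  shows "norm (\<integral>x. (gauss_density x * f x) *\<^sub>R g ((gauss_map ^^ j) x) \<partial>unif) \<le> c * B * (1 / 2) ^ j"
  using f c
proof (induction j arbitrary: f c)
  case 0
  note [measurable] = 0(1)
  have c: "0 \<le> c" using osc_le_abs[OF 0(2), of 0] by simp
  have B: "0 \<le> B" using g1[of 0] norm_ge_zero[of "g 0"] by (simp del: norm_ge_zero)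
  have fb: "\<bar>f x - f 0\<bar> \<le> c" if "x \<in> {0..1}" for x using osc_le_abs[OF 0(2) that] .
  have db: "\<bar>gauss_density x\<bar> \<le> 2" if "x \<in> {0..1}" for x using gauss_density_bounds[OF that] by simp
  have i1: "integrable unif (\<lambda>x. (gauss_density x * (f x - f 0)) *\<^sub>R g x)"
  proof (rule integrable_unif_bounded[where C="2 * c * B"])
    show "norm ((gauss_density x * (f x - f 0)) *\<^sub>R g x) \<le> 2 * c * B" if "x \<in> {0..1}" for x
      unfolding norm_scaleR abs_mult using fb[OF that] db[OF that] g1[OF that] c B by (intro mult_mono) auto
  qed measurable
  have i2: "integrable unif (\<lambda>x. f 0 *\<^sub>R (gauss_density x *\<^sub>R g x))"
  proof (intro integrable_scaleR_right integrable_unif_bounded[where C="2 * B"])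
    show "norm (gauss_density x *\<^sub>R g x) \<le> 2 * B" if "x \<in> {0..1}" for x
      unfolding norm_scaleR using db[OF that] g1[OF that] B by (intro mult_mono) auto
  qed measurable
  have i3: "integrable unif gauss_density"
    using db by (intro integrable_unif_bounded[where C=2]) auto
  have eq: "(gauss_density x * f x) *\<^sub>R g x = (gauss_density x * (f x - f 0)) *\<^sub>R g x + f 0 *\<^sub>R (gauss_density x *\<^sub>R g x)" for x
    by (simp add: algebra_simps)
  have "(\<integral>x. (gauss_density x * f x) *\<^sub>R g x \<partial>unif) = (\<integral>x. (gauss_density x * (f x - f 0)) *\<^sub>R g x \<partial>unif)"
    unfolding eq Bochner_Integration.integral_add[OF i1 i2] integral_scaleR_right g0 by simp
  also have "norm \<dots> \<le> (\<integral>x. norm ((gauss_density x * (f x - f 0)) *\<^sub>R g x) \<partial>unif)" by (rule integral_norm_bound)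
  also have "\<dots> \<le> (\<integral>x. gauss_density x * (c * B) \<partial>unif)"
  proof (rule integral_mono_AE)
    show "AE x in unif. norm ((gauss_density x * (f x - f 0)) *\<^sub>R g x) \<le> gauss_density x * (c * B)"
      using AE_unif_mem
    proof eventually_elim
      case (elim x)
      have "norm ((gauss_density x * (f x - f 0)) *\<^sub>R g x) = gauss_density x * (\<bar>f x - f 0\<bar> * norm (g x))"
        using gauss_density_bounds[OF elim] by (simp add: abs_mult)
      also have "\<dots> \<le> gauss_density x * (c * B)"
        using gauss_density_bounds[OF elim] fb[OF elim] g1[OF elim] c by (intro mult_left_mono mult_mono) auto
      finally show ?case .
    qed
    show "integrable unif (\<lambda>x. norm ((gauss_density x * (f x - f 0)) *\<^sub>R g x))"
      by (rule integrable_norm[OF i1])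
  qed (use i3 in auto)
  also have "\<dots> = c * B" by (simp add: gauss_density_integral)
  finally show ?case by simp
next
  case (Suc j)
  note [measurable] = Suc.prems(1)
  have "(\<integral>x. (gauss_density x * f x) *\<^sub>R g ((gauss_map ^^ Suc j) x) \<partial>unif) =
    (\<integral>x. (gauss_density x * f x) *\<^sub>R (\<lambda>y. g ((gauss_map ^^ j) y)) (gauss_map x) \<partial>unif)"
    by (simp add: funpow_swap1)
  also have "\<dots> = (\<integral>x. (gauss_density x * gauss_transfer f x) *\<^sub>R g ((gauss_map ^^ j) x) \<partial>unif)"
  proof (rule gauss_transfer_duality)
    show "\<bar>f x\<bar> \<le> c + \<bar>f 0\<bar>" if "x \<in> {0..1}" for x by (rule osc_le_bounded[OF Suc.prems(2) that])
    show "norm (g ((gauss_map ^^ j) x)) \<le> B" if "x \<in> {0..1}" for x by (rule g1[OF gauss_iter_range[OF that]])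
  qed measurable
  also have "norm \<dots> \<le> c / 2 * B * (1 / 2) ^ j"
    using Suc.prems by (intro Suc.IH osc_le_transfer gauss_transfer_borel)
  finally show ?case by simp
qed

lemma acim_gauss: "acim gauss_map gauss_density"
proof
  show "gauss_map x \<in> {0..1}" for x using gauss_map_range[of x] by simp
  show "\<exists>c C. 0 < c \<and> (\<forall>x\<in>{0..1}. c \<le> gauss_density x \<and> gauss_density x \<le> C)"
    using gauss_density_bounds by (intro exI[of _ "1 / 2"] exI[of _ 2]) auto
  have em: "emeasure (density unif (\<lambda>x. ennreal (gauss_density x))) A = ennreal (\<integral>x. gauss_density x *\<^sub>R indicator A x \<partial>unif)"
    if [measurable]: "A \<in> sets borel" for A
  proof -
    have i: "integrable unif (\<lambda>x. gauss_density x * indicator A x)"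
    proof (rule integrable_unif_bounded[where C=2])
      show "norm (gauss_density x * indicator A x) \<le> 2" if "x \<in> {0..1}" for x
        using gauss_density_bounds[OF that] by (auto simp: indicator_def)
    qed measurable
    have p: "AE x in unif. 0 \<le> gauss_density x * indicator A x"
    proof (rule eventually_mono[OF AE_unif_mem])
      fix x :: real assume "x \<in> {0..1}"
      then show "0 \<le> gauss_density x * indicator A x" using gauss_density_bounds[of x] by (auto simp: indicator_def)
    qed
    have "emeasure (density unif (\<lambda>x. ennreal (gauss_density x))) A = (\<integral>\<^sup>+x. ennreal (gauss_density x * indicator A x) \<partial>unif)"
      by (subst emeasure_density) (auto intro!: nn_integral_cong simp: indicator_def)
    also have "\<dots> = ennreal (\<integral>x. gauss_density x * indicator A x \<partial>unif)"
      by (rule nn_integral_eq_integral[OF i p])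
    finally show ?thesis by simp
  qed
  show "distr (density unif (\<lambda>x. ennreal (gauss_density x))) borel gauss_map = density unif (\<lambda>x. ennreal (gauss_density x))"
  proof (rule measure_eqI)
    fix A assume "A \<in> sets (distr (density unif (\<lambda>x. ennreal (gauss_density x))) borel gauss_map)"
    then have A[measurable]: "A \<in> sets borel" by simp
    have TA: "gauss_map -` A \<in> sets borel" using measurable_sets[OF gauss_map_borel A] by simp
    have "(\<integral>x. gauss_density x *\<^sub>R indicator (gauss_map -` A) x \<partial>unif) = (\<integral>x. gauss_density x *\<^sub>R (indicator A (gauss_map x) :: real) \<partial>unif)"
      by (simp add: indicator_def vimage_def)
    also have "\<dots> = (\<integral>x. gauss_density x *\<^sub>R indicator A x \<partial>unif)"
      by (rule gauss_density_invariant[where B=1]) (auto simp: indicator_def)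
    finally show "emeasure (distr (density unif (\<lambda>x. ennreal (gauss_density x))) borel gauss_map) A = emeasure (density unif (\<lambda>x. ennreal (gauss_density x))) A"
      using TA by (subst emeasure_distr) (auto simp: em)
  qed simp
qed (use gauss_density_integral in auto)

interpretation gauss: acim gauss_map gauss_density
  by (rule acim_gauss)

section \<open>Inverse branches along an orbit\<close>

text \<open>The value 1 is the default where there is no digit; with it the inverse branches below
  map the unit interval into itself for every \<open>x\<close>.\<close>

definition gauss_digit :: "real \<Rightarrow> real" where
  "gauss_digit x = max 1 (of_int \<lfloor>1 / x\<rfloor>)"

text \<open>
  \<open>gauss_branch k x\<close> is the inverse branch of the \<open>k\<close>-th iterate through \<open>x\<close>, and the modulus of its derivative is
  the square of \<open>gauss_contr k x\<close>.
\<close>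

fun gauss_branch :: "nat \<Rightarrow> real \<Rightarrow> real \<Rightarrow> real" where
  "gauss_branch 0 x v = v"
| "gauss_branch (Suc k) x v = 1 / (gauss_digit x + gauss_branch k (gauss_map x) v)"

fun gauss_contr :: "nat \<Rightarrow> real \<Rightarrow> real \<Rightarrow> real" where
  "gauss_contr 0 x v = 1"
| "gauss_contr (Suc k) x v = gauss_branch (Suc k) x v * gauss_contr k (gauss_map x) v"

lemma gauss_digit_ge: "1 \<le> gauss_digit x"
  by (simp add: gauss_digit_def)

lemma gauss_digit_nat: "\<exists>n\<ge>1. gauss_digit x = real n"
proof (cases "1 \<le> \<lfloor>1 / x\<rfloor>")
  case True
  then obtain n where n: "\<lfloor>1 / x\<rfloor> = int n" by (metis zero_le_imp_eq_int int_one_le_iff_zero_less less_imp_le)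
  have "gauss_digit x = real n" "1 \<le> n" using True unfolding gauss_digit_def n by auto
  then show ?thesis by blast
next
  case False
  then show ?thesis by (intro exI[of _ 1]) (auto simp: gauss_digit_def max_def)
qed

lemma gauss_branch_range: "v \<in> {0..1} \<Longrightarrow> gauss_branch k x v \<in> {0..1}"
proof (induction k arbitrary: x)
  case (Suc k)
  then have "0 \<le> gauss_branch k (gauss_map x) v" by simp
  then show ?case using gauss_digit_ge[of x] by simp
qed simp

lemma gauss_branch_range_open: "0 < v \<Longrightarrow> v < 1 \<Longrightarrow> 0 < gauss_branch k x v \<and> gauss_branch k x v < 1"
proof (induction k arbitrary: x)
  case (Suc k)
  then have "0 < gauss_branch k (gauss_map x) v" by simp
  then show ?case using gauss_digit_ge[of x] by simp
qed simp

lemma gauss_branch_borel [measurable]: "(\<lambda>x. gauss_branch k x v) \<in> borel_measurable borel"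
proof (induction k)
  case (Suc k)
  note [measurable] = Suc
  show ?case unfolding gauss_branch.simps gauss_digit_def by measurable
qed simp

lemma gauss_contr_pos: "v \<in> {0..1} \<Longrightarrow> 0 < gauss_contr k x v"
proof (induction k arbitrary: x)
  case (Suc k)
  then show ?case using gauss_branch_range[of v k "gauss_map x"] gauss_digit_ge[of x] by simp
qed simp

text \<open>A difference quotient of a Moebius map is, up to sign, the geometric mean of the moduli
  of its derivatives at the two points; hence an equality.\<close>

lemma gauss_branch_diff:
  assumes "u \<in> {0..1}" "v \<in> {0..1}"
  shows "\<bar>gauss_branch k x v - gauss_branch k x u\<bar> = \<bar>v - u\<bar> * gauss_contr k x v * gauss_contr k x u"
proof (induction k arbitrary: x)
  case (Suc k)
  let ?a = "gauss_digit x" and ?b = "\<lambda>v. gauss_branch k (gauss_map x) v"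
  have p: "0 < ?a + ?b v" "0 < ?a + ?b u"
    using gauss_digit_ge[of x] gauss_branch_range[OF assms(1), of k "gauss_map x"] gauss_branch_range[OF assms(2), of k "gauss_map x"] by auto
  have "gauss_branch (Suc k) x v - gauss_branch (Suc k) x u = (?b u - ?b v) * (1 / (?a + ?b v)) * (1 / (?a + ?b u))"
    using p by (simp add: field_simps)
  then have "\<bar>gauss_branch (Suc k) x v - gauss_branch (Suc k) x u\<bar> = \<bar>?b v - ?b u\<bar> * (1 / (?a + ?b v)) * (1 / (?a + ?b u))"
    using p by (simp add: abs_mult abs_minus_commute)
  then show ?case unfolding Suc.IH by (simp add: mult_ac)
qed simp

text \<open>The continued fraction matrix, with \<open>q\<close> and \<open>q'\<close> as
  consecutive denominators. The inequality on \<open>(q - q') + (p - p')\<close> is carried along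
  because it keeps \<open>q' \<le> q\<close> when a digit is added.\<close>

lemma gauss_moebius:
  "\<exists>p p' q q'. 0 \<le> p \<and> 0 \<le> p' \<and> 0 < q \<and> 0 \<le> q' \<and> q' \<le> q \<and> 0 \<le> (q - q') + (p - p') \<and>
    (\<forall>v\<in>{0..1}. gauss_branch k x v = (p + v * p') / (q + v * q') \<and> gauss_contr k x v = 1 / (q + v * q'))"
proof (induction k arbitrary: x)
  case 0
  show ?case by (intro exI[of _ 0] exI[of _ 1] exI[of _ 1] exI[of _ 0]) simp
next
  case (Suc k)
  obtain p p' q q' where h: "0 \<le> p" "0 \<le> p'" "0 < q" "0 \<le> q'" "q' \<le> q" "0 \<le> (q - q') + (p - p')"
    and e: "\<And>v. v \<in> {0..1} \<Longrightarrow> gauss_branch k (gauss_map x) v = (p + v * p') / (q + v * q')"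
      "\<And>v. v \<in> {0..1} \<Longrightarrow> gauss_contr k (gauss_map x) v = 1 / (q + v * q')"
    using Suc.IH[of "gauss_map x"] by blast
  define a where "a = gauss_digit x"
  have a: "1 \<le> a" by (simp add: a_def gauss_digit_ge)
  have B: "gauss_branch (Suc k) x v = (q + v * q') / ((a * q + p) + v * (a * q' + p'))" if v: "v \<in> {0..1}" for v
  proof -
    have "0 < q + v * q'" using h v by (intro add_pos_nonneg) auto
    then have "a + (p + v * p') / (q + v * q') = ((a * q + p) + v * (a * q' + p')) / (q + v * q')"
      by (simp add: field_simps)
    then show ?thesis unfolding gauss_branch.simps e(1)[OF v] a_def[symmetric] by simp
  qed
  have D: "gauss_contr (Suc k) x v = 1 / ((a * q + p) + v * (a * q' + p'))" if v: "v \<in> {0..1}" for v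
  proof -
    have "0 < q + v * q'" using h v by (intro add_pos_nonneg) auto
    then show ?thesis unfolding gauss_contr.simps(2) B[OF v] e(2)[OF v] by simp
  qed
  have le: "0 \<le> (q - q') * (a - 1)" using a h by simp
  show ?case
  proof (intro exI conjI ballI)
    show "0 \<le> q" "0 \<le> q'" "0 < a * q + p" "0 \<le> a * q' + p'" using h a by (auto intro: add_pos_nonneg)
    show "a * q' + p' \<le> a * q + p" using le h(6) by (simp add: algebra_simps)
    show "0 \<le> (a * q + p) - (a * q' + p') + (q - q')" using le h(5,6) by (simp add: algebra_simps)
  qed (use B D in auto)
qed

text \<open>Since \<open>q' \<le> q\<close>, all denominators \<open>q + v * q'\<close> lie between
  \<open>q\<close> and \<open>2 * q\<close>.\<close>

lemma gauss_distortion: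
  assumes "u \<in> {0..1}" "v \<in> {0..1}"
  shows "gauss_contr k x v \<le> 2 * gauss_contr k x u"
proof -
  obtain p p' q q' where h: "0 < q" "0 \<le> q'" "q' \<le> q" and e: "\<And>v. v \<in> {0..1} \<Longrightarrow> gauss_contr k x v = 1 / (q + v * q')"
    using gauss_moebius[of k x] by blast
  have "u * q' \<le> 1 * q" using assms h by (intro mult_mono) auto
  moreover have "0 \<le> v * q'" "0 \<le> u * q'" using assms h by auto
  ultimately have "1 / (q + v * q') \<le> 1 / ((q + u * q') / 2)" using h by (intro divide_left_mono) (auto intro!: mult_pos_pos add_pos_nonneg)
  then show ?thesis unfolding e[OF assms(1)] e[OF assms(2)] by simp
qed

text \<open>A single factor may be close to 1, but two consecutive ones multiply to
  \<open>b / (a + b)\<close> with \<open>a >= 1\<close> and \<open>0 <= b <= 1\<close>, at most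
  1/2.\<close>

lemma gauss_contr_small: "v \<in> {0..1} \<Longrightarrow> (gauss_contr k x v)\<^sup>2 \<le> 2 * (1 / 2) ^ k"
proof (induction k arbitrary: x rule: less_induct)
  case (less k)
  consider "k = 0" | "k = 1" | k' where "k = Suc (Suc k')" by (metis One_nat_def not0_implies_Suc)
  then show ?case
  proof cases
    case 2
    have "0 \<le> gauss_branch 1 x v" "gauss_branch 1 x v \<le> 1" using gauss_branch_range[OF less.prems, of 1 x] by auto
    then have "(gauss_branch 1 x v)\<^sup>2 \<le> 1" by (simp add: power_le_one)
    then show ?thesis using 2 by simp
  next
    case 3
    let ?b = "gauss_branch (Suc k') (gauss_map x) v"
    have b: "0 \<le> ?b" "?b \<le> 1" using gauss_branch_range[OF less.prems, of "Suc k'" "gauss_map x"] by auto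
    have a: "1 \<le> gauss_digit x" by (rule gauss_digit_ge)
    have half: "b / (a + b) \<le> 1 / 2" if "1 \<le> a" "0 \<le> b" "b \<le> 1" for a b :: real
      using that by (simp add: divide_le_eq)
    have "?b / (gauss_digit x + ?b) \<le> 1 / 2" by (rule half[OF a b])
    moreover have "0 \<le> ?b / (gauss_digit x + ?b)" using a b by simp
    ultimately have "(?b / (gauss_digit x + ?b))\<^sup>2 \<le> (1 / 2)\<^sup>2" by (intro power_mono)
    moreover have "(gauss_contr k' (gauss_map (gauss_map x)) v)\<^sup>2 \<le> 2 * (1 / 2) ^ k'"
      using less.IH[of k'] less.prems 3 by simp
    ultimately have "(?b / (gauss_digit x + ?b))\<^sup>2 * (gauss_contr k' (gauss_map (gauss_map x)) v)\<^sup>2 \<le> (1 / 2)\<^sup>2 * (2 * (1 / 2) ^ k')"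
      by (intro mult_mono) auto
    moreover have "gauss_contr k x v = ?b / (gauss_digit x + ?b) * gauss_contr k' (gauss_map (gauss_map x)) v"
      unfolding 3 by simp
    ultimately have "(gauss_contr k x v)\<^sup>2 \<le> (1 / 2)\<^sup>2 * (2 * (1 / 2) ^ k')" by (simp only: power_mult_distrib)
    also have "\<dots> = 2 * (1 / 2) ^ k" unfolding 3 by (simp add: power2_eq_square)
    finally show ?thesis .
  qed auto
qed

subsection \<open>Irrational orbits\<close>

definition irr :: "real set" where "irr = {0<..<1} - \<rat>"

lemma AE_irr: "AE x in unif. x \<in> irr"
proof -
  have "AE x in unif. x \<notin> \<rat>" by (rule AE_unif_countable[OF countable_rat])
  then show ?thesis using AE_unif_mem
  proof eventually_elim
    case (elim x)
    then have "x \<noteq> 0" "x \<noteq> 1" by auto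
    then show ?case using elim by (auto simp: irr_def)
  qed
qed

lemma irr_digit:
  assumes "x \<in> irr"
  shows "gauss_digit x = of_int \<lfloor>1 / x\<rfloor>" "1 / x = gauss_digit x + gauss_map x" "x = 1 / (gauss_digit x + gauss_map x)"
proof -
  have x: "0 < x" "x < 1" using assms by (auto simp: irr_def)
  then have "1 \<le> 1 / x" by simp
  then have "1 \<le> \<lfloor>1 / x\<rfloor>" by simp
  then show 1: "gauss_digit x = of_int \<lfloor>1 / x\<rfloor>" by (simp add: gauss_digit_def)
  then show 2: "1 / x = gauss_digit x + gauss_map x" using x by (simp add: gauss_map_def frac_def)
  show "x = 1 / (gauss_digit x + gauss_map x)" unfolding 2[symmetric] using x by simp
qed

lemma irr_map:
  assumes "x \<in> irr"
  shows "gauss_map x \<in> irr"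
proof -
  have x: "0 < x" "x \<notin> \<rat>" using assms by (auto simp: irr_def)
  have "gauss_map x \<notin> \<rat>"
  proof
    assume "gauss_map x \<in> \<rat>"
    then have "gauss_digit x + gauss_map x \<in> \<rat>" unfolding irr_digit(1)[OF assms] by simp
    then have "x \<in> \<rat>" using irr_digit(3)[OF assms] by (metis Rats_1 Rats_divide)
    with x show False by simp
  qed
  moreover from this have "gauss_map x \<noteq> 0" by auto
  ultimately show ?thesis using gauss_map_range[of x] by (auto simp: irr_def)
qed

lemma irr_iter: "x \<in> irr \<Longrightarrow> (gauss_map ^^ n) x \<in> irr"
  by (induction n) (auto intro: irr_map)

lemma irr_mem: "x \<in> irr \<Longrightarrow> x \<in> {0..1}"
  by (auto simp: irr_def)

lemma gauss_branch_iter: "x \<in> irr \<Longrightarrow> gauss_branch k x ((gauss_map ^^ k) x) = x"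
proof (induction k arbitrary: x)
  case (Suc k)
  have "gauss_branch k (gauss_map x) ((gauss_map ^^ Suc k) x) = gauss_map x"
    using Suc.IH[OF irr_map[OF Suc.prems]] by (simp add: funpow_swap1)
  then show ?case unfolding gauss_branch.simps using irr_digit(3)[OF Suc.prems] by simp
qed simp

lemma gauss_map_branch_point:
  assumes "0 \<le> r" "r < 1"
  shows "gauss_map (1 / (gauss_digit x + r)) = r"
  using gauss_digit_nat[of x] gauss_map_branch(1)[of _ r] assms by metis

lemma iter_gauss_branch:
  assumes "0 < v" "v < 1"
  shows "n \<le> k \<Longrightarrow> (gauss_map ^^ n) (gauss_branch k x v) = gauss_branch (k - n) ((gauss_map ^^ n) x) v"
proof (induction n arbitrary: k x)
  case (Suc n)
  then obtain k' where k: "k = Suc k'" by (cases k) auto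
  have "gauss_map (gauss_branch k x v) = gauss_branch k' (gauss_map x) v"
    unfolding k gauss_branch.simps using gauss_branch_range_open[OF assms, of k' "gauss_map x"]
    by (intro gauss_map_branch_point) auto
  then show ?case using Suc k by (simp add: funpow_swap1)
qed simp

definition gauss_log :: "nat \<Rightarrow> real \<Rightarrow> real" where
  "gauss_log k x = (\<Sum>i<k. - ln ((gauss_map ^^ i) x))"

lemma gauss_log_borel [measurable]: "gauss_log k \<in> borel_measurable borel"
  unfolding gauss_log_def[abs_def] by measurable

text \<open>The chain rule along the orbit: \<open>exp (- 2 * gauss_log k x)\<close> is the modulus
  of the derivative of the inverse branch and, up to a constant, the length of the cylinder.\<close>

lemma gauss_contr_iter: "x \<in> irr \<Longrightarrow> gauss_contr k x ((gauss_map ^^ k) x) = exp (- gauss_log k x)"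
proof (induction k arbitrary: x)
  case (Suc k)
  have x: "0 < x" using Suc.prems by (auto simp: irr_def)
  have "gauss_contr (Suc k) x ((gauss_map ^^ Suc k) x) = x * exp (- gauss_log k (gauss_map x))"
    unfolding gauss_contr.simps gauss_branch_iter[OF Suc.prems]
    using Suc.IH[OF irr_map[OF Suc.prems]] by (simp add: funpow_swap1)
  also have "\<dots> = exp (ln x - gauss_log k (gauss_map x))" using x by (simp add: exp_diff exp_minus field_simps)
  also have "ln x - gauss_log k (gauss_map x) = - gauss_log (Suc k) x"
    unfolding gauss_log_def sum.lessThan_Suc_shift by (simp add: funpow_swap1)
  finally show ?case .
qed (simp add: gauss_log_def)

text \<open>
  A point \<open>y\<close> near \<open>x\<close> either follows the branch of \<open>x\<close>, or some end point of the cylinder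
  of \<open>x\<close> lies between them.
\<close>

lemma gauss_companion:
  assumes "x \<in> irr" "y \<in> {0..1}"
  shows "\<exists>v\<in>{0..1}. gauss_branch m x v \<in> closed_segment x y \<and> (v = (gauss_map ^^ m) y \<or> v \<in> {0, 1})"
  using assms
proof (induction m arbitrary: x y)
  case (Suc m)
  define a where "a = gauss_digit x"
  let ?x = "gauss_map x"
  have x': "?x \<in> irr" by (rule irr_map[OF Suc.prems(1)])
  have a: "1 \<le> a" by (simp add: a_def gauss_digit_ge)
  have xe: "x = 1 / (a + ?x)" using irr_digit(3)[OF Suc.prems(1)] by (simp add: a_def)
  have x0: "0 < ?x" "?x < 1" using x' by (auto simp: irr_def)
  have seg: "1 / (a + z) \<in> closed_segment x (1 / (a + e))" if "z \<in> closed_segment ?x e" "0 \<le> e" for z e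
  proof -
    have "?x \<le> z \<and> z \<le> e \<or> e \<le> z \<and> z \<le> ?x" using that by (auto simp: closed_segment_eq_real_ivl split: if_splits)
    then have "1 / (a + e) \<le> 1 / (a + z) \<and> 1 / (a + z) \<le> 1 / (a + ?x) \<or> 1 / (a + ?x) \<le> 1 / (a + z) \<and> 1 / (a + z) \<le> 1 / (a + e)"
      using a x0 that(2) by (elim disjE) (auto intro!: divide_left_mono mult_pos_pos)
    then show ?thesis by (subst xe) (auto simp: closed_segment_eq_real_ivl)
  qed
  \<comment> \<open>\<open>e\<close> takes the part of \<open>gauss_map y\<close> in the induction:
    it is that point if \<open>y\<close> has the digit of \<open>x\<close>, and otherwise the end
    point 0 or 1 whose image \<open>1 / (a + e)\<close> lies between \<open>x\<close> and
    \<open>y\<close>.\<close>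
  have step: ?case if e: "e \<in> {0..1}" "1 / (a + e) \<in> closed_segment x y" "e \<in> {0, 1} \<or> e = gauss_map y" for e
  proof -
    obtain v where v: "v \<in> {0..1}" "gauss_branch m ?x v \<in> closed_segment ?x e" "v = (gauss_map ^^ m) e \<or> v \<in> {0, 1}"
      using Suc.IH[OF x' e(1)] by blast
    have "gauss_branch (Suc m) x v \<in> closed_segment x (1 / (a + e))"
      using seg[OF v(2)] e(1) by (simp add: a_def)
    moreover have "closed_segment x (1 / (a + e)) \<subseteq> closed_segment x y"
      using e(2) by (simp add: subset_closed_segment)
    moreover have "(gauss_map ^^ m) e \<in> {0, 1} \<or> (gauss_map ^^ m) e = (gauss_map ^^ Suc m) y"
    proof -
      have g0: "gauss_map 0 = 0" "gauss_map 1 = 0" by (simp_all add: gauss_map_def)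
      have i0: "(gauss_map ^^ i) 0 = 0" for i by (induction i) (simp_all add: g0)
      have "(gauss_map ^^ i) 1 \<in> {0, 1}" for i by (cases i) (simp_all add: funpow_swap1 g0 i0 del: funpow.simps, simp_all add: funpow_swap1 g0 i0)
      then show ?thesis using e(3) i0 by (auto simp: funpow_swap1)
    qed
    ultimately show ?thesis using v by (metis subsetD insertCI)
  qed
  have a_int: "a = of_int \<lfloor>1 / x\<rfloor>" using irr_digit(1)[OF Suc.prems(1)] by (simp add: a_def)
  have xlow: "1 / (a + 1) \<le> x" "x \<le> 1 / a" using a x0 by (subst xe, intro divide_left_mono, auto)+
  consider "y < 1 / (a + 1)" | "1 / a < y" | "1 / (a + 1) \<le> y" "y \<le> 1 / a" by linarith
  then show ?case
  proof cases
    case 1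
    then show ?thesis using xlow by (intro step[of 1]) (auto simp: closed_segment_eq_real_ivl)
  next
    case 2
    then show ?thesis using xlow by (intro step[of 0]) (auto simp: closed_segment_eq_real_ivl)
  next
    case 3
    show ?thesis
    proof (cases "y = 1 / (a + 1)")
      case True
      then show ?thesis using xlow by (intro step[of 1]) (auto simp: closed_segment_eq_real_ivl)
    next
      case False
      have y0: "0 < y" using 3(1) a by (meson add_pos_pos divide_pos_pos less_le_trans zero_less_one)
      have "a \<le> 1 / y" using 3(2) y0 a by (simp add: field_simps)
      moreover have "1 / y < a + 1" using 3(1) False y0 a by (simp add: field_simps)
      ultimately have "\<lfloor>1 / y\<rfloor> = \<lfloor>1 / x\<rfloor>" unfolding a_int by (simp add: floor_eq_iff)
      then have "1 / y = a + gauss_map y" using y0 by (simp add: gauss_map_def frac_def a_int)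
      then have "1 / (a + gauss_map y) = y" by (metis div_by_1 divide_divide_eq_right mult_1)
      then show ?thesis using gauss_map_range[of y] by (intro step[of "gauss_map y"]) (auto simp: less_imp_le)
    qed
  qed
qed auto

section \<open>Cylinder mixing for the Gauss map\<close>

text \<open>
  Since inverse branches are Moebius maps, the density on a cylinder, transported to \<open>{0..1}\<close> and
  normalised, is \<open>rho s\<close> for some \<open>s\<close>.
\<close>

definition rho :: "real \<Rightarrow> real \<Rightarrow> real" where
  "rho s t = (1 + s) / (1 + s * t)\<^sup>2"

lemma rho_borel [measurable]: "rho s \<in> borel_measurable borel"
  unfolding rho_def[abs_def] by measurable

lemma rho_bounds: "s \<in> {0..1} \<Longrightarrow> t \<in> {0..1} \<Longrightarrow> 0 \<le> rho s t \<and> rho s t \<le> 2"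
proof -
  assume "s \<in> {0..1}" "t \<in> {0..1}"
  then have "(1 + s) / (1 + s * t)\<^sup>2 \<le> 2 / 1" by (intro frac_le) (auto simp: one_le_power)
  then show ?thesis using \<open>s \<in> {0..1}\<close> by (simp add: rho_def)
qed

text \<open>Relative to the Gauss density, \<open>rho s\<close> need not be monotone, but it is the
  difference \<open>u - v\<close> of two increasing functions with oscillations at most 2 and 4;
  hence the constant 6.\<close>

lemma rho_mixing:
  fixes g :: "real \<Rightarrow> complex"
  assumes g[measurable]: "g \<in> borel_measurable borel" and g1: "\<And>x. x \<in> {0..1} \<Longrightarrow> norm (g x) \<le> 1"
    and g0: "(\<integral>x. gauss_density x *\<^sub>R g x \<partial>unif) = 0" and s: "s \<in> {0..1}"
  shows "norm (\<integral>x. rho s x *\<^sub>R g ((gauss_map ^^ j) x) \<partial>unif) \<le> 6 * (1 / 2) ^ j"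
proof -
  define u where "u t = ln 2 * (1 + s) * (1 + t)" for t :: real
  define v where "v t = ln 2 * (1 + s) * ((1 + t) * (1 - 1 / (1 + s * t)\<^sup>2))" for t :: real
  have [measurable]: "u \<in> borel_measurable borel" "v \<in> borel_measurable borel"
    unfolding u_def[abs_def] v_def[abs_def] by measurable
  have l: "0 < ln (2::real)" "ln 2 \<le> (1::real)" using ln2_le_25_over_36 by auto
  have K: "0 \<le> ln 2 * (1 + s)" "ln 2 * (1 + s) \<le> 2"
    using s l mult_mono[of "ln 2" 1 "1 + s" 2] by auto
  have ou: "osc_le 2 u" unfolding osc_le_def
  proof (intro disjI1 conjI mono_onI)
    show "u t \<le> u t'" if "t \<le> t'" for t t' using that K unfolding u_def by (intro mult_left_mono) auto
    show "u 1 - u 0 \<le> 2" unfolding u_def using K by (simp add: algebra_simps)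
  qed
  have ov: "osc_le 4 v" unfolding osc_le_def
  proof (intro disjI1 conjI mono_onI)
    fix t t' :: real assume t: "t \<in> {0..1}" "t' \<in> {0..1}" "t \<le> t'"
    have "1 \<le> (1 + s * t)\<^sup>2" using s t by (simp add: one_le_power)
    moreover have "(1 + s * t)\<^sup>2 \<le> (1 + s * t')\<^sup>2" using s t by (intro power_mono) (auto intro: mult_left_mono)
    moreover have "1 / b \<le> 1 / a \<and> 1 / a \<le> 1" if "1 \<le> a" "a \<le> b" for a b :: real
      using that by (auto intro!: divide_left_mono mult_pos_pos)
    ultimately have "1 / (1 + s * t')\<^sup>2 \<le> 1 / (1 + s * t)\<^sup>2" "1 / (1 + s * t)\<^sup>2 \<le> 1"
      by blast+
    then show "v t \<le> v t'" unfolding v_def using K t by (intro mult_left_mono mult_mono) auto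
  next
    have "0 \<le> 1 / (1 + s * 1)\<^sup>2" by simp
    then have "(1 + 1) * (1 - 1 / (1 + s * 1)\<^sup>2) \<le> (2::real)" by (simp add: algebra_simps)
    then have "v 1 \<le> ln 2 * (1 + s) * 2"
      unfolding v_def by (rule mult_left_mono[OF _ K(1)])
    moreover have "v 0 = 0" by (simp add: v_def)
    ultimately show "v 1 - v 0 \<le> 4" using K(2) by linarith
  qed
  let ?g = "\<lambda>x. g ((gauss_map ^^ j) x)"
  have gb: "norm (?g x) \<le> 1" if "x \<in> {0..1}" for x using g1[OF gauss_iter_range[OF that]] .
  have i: "integrable unif (\<lambda>x. (gauss_density x * f x) *\<^sub>R ?g x)" if f[measurable]: "f \<in> borel_measurable borel" and o: "osc_le c f" for f c
  proof (rule integrable_unif_bounded[where C="2 * (c + \<bar>f 0\<bar>) * 1"])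
    fix x :: real assume x: "x \<in> {0..1}"
    have "\<bar>gauss_density x\<bar> \<le> 2" using gauss_density_bounds[OF x] by simp
    moreover have "0 \<le> c" using osc_le_abs[OF o, of 0] by simp
    ultimately show "norm ((gauss_density x * f x) *\<^sub>R ?g x) \<le> 2 * (c + \<bar>f 0\<bar>) * 1"
      unfolding norm_scaleR abs_mult using osc_le_bounded[OF o x] gb[OF x] by (intro mult_mono) auto
  qed measurable
  have "(\<integral>x. rho s x *\<^sub>R ?g x \<partial>unif) = (\<integral>x. (gauss_density x * u x) *\<^sub>R ?g x - (gauss_density x * v x) *\<^sub>R ?g x \<partial>unif)"
  proof (rule integral_cong_AE)
    show "AE x in unif. rho s x *\<^sub>R ?g x = (gauss_density x * u x) *\<^sub>R ?g x - (gauss_density x * v x) *\<^sub>R ?g x"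
    proof (rule eventually_mono[OF AE_unif_mem])
      fix x :: real assume "x \<in> {0..1}"
      then have "1 + x \<noteq> 0" by auto
      then have "gauss_density x * u x - gauss_density x * v x = rho s x"
        using l by (simp add: gauss_density_def u_def v_def rho_def right_diff_distrib)
      then show "rho s x *\<^sub>R ?g x = (gauss_density x * u x) *\<^sub>R ?g x - (gauss_density x * v x) *\<^sub>R ?g x"
        by (simp only: scaleR_diff_left[symmetric])
    qed
  qed measurable
  also have "\<dots> = (\<integral>x. (gauss_density x * u x) *\<^sub>R ?g x \<partial>unif) - (\<integral>x. (gauss_density x * v x) *\<^sub>R ?g x \<partial>unif)"
    using i ou ov by (intro Bochner_Integration.integral_diff) auto
  finally have "norm (\<integral>x. rho s x *\<^sub>R ?g x \<partial>unif) \<le> norm (\<integral>x. (gauss_density x * u x) *\<^sub>R ?g x \<partial>unif) + norm (\<integral>x. (gauss_density x * v x) *\<^sub>R ?g x \<partial>unif)"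
    by (simp only: norm_triangle_ineq4)
  moreover have "norm (\<integral>x. (gauss_density x * u x) *\<^sub>R ?g x \<partial>unif) \<le> 2 * 1 * (1 / 2) ^ j"
    by (rule gauss_mixing_monotone[OF _ ou g g1 g0]) auto
  moreover have "norm (\<integral>x. (gauss_density x * v x) *\<^sub>R ?g x \<partial>unif) \<le> 4 * 1 * (1 / 2) ^ j"
    by (rule gauss_mixing_monotone[OF _ ov g g1 g0]) auto
  ultimately show ?thesis by simp
qed

lemma gauss_branch_half_Suc:
  assumes "0 \<le> t" "t < 1"
  shows "gauss_branch (Suc k) (1 / (real (Suc a) + t)) v = 1 / (real (Suc a) + gauss_branch k t v)"
  using gauss_map_branch[of "Suc a" t] assms by (simp add: gauss_digit_def del: of_nat_Suc)

text \<open>The family \<open>rho s\<close> is stable: restricted to the branch of digit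
  \<open>Suc a\<close> and pulled back, it is a weight times \<open>rho (1 / (Suc a + s))\<close>,
  with weights of sum 1. A bound \<open>M\<close> valid for all \<open>s\<close> therefore survives
  any number of steps.\<close>

lemma gauss_cylinder_integral:
  fixes F Z :: "real \<Rightarrow> complex"
  assumes F[measurable]: "F \<in> borel_measurable borel" and F1: "\<And>x. x \<in> {0..1} \<Longrightarrow> norm (F x) \<le> 1"
    and M: "\<And>s. s \<in> {0..1} \<Longrightarrow> norm (\<integral>x. rho s x *\<^sub>R F x \<partial>unif) \<le> M"
    and "Z \<in> borel_measurable borel" "\<And>x. norm (Z x) \<le> 1" "s \<in> {0..1}"
  shows "norm (\<integral>x. rho s x *\<^sub>R (Z (gauss_branch k x (1 / 2)) * F ((gauss_map ^^ k) x)) \<partial>unif) \<le> M"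
  using assms(4-6)
proof (induction k arbitrary: Z s)
  case 0
  have "(\<integral>x. rho s x *\<^sub>R (Z (1 / 2) * F x) \<partial>unif) = Z (1 / 2) * (\<integral>x. rho s x *\<^sub>R F x \<partial>unif)"
    by (simp flip: mult_scaleR_right)
  also have "norm \<dots> \<le> 1 * M" unfolding norm_mult using 0 M by (intro mult_mono) auto
  finally show ?case by simp
next
  case (Suc k)
  note [measurable] = Suc.prems(1)
  have s: "0 \<le> s" using Suc.prems by auto
  let ?H = "\<lambda>x. rho s x *\<^sub>R (Z (gauss_branch (Suc k) x (1 / 2)) * F ((gauss_map ^^ Suc k) x))"
  let ?I = "\<lambda>a. \<integral>t. rho (1 / (real (Suc a) + s)) t *\<^sub>R (Z (1 / (real (Suc a) + gauss_branch k t (1 / 2))) * F ((gauss_map ^^ k) t)) \<partial>unif"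
  have Hm: "?H \<in> borel_measurable borel"
    by (intro borel_measurable_scaleR borel_measurable_times measurable_compose[OF gauss_branch_borel Suc.prems(1)] measurable_compose[OF gauss_iter_borel F]) measurable
  have iH: "integrable unif ?H"
  proof (rule integrable_unif_bounded[where C="2 * (1 * 1)"])
    show "?H \<in> borel_measurable borel" by (rule Hm)
    show "norm (?H x) \<le> 2 * (1 * 1)" if "x \<in> {0..1}" for x
      unfolding norm_scaleR norm_mult using rho_bounds[OF Suc.prems(3) that] Suc.prems(2) F1[OF gauss_iter_range[OF that, of "Suc k"]]
      by (intro mult_mono) (auto simp del: funpow.simps)
  qed
  note [measurable] = Hm
  have term_eq: "(\<integral>t. (1 / (real (Suc a) + t)\<^sup>2) *\<^sub>R ?H (1 / (real (Suc a) + t)) \<partial>unif) = gauss_weight (Suc a) s *\<^sub>R ?I a" for a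
  proof -
    have ne1: "AE x in unif. x \<noteq> 1" using AE_unif_countable[of "{1::real}"] by simp
    have "(\<integral>t. (1 / (real (Suc a) + t)\<^sup>2) *\<^sub>R ?H (1 / (real (Suc a) + t)) \<partial>unif) =
      (\<integral>t. gauss_weight (Suc a) s *\<^sub>R (rho (1 / (real (Suc a) + s)) t *\<^sub>R (Z (1 / (real (Suc a) + gauss_branch k t (1 / 2))) * F ((gauss_map ^^ k) t))) \<partial>unif)"
    proof (rule integral_cong_AE)
      show "AE t in unif. (1 / (real (Suc a) + t)\<^sup>2) *\<^sub>R ?H (1 / (real (Suc a) + t)) =
        gauss_weight (Suc a) s *\<^sub>R (rho (1 / (real (Suc a) + s)) t *\<^sub>R (Z (1 / (real (Suc a) + gauss_branch k t (1 / 2))) * F ((gauss_map ^^ k) t)))"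
        using AE_unif_mem ne1
      proof eventually_elim
        case (elim t)
        then have t: "0 \<le> t" "t < 1" by auto
        define n where "n = real (Suc a)"
        have n: "0 < n" by (simp add: n_def)
        have w: "gauss_weight (Suc a) s = (1 + s) / ((n + s) * (n + s + 1))" by (simp add: gauss_weight_def n_def)
        have pos: "0 < n + t" "0 < n + s" "0 < n + s + 1" "0 < n + t + s" using n t s by auto
        have r1: "rho s (1 / (n + t)) = (1 + s) * (n + t)\<^sup>2 / (n + t + s)\<^sup>2"
        proof -
          have "1 + s * (1 / (n + t)) = (n + t + s) / (n + t)" using pos by (simp add: field_simps)
          then show ?thesis unfolding rho_def by (simp add: power_divide)
        qed
        have r2: "rho (1 / (n + s)) t = (n + s + 1) * (n + s) / (n + t + s)\<^sup>2"
        proof -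
          have "1 + 1 / (n + s) * t = (n + t + s) / (n + s)" "1 + 1 / (n + s) = (n + s + 1) / (n + s)" using pos by (simp_all add: field_simps)
          then show ?thesis unfolding rho_def using pos by (simp add: power_divide power2_eq_square)
        qed
        have "1 / (n + t)\<^sup>2 * rho s (1 / (n + t)) = (1 + s) / (n + t + s)\<^sup>2" unfolding r1 using pos by simp
        also have "\<dots> = gauss_weight (Suc a) s * rho (1 / (n + s)) t" unfolding r2 w using pos by simp
        finally have "1 / (real (Suc a) + t)\<^sup>2 * rho s (1 / (real (Suc a) + t)) = gauss_weight (Suc a) s * rho (1 / (real (Suc a) + s)) t"
          by (simp only: n_def)
        moreover have "(gauss_map ^^ Suc k) (1 / (real (Suc a) + t)) = (gauss_map ^^ k) t"
          using gauss_map_branch(1)[of "Suc a" t] t by (simp add: funpow_swap1 del: of_nat_Suc)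
        ultimately show ?case unfolding scaleR_scaleR gauss_branch_half_Suc[OF t] by (simp only:)
      qed
    qed measurable
    then show ?thesis unfolding integral_scaleR_right .
  qed
  have Ib: "norm (gauss_weight (Suc a) s *\<^sub>R ?I a) \<le> gauss_weight (Suc a) s * M" for a
  proof -
    have "norm (?I a) \<le> M"
      using Suc.prems(2) branch_mem[OF Suc.prems(3)] by (intro Suc.IH[of "\<lambda>y. Z (1 / (real (Suc a) + y))"]) auto
    then show ?thesis unfolding norm_scaleR using gauss_weight_pos[of "Suc a" s] s by (simp add: mult_left_mono)
  qed
  have w: "(\<lambda>a. gauss_weight (Suc a) s * M) sums (1 * M)" using gauss_weight_sums[OF s] by (rule sums_mult2)
  have "(\<lambda>a. gauss_weight (Suc a) s *\<^sub>R ?I a) sums (\<integral>x. ?H x \<partial>unif)"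
    using gauss_branch_sums[OF Hm iH] unfolding term_eq .
  then have "(\<integral>x. ?H x \<partial>unif) = (\<Sum>a. gauss_weight (Suc a) s *\<^sub>R ?I a)" by (simp add: sums_iff)
  also have "norm \<dots> \<le> (\<Sum>a. gauss_weight (Suc a) s * M)" using Ib w by (intro norm_suminf_le) (auto simp: sums_iff)
  also have "\<dots> = M" using w by (simp add: sums_iff)
  finally show ?case .
qed

section \<open>The entropy of the Gauss map\<close>

text \<open>Up to sign the terms of the entropy integral once \<open>1 / (1 + x)\<close> is expanded
  in powers of \<open>x\<close>.\<close>

lemma integral_power_ln:
  "integrable unif (\<lambda>x. x ^ n * (- ln x))" "(\<integral>x. x ^ n * (- ln x) \<partial>unif) = 1 / (real n + 1)\<^sup>2"
proof -
  let ?f = "\<lambda>x::real. x ^ n * (- ln x)"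
  define F where "F x = - (x ^ Suc n * ln x) / real (Suc n) + x ^ Suc n / (real (Suc n))\<^sup>2" for x :: real
  have DF: "DERIV F x :> ?f x" if x: "0 < x" for x
  proof -
    have d1: "((\<lambda>x. x ^ Suc n) has_real_derivative real (Suc n) * x ^ n) (at x)"
      using DERIV_pow[of "Suc n" x] by simp
    have "(F has_real_derivative - (real (Suc n) * x ^ n * ln x + (1 / x) * x ^ Suc n) / real (Suc n) + real (Suc n) * x ^ n / (real (Suc n))\<^sup>2) (at x)"
      unfolding F_def[abs_def] by (intro DERIV_add DERIV_cdivide DERIV_minus DERIV_mult d1 DERIV_ln_divide x)
    moreover have "- (N * P * l + (1 / x) * (x * P)) / N + N * P / N\<^sup>2 = P * (- l)" if "N \<noteq> 0" for N P l :: real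
      using that x by (simp add: field_simps power2_eq_square)
    ultimately show ?thesis by (simp only: power_Suc of_nat_neq_0 not_False_eq_True)
  qed
  have nn: "AE x in lborel. 0 < ereal x \<longrightarrow> ereal x < 1 \<longrightarrow> 0 \<le> ?f x"
    by (intro AE_I2) (auto intro: mult_nonneg_nonpos)
  have "((\<lambda>x::real. x * ln x) \<longlongrightarrow> 0) (at_right 0)" by real_asymp
  moreover have "F = (\<lambda>x. - (x ^ n * (x * ln x)) / real (Suc n) + x ^ Suc n / (real (Suc n))\<^sup>2)"
    by (rule ext) (simp add: F_def mult_ac)
  ultimately have "(F \<longlongrightarrow> - (0 ^ n * 0) / real (Suc n) + 0 ^ Suc n / (real (Suc n))\<^sup>2) (at_right 0)"
    by (simp only:) (intro tendsto_intros; simp)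
  then have L0: "(F \<longlongrightarrow> 0) (at_right 0)" by simp
  have "isCont F 1" by (rule DERIV_isCont[OF DF]) simp
  then have L1: "(F \<longlongrightarrow> F 1) (at_left 1)" by (simp add: continuous_at_imp_continuous_at_within continuous_within[symmetric])
  have A: "((F \<circ> real_of_ereal) \<longlongrightarrow> 0) (at_right (0::ereal))"
    using L0 unfolding zero_ereal_def ereal_tendsto_simps .
  have B: "((F \<circ> real_of_ereal) \<longlongrightarrow> F 1) (at_left (1::ereal))"
    using L1 unfolding one_ereal_def ereal_tendsto_simps .
  have P1: "(0::ereal) < 1" by simp
  have P2: "DERIV F x :> ?f x" if "0 < ereal x" "ereal x < 1" for x using that by (intro DF) simp
  have P3: "isCont ?f x" if "0 < ereal x" "ereal x < 1" for x using that by (intro continuous_intros) auto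
  note si = interval_integral_FTC_nonneg(1)[OF P1 P2 P3 nn A B]
  note li = interval_integral_FTC_nonneg(2)[OF P1 P2 P3 nn A B]
  have ei: "einterval 0 1 = {0<..<(1::real)}" by (auto simp: einterval_def)
  have ae: "AE x in lborel. indicator {0<..<1} x *\<^sub>R ?f x = indicator {0..1} x *\<^sub>R ?f x"
    using AE_lborel_singleton[of 0] AE_lborel_singleton[of 1] by eventually_elim (auto simp: indicator_def)
  show "integrable unif ?f"
    using si unfolding set_integrable_def ei by (subst integrable_unif_iff, simp, subst integrable_cong_AE[OF _ _ ae, symmetric]) auto
  have "(\<integral>x. ?f x \<partial>unif) = (\<integral>x. indicator {0<..<1} x *\<^sub>R ?f x \<partial>lborel)"
    by (subst integral_unif, simp, intro integral_cong_AE) (use ae in \<open>auto elim!: eventually_mono\<close>)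
  also have "\<dots> = F 1" using li by (simp add: interval_lebesgue_integral_def set_lebesgue_integral_def ei)
  finally show "(\<integral>x. ?f x \<partial>unif) = 1 / (real n + 1)\<^sup>2" by (simp add: F_def add.commute)
qed

text \<open>From the sum \<open>pi\<^sup>2 / 6\<close> of all terms those with even denominators, a
  quarter of it, are subtracted twice.\<close>

lemma alternating_inverse_squares: "(\<lambda>n. (- 1) ^ n * (1 / (real n + 1)\<^sup>2)) sums (pi\<^sup>2 / 12)"
proof -
  define b where "b n = (if odd n then 2 / (real n + 1)\<^sup>2 else 0)" for n
  have s: "(\<lambda>n. 1 / (real n + 1)\<^sup>2) sums (pi\<^sup>2 / 6)" using inverse_squares_sums by (simp add: add.commute)
  have "(\<lambda>k. b (2 * k + 1)) = (\<lambda>k. (1 / 2) * (1 / (real k + 1)\<^sup>2))"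
  proof (rule ext)
    fix k
    have "real (2 * k + 1) + 1 = 2 * (real k + 1)" by simp
    then have "b (2 * k + 1) = 2 / (2 * (real k + 1))\<^sup>2" unfolding b_def by (metis even_plus_one_iff even_mult_iff even_numeral)
    then show "b (2 * k + 1) = (1 / 2) * (1 / (real k + 1)\<^sup>2)" unfolding power_mult_distrib by simp
  qed
  then have "(\<lambda>k. b (2 * k + 1)) sums ((1 / 2) * (pi\<^sup>2 / 6))" using sums_mult[OF s, of "1/2"] by simp
  moreover have "((\<lambda>k. b (2 * k + 1)) sums ((1 / 2) * (pi\<^sup>2 / 6))) \<longleftrightarrow> (b sums ((1 / 2) * (pi\<^sup>2 / 6)))"
  proof (rule sums_mono_reindex)
    show "strict_mono (\<lambda>k::nat. 2 * k + 1)" by (simp add: strict_mono_def)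
    show "b n = 0" if "n \<notin> range (\<lambda>k. 2 * k + 1)" for n
      using that by (metis b_def oddE rangeI)
  qed
  ultimately have "b sums ((1 / 2) * (pi\<^sup>2 / 6))" by simp
  from sums_diff[OF s this] have "(\<lambda>n. 1 / (real n + 1)\<^sup>2 - b n) sums (pi\<^sup>2 / 12)" by simp
  moreover have "1 / (real n + 1)\<^sup>2 - b n = (- 1) ^ n * (1 / (real n + 1)\<^sup>2)" for n
    by (auto simp: b_def)
  ultimately show ?thesis by simp
qed

text \<open>Half of the entropy, because cylinder lengths are comparable to the square of
  \<open>exp (- gauss_log k x)\<close>. Exchanging series and integral is justified by the
  convergence of the sum of \<open>1 / (n + 1)\<^sup>2\<close>.\<close>

lemma gauss_entropy:
  "integrable unif (\<lambda>x. gauss_density x * (- ln x))"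
  "(\<integral>x. gauss_density x * (- ln x) \<partial>unif) = pi\<^sup>2 / (12 * ln 2)"
proof -
  let ?f = "\<lambda>n x::real. (- 1) ^ n * (x ^ n * (- ln x))"
  have i: "integrable unif (?f n)" for n using integral_power_ln(1)[of n] by (rule integrable_mult_right)
  have mem: "AE x in unif. 0 < x \<and> x < 1"
    using AE_irr by (rule eventually_mono) (auto simp: irr_def)
  have sm: "AE x in unif. summable (\<lambda>n. norm (?f n x))"
    using mem
  proof eventually_elim
    case (elim x)
    have "norm (?f n x) = x ^ n * \<bar>ln x\<bar>" for n using elim by (simp add: abs_mult)
    moreover have "summable (\<lambda>n. x ^ n * \<bar>ln x\<bar>)"
      using elim by (intro summable_mult2 summable_geometric) auto
    ultimately show ?case by (simp only:)
  qed
  have sn: "summable (\<lambda>n. \<integral>x. norm (?f n x) \<partial>unif)"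
  proof -
    have "(\<integral>x. norm (?f n x) \<partial>unif) = 1 / (real n + 1)\<^sup>2" for n
      unfolding integral_power_ln(2)[symmetric]
    proof (rule integral_cong_AE)
      show "AE x in unif. norm (?f n x) = x ^ n * (- ln x)"
        using mem by eventually_elim (auto simp: abs_mult)
    qed measurable
    then show ?thesis using inverse_squares_sums by (simp add: sums_iff add.commute)
  qed
  have ae: "AE x in unif. (\<Sum>n. ?f n x) = ln 2 * (gauss_density x * (- ln x))"
    using mem
  proof eventually_elim
    case (elim x)
    have "(\<lambda>n. (- x) ^ n) sums (1 / (1 - (- x)))" using elim by (intro geometric_sums) auto
    from sums_mult2[OF this, of "- ln x"] have "(\<lambda>n. (- x) ^ n * (- ln x)) sums (1 / (1 + x) * (- ln x))" by simp
    moreover have "(- x) ^ n * (- ln x) = ?f n x" for n unfolding power_minus[of x] by (simp only: mult.assoc)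
    ultimately have "(\<lambda>n. ?f n x) sums (1 / (1 + x) * (- ln x))" by (simp only:)
    from sums_unique[OF this] show ?case by (simp add: gauss_density_def)
  qed
  have iS: "integrable unif (\<lambda>x. \<Sum>n. ?f n x)" by (rule integrable_suminf[OF i sm sn])
  then have "integrable unif (\<lambda>x. ln 2 * (gauss_density x * (- ln x)))"
    by (subst integrable_cong_AE[OF _ _ ae, symmetric]) auto
  then have "integrable unif (\<lambda>x. (1 / ln 2) * (ln 2 * (gauss_density x * (- ln x))))" by (rule integrable_mult_right)
  then show "integrable unif (\<lambda>x. gauss_density x * (- ln x))" by simp
  have "(\<lambda>n. \<integral>x. ?f n x \<partial>unif) sums (\<integral>x. (\<Sum>n. ?f n x) \<partial>unif)" by (rule sums_integral[OF i sm sn])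
  moreover have "(\<integral>x. ?f n x \<partial>unif) = (- 1) ^ n * (1 / (real n + 1)\<^sup>2)" for n
    using integral_power_ln(2)[of n] by (simp only: integral_mult_right_zero)
  ultimately have "(\<integral>x. (\<Sum>n. ?f n x) \<partial>unif) = pi\<^sup>2 / 12"
    using alternating_inverse_squares sums_unique2 by (simp only:) blast
  moreover have "(\<integral>x. (\<Sum>n. ?f n x) \<partial>unif) = (\<integral>x. ln 2 * (gauss_density x * (- ln x)) \<partial>unif)"
    by (intro integral_cong_AE ae) auto
  ultimately have "ln 2 * (\<integral>x. gauss_density x * (- ln x) \<partial>unif) = pi\<^sup>2 / 12" by (simp only: integral_mult_right_zero)
  then show "(\<integral>x. gauss_density x * (- ln x) \<partial>unif) = pi\<^sup>2 / (12 * ln 2)" by (simp add: field_simps)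
qed

section \<open>Cylinder lengths of the Gauss map\<close>

lemma gauss_density_invariant_iter:
  fixes g :: "real \<Rightarrow> 'a::{banach, second_countable_topology}"
  assumes g[measurable]: "g \<in> borel_measurable borel" and gb: "\<And>x. x \<in> {0..1} \<Longrightarrow> norm (g x) \<le> B"
  shows "(\<integral>x. gauss_density x *\<^sub>R g ((gauss_map ^^ n) x) \<partial>unif) = (\<integral>x. gauss_density x *\<^sub>R g x \<partial>unif)"
proof (induction n)
  case (Suc n)
  have "(\<integral>x. gauss_density x *\<^sub>R (\<lambda>y. g ((gauss_map ^^ n) y)) (gauss_map x) \<partial>unif) = (\<integral>x. gauss_density x *\<^sub>R g ((gauss_map ^^ n) x) \<partial>unif)"
    using gb gauss_iter_range by (intro gauss_density_invariant[where B=B]) auto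
  then show ?case using Suc by (simp add: funpow_swap1)
qed simp

lemma osc_le_shift: "osc_le c f \<Longrightarrow> osc_le c (\<lambda>x. f x - m)"
  unfolding osc_le_def mono_on_def by auto

text \<open>Covariances decay like \<open>(1 / 2) ^ j\<close>, so each new term adds at most
  \<open>4 * c\<^sup>2\<close> for its own square and \<open>2 * (2 * c\<^sup>2)\<close> for its
  covariances with all earlier ones.\<close>

lemma gauss_variance:
  assumes f[measurable]: "f \<in> borel_measurable borel" and o: "osc_le c f"
  defines "m \<equiv> \<integral>x. gauss_density x * f x \<partial>unif"
  shows "(\<integral>x. gauss_density x * (\<Sum>i<k. f ((gauss_map ^^ i) x) - m)\<^sup>2 \<partial>unif) \<le> 8 * c\<^sup>2 * real k"
    and "x \<in> {0..1} \<Longrightarrow> \<bar>f x - m\<bar> \<le> 2 * c"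
proof -
  have c: "0 \<le> c" using osc_le_abs[OF o, of 0] by simp
  have gd: "0 \<le> gauss_density x" "\<bar>gauss_density x\<bar> \<le> 2" if "x \<in> {0..1}" for x
    using gauss_density_bounds[OF that] by auto
  have bint: "integrable unif (\<lambda>x. gauss_density x * F x)" if [measurable]: "F \<in> borel_measurable borel" and b: "\<And>x. x \<in> {0..1} \<Longrightarrow> \<bar>F x\<bar> \<le> B" for F B
  proof (rule integrable_unif_bounded[where C="2 * B"])
    show "norm (gauss_density x * F x) \<le> 2 * B" if "x \<in> {0..1}" for x
      unfolding real_norm_def abs_mult using gd[OF that] b[OF that] by (intro mult_mono) auto
  qed measurable
  have if0: "integrable unif (\<lambda>x. gauss_density x * f x)" using osc_le_bounded[OF o] by (intro bint) auto
  have igd: "integrable unif gauss_density" using bint[of "\<lambda>_. 1" 1] by simp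
  have mf: "\<bar>m - f 0\<bar> \<le> c"
  proof -
    have "m - f 0 = (\<integral>x. gauss_density x * f x - gauss_density x * f 0 \<partial>unif)"
      using if0 igd by (simp add: m_def gauss_density_integral)
    also have "\<bar>\<dots>\<bar> \<le> (\<integral>x. \<bar>gauss_density x * f x - gauss_density x * f 0\<bar> \<partial>unif)" by (rule integral_abs_bound)
    also have "\<dots> \<le> (\<integral>x. gauss_density x * c \<partial>unif)"
    proof (rule integral_mono_AE)
      show "AE x in unif. \<bar>gauss_density x * f x - gauss_density x * f 0\<bar> \<le> gauss_density x * c"
      proof (rule eventually_mono[OF AE_unif_mem])
        fix x :: real assume x: "x \<in> {0..1}"
        have "\<bar>gauss_density x * f x - gauss_density x * f 0\<bar> = gauss_density x * \<bar>f x - f 0\<bar>"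
          using gd[OF x] by (simp add: right_diff_distrib[symmetric] abs_mult)
        then show "\<bar>gauss_density x * f x - gauss_density x * f 0\<bar> \<le> gauss_density x * c"
          using gd[OF x] osc_le_abs[OF o x] by (simp add: mult_left_mono)
      qed
    qed (use if0 igd in auto)
    finally show ?thesis by (simp add: gauss_density_integral)
  qed
  have fb: "\<bar>f x - m\<bar> \<le> 2 * c" if "x \<in> {0..1}" for x using osc_le_abs[OF o that] mf by linarith
  then show "x \<in> {0..1} \<Longrightarrow> \<bar>f x - m\<bar> \<le> 2 * c" .
  let ?X = "\<lambda>i x. f ((gauss_map ^^ i) x) - m"
  have Xb: "\<bar>?X i x\<bar> \<le> 2 * c" if "x \<in> {0..1}" for i x using fb[OF gauss_iter_range[OF that]] .
  have g0: "(\<integral>x. gauss_density x *\<^sub>R (f x - m) \<partial>unif) = 0"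
    using if0 igd by (simp add: right_diff_distrib m_def[symmetric] gauss_density_integral)
  have cov: "(\<integral>x. gauss_density x * (?X i x * ?X j x) \<partial>unif) \<le> 2 * c\<^sup>2 * (1 / 2) ^ (j - i)" if ij: "i < j" for i j
  proof -
    define H where "H y = (f y - m) * (f ((gauss_map ^^ (j - i)) y) - m)" for y
    have [measurable]: "H \<in> borel_measurable borel" unfolding H_def[abs_def] by measurable
    have HX: "?X i x * ?X j x = H ((gauss_map ^^ i) x)" for x
    proof -
      have "(gauss_map ^^ j) x = (gauss_map ^^ (j - i)) ((gauss_map ^^ i) x)"
        using ij by (metis add.commute comp_apply funpow_add le_add_diff_inverse2 less_imp_le)
      then show ?thesis by (simp add: H_def)
    qed
    have Hb: "norm (H y) \<le> (2 * c) * (2 * c)" if "y \<in> {0..1}" for y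
      unfolding H_def real_norm_def abs_mult using fb[OF that] Xb[OF that, of "j - i"] c by (intro mult_mono) auto
    have "(\<integral>x. gauss_density x * (?X i x * ?X j x) \<partial>unif) = (\<integral>x. gauss_density x *\<^sub>R H ((gauss_map ^^ i) x) \<partial>unif)"
      unfolding HX by simp
    also have "\<dots> = (\<integral>x. gauss_density x *\<^sub>R H x \<partial>unif)" by (rule gauss_density_invariant_iter[OF _ Hb]) auto
    also have "\<dots> = (\<integral>x. (gauss_density x * (f x - m)) *\<^sub>R (f ((gauss_map ^^ (j - i)) x) - m) \<partial>unif)"
      by (simp add: H_def mult.assoc)
    also have "\<dots> \<le> norm (\<integral>x. (gauss_density x * (f x - m)) *\<^sub>R (f ((gauss_map ^^ (j - i)) x) - m) \<partial>unif)" by simp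
    also have "\<dots> \<le> c * (2 * c) * (1 / 2) ^ (j - i)"
      using gauss_mixing_monotone[of "\<lambda>x. f x - m" c "\<lambda>x. f x - m" "2 * c" "j - i"] osc_le_shift[OF o] fb g0 by auto
    finally show ?thesis by (simp add: power2_eq_square mult_ac)
  qed
  show "(\<integral>x. gauss_density x * (\<Sum>i<k. ?X i x)\<^sup>2 \<partial>unif) \<le> 8 * c\<^sup>2 * real k"
  proof (induction k)
    case (Suc k)
    have Sb: "\<bar>\<Sum>i<k. ?X i x\<bar> \<le> real k * (2 * c)" if "x \<in> {0..1}" for x
      using sum_norm_le[of "{..<k}" "\<lambda>i. ?X i x" "\<lambda>_. 2 * c"] Xb[OF that] by simp
    have i1: "integrable unif (\<lambda>x. gauss_density x * (\<Sum>i<k. ?X i x)\<^sup>2)"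
    proof (rule bint)
      show "\<bar>(\<Sum>i<k. ?X i x)\<^sup>2\<bar> \<le> (real k * (2 * c))\<^sup>2" if "x \<in> {0..1}" for x
        using power_mono[OF Sb[OF that], of 2] by simp
    qed measurable
    have i2: "integrable unif (\<lambda>x. gauss_density x * (?X i x * ?X j x))" for i j
    proof (rule bint)
      show "\<bar>?X i x * ?X j x\<bar> \<le> (2 * c) * (2 * c)" if "x \<in> {0..1}" for x
        unfolding abs_mult using Xb[OF that] c by (intro mult_mono) auto
    qed measurable
    have alg: "G * (S + y)\<^sup>2 = G * S\<^sup>2 + (2 * (G * (S * y)) + G * (y * y))" for G S y :: real
      by (simp add: power2_eq_square algebra_simps)
    have pull: "(\<Sum>i<k. gauss_density x * (?X i x * ?X k x)) = gauss_density x * ((\<Sum>i<k. ?X i x) * ?X k x)" for x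
      by (simp only: sum_distrib_left sum_distrib_right)
    have sq: "gauss_density x * (\<Sum>i<Suc k. ?X i x)\<^sup>2 = gauss_density x * (\<Sum>i<k. ?X i x)\<^sup>2 +
      (2 * (\<Sum>i<k. gauss_density x * (?X i x * ?X k x)) + gauss_density x * (?X k x * ?X k x))" for x
      unfolding pull sum.lessThan_Suc by (rule alg)
    have "(\<integral>x. gauss_density x * (\<Sum>i<Suc k. ?X i x)\<^sup>2 \<partial>unif) = (\<integral>x. gauss_density x * (\<Sum>i<k. ?X i x)\<^sup>2 \<partial>unif) +
      (2 * (\<Sum>i<k. \<integral>x. gauss_density x * (?X i x * ?X k x) \<partial>unif) + (\<integral>x. gauss_density x * (?X k x * ?X k x) \<partial>unif))"
      unfolding sq using i1 i2 by (simp add: Bochner_Integration.integral_sum)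
    moreover have "(\<Sum>i<k. \<integral>x. gauss_density x * (?X i x * ?X k x) \<partial>unif) \<le> 2 * c\<^sup>2"
    proof -
      have "(\<Sum>i<k. \<integral>x. gauss_density x * (?X i x * ?X k x) \<partial>unif) \<le> (\<Sum>i<k. 2 * c\<^sup>2 * (1 / 2) ^ (k - i))"
        by (intro sum_mono cov) auto
      also have "\<dots> = 2 * c\<^sup>2 * (\<Sum>i<k. (1 / 2) ^ (k - i))" by (simp add: sum_distrib_left)
      also have "(\<Sum>i<k. (1 / 2 :: real) ^ (k - i)) = (\<Sum>i<k. (1 / 2) ^ Suc i)"
        by (rule sum.reindex_bij_witness[of _ "\<lambda>i. k - Suc i" "\<lambda>i. k - Suc i"]) (auto simp: Suc_diff_Suc)
      also have "2 * c\<^sup>2 * (\<Sum>i<k. (1 / 2) ^ Suc i) \<le> 2 * c\<^sup>2 * 1"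
      proof (rule mult_left_mono)
        have "(\<Sum>i<k. (1 / 2 :: real) ^ Suc i) \<le> (\<Sum>i. (1 / 2) ^ Suc i)"
          using sums_summable[OF power_half_series] by (intro sum_le_suminf) auto
        then show "(\<Sum>i<k. (1 / 2 :: real) ^ Suc i) \<le> 1" using power_half_series by (simp add: sums_iff)
      qed simp
      finally show ?thesis by simp
    qed
    moreover have "(\<integral>x. gauss_density x * (?X k x * ?X k x) \<partial>unif) \<le> 4 * c\<^sup>2"
    proof -
      have "(\<integral>x. gauss_density x * (?X k x * ?X k x) \<partial>unif) \<le> (\<integral>x. gauss_density x * (4 * c\<^sup>2) \<partial>unif)"
      proof (rule integral_mono_AE)
        show "AE x in unif. gauss_density x * (?X k x * ?X k x) \<le> gauss_density x * (4 * c\<^sup>2)"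
        proof (rule eventually_mono[OF AE_unif_mem])
          fix x :: real assume x: "x \<in> {0..1}"
          have "?X k x * ?X k x = \<bar>?X k x\<bar> * \<bar>?X k x\<bar>" by simp
          also have "\<dots> \<le> (2 * c) * (2 * c)" using Xb[OF x] c by (intro mult_mono) auto
          also have "\<dots> = 4 * c\<^sup>2" by (simp add: power2_eq_square)
          finally show "gauss_density x * (?X k x * ?X k x) \<le> gauss_density x * (4 * c\<^sup>2)" using gd[OF x] by (intro mult_left_mono)
        qed
      qed (use i2 igd in auto)
      then show ?thesis by (simp add: gauss_density_integral)
    qed
    ultimately show ?case using Suc.IH by (simp add: algebra_simps)
  qed simp
qed

text \<open>The factor 16 in place of 8 comes from measuring with \<open>unif\<close>, which is at
  most twice the Gauss measure.\<close>

lemma gauss_chebyshev: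
  assumes f[measurable]: "f \<in> borel_measurable borel" and o: "osc_le c f" and t: "0 < t"
  defines "m \<equiv> \<integral>x. gauss_density x * f x \<partial>unif"
  shows "measure unif {x. t \<le> \<bar>\<Sum>i<k. f ((gauss_map ^^ i) x) - m\<bar>} \<le> 16 * c\<^sup>2 * real k / t\<^sup>2"
proof -
  define S where "S x = (\<Sum>i<k. f ((gauss_map ^^ i) x) - m)" for x
  have [measurable]: "S \<in> borel_measurable borel" unfolding S_def[abs_def] by measurable
  let ?A = "{x. t \<le> \<bar>S x\<bar>}"
  have Am[measurable]: "?A \<in> sets borel" by measurable
  have Sb: "\<bar>S x\<bar> \<le> real k * (2 * c)" if "x \<in> {0..1}" for x
    unfolding S_def using sum_norm_le[of "{..<k}" "\<lambda>i. f ((gauss_map ^^ i) x) - m" "\<lambda>_. 2 * c"]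
      gauss_variance(2)[OF f o gauss_iter_range[OF that]] by (simp add: m_def)
  have i: "integrable unif (\<lambda>x. 2 / t\<^sup>2 * (gauss_density x * (S x)\<^sup>2))"
  proof (intro integrable_mult_right integrable_unif_bounded[where C="2 * (real k * (2 * c))\<^sup>2"])
    fix x :: real assume x: "x \<in> {0..1}"
    have "\<bar>gauss_density x\<bar> \<le> 2" using gauss_density_bounds[OF x] by simp
    moreover have "(S x)\<^sup>2 \<le> (real k * (2 * c))\<^sup>2" using power_mono[OF Sb[OF x], of 2] by simp
    ultimately show "norm (gauss_density x * (S x)\<^sup>2) \<le> 2 * (real k * (2 * c))\<^sup>2"
      unfolding real_norm_def abs_mult by (intro mult_mono) auto
  qed measurable
  have "measure unif ?A = (\<integral>x. indicator ?A x \<partial>unif)" by simp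
  also have "\<dots> \<le> (\<integral>x. 2 / t\<^sup>2 * (gauss_density x * (S x)\<^sup>2) \<partial>unif)"
  proof (rule integral_mono_AE)
    show "integrable unif (indicat_real ?A)" by (intro integrable_unif_bounded[where C=1]) (auto simp: indicator_def)
    show "AE x in unif. indicat_real ?A x \<le> 2 / t\<^sup>2 * (gauss_density x * (S x)\<^sup>2)"
    proof (rule eventually_mono[OF AE_unif_mem])
      fix x :: real assume x: "x \<in> {0..1}"
      have g: "1 / 2 \<le> gauss_density x" using gauss_density_bounds[OF x] by simp
      show "indicat_real ?A x \<le> 2 / t\<^sup>2 * (gauss_density x * (S x)\<^sup>2)"
      proof (cases "x \<in> ?A")
        case True
        then have "t\<^sup>2 \<le> (S x)\<^sup>2" using t power_mono[of t "\<bar>S x\<bar>" 2] by simp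
        then have "1 / 2 * t\<^sup>2 \<le> gauss_density x * (S x)\<^sup>2" using g by (intro mult_mono) auto
        then have "2 / t\<^sup>2 * (1 / 2 * t\<^sup>2) \<le> 2 / t\<^sup>2 * (gauss_density x * (S x)\<^sup>2)" by (intro mult_left_mono) auto
        then show ?thesis using True t by simp
      next
        case False
        then show ?thesis using g by simp
      qed
    qed
  qed (rule i)
  also have "\<dots> = 2 / t\<^sup>2 * (\<integral>x. gauss_density x * (S x)\<^sup>2 \<partial>unif)" by simp
  also have "\<dots> \<le> 2 / t\<^sup>2 * (8 * c\<^sup>2 * real k)"
    unfolding S_def m_def by (intro mult_left_mono gauss_variance(1)[OF f o]) auto
  finally show ?thesis by (simp add: S_def)
qed

text \<open>\<open>- ln\<close> is unbounded and thus out of reach of \<open>gauss_variance\<close>.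
  The case \<open>x <= 0\<close> overrides \<open>ln 0 = 0\<close> and keeps the truncation
  decreasing on the closed interval.\<close>

definition trunc_log :: "real \<Rightarrow> real \<Rightarrow> real" where
  "trunc_log M x = max 0 (min M (if x \<le> 0 then M else - ln x))"

lemma trunc_log_borel [measurable]: "trunc_log M \<in> borel_measurable borel"
  unfolding trunc_log_def[abs_def] by measurable

lemma osc_le_trunc_log: "0 \<le> M \<Longrightarrow> osc_le M (trunc_log M)"
  unfolding osc_le_def
proof (intro disjI2 conjI mono_onI)
  fix x y :: real assume "x \<in> {0..1}" "y \<in> {0..1}" "x \<le> y"
  then consider "x = 0" | "0 < x" "0 < y" "ln x \<le> ln y" by fastforce
  then show "- trunc_log M x \<le> - trunc_log M y"
  proof cases
    case 2
    have "max 0 (min M (- l')) \<le> max 0 (min M (- l))" if "l \<le> l'" for l l' :: real using that by auto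
    from this[OF 2(3)] show ?thesis using 2(1,2) by (simp add: trunc_log_def)
  qed (auto simp: trunc_log_def)
qed (auto simp: trunc_log_def)

definition gauss_mean_log :: real where "gauss_mean_log = pi\<^sup>2 / (12 * ln 2)"

lemma gauss_log_deviation:
  assumes e: "0 < e"
  shows "\<exists>K. \<forall>k\<ge>1. measure unif {x. e * real k \<le> \<bar>gauss_log k x - gauss_mean_log * real k\<bar>} \<le> K / sqrt (real k)"
proof -
  \<comment> \<open>The level grows so slowly that its square is negligible against
    \<open>sqrt k\<close>, and yet an orbit point lies below \<open>exp (- M k)\<close> only with
    probability O(1 / k^2), so that all of the first \<open>k\<close> points stay above it up to O(1
    / k).\<close>
  define M where "M k = 2 * ln (real k) + 1" for k
  define m where "m k = (\<integral>x. gauss_density x * trunc_log (M k) x \<partial>unif)" for k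
  have M0: "0 \<le> M k" if "1 \<le> k" for k using that by (simp add: M_def)
  have "m \<longlonglongrightarrow> gauss_mean_log"
    unfolding m_def gauss_mean_log_def gauss_entropy(2)[symmetric]
  proof (rule integral_dominated_convergence[where w="\<lambda>x. gauss_density x * (- ln x)"])
    show "AE x in unif. (\<lambda>k. gauss_density x * trunc_log (M k) x) \<longlonglongrightarrow> gauss_density x * (- ln x)"
    proof (rule eventually_mono[OF AE_irr])
      fix x assume "x \<in> irr"
      then have x: "0 < x" "x < 1" by (auto simp: irr_def)
      have "filterlim M at_top sequentially" unfolding M_def by real_asymp
      then have "eventually (\<lambda>k. - ln x \<le> M k) sequentially" by (simp add: filterlim_at_top)
      then have "eventually (\<lambda>k. gauss_density x * trunc_log (M k) x = gauss_density x * (- ln x)) sequentially"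
        by eventually_elim (use x in \<open>auto simp: trunc_log_def\<close>)
      then show "(\<lambda>k. gauss_density x * trunc_log (M k) x) \<longlonglongrightarrow> gauss_density x * (- ln x)" by (rule tendsto_eventually)
    qed
    show "AE x in unif. norm (gauss_density x * trunc_log (M k) x) \<le> gauss_density x * (- ln x)" for k
    proof (rule eventually_mono[OF AE_irr])
      fix x assume "x \<in> irr"
      then have x: "0 < x" "x < 1" by (auto simp: irr_def)
      have "0 \<le> gauss_density x" using gauss_density_bounds[of x] x by simp
      moreover have "0 \<le> trunc_log (M k) x" "trunc_log (M k) x \<le> - ln x" using x by (auto simp: trunc_log_def)
      ultimately show "norm (gauss_density x * trunc_log (M k) x) \<le> gauss_density x * (- ln x)"
        using mult_left_mono[of "trunc_log (M k) x" "- ln x" "gauss_density x"] by (simp add: abs_mult)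
    qed
  qed (use gauss_entropy(1) in auto)
  then have "eventually (\<lambda>k. dist (m k) gauss_mean_log < e / 2) sequentially"
    using e by (intro tendstoD) auto
  then obtain k0 where k0: "\<And>k. k0 \<le> k \<Longrightarrow> \<bar>m k - gauss_mean_log\<bar> < e / 2"
    unfolding eventually_sequentially dist_real_def by blast
  have "(\<lambda>k. (2 * ln (real k) + 1)\<^sup>2 / sqrt (real k)) \<longlonglongrightarrow> 0" by real_asymp
  then have "Bseq (\<lambda>k. (2 * ln (real k) + 1)\<^sup>2 / sqrt (real k))" by (intro convergent_imp_Bseq convergentI)
  then obtain K1 where K1: "0 < K1" "\<And>k. norm ((2 * ln (real k) + 1)\<^sup>2 / sqrt (real k)) \<le> K1" unfolding Bseq_def by blast
  obtain Cn where Cn: "0 \<le> Cn" "\<And>n A. A \<in> sets borel \<Longrightarrow> measure unif ((gauss_map ^^ n) -` A) \<le> Cn * measure unif A"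
    using gauss.ex_nonsingular by blast
  \<comment> \<open>\<open>sqrt k0\<close> makes the claim trivial for \<open>k < k0\<close>, where
    the truncated mean need not yet be close to its limit.\<close>
  define K where "K = sqrt (real k0) + Cn + 64 / e\<^sup>2 * K1"
  show ?thesis
  proof (intro exI[of _ K] allI impI)
    fix k :: nat assume k: "1 \<le> k"
    let ?A = "{x. e * real k \<le> \<bar>gauss_log k x - gauss_mean_log * real k\<bar>}"
    have sk: "1 \<le> sqrt (real k)" using k by simp
    have sks: "sqrt (real k) \<le> real k" using real_sqrt_le_mono[of "real k" "real k * real k"] k by (simp add: real_sqrt_mult)
    show "measure unif ?A \<le> K / sqrt (real k)"
    proof (cases "k0 \<le> k")
      case False
      have "measure unif ?A \<le> 1" by simp
      also have "1 \<le> sqrt (real k0) / sqrt (real k)" using False k by simp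
      also have "\<dots> \<le> K / sqrt (real k)" unfolding K_def using Cn K1 e by (intro divide_right_mono) auto
      finally show ?thesis .
    next
      case True
      let ?U = "\<Union>i\<in>{..<k}. (gauss_map ^^ i) -` {0..exp (- M k)}"
      let ?V = "{x. e / 2 * real k \<le> \<bar>\<Sum>i<k. trunc_log (M k) ((gauss_map ^^ i) x) - m k\<bar>}"
      have Um: "(gauss_map ^^ i) -` {0..exp (- M k)} \<in> sets borel" for i
        using measurable_sets[OF gauss_iter_borel, of "{0..exp (- M k)}" i] by simp
      have U: "?U \<in> sets borel" using Um by auto
      have V: "?V \<in> sets borel" by measurable
      have "AE x in unif. x \<in> ?A \<longrightarrow> x \<in> ?U \<union> ?V"
      proof (rule eventually_mono[OF AE_irr], intro impI)
        fix x assume x: "x \<in> irr" and xA: "x \<in> ?A"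
        show "x \<in> ?U \<union> ?V"
        proof (rule ccontr)
          assume n: "x \<notin> ?U \<union> ?V"
          have "trunc_log (M k) ((gauss_map ^^ i) x) = - ln ((gauss_map ^^ i) x)" if "i < k" for i
          proof -
            have y: "0 < (gauss_map ^^ i) x" "(gauss_map ^^ i) x < 1" using irr_iter[OF x, of i] by (auto simp: irr_def)
            have "(gauss_map ^^ i) x \<notin> {0..exp (- M k)}" using n that by blast
            then have "exp (- M k) < (gauss_map ^^ i) x" using y by simp
            then have "- M k < ln ((gauss_map ^^ i) x)" using y ln_less_cancel_iff[of "exp (- M k)" "(gauss_map ^^ i) x"] by simp
            then show ?thesis using y by (simp add: trunc_log_def)
          qed
          then have "gauss_log k x = (\<Sum>i<k. trunc_log (M k) ((gauss_map ^^ i) x))" by (simp add: gauss_log_def)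
          then have "gauss_log k x - m k * real k = (\<Sum>i<k. trunc_log (M k) ((gauss_map ^^ i) x) - m k)" by (simp add: sum_subtractf mult.commute)
          moreover have "\<bar>\<Sum>i<k. trunc_log (M k) ((gauss_map ^^ i) x) - m k\<bar> < e / 2 * real k" using n by auto
          moreover have "\<bar>m k * real k - gauss_mean_log * real k\<bar> \<le> e / 2 * real k"
          proof -
            have "\<bar>m k * real k - gauss_mean_log * real k\<bar> = \<bar>m k - gauss_mean_log\<bar> * real k" by (simp add: abs_mult flip: left_diff_distrib)
            also have "\<dots> \<le> e / 2 * real k" using k0[OF True] by (intro mult_right_mono) auto
            finally show ?thesis .
          qed
          ultimately have "\<bar>gauss_log k x - gauss_mean_log * real k\<bar> < e * real k" by linarith
          with xA show False by simp
        qed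
      qed
      then have "measure unif ?A \<le> measure unif (?U \<union> ?V)"
        by (intro unif.finite_measure_mono_AE) (use U V in auto)
      also have "\<dots> \<le> measure unif ?U + measure unif ?V" using U V by (intro measure_Un_le) auto
      also have "measure unif ?U \<le> (\<Sum>i<k. measure unif ((gauss_map ^^ i) -` {0..exp (- M k)}))"
        using Um by (intro unif.finite_measure_subadditive_finite) auto
      also have "\<dots> \<le> (\<Sum>i<k. Cn * (1 / (real k)\<^sup>2))"
      proof (rule sum_mono)
        fix i
        have "measure unif ((gauss_map ^^ i) -` {0..exp (- M k)}) \<le> Cn * measure unif {0..exp (- M k)}" by (intro Cn) auto
        also have "\<dots> \<le> Cn * (exp (- M k) - 0)" by (intro mult_left_mono measure_unif_le Cn) auto
        also have "\<dots> \<le> Cn * (1 / (real k)\<^sup>2)"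
        proof (rule mult_left_mono[OF _ Cn(1)])
          have "exp (2 * ln (real k)) = (real k)\<^sup>2" using k by (simp add: exp_double)
          moreover have "- M k = - 1 - 2 * ln (real k)" by (simp add: M_def)
          ultimately have "exp (- M k) = exp (- 1) / (real k)\<^sup>2" by (simp only: exp_diff)
          then show "exp (- M k) - 0 \<le> 1 / (real k)\<^sup>2" by (simp add: divide_right_mono)
        qed
        finally show "measure unif ((gauss_map ^^ i) -` {0..exp (- M k)}) \<le> Cn * (1 / (real k)\<^sup>2)" .
      qed
      also have "\<dots> = Cn / real k" using k by (simp add: power2_eq_square)
      also have "\<dots> \<le> Cn / sqrt (real k)" using sk sks Cn by (intro divide_left_mono) auto
      also have "measure unif ?V \<le> 16 * (M k)\<^sup>2 * real k / (e / 2 * real k)\<^sup>2"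
        unfolding m_def using e k by (intro gauss_chebyshev osc_le_trunc_log M0) auto
      also have "\<dots> = 64 / e\<^sup>2 * ((M k)\<^sup>2 / sqrt (real k)) / sqrt (real k)"
        using k e by (simp add: power2_eq_square field_simps)
      also have "\<dots> \<le> 64 / e\<^sup>2 * K1 / sqrt (real k)"
      proof (intro divide_right_mono mult_left_mono)
        show "(M k)\<^sup>2 / sqrt (real k) \<le> K1" using K1(2)[of k] unfolding M_def by simp
      qed (use e in auto)
      also have "Cn / sqrt (real k) + 64 / e\<^sup>2 * K1 / sqrt (real k) \<le> K / sqrt (real k)"
        unfolding K_def add_divide_distrib using sk by simp
      finally show ?thesis by simp
    qed
  qed
qed

section \<open>The Gauss map as a system with cylinder representatives\<close>

theorem jsys_gauss: "jsys gauss_map gauss_density (pi\<^sup>2 / (6 * ln 2))"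
proof
  have h: "pi\<^sup>2 / (6 * ln 2) = 2 * gauss_mean_log" by (simp add: gauss_mean_log_def)
  show "0 < pi\<^sup>2 / (6 * ln (2::real))" by simp
  \<comment> \<open>An interior point of the unit interval, so that its images under inverse
    branches avoid the end points and \<open>iter_gauss_branch\<close> applies.\<close>
  let ?r = "\<lambda>k x. gauss_branch k x (1 / 2)"
  have half: "(1 / 2 :: real) \<in> {0..1}" by simp
  have p1: "cylinder_points ?r" unfolding cylinder_points_def
    using gauss_branch_borel gauss_branch_range[OF half] by blast
  have p2: "cylinder_mixing gauss_map gauss_density ?r 6 (1 / 2)" unfolding cylinder_mixing_def
  proof (intro allI impI)
    fix Z g :: "real \<Rightarrow> complex" and k j
    assume Z: "Z \<in> borel_measurable borel" and g[measurable]: "g \<in> borel_measurable borel"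
      and Z1: "\<forall>x. norm (Z x) \<le> 1" and g1: "\<forall>x. norm (g x) \<le> 1" and g0: "(\<integral>x. gauss_density x *\<^sub>R g x \<partial>unif) = 0"
    \<comment> \<open>\<open>rho 0\<close> is the constant density 1, so this is a statement about
      \<open>unif\<close>.\<close>
    have "norm (\<integral>x. rho 0 x *\<^sub>R (Z (?r k x) * (\<lambda>y. g ((gauss_map ^^ j) y)) ((gauss_map ^^ k) x)) \<partial>unif) \<le> 6 * (1 / 2) ^ j"
      using rho_mixing[OF g _ g0] g1 Z Z1 by (intro gauss_cylinder_integral) auto
    then show "norm (\<integral>x. Z (?r k x) * g ((gauss_map ^^ (k + j)) x) \<partial>unif) \<le> 6 * (1 / 2) ^ j"
      by (simp add: rho_def add.commute[of k j] funpow_add)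
  qed
  have diff: "\<bar>x - gauss_branch k x v\<bar> = \<bar>(gauss_map ^^ k) x - v\<bar> * gauss_contr k x ((gauss_map ^^ k) x) * gauss_contr k x v"
    if "x \<in> irr" "v \<in> {0..1}" for x v k
    using gauss_branch_diff[of v "(gauss_map ^^ k) x" k x] gauss_branch_iter[OF that(1), of k] irr_mem[OF irr_iter[OF that(1), of k]] that(2)
    by simp
  have p3: "cylinder_size (pi\<^sup>2 / (6 * ln 2)) ?r" unfolding cylinder_size_def h
  proof (intro allI impI)
    fix \<epsilon> :: real assume e: "0 < \<epsilon>"
    then obtain K where K: "\<And>k. 1 \<le> k \<Longrightarrow> measure unif {x. \<epsilon> / 2 * real k \<le> \<bar>gauss_log k x - gauss_mean_log * real k\<bar>} \<le> K / sqrt (real k)"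
      using gauss_log_deviation[of "\<epsilon> / 2"] by auto
    have "measure unif {x. exp (- (2 * gauss_mean_log - \<epsilon>) * real k) < \<bar>x - ?r k x\<bar>} \<le> K / sqrt (real k)" if k: "1 \<le> k" for k
    proof -
      have "AE x in unif. exp (- (2 * gauss_mean_log - \<epsilon>) * real k) < \<bar>x - ?r k x\<bar> \<longrightarrow> \<epsilon> / 2 * real k \<le> \<bar>gauss_log k x - gauss_mean_log * real k\<bar>"
      proof (rule eventually_mono[OF AE_irr], intro impI)
        fix x assume x: "x \<in> irr" and lt: "exp (- (2 * gauss_mean_log - \<epsilon>) * real k) < \<bar>x - ?r k x\<bar>"
        let ?u = "(gauss_map ^^ k) x"
        have u: "?u \<in> {0..1}" using irr_mem[OF irr_iter[OF x]] .
        have ce: "gauss_contr k x ?u = exp (- gauss_log k x)" by (rule gauss_contr_iter[OF x])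
        \<comment> \<open>Distortion replaces the contraction at the midpoint by that at the orbit
          point; a cylinder that is too long thus forces \<open>gauss_log\<close> to deviate from
          its mean.\<close>
        have "\<bar>x - ?r k x\<bar> = \<bar>?u - 1 / 2\<bar> * exp (- gauss_log k x) * gauss_contr k x (1 / 2)"
          using diff[OF x half, of k] ce by simp
        also have "\<dots> \<le> 1 / 2 * exp (- gauss_log k x) * (2 * exp (- gauss_log k x))"
        proof (intro mult_mono)
          show "\<bar>?u - 1 / 2\<bar> \<le> 1 / 2" using u by (simp only: atLeastAtMost_iff abs_le_iff) linarith
          show "gauss_contr k x (1 / 2) \<le> 2 * exp (- gauss_log k x)" using gauss_distortion[OF u half, of k x] ce by simp
        qed (use gauss_contr_pos[OF half, of k x] in auto)
        also have "\<dots> = exp (- 2 * gauss_log k x)" by (simp add: exp_double flip: exp_add)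
        finally have "- (2 * gauss_mean_log - \<epsilon>) * real k < - 2 * gauss_log k x" using lt by (meson exp_less_cancel_iff less_le_trans)
        then have "gauss_log k x - gauss_mean_log * real k \<le> - (\<epsilon> / 2 * real k)" by (simp add: algebra_simps)
        then show "\<epsilon> / 2 * real k \<le> \<bar>gauss_log k x - gauss_mean_log * real k\<bar>" by linarith
      qed
      then have "measure unif {x. exp (- (2 * gauss_mean_log - \<epsilon>) * real k) < \<bar>x - ?r k x\<bar>} \<le> measure unif {x. \<epsilon> / 2 * real k \<le> \<bar>gauss_log k x - gauss_mean_log * real k\<bar>}"
        by (intro unif.finite_measure_mono_AE) auto
      then show ?thesis using K[OF k] by linarith
    qed
    then show "\<exists>K. \<forall>k\<ge>1. measure unif {x. exp (- (2 * gauss_mean_log - \<epsilon>) * real k) < \<bar>x - ?r k x\<bar>} \<le> K / sqrt (real k)" by blast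
  qed
  have p4: "cylinder_contraction gauss_map ?r 6 (1 / 2)" unfolding cylinder_contraction_def
  proof (intro allI impI)
    fix k n :: nat assume nk: "n \<le> k"
    show "AE x in unif. \<bar>(gauss_map ^^ n) x - (gauss_map ^^ n) (?r k x)\<bar> \<le> 6 * (1 / 2) ^ (k - n)"
    proof (rule eventually_mono[OF AE_irr])
      fix x assume x: "x \<in> irr"
      let ?y = "(gauss_map ^^ n) x"
      have y: "?y \<in> irr" by (rule irr_iter[OF x])
      let ?d = "k - n" let ?u = "(gauss_map ^^ ?d) ?y"
      have u: "?u \<in> {0..1}" using irr_mem[OF irr_iter[OF y]] .
      have "(gauss_map ^^ n) (?r k x) = ?r ?d ?y" by (rule iter_gauss_branch[OF _ _ nk]) auto
      then have "\<bar>?y - (gauss_map ^^ n) (?r k x)\<bar> = \<bar>?u - 1 / 2\<bar> * gauss_contr ?d ?y ?u * gauss_contr ?d ?y (1 / 2)"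
        using diff[OF y half, of ?d] by simp
      also have "\<dots> \<le> 1 * gauss_contr ?d ?y ?u * (2 * gauss_contr ?d ?y ?u)"
      proof (intro mult_mono)
        show "\<bar>?u - 1 / 2\<bar> \<le> 1" using u by (simp only: atLeastAtMost_iff abs_le_iff) linarith
        show "gauss_contr ?d ?y (1 / 2) \<le> 2 * gauss_contr ?d ?y ?u" by (rule gauss_distortion[OF u half])
      qed (use gauss_contr_pos[OF half, of ?d ?y] gauss_contr_pos[OF u, of ?d ?y] in auto)
      also have "\<dots> = 2 * (gauss_contr ?d ?y ?u)\<^sup>2" by (simp add: power2_eq_square)
      also have "\<dots> \<le> 2 * (2 * (1 / 2) ^ ?d)" by (intro mult_left_mono gauss_contr_small u) auto
      also have "\<dots> \<le> 6 * (1 / 2) ^ ?d" by simp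
      finally show "\<bar>?y - (gauss_map ^^ n) (?r k x)\<bar> \<le> 6 * (1 / 2) ^ (k - n)" .
    qed
  qed
  show "\<exists>r C \<theta>. 0 < \<theta> \<and> \<theta> < 1 \<and> 0 \<le> C \<and> cylinder_points r \<and> cylinder_mixing gauss_map gauss_density r C \<theta> \<and>
      cylinder_size (pi\<^sup>2 / (6 * ln 2)) r \<and> cylinder_contraction gauss_map r C \<theta>"
    using p1 p2 p3 p4 by (intro exI[of _ ?r] exI[of _ 6] exI[of _ "1 / 2"]) auto
next
  have h: "pi\<^sup>2 / (6 * ln 2) = 2 * gauss_mean_log" by (simp add: gauss_mean_log_def)
  fix \<epsilon> :: real and D :: "real set" assume e: "0 < \<epsilon>" and D: "finite D"
  then obtain K where K: "\<And>k. 1 \<le> k \<Longrightarrow> measure unif {x. \<epsilon> / 2 * real k \<le> \<bar>gauss_log k x - gauss_mean_log * real k\<bar>} \<le> K / sqrt (real k)"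
    using gauss_log_deviation[of "\<epsilon> / 2"] by auto
  have Kp: "0 \<le> K" using order_trans[OF measure_nonneg K[of 1]] by simp
  obtain Cn where Cn: "0 \<le> Cn" "\<And>n A. A \<in> sets borel \<Longrightarrow> measure unif ((gauss_map ^^ n) -` A) \<le> Cn * measure unif A"
    using gauss.ex_nonsingular by blast
  \<comment> \<open>The end points join \<open>D\<close> so that the companion point of
    \<open>gauss_companion\<close> cannot be one of them.\<close>
  define P where "P = D \<union> {0, 1}"
  have P: "finite P" using D by (simp add: P_def)
  define L where "L = max K (Cn * (4 * real (card P)))"
  show "\<exists>K. \<forall>m\<ge>1. \<forall>\<delta>\<ge>0. \<exists>B\<in>sets borel.
      measure unif B \<le> K * (exp ((pi\<^sup>2 / (6 * ln 2) + \<epsilon>) * real m) * \<delta> + 1 / sqrt (real m)) \<and>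
      (\<forall>x\<in>{0..1} - B. \<forall>y\<in>{0..1}. \<bar>y - x\<bar> \<le> \<delta> \<longrightarrow> closed_segment ((gauss_map ^^ m) x) ((gauss_map ^^ m) y) \<inter> D = {})"
    unfolding h
  proof (intro exI[of _ L] allI impI)
    fix m :: nat and \<delta> :: real assume m: "1 \<le> m" and \<delta>: "0 \<le> \<delta>"
    define E where "E = exp ((2 * gauss_mean_log + \<epsilon>) * real m)"
    define \<eta> where "\<eta> = 2 * E * \<delta>"
    have \<eta>: "0 \<le> \<eta>" using \<delta> by (simp add: \<eta>_def E_def)
    define B1 where "B1 = {x. \<epsilon> / 2 * real m \<le> \<bar>gauss_log m x - gauss_mean_log * real m\<bar>}"
    define B2 where "B2 = (gauss_map ^^ m) -` nbhd P \<eta>"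
    define B where "B = B1 \<union> B2 \<union> - irr"
    have irrm[measurable]: "irr \<in> sets borel" unfolding irr_def by (intro sets.Diff) (auto intro: sets.countable countable_rat)
    have B1[measurable]: "B1 \<in> sets borel" unfolding B1_def by measurable
    have B2[measurable]: "B2 \<in> sets borel" unfolding B2_def using measurable_sets[OF gauss_iter_borel nbhd_borel[OF P]] by simp
    have Bm: "B \<in> sets borel" unfolding B_def by auto
    have "AE x in unif. x \<in> B \<longrightarrow> x \<in> B1 \<union> B2" using AE_irr by (rule eventually_mono) (auto simp: B_def)
    then have "measure unif B \<le> measure unif (B1 \<union> B2)" using Bm by (intro unif.finite_measure_mono_AE) auto
    also have "\<dots> \<le> measure unif B1 + measure unif B2" by (intro measure_Un_le) auto
    also have "measure unif B1 \<le> K / sqrt (real m)" unfolding B1_def by (rule K[OF m])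
    also have "\<dots> \<le> L * (1 / sqrt (real m))" by (simp add: L_def divide_right_mono)
    also have "measure unif B2 \<le> Cn * measure unif (nbhd P \<eta>)" unfolding B2_def by (intro Cn nbhd_borel P)
    also have "\<dots> \<le> Cn * (2 * real (card P) * \<eta>)" by (intro mult_left_mono measure_nbhd_le P \<eta> Cn)
    also have "\<dots> = Cn * (4 * real (card P)) * (E * \<delta>)" by (simp add: \<eta>_def)
    also have "\<dots> \<le> L * (E * \<delta>)" using \<delta> by (intro mult_right_mono) (auto simp: L_def E_def)
    finally have mB: "measure unif B \<le> L * (E * \<delta> + 1 / sqrt (real m))" by (simp add: distrib_left add.commute)
    have seg: "closed_segment ((gauss_map ^^ m) x) ((gauss_map ^^ m) y) \<inter> D = {}"
      if x: "x \<in> {0..1} - B" and y: "y \<in> {0..1}" and d: "\<bar>y - x\<bar> \<le> \<delta>" for x y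
    proof -
      have xi: "x \<in> irr" using x by (auto simp: B_def)
      let ?u = "(gauss_map ^^ m) x"
      have u: "?u \<in> {0..1}" using irr_mem[OF irr_iter[OF xi]] .
      have nu: "?u \<notin> nbhd P \<eta>" using x by (auto simp: B_def B2_def)
      have "\<bar>gauss_log m x - gauss_mean_log * real m\<bar> < \<epsilon> / 2 * real m" using x by (auto simp: B_def B1_def)
      then have "gauss_log m x - gauss_mean_log * real m < \<epsilon> / 2 * real m" by linarith
      then have "2 * gauss_log m x \<le> (2 * gauss_mean_log + \<epsilon>) * real m" by (simp add: algebra_simps)
      then have EE: "exp (2 * gauss_log m x) \<le> E" by (simp add: E_def)
      obtain v where v: "v \<in> {0..1}" "gauss_branch m x v \<in> closed_segment x y" "v = (gauss_map ^^ m) y \<or> v \<in> {0, 1}"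
        using gauss_companion[OF xi y, of m] by blast
      have ce: "gauss_contr m x ?u = exp (- gauss_log m x)" by (rule gauss_contr_iter[OF xi])
      \<comment> \<open>\<open>gauss_branch_diff\<close> read backwards: the branch magnifies the
        distance of \<open>x\<close> and \<open>y\<close> by at most
        \<open>2 * exp (2 * gauss_log m x)\<close>, which \<open>E\<close> controls outside
        \<open>B1\<close>.\<close>
      have "\<bar>?u - v\<bar> * exp (- gauss_log m x) * (exp (- gauss_log m x) / 2) \<le> \<bar>?u - v\<bar> * exp (- gauss_log m x) * gauss_contr m x v"
        using gauss_distortion[OF v(1) u, of m x] ce by (intro mult_left_mono) auto
      also have "\<dots> = \<bar>x - gauss_branch m x v\<bar>"
        using gauss_branch_diff[OF v(1) u, of m x] gauss_branch_iter[OF xi, of m] ce by simp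
      also have "\<dots> \<le> \<bar>y - x\<bar>" using v(2) by (auto simp: closed_segment_eq_real_ivl split: if_splits)
      finally have "\<bar>?u - v\<bar> * exp (- gauss_log m x) * (exp (- gauss_log m x) / 2) \<le> \<delta>" using d by linarith
      then have "(\<bar>?u - v\<bar> * exp (- gauss_log m x) * (exp (- gauss_log m x) / 2)) * (2 * exp (2 * gauss_log m x)) \<le> \<delta> * (2 * exp (2 * gauss_log m x))"
        by (intro mult_right_mono) auto
      also have "(\<bar>?u - v\<bar> * exp (- gauss_log m x) * (exp (- gauss_log m x) / 2)) * (2 * exp (2 * gauss_log m x)) = \<bar>?u - v\<bar>"
        by (simp add: exp_double exp_minus power2_eq_square field_simps)
      also have "\<delta> * (2 * exp (2 * gauss_log m x)) \<le> \<delta> * (2 * E)" using EE \<delta> by (intro mult_left_mono) auto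
      finally have uv: "\<bar>?u - v\<bar> \<le> \<eta>" by (simp add: \<eta>_def mult_ac)
      have "v \<notin> {0, 1}" using uv nu by (auto simp: mem_nbhd P_def)
      then have "v = (gauss_map ^^ m) y" using v(3) by blast
      then have "\<bar>(gauss_map ^^ m) y - ?u\<bar> \<le> \<eta>" using uv by (simp add: abs_minus_commute)
      from closed_segment_avoids_far_set[OF nu this] show ?thesis by (auto simp: P_def)
    qed
    show "\<exists>B\<in>sets borel. measure unif B \<le> L * (exp ((2 * gauss_mean_log + \<epsilon>) * real m) * \<delta> + 1 / sqrt (real m)) \<and>
        (\<forall>x\<in>{0..1} - B. \<forall>y\<in>{0..1}. \<bar>y - x\<bar> \<le> \<delta> \<longrightarrow> closed_segment ((gauss_map ^^ m) x) ((gauss_map ^^ m) y) \<inter> D = {})"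
      using Bm mB seg unfolding E_def by blast
  qed
qed

section \<open>Transfer to Lebesgue measurable functions\<close>

lemma leb01_Int: "{0..1::real} \<inter> space lebesgue \<in> sets lebesgue"
  by simp

lemma AE_leb01_iff: "(AE x in leb01. P x) \<longleftrightarrow> (AE x in unif. P x)"
  unfolding AE_restrict_space_iff[OF leb01_Int] AE_completion_iff AE_unif_iff ..

lemma space_leb01: "space leb01 = {0..1}"
  by (simp add: space_restrict_space)

lemma borel_measurable_leb01: "f \<in> borel_measurable borel \<Longrightarrow> f \<in> borel_measurable leb01"
  by (intro measurable_restrict_space1 measurable_completion) simp

lemma sets_leb01_borel:
  assumes "A \<in> sets borel"
  shows "A \<inter> {0..1} \<in> sets leb01"
proof -
  have "A \<in> sets lebesgue" using assms by (simp add: sets_completionI_sets)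
  then show ?thesis unfolding sets_restrict_space by (rule image_eqI[rotated]) auto
qed

lemma nn_integral_leb01: "(\<integral>\<^sup>+x. f x \<partial>leb01) = (\<integral>\<^sup>+x. indicator {0..1} x * f x \<partial>lborel)"
  by (subst nn_integral_restrict_space[OF leb01_Int]) (simp add: nn_integral_completion mult.commute)

lemma nn_integral_leb01_unif:
  assumes [measurable]: "f \<in> borel_measurable borel"
  shows "(\<integral>\<^sup>+x. f x \<partial>leb01) = (\<integral>\<^sup>+x. f x \<partial>unif)"
  unfolding nn_integral_leb01 unif_def by (subst nn_integral_density) auto

lemma integral_leb01_unif:
  fixes f :: "real \<Rightarrow> 'a::{banach, second_countable_topology}"
  assumes [measurable]: "f \<in> borel_measurable borel"
  shows "(\<integral>x. f x \<partial>leb01) = (\<integral>x. f x \<partial>unif)"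
  unfolding integral_restrict_space[OF leb01_Int] by (subst integral_completion) (auto simp: integral_unif)

lemma finite_measure_leb01: "finite_measure leb01"
  by (rule finite_measure_lebesgue_on) simp

lemma ex_borel_set_leb01:
  assumes "A \<in> sets leb01"
  shows "\<exists>B\<in>sets borel. AE x in unif. x \<in> A \<longleftrightarrow> x \<in> B"
proof -
  have "A \<in> sets lebesgue" using assms by (auto simp: sets_restrict_space)
  then obtain S N N' where A: "A = S \<union> N" "N \<subseteq> N'" "N' \<in> null_sets lborel" "S \<in> sets lborel"
    by (rule sets_completionE)
  have "AE x in unif. x \<notin> N'" unfolding AE_unif_iff using AE_not_in[OF A(3)] by (rule eventually_mono) simp
  then have "AE x in unif. x \<in> A \<longleftrightarrow> x \<in> S" by (rule eventually_mono) (use A in auto)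
  then show ?thesis using A(4) by auto
qed

lemma ex_borel_fun_leb01:
  fixes f :: "real \<Rightarrow> complex"
  assumes "f \<in> Linfty leb01"
  shows "\<exists>f' C. f' \<in> borel_measurable borel \<and> 1 \<le> C \<and> (\<forall>x. norm (f' x) \<le> C) \<and> (AE x in unif. f x = f' x)"
proof -
  obtain C where f: "f \<in> borel_measurable leb01" and C: "AE x in leb01. norm (f x) \<le> C" using assms by (auto simp: Linfty_def)
  let ?g = "\<lambda>x. indicator {0..1} x *\<^sub>R f x"
  have g: "?g \<in> borel_measurable lebesgue"
    using f by (subst (asm) borel_measurable_restrict_space_iff[OF leb01_Int])
  then have m: "(\<lambda>x. Re (?g x)) \<in> borel_measurable lebesgue" "(\<lambda>x. Im (?g x)) \<in> borel_measurable lebesgue" by measurable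
  obtain u where u: "u \<in> borel_measurable lborel" "AE x in lborel. Re (?g x) = u x"
    using completion_ex_borel_measurable_real[OF m(1)] by blast
  obtain v where v: "v \<in> borel_measurable lborel" "AE x in lborel. Im (?g x) = v x"
    using completion_ex_borel_measurable_real[OF m(2)] by blast
  have uv[measurable]: "u \<in> borel_measurable borel" "v \<in> borel_measurable borel" using u v by simp_all
  note ae = u(2) v(2)
  define C' where "C' = max 1 C"
  define f' where "f' x = (if norm (Complex (u x) (v x)) \<le> C' then Complex (u x) (v x) else 0)" for x
  have [measurable]: "(\<lambda>x. Complex (u x) (v x)) \<in> borel_measurable borel"
  proof -
    have "(\<lambda>x. complex_of_real (u x) + \<i> * complex_of_real (v x)) \<in> borel_measurable borel" using uv by measurable
    then show ?thesis by (simp add: Complex_eq)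
  qed
  have "f' \<in> borel_measurable borel" unfolding f'_def by measurable
  moreover have "norm (f' x) \<le> C'" for x by (auto simp: f'_def C'_def)
  moreover have "AE x in unif. f x = f' x"
  proof -
    have "AE x in unif. Re (?g x) = u x \<and> Im (?g x) = v x"
      unfolding AE_unif_iff using ae by eventually_elim auto
    moreover have "AE x in unif. norm (f x) \<le> C" using C unfolding AE_leb01_iff .
    ultimately show ?thesis using AE_unif_mem
    proof eventually_elim
      case (elim x)
      then have "f x = Complex (u x) (v x)" by (simp add: complex_eq_iff)
      then show ?case using elim(2) by (simp add: f'_def C'_def)
    qed
  qed
  moreover have "1 \<le> C'" by (simp add: C'_def)
  ultimately show ?thesis by blast
qed

context acim
begin

text \<open>Preimages of null sets are null, so functions may be replaced by almost everywhere equal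
  ones along whole orbits.\<close>

lemma AE_iter:
  assumes "AE x in unif. P x"
  shows "AE x in unif. P ((T ^^ n) x)"
proof -
  obtain N where N: "{x \<in> space unif. \<not> P x} \<subseteq> N" "emeasure unif N = 0" "N \<in> sets unif" using assms by (rule AE_E)
  have Nb: "N \<in> sets borel" using N(3) by simp
  obtain C where "measure unif ((T ^^ n) -` N) \<le> C * measure unif N" using ex_nonsingular Nb by blast
  moreover have "measure unif N = 0" using N by (simp add: measure_def)
  ultimately have "measure unif ((T ^^ n) -` N) = 0" by (simp add: measure_le_0_iff)
  moreover have "(T ^^ n) -` N \<in> sets unif" using measurable_sets[OF iter_borel Nb, of n] by simp
  ultimately have "(T ^^ n) -` N \<in> null_sets unif" by (simp add: null_sets_def unif.emeasure_eq_measure)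
  then have "AE x in unif. x \<notin> (T ^^ n) -` N" by (rule AE_not_in)
  then show ?thesis by (rule eventually_mono) (use N(1) in auto)
qed

text \<open>Borel maps need not respect the completion. This one does: a Lebesgue set is almost a
  Borel set, and the preimage of the null difference is null.\<close>

lemma T_measurable_leb01: "T \<in> measurable leb01 leb01"
proof (rule measurableI)
  fix x assume "x \<in> space leb01" then show "T x \<in> space leb01" using T_mem by (simp add: space_leb01)
next
  fix A assume "A \<in> sets leb01"
  then obtain B where B: "B \<in> sets borel" "AE x in unif. x \<in> A \<longleftrightarrow> x \<in> B" using ex_borel_set_leb01 by blast
  have TB: "T -` B \<in> sets borel" using measurable_sets[OF T_borel B(1)] by simp
  have "AE x in unif. T x \<in> A \<longleftrightarrow> T x \<in> B" using AE_iter[OF B(2), of 1] by simp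
  then have "AE x in lborel. x \<in> {0..1} \<longrightarrow> (T x \<in> A \<longleftrightarrow> T x \<in> B)" unfolding AE_unif_iff .
  then obtain N where N: "{x \<in> space lborel. \<not> (x \<in> {0..1} \<longrightarrow> (T x \<in> A \<longleftrightarrow> T x \<in> B))} \<subseteq> N" "emeasure lborel N = 0" "N \<in> sets lborel"
    by (rule AE_E)
  have Nn: "N \<in> null_sets lborel" using N by (simp add: null_sets_def)
  let ?D = "T -` A \<inter> {0..1}"
  have "?D - T -` B \<subseteq> N" "(T -` B \<inter> {0..1}) - ?D \<subseteq> N" using N(1) by auto
  then have s: "?D - T -` B \<in> sets lebesgue" "(T -` B \<inter> {0..1}) - ?D \<in> sets lebesgue"
    using sets_completionI_sub[OF Nn] by auto
  have "T -` B \<inter> {0..1} \<in> sets lebesgue" using TB by (intro sets_completionI_sets) auto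
  moreover have "?D = ((T -` B \<inter> {0..1}) - ((T -` B \<inter> {0..1}) - ?D)) \<union> (?D - T -` B)" by auto
  ultimately have "?D \<in> sets lebesgue" using s by (metis sets.Diff sets.Un)
  then show "T -` A \<inter> space leb01 \<in> sets leb01"
    unfolding space_leb01 by (auto simp: sets_restrict_space intro: image_eqI[of _ _ ?D])
qed

definition leb_measure :: "real measure" where
  "leb_measure = density leb01 (\<lambda>x. ennreal (w x))"

lemma sets_leb_measure [simp, measurable_cong]: "sets leb_measure = sets leb01"
  by (simp add: leb_measure_def)

lemma space_leb_measure: "space leb_measure = {0..1}"
  by (simp add: leb_measure_def space_leb01)

lemma w_leb01 [measurable]: "w \<in> borel_measurable leb01"
  by (rule borel_measurable_leb01) simp

lemma integral_leb_measure:
  fixes f f' :: "real \<Rightarrow> 'b::{banach, second_countable_topology}"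
  assumes f: "f \<in> borel_measurable leb01" and f': "f' \<in> borel_measurable borel" and ae: "AE x in unif. f x = f' x"
  shows "(\<integral>x. f x \<partial>leb_measure) = (\<integral>x. w x *\<^sub>R f' x \<partial>unif)"
proof -
  have "(\<integral>x. f x \<partial>leb_measure) = (\<integral>x. w x *\<^sub>R f x \<partial>leb01)"
    unfolding leb_measure_def using AE_w_nonneg f unfolding AE_leb01_iff[symmetric] by (intro integral_density) auto
  also have "\<dots> = (\<integral>x. w x *\<^sub>R f' x \<partial>leb01)"
    using ae f borel_measurable_leb01[OF f'] unfolding AE_leb01_iff[symmetric]
    by (intro integral_cong_AE) (auto elim!: eventually_mono)
  also have "\<dots> = (\<integral>x. w x *\<^sub>R f' x \<partial>unif)" using f' by (intro integral_leb01_unif) auto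
  finally show ?thesis .
qed

lemma emeasure_leb_measure:
  assumes A: "A \<in> sets leb01" and B: "B \<in> sets borel" and ae: "AE x in unif. x \<in> A \<longleftrightarrow> x \<in> B"
  shows "emeasure leb_measure A = emeasure \<mu> B"
proof -
  have "emeasure leb_measure A = (\<integral>\<^sup>+x. ennreal (w x) * indicator A x \<partial>leb01)"
    unfolding leb_measure_def using A by (subst emeasure_density) auto
  also have "\<dots> = (\<integral>\<^sup>+x. ennreal (w x) * indicator B x \<partial>leb01)"
    using ae unfolding AE_leb01_iff[symmetric] by (intro nn_integral_cong_AE) (auto elim!: eventually_mono simp: indicator_def)
  also have "\<dots> = (\<integral>\<^sup>+x. ennreal (w x) * indicator B x \<partial>unif)" using B by (intro nn_integral_leb01_unif) auto
  also have "\<dots> = emeasure \<mu> B" using B by (subst emeasure_density) auto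
  finally show ?thesis .
qed

lemma prob_space_leb_measure: "prob_space leb_measure"
proof (rule prob_spaceI)
  interpret m: prob_space \<mu> by (rule prob_space_mu)
  have "emeasure leb_measure {0..1} = emeasure \<mu> UNIV"
    using AE_unif_mem sets_leb01_borel[of UNIV] by (intro emeasure_leb_measure) auto
  then show "emeasure leb_measure (space leb_measure) = 1" using m.emeasure_space_1 by (simp add: space_leb_measure)
qed

lemma invariant_leb_measure: "invariant_under leb_measure T"
  unfolding invariant_under_def
proof
  show T: "T \<in> measurable leb_measure leb_measure"
    using T_measurable_leb01 by (simp add: measurable_cong_sets[OF sets_leb_measure sets_leb_measure])
  show "distr leb_measure leb_measure T = leb_measure"
  proof (rule measure_eqI)
    fix A assume "A \<in> sets (distr leb_measure leb_measure T)"
    then have A: "A \<in> sets leb01" by simp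
    then obtain B where B: "B \<in> sets borel" "AE x in unif. x \<in> A \<longleftrightarrow> x \<in> B" using ex_borel_set_leb01 by blast
    have TB: "T -` B \<in> sets borel" using measurable_sets[OF T_borel B(1)] by simp
    have TA: "T -` A \<inter> {0..1} \<in> sets leb01" using measurable_sets[OF T_measurable_leb01 A] by (simp add: space_leb01)
    have "AE x in unif. T x \<in> A \<longleftrightarrow> T x \<in> B" using AE_iter[OF B(2), of 1] by simp
    then have ae: "AE x in unif. x \<in> T -` A \<inter> {0..1} \<longleftrightarrow> x \<in> T -` B"
      using AE_unif_mem by eventually_elim auto
    have "emeasure (distr leb_measure leb_measure T) A = emeasure leb_measure (T -` A \<inter> {0..1})"
      using T A by (subst emeasure_distr) (auto simp: space_leb_measure)
    also have "\<dots> = emeasure \<mu> (T -` B)" by (rule emeasure_leb_measure[OF TA TB ae])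
    also have "\<dots> = emeasure (distr \<mu> borel T) B" using B(1) by (subst emeasure_distr) auto
    also have "\<dots> = emeasure leb_measure A" unfolding T_inv using emeasure_leb_measure[OF A B] by simp
    finally show "emeasure (distr leb_measure leb_measure T) A = emeasure leb_measure A" .
  qed simp
qed

end

text \<open>The case of a single map is the pointwise ergodic theorem.\<close>

context jsys
begin

lemma pointwise_ergodic:
  assumes A: "A \<in> sets leb01"
  shows "AE x in leb01. (\<lambda>N. (\<Sum>n<N. indicat_real A ((T ^^ n) x)) / real N) \<longlonglongrightarrow> measure leb_measure A"
proof -
  obtain B where B[measurable]: "B \<in> sets borel" and ae: "AE x in unif. x \<in> A \<longleftrightarrow> x \<in> B" using ex_borel_set_leb01[OF A] by blast
  have "AE x in unif. (\<lambda>N. (\<Sum>n<N. \<Prod>j\<in>{()}. indicator B ((T ^^ n) x)) / of_nat N) \<longlonglongrightarrow> (\<Prod>j\<in>{()}. \<integral>x. w x *\<^sub>R (indicator B x :: complex) \<partial>unif)"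
    by (rule joint_average_bounded[where T="\<lambda>_. T" and w="\<lambda>_. w" and h="\<lambda>_. h" and f="\<lambda>_. indicator B"])
      (auto simp: indicator_def intro: jsys_axioms)
  moreover have "AE x in unif. \<forall>n. (T ^^ n) x \<in> A \<longleftrightarrow> (T ^^ n) x \<in> B"
    unfolding AE_all_countable by (intro allI AE_iter[OF ae])
  ultimately have "AE x in unif. (\<lambda>N. (\<Sum>n<N. indicat_real A ((T ^^ n) x)) / real N) \<longlonglongrightarrow> measure leb_measure A"
  proof eventually_elim
    case (elim x)
    have ind: "indicator B ((T ^^ n) x) = complex_of_real (indicat_real A ((T ^^ n) x))" for n using elim(2) by (auto simp: indicator_def)
    have "(\<integral>x. w x *\<^sub>R (indicator B x :: complex) \<partial>unif) = (\<integral>x. complex_of_real (w x * indicat_real B x) \<partial>unif)"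
      by (intro Bochner_Integration.integral_cong) (auto simp: indicator_def scaleR_conv_of_real)
    also have "\<dots> = complex_of_real (\<integral>x. w x *\<^sub>R indicat_real B x \<partial>unif)" by (simp only: integral_complex_of_real real_scaleR_def)
    also have "(\<integral>x. w x *\<^sub>R indicat_real B x \<partial>unif) = measure \<mu> B"
      using integral_mu[of "indicat_real B"] by simp
    also have "\<dots> = measure leb_measure A" using emeasure_leb_measure[OF A B ae] by (simp add: measure_def)
    finally have "(\<lambda>N. complex_of_real ((\<Sum>n<N. indicat_real A ((T ^^ n) x)) / real N)) \<longlonglongrightarrow> complex_of_real (measure leb_measure A)"
      using elim(1) by (simp add: ind)
    then show ?case by (rule tendsto_of_real_iff[THEN iffD1])
  qed
  then show ?thesis unfolding AE_leb01_iff .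
qed

text \<open>On an invariant set the averages are constant in time, so the pointwise limit makes its
  indicator equal to its measure almost everywhere.\<close>

lemma ergodic_leb_measure: "ergodic_under leb_measure T"
  unfolding ergodic_under_def
proof (intro ballI impI)
  fix A assume "A \<in> sets leb_measure" and inv: "T -` A \<inter> space leb_measure = A"
  then have A: "A \<in> sets leb01" by simp
  interpret p: prob_space leb_measure by (rule prob_space_leb_measure)
  have it: "indicat_real A ((T ^^ n) x) = indicat_real A x" if "x \<in> {0..1}" for x n
  proof (induction n)
    case (Suc n)
    have "(T ^^ n) x \<in> {0..1}" by (rule iter_mem[OF that])
    then have "T ((T ^^ n) x) \<in> A \<longleftrightarrow> (T ^^ n) x \<in> A" using inv unfolding space_leb_measure by blast
    then show ?case using Suc by (simp add: indicator_def)
  qed simp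
  have "AE x in leb01. measure leb_measure A \<in> {0, 1}"
    using pointwise_ergodic[OF A] AE_space
  proof eventually_elim
    case (elim x)
    then have x: "x \<in> {0..1}" by (simp add: space_leb01)
    have "(\<lambda>N. (\<Sum>n<N. indicat_real A ((T ^^ n) x)) / real N) \<longlonglongrightarrow> indicat_real A x"
    proof (rule tendsto_eventually)
      show "eventually (\<lambda>N. (\<Sum>n<N. indicat_real A ((T ^^ n) x)) / real N = indicat_real A x) sequentially"
        using eventually_gt_at_top[of 0] by eventually_elim (simp add: it[OF x])
    qed
    then have "measure leb_measure A = indicat_real A x" using elim(1) LIMSEQ_unique by blast
    then show ?case by (auto simp: indicator_def)
  qed
  then have "AE x in unif. measure leb_measure A \<in> {0, 1}" unfolding AE_leb01_iff .
  then show "measure leb_measure A = 0 \<or> measure leb_measure A = 1" by (simp add: unif.AE_const)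
qed

text \<open>Absolute continuity carries the almost sure convergence over to \<open>M\<close>. By
  invariance the \<open>M\<close>-integral of the averages is \<open>measure M A\<close> for every
  positive \<open>N\<close>, while by dominated convergence it tends to
  \<open>measure leb_measure A\<close>.\<close>

lemma unique_invariant:
  assumes s: "sets M = sets leb01" and "prob_space M" and inv: "invariant_under M T" and ac: "absolutely_continuous leb01 M"
  shows "M = leb_measure"
proof (rule measure_eqI)
  interpret M: prob_space M by fact
  interpret p: prob_space leb_measure by (rule prob_space_leb_measure)
  fix A assume AM: "A \<in> sets M"
  then have A: "A \<in> sets leb01" using s by simp
  have sp: "space M = {0..1}" using sets_eq_imp_space_eq[OF s] by (simp add: space_leb01)
  have T[measurable]: "T \<in> measurable M M" and d: "distr M M T = M" using inv by (auto simp: invariant_under_def)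
  have Tn[measurable]: "(T ^^ n) \<in> measurable M M" for n by (induction n) (auto intro: measurable_comp)
  have dn: "distr M M (T ^^ n) = M" for n
  proof (induction n)
    case 0
    then show ?case using distr_id2[of M M] by (simp add: id_def)
  next
    case (Suc n)
    have "distr M M (T ^^ Suc n) = distr (distr M M (T ^^ n)) M T" by (subst distr_distr) auto
    then show ?case unfolding Suc d .
  qed
  have ind: "(\<integral>x. indicat_real A ((T ^^ n) x) \<partial>M) = measure M A" for n
  proof -
    have "(\<integral>x. indicat_real A ((T ^^ n) x) \<partial>M) = (\<integral>x. indicat_real A x \<partial>distr M M (T ^^ n))"
      using AM by (subst integral_distr) auto
    then show ?thesis unfolding dn using AM by simp
  qed
  have meas: "(\<lambda>x. indicat_real A ((T ^^ n) x)) \<in> borel_measurable M" for n using AM by measurable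
  have ii: "integrable M (\<lambda>x. indicat_real A ((T ^^ n) x))" for n
    using meas by (intro M.integrable_const_bound[where B=1]) (auto simp: indicator_def)
  have ae: "AE x in M. (\<lambda>N. (\<Sum>n<N. indicat_real A ((T ^^ n) x)) / real N) \<longlonglongrightarrow> measure leb_measure A"
    using absolutely_continuous_AE[OF s ac pointwise_ergodic[OF A]] .
  have "(\<lambda>N. \<integral>x. (\<Sum>n<N. indicat_real A ((T ^^ n) x)) / real N \<partial>M) \<longlonglongrightarrow> (\<integral>x. measure leb_measure A \<partial>M)"
  proof (rule integral_dominated_convergence[where w="\<lambda>_. 1"])
    show "AE x in M. norm ((\<Sum>n<N. indicat_real A ((T ^^ n) x)) / real N) \<le> 1" for N
    proof (rule AE_I2)
      fix x
      have "(\<Sum>n<N. indicat_real A ((T ^^ n) x)) \<le> (\<Sum>n<N. 1)" by (intro sum_mono) (auto simp: indicator_def)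
      moreover have "0 \<le> (\<Sum>n<N. indicat_real A ((T ^^ n) x))" by (intro sum_nonneg) auto
      ultimately show "norm ((\<Sum>n<N. indicat_real A ((T ^^ n) x)) / real N) \<le> 1" by (cases "N = 0") auto
    qed
  qed (use meas ae in auto)
  moreover have iN: "(\<integral>x. (\<Sum>n<N. indicat_real A ((T ^^ n) x)) / real N \<partial>M) = measure M A" if "0 < N" for N
    using ii that by (simp add: Bochner_Integration.integral_sum ind)
  have "eventually (\<lambda>N. (\<integral>x. (\<Sum>n<N. indicat_real A ((T ^^ n) x)) / real N \<partial>M) = measure M A) sequentially"
    by (rule eventually_mono[OF eventually_gt_at_top[of 0]]) (rule iN)
  then have "(\<lambda>N. \<integral>x. (\<Sum>n<N. indicat_real A ((T ^^ n) x)) / real N \<partial>M) \<longlonglongrightarrow> measure M A" by (rule tendsto_eventually)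
  ultimately have "measure M A = (\<integral>x. measure leb_measure A \<partial>M)" by (rule LIMSEQ_unique[rotated])
  then have "measure M A = measure leb_measure A" by (simp add: M.prob_space)
  then show "emeasure M A = emeasure leb_measure A" by (simp add: M.emeasure_eq_measure p.emeasure_eq_measure)
qed (simp add: s)

end

context beta_map
begin

text \<open>The Parry measure has all the required properties, its density being the Radon-Nikodym
  derivative, and \<open>unique_invariant\<close> leaves no other candidate for the definite
  description.\<close>

lemma renyi_measure_eq: "renyi_measure \<beta> = acim.leb_measure parry"
proof -
  interpret jsys T parry "ln \<beta>" by (rule jsys_beta)
  have ac: "absolutely_continuous leb01 leb_measure"
    unfolding leb_measure_def by (rule absolutely_continuousI_density) simp
  have rn: "AE x in leb01. ennreal (parry x) = RN_deriv leb01 leb_measure x"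
  proof -
    interpret finite_measure leb01 by (rule finite_measure_leb01)
    show ?thesis by (rule RN_deriv_unique) (auto simp: leb_measure_def)
  qed
  have "is_renyi_measure \<beta> leb_measure"
    unfolding is_renyi_measure_def
  proof (intro conjI)
    show "AE x in leb01. ennreal (1 - 1 / \<beta>) \<le> RN_deriv leb01 leb_measure x \<and> RN_deriv leb01 leb_measure x \<le> ennreal (1 / (1 - 1 / \<beta>))"
      using rn AE_space
    proof eventually_elim
      case (elim x)
      then have "x \<le> 1" by (simp add: space_leb01)
      then show ?case unfolding elim(1)[symmetric] using parry_bounds by (auto intro: ennreal_leI)
    qed
  qed (use prob_space_leb_measure invariant_leb_measure ergodic_leb_measure ac in auto)
  then show ?thesis unfolding renyi_measure_def
    by (rule the_equality) (auto simp: is_renyi_measure_def intro: unique_invariant)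
qed

text \<open>The orbit of 1 is 0 from the first step on, so for \<open>0 < x \<le> 1\<close> only the
  term \<open>k = 0\<close> remains.\<close>

lemma parry_integer:
  assumes "\<beta> \<in> \<int>"
  shows "AE x in unif. parry x = 1"
proof -
  have o: "orbit1 k = 0" if "0 < k" for k
  proof -
    obtain k' where k: "k = Suc k'" using \<open>0 < k\<close> gr0_implies_Suc by blast
    have "T 1 = 0" using assms by (simp add: mult_mod1_def frac_eq_0_iff)
    then show ?thesis using iter_0[of k'] unfolding orbit1_def k by (simp add: funpow_swap1)
  qed
  have ae: "AE x in unif. parry0 x = 1"
    using AE_irr
  proof (rule eventually_mono)
    fix x assume "x \<in> irr"
    then have x: "0 < x" "x \<le> 1" by (auto simp: irr_def)
    have "(\<Sum>k. (1 / \<beta>) ^ k * indicator {..orbit1 k} x) = (\<Sum>k\<in>{0}. (1 / \<beta>) ^ k * indicator {..orbit1 k} x)"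
      using o x by (intro suminf_finite) (auto simp: indicator_def)
    then show "parry0 x = 1" unfolding parry0_def using x by (simp add: indicator_def)
  qed
  have "parry_mass = (\<integral>x. 1 \<partial>unif)" unfolding parry_mass_def by (intro integral_cong_AE) (use ae in auto)
  then have "parry_mass = 1" using unif.prob_space by simp
  then show ?thesis using ae by (auto simp: parry_def)
qed

end

section \<open>The main theorem\<close>

lemma joint_average_Linfty:
  fixes I :: "'i set" and T w :: "'i \<Rightarrow> real \<Rightarrow> real" and h :: "'i \<Rightarrow> real" and f :: "'i \<Rightarrow> real \<Rightarrow> complex"
  assumes I: "finite I" and T: "\<And>j. j \<in> I \<Longrightarrow> jsys (T j) (w j) (h j)" and inj: "inj_on h I"
    and f: "\<And>j. j \<in> I \<Longrightarrow> f j \<in> Linfty leb01"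
  shows "AE x in leb01. (\<lambda>N. 1 / of_nat N * (\<Sum>n<N. \<Prod>j\<in>I. f j ((T j ^^ n) x))) \<longlonglongrightarrow> (\<Prod>j\<in>I. \<integral>x. f j x \<partial>acim.leb_measure (w j))"
proof -
  define P where "P j f' C \<longleftrightarrow> f' \<in> borel_measurable borel \<and> 1 \<le> C \<and> (\<forall>x. norm (f' x) \<le> C) \<and> (AE x in unif. f j x = f' x)"
    for j and f' :: "real \<Rightarrow> complex" and C :: real
  have "\<exists>f' C. P j f' C" if "j \<in> I" for j using ex_borel_fun_leb01[OF f[OF that]] unfolding P_def .
  then obtain f' C where P: "\<And>j. j \<in> I \<Longrightarrow> P j (f' j) (C j)" by metis
  have f'm: "f' j \<in> borel_measurable borel" and C: "1 \<le> C j" and f'C: "norm (f' j x) \<le> C j" and ae: "AE x in unif. f j x = f' j x" if "j \<in> I" for j x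
    using P[OF that] by (auto simp: P_def)
  \<comment> \<open>Scaling to norm at most 1; the constants leave the product as the factor
    \<open>K\<close>.\<close>
  define u where "u j x = f' j x / of_real (C j)" for j x
  have "AE x in unif. (\<lambda>N. (\<Sum>n<N. \<Prod>j\<in>I. u j ((T j ^^ n) x)) / of_nat N) \<longlonglongrightarrow> (\<Prod>j\<in>I. \<integral>x. w j x *\<^sub>R u j x \<partial>unif)"
  proof (rule joint_average_bounded[OF I T inj])
    show "u j \<in> borel_measurable borel" if "j \<in> I" for j unfolding u_def using f'm[OF that] by measurable
    show "norm (u j x) \<le> 1" if "j \<in> I" for j x unfolding u_def using C[OF that] f'C[OF that, of x] by (simp add: norm_divide)
  qed
  moreover have "AE x in unif. \<forall>j\<in>I. \<forall>n. f j ((T j ^^ n) x) = f' j ((T j ^^ n) x)"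
    using I by (intro AE_finite_allI) (auto simp: AE_all_countable intro: acim.AE_iter[OF jsys.axioms(1)[OF T] ae])
  ultimately have "AE x in unif. (\<lambda>N. 1 / of_nat N * (\<Sum>n<N. \<Prod>j\<in>I. f j ((T j ^^ n) x))) \<longlonglongrightarrow> (\<Prod>j\<in>I. \<integral>x. f j x \<partial>acim.leb_measure (w j))"
  proof eventually_elim
    case (elim x)
    define K where "K = (\<Prod>j\<in>I. complex_of_real (C j))"
    have fu: "f' j y = of_real (C j) * u j y" if "j \<in> I" for j y using C[OF that] by (simp add: u_def)
    have "(\<Prod>j\<in>I. f j ((T j ^^ n) x)) = K * (\<Prod>j\<in>I. u j ((T j ^^ n) x))" for n
      unfolding K_def prod.distrib[symmetric] using elim(2) fu by (intro prod.cong) auto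
    then have eq: "1 / of_nat N * (\<Sum>n<N. \<Prod>j\<in>I. f j ((T j ^^ n) x)) = K * ((\<Sum>n<N. \<Prod>j\<in>I. u j ((T j ^^ n) x)) / of_nat N)" for N
      by (simp add: sum_distrib_left sum_divide_distrib)
    have "(\<integral>x. f j x \<partial>acim.leb_measure (w j)) = of_real (C j) * (\<integral>x. w j x *\<^sub>R u j x \<partial>unif)" if j: "j \<in> I" for j
    proof -
      interpret jsys "T j" "w j" "h j" by (rule T[OF j])
      have "(\<integral>x. f j x \<partial>leb_measure) = (\<integral>x. w j x *\<^sub>R f' j x \<partial>unif)"
        using f[OF j] f'm[OF j] ae[OF j] by (intro integral_leb_measure) (auto simp: Linfty_def)
      also have "\<dots> = (\<integral>x. of_real (C j) * (w j x *\<^sub>R u j x) \<partial>unif)"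
        by (simp only: fu[OF j] mult_scaleR_right)
      finally show ?thesis by (simp only: integral_mult_right_zero)
    qed
    then have "(\<Prod>j\<in>I. \<integral>x. f j x \<partial>acim.leb_measure (w j)) = K * (\<Prod>j\<in>I. \<integral>x. w j x *\<^sub>R u j x \<partial>unif)"
      unfolding K_def prod.distrib[symmetric] by (intro prod.cong) auto
    then show ?case unfolding eq using tendsto_mult[OF tendsto_const elim(1), of K] by simp
  qed
  then show ?thesis unfolding AE_leb01_iff .
qed

lemma integral_gauss_measure:
  assumes "f \<in> Linfty leb01"
  shows "(\<integral>x. f x \<partial>acim.leb_measure gauss_density) = (\<integral>x. f x \<partial>gauss_measure)"
  unfolding gauss.leb_measure_def gauss_measure_def gauss_density_def ..

lemma integral_renyi_integer:
  assumes f: "f \<in> Linfty leb01" and b: "2 \<le> (b::int)"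
  shows "(\<integral>x. f x \<partial>acim.leb_measure (beta_map.parry (of_int b))) = (\<integral>x. f x \<partial>leb01)"
proof -
  interpret beta_map "of_int b" using b by unfold_locales simp
  interpret acim T parry by (rule acim_parry)
  have "AE x in leb01. ennreal (parry x) = 1" using parry_integer unfolding AE_leb01_iff by auto
  then have "leb_measure = density leb01 (\<lambda>_. 1)" unfolding leb_measure_def by (intro density_cong) auto
  then show ?thesis by (simp add: density_1)
qed

lemma ln_int_neq_gauss_entropy:
  assumes b: "2 \<le> (b::int)"
  shows "ln (of_int b) \<noteq> pi\<^sup>2 / (6 * ln 2)"
proof -
  have l2: "0 < ln (2::real)" by simp
  have up: "ln (2::real) \<le> 25 / 36" by (rule ln2_le_25_over_36)
  have lo: "0.692 \<le> ln (2::real)" using ln_approx_bounds[of 2 3] by (simp add: eval_nat_numeral)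
  have p: "3.14 \<le> pi" "pi \<le> 3.1416" using pi_approx by auto
  show ?thesis
  proof (cases "b \<le> 10")
    case True
    \<comment> \<open>\<open>10 ^ 3 <= 2 ^ 10\<close> bounds \<open>ln 10\<close> by
      \<open>10 / 3 * ln 2\<close>, sharp enough for
      \<open>20 * (ln 2)\<^sup>2 < pi\<^sup>2\<close>.\<close>
    have "3 * ln (10::real) = ln (10 ^ 3)" by (simp only: ln_realpow)
    also have "\<dots> \<le> ln (2 ^ 10)" by simp
    also have "\<dots> = 10 * ln 2" by (simp only: ln_realpow)
    finally have "3 * ln (10::real) \<le> 10 * ln 2" .
    moreover have "ln (of_int b) \<le> ln (10::real)" using b True by (subst ln_le_cancel_iff) auto
    ultimately have "ln (of_int b) \<le> 10 / 3 * ln (2::real)" by linarith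
    then have "6 * ln 2 * ln (of_int b) \<le> 6 * ln 2 * (10 / 3 * ln (2::real))" using l2 by (intro mult_left_mono) auto
    also have "\<dots> = 20 * (ln 2)\<^sup>2" by (simp add: power2_eq_square)
    also have "\<dots> \<le> 20 * (25 / 36)\<^sup>2" using up l2 by (intro mult_left_mono power_mono) auto
    also have "\<dots> < 3.14\<^sup>2" by (simp add: power2_eq_square)
    also have "\<dots> \<le> pi\<^sup>2" using p by (intro power_mono) auto
    finally have "6 * ln 2 * ln (of_int b) < pi\<^sup>2" .
    then show ?thesis using l2 by (auto simp: field_simps)
  next
    case False
    \<comment> \<open>\<open>2 ^ 38 <= 11 ^ 11\<close> is a close lower bound for
      \<open>ln 11\<close>. The margin left to \<open>pi\<^sup>2\<close> is about half a percent,
      hence the precision asked of \<open>ln 2\<close> and \<open>pi\<close>.\<close>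
    have "38 * ln (2::real) = ln (2 ^ 38)" by (simp only: ln_realpow)
    also have "\<dots> \<le> ln (11 ^ 11)" by simp
    also have "\<dots> = 11 * ln 11" by (simp only: ln_realpow)
    finally have "38 / 11 * ln (2::real) \<le> ln 11" by simp
    also have "\<dots> \<le> ln (of_int b)" using False by simp
    finally have "6 * ln 2 * (38 / 11 * ln (2::real)) \<le> 6 * ln 2 * ln (of_int b)" using l2 by (intro mult_left_mono) auto
    moreover have "6 * ln 2 * (38 / 11 * ln (2::real)) = 228 / 11 * (ln 2)\<^sup>2" by (simp add: power2_eq_square)
    moreover have "228 / 11 * (0.692)\<^sup>2 \<le> 228 / 11 * (ln (2::real))\<^sup>2" using lo by (intro mult_left_mono power_mono) auto
    moreover have "(3.1416::real)\<^sup>2 < 228 / 11 * (0.692)\<^sup>2" by (simp add: power2_eq_square)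
    moreover have "pi\<^sup>2 \<le> 3.1416\<^sup>2" using p by (intro power_mono) auto
    ultimately have "pi\<^sup>2 < 6 * ln 2 * ln (of_int b)" by linarith
    then show ?thesis using l2 by (auto simp: field_simps)
  qed
qed

theorem theorem1p2:
  fixes s t :: nat and b :: "nat \<Rightarrow> int" and \<beta> :: "nat \<Rightarrow> real"
  assumes "1 \<le> s" and "1 \<le> t"
    and "inj_on b {1..s}" and "\<forall>i\<in>{1..s}. 2 \<le> b i"
    and "inj_on \<beta> {1..t}" and "\<forall>j\<in>{1..t}. 1 < \<beta> j \<and> \<beta> j \<notin> \<int>"
  shows
    "(\<forall>(f :: nat \<Rightarrow> real \<Rightarrow> complex) (g :: nat \<Rightarrow> real \<Rightarrow> complex).
        (\<forall>i\<in>{1..s}. f i \<in> Linfty leb01) \<longrightarrow> (\<forall>j\<in>{1..t}. g j \<in> Linfty leb01) \<longrightarrow>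
        (AE x in leb01.
          (\<lambda>N. 1 / of_nat N * (\<Sum>n<N.
              (\<Prod>i=1..s. f i ((mult_mod1 (of_int (b i)) ^^ n) x)) *
              (\<Prod>j=1..t. g j ((mult_mod1 (\<beta> j) ^^ n) x))))
          \<longlonglongrightarrow> (\<Prod>i=1..s. integral\<^sup>L leb01 (f i)) *
              (\<Prod>j=1..t. integral\<^sup>L (renyi_measure (\<beta> j)) (g j))))
     \<and>
     ((\<forall>j\<in>{1..t}. ln (\<beta> j) \<noteq> pi\<^sup>2 / (6 * ln 2)) \<longrightarrow>
      (\<forall>(f0 :: real \<Rightarrow> complex) (f :: nat \<Rightarrow> real \<Rightarrow> complex) (g :: nat \<Rightarrow> real \<Rightarrow> complex).
        f0 \<in> Linfty leb01 \<longrightarrow>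
        (\<forall>i\<in>{1..s}. f i \<in> Linfty leb01) \<longrightarrow> (\<forall>j\<in>{1..t}. g j \<in> Linfty leb01) \<longrightarrow>
        (AE x in leb01.
          (\<lambda>N. 1 / of_nat N * (\<Sum>n<N.
              f0 ((gauss_map ^^ n) x) *
              (\<Prod>i=1..s. f i ((mult_mod1 (of_int (b i)) ^^ n) x)) *
              (\<Prod>j=1..t. g j ((mult_mod1 (\<beta> j) ^^ n) x))))
          \<longlonglongrightarrow> integral\<^sup>L gauss_measure f0 *
              (\<Prod>i=1..s. integral\<^sup>L leb01 (f i)) *
              (\<Prod>j=1..t. integral\<^sup>L (renyi_measure (\<beta> j)) (g j)))))"
proof -
  \<comment> \<open>One index set for both families: left summands for the integer bases, read as
    \<beta>-maps, and right summands for the \<beta>.\<close>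
  define base :: "nat + nat \<Rightarrow> real" where "base = case_sum (\<lambda>i. of_int (b i)) \<beta>"
  define I where "I = {1..s} <+> {1..t}"
  have Ifin: "finite I" by (simp add: I_def)
  have base1: "1 < base k" if "k \<in> I" for k
    using that assms(4,6) by (force simp: I_def base_def)
  have inj: "inj_on (\<lambda>k. ln (base k)) I"
  proof (rule inj_onI)
    fix k l assume k: "k \<in> I" and l: "l \<in> I" and "ln (base k) = ln (base l)"
    then have eq: "base k = base l" using base1[OF k] base1[OF l] ln_inj_iff[of "base k" "base l"] by simp
    \<comment> \<open>Non-integrality is what keeps the entropies of the two families apart.\<close>
    have nz: "\<beta> j \<noteq> of_int m" if "j \<in> {1..t}" for j m using assms(6) that by (metis Ints_of_int)
    show "k = l"
    proof (cases k)
      case (Inl i)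
      then have i: "i \<in> {1..s}" using k by (auto simp: I_def)
      show ?thesis
      proof (cases l)
        case (Inl i')
        then have "i' \<in> {1..s}" using l by (auto simp: I_def)
        then show ?thesis using eq i \<open>k = Inl i\<close> Inl inj_onD[OF assms(3), of i i'] by (simp add: base_def)
      next
        case (Inr j)
        then have "j \<in> {1..t}" using l by (auto simp: I_def)
        then show ?thesis using eq \<open>k = Inl i\<close> Inr nz[of j "b i"] by (simp add: base_def)
      qed
    next
      case (Inr j)
      then have j: "j \<in> {1..t}" using k by (auto simp: I_def)
      show ?thesis
      proof (cases l)
        case (Inl i)
        then show ?thesis using eq \<open>k = Inr j\<close> j nz[of j "b i"] by (simp add: base_def)
      next
        case (Inr j')
        then have "j' \<in> {1..t}" using l by (auto simp: I_def)
        then show ?thesis using eq j \<open>k = Inr j\<close> Inr inj_onD[OF assms(5), of j j'] by (simp add: base_def)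
      qed
    qed
  qed
  have sys: "jsys (mult_mod1 (base k)) (beta_map.parry (base k)) (ln (base k))" if "k \<in> I" for k
    using beta_map.jsys_beta[of "base k"] base1[OF that] by (simp add: beta_map_def)
  have Lf: "case_sum f g k \<in> Linfty leb01" if "\<forall>i\<in>{1..s}. f i \<in> Linfty leb01" "\<forall>j\<in>{1..t}. g j \<in> Linfty leb01" "k \<in> I" for f g k
    using that by (auto simp: I_def)
  have prodI: "(\<Prod>k\<in>I. H k) = (\<Prod>i=1..s. H (Inl i)) * (\<Prod>j=1..t. H (Inr j))" for H :: "nat + nat \<Rightarrow> complex"
    unfolding I_def by (subst prod.Plus) (auto simp: comp_def)
  have lim: "(\<Prod>k\<in>I. \<integral>x. case_sum f g k x \<partial>acim.leb_measure (beta_map.parry (base k))) =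
     (\<Prod>i=1..s. integral\<^sup>L leb01 (f i)) * (\<Prod>j=1..t. integral\<^sup>L (renyi_measure (\<beta> j)) (g j))"
    if "\<forall>i\<in>{1..s}. f i \<in> Linfty leb01" "\<forall>j\<in>{1..t}. g j \<in> Linfty leb01" for f g :: "nat \<Rightarrow> real \<Rightarrow> complex"
  proof -
    have "(\<Prod>i=1..s. \<integral>x. f i x \<partial>acim.leb_measure (beta_map.parry (of_int (b i)))) = (\<Prod>i=1..s. integral\<^sup>L leb01 (f i))"
      using that assms(4) by (intro prod.cong integral_renyi_integer) auto
    moreover have "(\<Prod>j=1..t. \<integral>x. g j x \<partial>acim.leb_measure (beta_map.parry (\<beta> j))) = (\<Prod>j=1..t. integral\<^sup>L (renyi_measure (\<beta> j)) (g j))"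
      using assms(6) by (intro prod.cong) (auto simp: beta_map.renyi_measure_eq[OF beta_map.intro])
    ultimately show ?thesis unfolding prodI by (simp add: base_def)
  qed
  show ?thesis
  proof (intro conjI allI impI)
    fix f g :: "nat \<Rightarrow> real \<Rightarrow> complex"
    assume f: "\<forall>i\<in>{1..s}. f i \<in> Linfty leb01" and g: "\<forall>j\<in>{1..t}. g j \<in> Linfty leb01"
    have L: "case_sum f g k \<in> Linfty leb01" if "k \<in> I" for k using Lf[OF f g that] .
    from joint_average_Linfty[where f="case_sum f g" and T="\<lambda>k. mult_mod1 (base k)" and w="\<lambda>k. beta_map.parry (base k)"
        and h="\<lambda>k. ln (base k)", OF Ifin sys inj L]
    show "AE x in leb01.
          (\<lambda>N. 1 / of_nat N * (\<Sum>n<N.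
              (\<Prod>i=1..s. f i ((mult_mod1 (of_int (b i)) ^^ n) x)) *
              (\<Prod>j=1..t. g j ((mult_mod1 (\<beta> j) ^^ n) x))))
          \<longlonglongrightarrow> (\<Prod>i=1..s. integral\<^sup>L leb01 (f i)) *
              (\<Prod>j=1..t. integral\<^sup>L (renyi_measure (\<beta> j)) (g j))"
      unfolding lim[OF f g] prodI by (simp add: base_def)
  next
    fix f0 :: "real \<Rightarrow> complex" and f g :: "nat \<Rightarrow> real \<Rightarrow> complex"
    assume nh: "\<forall>j\<in>{1..t}. ln (\<beta> j) \<noteq> pi\<^sup>2 / (6 * ln 2)" and f0: "f0 \<in> Linfty leb01"
      and f: "\<forall>i\<in>{1..s}. f i \<in> Linfty leb01" and g: "\<forall>j\<in>{1..t}. g j \<in> Linfty leb01"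
    \<comment> \<open>\<open>None\<close> stands for the Gauss map; its entropy differs from the
      others by hypothesis and by \<open>ln_int_neq_gauss_entropy\<close>.\<close>
    define J where "J = insert None (Some ` I)"
    define TT where "TT = case_option gauss_map (\<lambda>k. mult_mod1 (base k))"
    define W where "W = case_option gauss_density (\<lambda>k. beta_map.parry (base k))"
    define H where "H = case_option (pi\<^sup>2 / (6 * ln 2)) (\<lambda>k. ln (base k))"
    define F where "F = case_option f0 (case_sum f g)"
    have "finite J" using Ifin by (simp add: J_def)
    moreover have "jsys (TT k) (W k) (H k)" if "k \<in> J" for k
      using that sys jsys_gauss by (auto simp: J_def TT_def W_def H_def)
    moreover have "inj_on H J"
    proof -
      have "ln (base k) \<noteq> pi\<^sup>2 / (6 * ln 2)" if "k \<in> I" for k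
        using that nh ln_int_neq_gauss_entropy assms(4) by (auto simp: I_def base_def)
      then have "pi\<^sup>2 / (6 * ln 2) \<notin> (\<lambda>k. ln (base k)) ` I" by force
      moreover have "inj_on H (Some ` I)" using inj by (auto simp: inj_on_def H_def)
      ultimately show ?thesis unfolding J_def by (auto simp: H_def image_image)
    qed
    moreover have "F k \<in> Linfty leb01" if "k \<in> J" for k
      using that f0 Lf[OF f g] by (auto simp: J_def F_def)
    ultimately have "AE x in leb01. (\<lambda>N. 1 / of_nat N * (\<Sum>n<N. \<Prod>k\<in>J. F k ((TT k ^^ n) x))) \<longlonglongrightarrow> (\<Prod>k\<in>J. \<integral>x. F k x \<partial>acim.leb_measure (W k))"
      by (rule joint_average_Linfty)
    moreover have prodJ: "(\<Prod>k\<in>J. G k) = G None * (\<Prod>k\<in>I. G (Some k))" for G :: "(nat + nat) option \<Rightarrow> complex"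
      unfolding J_def using Ifin by (subst prod.insert) (auto simp: prod.reindex)
    moreover have "(\<Prod>k\<in>J. \<integral>x. F k x \<partial>acim.leb_measure (W k)) = integral\<^sup>L gauss_measure f0 *
       ((\<Prod>i=1..s. integral\<^sup>L leb01 (f i)) * (\<Prod>j=1..t. integral\<^sup>L (renyi_measure (\<beta> j)) (g j)))"
      unfolding prodJ lim[OF f g, symmetric] by (simp add: F_def W_def integral_gauss_measure[OF f0])
    ultimately show "AE x in leb01.
          (\<lambda>N. 1 / of_nat N * (\<Sum>n<N.
              f0 ((gauss_map ^^ n) x) *
              (\<Prod>i=1..s. f i ((mult_mod1 (of_int (b i)) ^^ n) x)) *
              (\<Prod>j=1..t. g j ((mult_mod1 (\<beta> j) ^^ n) x))))
          \<longlonglongrightarrow> integral\<^sup>L gauss_measure f0 *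
              (\<Prod>i=1..s. integral\<^sup>L leb01 (f i)) *
              (\<Prod>j=1..t. integral\<^sup>L (renyi_measure (\<beta> j)) (g j))"
      by (simp add: prodI F_def TT_def base_def mult.assoc)
  qed
qed

end
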